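(* Let $\rho=\rho(\mathcal T,y,r,\phi)$, let $s=r/2$, and let $\Gamma$ be a $G$-generic element of depth $-r$ that represents $\phi$. The decomposition into irreducible $\mathcal K$-representations of the restriction to $\mathcal K$ of the associated supercuspidal representation $\text{c-Ind}_{\mathcal TG_{y,s}}^G\rho$ is as follows. If $y=0$ (so $\mathcal T=\mathcal T_{1,1}$), then with $\mathcal K_s=G_{0,s}$, $$\mathrm{Res}^G_{\mathcal K}\,\text{c-Ind}_{\mathcal T\mathcal K_s}^{G}\rho\cong\mathrm{Ind}_{\mathcal T\mathcal K_s}^{\mathcal K}\rho\oplus\bigoplus_{t>0}\mathcal S_{r+2t}(\Gamma^{\alpha^t},\phi^{\alpha^t}).$$ If $y=1$ (so $\mathcal T=\mathcal T_{\varpi^{-1},\varpi}$), then $$\mathrm{Res}^G_{\mathcal K}\,\text{c-Ind}_{\mathcal TG_{1,s}}^{G}\rho\cong\bigoplus_{t\ge0}\mathcal S_{r+2t+1}(\Gamma^{\alpha^t},\phi^{\alpha^t}).$$ If $y=\tfrac12$ (so $\mathcal T$ is ramified), then $$\mathrm{Res}^G_{\mathcal K}\,\text{c-Ind}_{\mathcal TG_{\frac12,s}}^{G}\rho\cong\mathcal S_{r+\frac12}(\Gamma,\phi)\oplus\bigoplus_{t>0}\Big(\mathcal S_{r+2t+\frac12}(\Gamma^{\alpha^t},\phi^{\alpha^t})\oplus\mathcal S_{r+2t-\frac12}(\Gamma^{\alpha^t\mathrm w},\phi^{\alpha^t\mathrm w})\Big).$$ Here $t$ runs over integers.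
   Context: All representations are smooth and complex. For $g\in G$, $H^g=gHg^{-1}$, $X^g=gXg^{-1}$, and $\tau^g(x)=\tau(g^{-1}xg)$ for a representation $\tau$ of $H$. Group. $F$ is a non-archimedean local field of residual characteristic $p\neq 2$, with $\mathcal O_F$, $\mathfrak p_F$, uniformizer $\varpi$, valuation $\nu$ with $\nu(\varpi)=1$, residue field of cardinality $q$; $E=F[\sqrt\epsilon]$ is the unramified quadratic extension ($\epsilon\in\mathcal O_F^\times$ a non-square) with $\mathcal O_E,\mathfrak p_E$ and conjugation $x\mapsto\overline x$. $\psi'$ is an additive character of $F$ trivial on $\mathfrak p_F$, nontrivial on $\mathcal O_F$, and $\psi(x)=\psi'((x+\overline x)/2)$ on $E$. $G=\{g\in M_2(E):\overline g^{\top}\mathrm w g=\mathrm w\}$, $\mathrm w=\begin{pmatrix}0&1\\ 1&0\end{pmatrix}$; $Z$ is its center (scalars of norm one); $\mathfrak g=\left\{\begin{pmatrix}u+\sqrt\epsilon v&y\sqrt\epsilon\\ z\sqrt\epsilon&-u+\sqrt\epsilon v\end{pmatrix}:u,v,y,z\in F\right\}$; $\mathcal K=G\cap M_2(\mathcal O_E)$; $\alpha^t=\begin{pmatrix}\varpi^{-t}&0\\ 0&\varpi^t\end{pmatrix}$. For $y\in\mathbb R$, $r>0$: $G_{y,r}=\begin{pmatrix}1+\mathfrak p_E^{\lceil r\rceil}&\mathfrak p_E^{\lceil r-y\rceil}\\ \mathfrak p_E^{\lceil r+y\rceil}&1+\mathfrak p_E^{\lceil r\rceil}\end{pmatrix}\cap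 G$; $G_{y,r+}=\bigcup_{s>r}G_{y,s}$ ($r\ge0$). For $r\in\mathbb R$: $\mathfrak g_{y,r}=\begin{pmatrix}\mathfrak p_E^{\lceil r\rceil}&\sqrt\epsilon\mathfrak p_F^{\lceil r-y\rceil}\\ \sqrt\epsilon\mathfrak p_F^{\lceil r+y\rceil}&\mathfrak p_E^{\lceil r\rceil}\end{pmatrix}\cap\mathfrak g$. Tori. $\mathcal T=\mathcal T_{\gamma_1,\gamma_2}=\left\{\begin{pmatrix}a&b\gamma_1\\ b\gamma_2&a\end{pmatrix}\in G:a,b\in E\right\}$ with $(\gamma_1,\gamma_2)\in\{(1,1),(\varpi^{-1},\varpi),(1,\varpi),(1,\epsilon^{-1}\varpi)\}$; the associated point $y$ is $0,1,\tfrac12,\tfrac12$ respectively; the first two are unramified, the last two ramified. $\mathcal T_r=\mathcal T\cap G_{y,r}$ for $r>0$, $\mathcal T_{r+}=\mathcal T\cap G_{y,r+}$. $\mathfrak t=\left\{\Gamma_{u,v}=\begin{pmatrix}u\sqrt\epsilon&v\gamma_1\sqrt\epsilon\\ v\gamma_2\sqrt\epsilon&u\sqrt\epsilon\end{pmatrix}:u,v\in F\right\}$ is the Lie algebra and $\mathfrak t_r=\mathfrak t\cap\mathfrak g_{y,r}$. Generic characters and the datum. Let $r>0$, $s=r/2$. An element $\Gamma=\Gamma_{u,v}\in\mathfrak t_{-r}$ is $G$-generic of depth $-r$ if $\nu(v\gamma_1)=-r-y$ (equivalently $\nu(\mathrm{Tr}(\Gamma H_a))=-r$ for every absolute root $a$,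 $H_a$ being the derivative at $1$ of the coroot). It represents (realizes) a character $\phi$ of $\mathcal T$ if $\phi(t)=\psi(\mathrm{Tr}(\Gamma(t-I)))$ for all $t\in\mathcal T_{s+}$. A character $\phi$ of $\mathcal T$ is $G$-generic of depth $r$ if it is trivial on $\mathcal T_{r+}$, nontrivial on $\mathcal T_r$, and is represented by some $G$-generic $\Gamma\in\mathfrak t_{-r}$. Then $r\in\mathbb Z_{>0}$ if $\mathcal T$ is unramified and $r\in\tfrac12+\mathbb Z_{\ge0}$ if $\mathcal T$ is ramified. A datum $(\mathcal T,y,r,\phi)$ consists of a torus $\mathcal T$ above, its point $y$, $r>0$ and a $G$-generic character $\phi$ of $\mathcal T$ of depth $r$. The representation $\rho(\mathcal T,y,r,\phi)$ of $G_{y,s}\mathcal T$. Let $\Psi_\Gamma(g)=\psi(\mathrm{Tr}(\Gamma(g-I)))$ for $g\in G_{y,s+}$ and let $\hat\phi$ be the character of $G_{y,s+}\mathcal T$ with $\hat\phi(gt)=\Psi_\Gamma(g)\phi(t)$. If $G_{y,s}=G_{y,s+}$ ($\mathcal T$ ramified, or unramified with $r$ odd), $\rho=\hat\phi$. If $\mathcal T$ is unramified and $r$ is even, $V=G_{y,s}/G_{y,s+}\mathcal T_s$ is a 2-dimensional symplectic space over the residue field $\mathfrak f$ of $F$ (form induced by $\hat\phi$ of commutators), there is a unique irreducible representation $\eta_\phi$ of $G_{y,s}$ (dimension $q$) that is $\hat\phi$-isotypic on $G_{y,s+}\mathcal T_s$, and $\rho(gt)=\eta_\phi(g)\,\omega(t)\,\phi(t)$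 for $g\in G_{y,s},t\in\mathcal T$, where $\omega$ is the Weil representation associated with $\eta_\phi$, pulled back along the conjugation action $\mathcal T\to\mathrm{Sp}(V)$. In that case $\rho$ has dimension $q$, is $\hat\phi$-isotypic on $G_{y,s+}\mathcal T_s$ and $\phi$-isotypic on $Z\mathcal T_{0+}$. The representation $\text{c-Ind}_{G_{y,s}\mathcal T}^G\rho$ is irreducible supercuspidal of depth $r$. The representations $\mathcal S_d(X,\zeta)$. For an integer $d>0$ let $\mathcal J_d=\begin{pmatrix}1+\mathfrak p_E^{\lceil d/2\rceil}&\mathfrak p_E^{\lceil d/2\rceil}\\ \mathfrak p_E^{\lceil(d+1)/2\rceil}&1+\mathfrak p_E^{\lceil d/2\rceil}\end{pmatrix}\cap G$. For $X=\begin{pmatrix}z\sqrt\epsilon&u\sqrt\epsilon\\ v\sqrt\epsilon&z\sqrt\epsilon\end{pmatrix}$ with $z,u,v\in F$, $\nu(z),\nu(v)>\nu(u)=-d$, let $T(X)$ be the centralizer of $X$ in $\mathcal K$ and $\Psi_X(k)=\psi(\mathrm{Tr}(X(k-I)))$, a character of $\mathcal J_d$. If $\zeta$ is a character of $T(X)$ agreeing with $\Psi_X$ on $T(X)\cap\mathcal J_d$, let $\Psi_{X,\zeta}$ be the unique character of $T(X)\mathcal J_d$ extending both, and $\mathcal S_d(X,\zeta)=\mathrm{Ind}_{T(X)\mathcal J_d}^{\mathcal K}\Psi_{X,\zeta}$ (irreducible of depth $d$ and degree $(q^2-1)q^{d-1}$, by earlier work). For $X=\Gamma^g$, one has $T(\Gamma^g)=\mathcal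 K\cap\mathcal T^g$, and $\zeta=\phi^g$ means its restriction to $\mathcal K\cap\mathcal T^g$. *)

theory Defs
  imports "HOL-Analysis.Analysis" "HOL-Library.Function_Algebras" "HOL-Library.FuncSet"
begin

section \<open>Local fields\<close>

text \<open>A discrete valuation is a function to the integers whose value at \<open>0\<close> carries no meaning:
  the case \<open>x = 0\<close> (valuation infinity) is always treated separately.\<close>

definition val_ideal :: "('f::field \<Rightarrow> int) \<Rightarrow> int \<Rightarrow> 'f set" where
  "val_ideal \<nu> n = {x. x = 0 \<or> n \<le> \<nu> x}"

locale nonarch_local_field =
  fixes \<nu> :: "'f::field \<Rightarrow> int" and unf :: 'f
  assumes val_mult: "x \<noteq> 0 \<Longrightarrow> y \<noteq> 0 \<Longrightarrow> \<nu> (x * y) = \<nu> x + \<nu> y"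
    and val_add: "x \<noteq> 0 \<Longrightarrow> y \<noteq> 0 \<Longrightarrow> x + y \<noteq> 0 \<Longrightarrow> min (\<nu> x) (\<nu> y) \<le> \<nu> (x + y)"
    and unif_nonzero: "unf \<noteq> 0"
    and val_unif: "\<nu> unf = 1"
    and complete: "(\<forall>n. \<exists>N. \<forall>i\<ge>N. \<forall>j\<ge>N. X i - X j \<in> val_ideal \<nu> n) \<Longrightarrow>
                   \<exists>L. \<forall>n. \<exists>N. \<forall>i\<ge>N. (X :: nat \<Rightarrow> 'f) i - L \<in> val_ideal \<nu> n"
    and finite_residue_field: "finite ((\<lambda>x. {y. y - x \<in> val_ideal \<nu> 1}) ` val_ideal \<nu> 0)"

definition residual_char :: "('f::field \<Rightarrow> int) \<Rightarrow> nat" where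
  "residual_char \<nu> = (LEAST p. 0 < p \<and> of_nat p \<in> val_ideal \<nu> 1)"


section \<open>The quadratic extension\<close>

text \<open>The data fixed throughout: valuation and uniformizer of \<open>F\<close>, the embedding of \<open>F\<close> into \<open>E\<close>,
  the non-square unit and its square root in \<open>E\<close>, and the additive character of \<open>F\<close>.\<close>

record ('f, 'e) setting =
  nu :: "'f \<Rightarrow> int"
  unif :: 'f
  emb :: "'f \<Rightarrow> 'e"
  eps :: 'f
  sqrt_eps :: 'e
  psiF :: "'f \<Rightarrow> complex"

definition u11_setting :: "('f::field, 'e::field) setting \<Rightarrow> bool" where
  "u11_setting S \<longleftrightarrow>
     nonarch_local_field (nu S) (unif S) \<and> residual_char (nu S) \<noteq> 2 \<and>
     emb S 1 = 1 \<and> (\<forall>x y. emb S (x + y) = emb S x + emb S y) \<and>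
     (\<forall>x y. emb S (x * y) = emb S x * emb S y) \<and>
     eps S \<noteq> 0 \<and> nu S (eps S) = 0 \<and> (\<nexists>x. x ^ 2 = eps S) \<and>
     sqrt_eps S ^ 2 = emb S (eps S) \<and> (\<forall>x. \<exists>a b. x = emb S a + emb S b * sqrt_eps S) \<and>
     psiF S 0 = 1 \<and> (\<forall>x y. psiF S (x + y) = psiF S x * psiF S y) \<and>
     (\<forall>x\<in>val_ideal (nu S) 1. psiF S x = 1) \<and> (\<exists>x\<in>val_ideal (nu S) 0. psiF S x \<noteq> 1)"

abbreviation pF :: "('f::field, 'e::field) setting \<Rightarrow> int \<Rightarrow> 'f set" where
  "pF S n \<equiv> val_ideal (nu S) n"

definition conjE :: "('f::field, 'e::field) setting \<Rightarrow> 'e \<Rightarrow> 'e" where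
  "conjE S x = (THE y. \<exists>a b. x = emb S a + emb S b * sqrt_eps S \<and> y = emb S a - emb S b * sqrt_eps S)"

definition normE :: "('f::field, 'e::field) setting \<Rightarrow> 'e \<Rightarrow> 'f" where
  "normE S x = inv (emb S) (x * conjE S x)"

text \<open>The valuation of \<open>E\<close> extending that of \<open>F\<close> is half the valuation of the norm.\<close>

definition pE :: "('f::field, 'e::field) setting \<Rightarrow> int \<Rightarrow> 'e set" where
  "pE S n = {x. x = 0 \<or> 2 * n \<le> nu S (normE S x)}"

definition psiE :: "('f::field, 'e::field) setting \<Rightarrow> 'e \<Rightarrow> complex" where
  "psiE S x = psiF S (inv (emb S) ((x + conjE S x) / 2))"


section \<open>The unitary group and its filtrations\<close>

definition mat2 :: "'e \<Rightarrow> 'e \<Rightarrow> 'e \<Rightarrow> 'e \<Rightarrow> 'e::field ^ 2 ^ 2" where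
  "mat2 a b c d = vector [vector [a, b], vector [c, d]]"

definition wmat :: "'e::field ^ 2 ^ 2" where
  "wmat = mat2 0 1 1 0"

definition unitary_group :: "('f::field, 'e::field) setting \<Rightarrow> ('e ^ 2 ^ 2) set" where
  "unitary_group S = {g. transpose (\<chi> i j. conjE S (g $ i $ j)) ** wmat ** g = wmat}"

definition maxK :: "('f::field, 'e::field) setting \<Rightarrow> ('e ^ 2 ^ 2) set" where
  "maxK S = {g \<in> unitary_group S. \<forall>i j. g $ i $ j \<in> pE S 0}"

definition alpha :: "('f::field, 'e::field) setting \<Rightarrow> int \<Rightarrow> 'e ^ 2 ^ 2" where
  "alpha S t = mat2 (emb S (unif S powi (- t))) 0 0 (emb S (unif S powi t))"

definition mconj :: "'e::field ^ 2 ^ 2 \<Rightarrow> 'e ^ 2 ^ 2 \<Rightarrow> 'e ^ 2 ^ 2" where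
  "mconj g X = g ** X ** matrix_inv g"

definition cconj :: "'e::field ^ 2 ^ 2 \<Rightarrow> ('e ^ 2 ^ 2 \<Rightarrow> complex) \<Rightarrow> 'e ^ 2 ^ 2 \<Rightarrow> complex" where
  "cconj g \<xi> = (\<lambda>x. \<xi> (matrix_inv g ** x ** g))"

definition set_prod :: "('e::field ^ 2 ^ 2) set \<Rightarrow> ('e ^ 2 ^ 2) set \<Rightarrow> ('e ^ 2 ^ 2) set" where
  "set_prod A B = {a ** b |a b. a \<in> A \<and> b \<in> B}"

definition mat_lattice :: "('f::field, 'e::field) setting \<Rightarrow> real \<Rightarrow> real \<Rightarrow> ('e ^ 2 ^ 2) set" where
  "mat_lattice S y r = {X. X $ 1 $ 1 \<in> pE S \<lceil>r\<rceil> \<and> X $ 1 $ 2 \<in> pE S \<lceil>r - y\<rceil> \<and>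
                           X $ 2 $ 1 \<in> pE S \<lceil>r + y\<rceil> \<and> X $ 2 $ 2 \<in> pE S \<lceil>r\<rceil>}"

definition Gyr :: "('f::field, 'e::field) setting \<Rightarrow> real \<Rightarrow> real \<Rightarrow> ('e ^ 2 ^ 2) set" where
  "Gyr S y r = {g \<in> unitary_group S. g - mat 1 \<in> mat_lattice S y r}"

definition Gyr_plus :: "('f::field, 'e::field) setting \<Rightarrow> real \<Rightarrow> real \<Rightarrow> ('e ^ 2 ^ 2) set" where
  "Gyr_plus S y r = (\<Union>s\<in>{r<..}. Gyr S y s)"

definition lie_alg :: "('f::field, 'e::field) setting \<Rightarrow> ('e ^ 2 ^ 2) set" where
  "lie_alg S = {mat2 (emb S u + sqrt_eps S * emb S v) (emb S y * sqrt_eps S)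
                     (emb S z * sqrt_eps S) (- emb S u + sqrt_eps S * emb S v) |u v y z. True}"

definition lie_yr :: "('f::field, 'e::field) setting \<Rightarrow> real \<Rightarrow> real \<Rightarrow> ('e ^ 2 ^ 2) set" where
  "lie_yr S y r = {X \<in> lie_alg S.
     X $ 1 $ 1 \<in> pE S \<lceil>r\<rceil> \<and> X $ 1 $ 2 \<in> (\<lambda>a. sqrt_eps S * emb S a) ` pF S \<lceil>r - y\<rceil> \<and>
     X $ 2 $ 1 \<in> (\<lambda>a. sqrt_eps S * emb S a) ` pF S \<lceil>r + y\<rceil> \<and> X $ 2 $ 2 \<in> pE S \<lceil>r\<rceil>}"


section \<open>Tori, generic elements and generic characters\<close>

definition torus_point :: "('f::field, 'e::field) setting \<Rightarrow> 'f \<Rightarrow> 'f \<Rightarrow> real \<Rightarrow> bool" where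
  "torus_point S \<gamma>1 \<gamma>2 y \<longleftrightarrow>
     (\<gamma>1, \<gamma>2, y) \<in> {(1, 1, 0), (inverse (unif S), unif S, 1),
                    (1, unif S, 1 / 2), (1, inverse (eps S) * unif S, 1 / 2)}"

definition torus :: "('f::field, 'e::field) setting \<Rightarrow> 'f \<Rightarrow> 'f \<Rightarrow> ('e ^ 2 ^ 2) set" where
  "torus S \<gamma>1 \<gamma>2 = {g \<in> unitary_group S. \<exists>a b. g = mat2 a (b * emb S \<gamma>1) (b * emb S \<gamma>2) a}"

definition torus_r :: "('f::field, 'e::field) setting \<Rightarrow> 'f \<Rightarrow> 'f \<Rightarrow> real \<Rightarrow> real \<Rightarrow> ('e ^ 2 ^ 2) set" where
  "torus_r S \<gamma>1 \<gamma>2 y r = torus S \<gamma>1 \<gamma>2 \<inter> Gyr S y r"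

definition torus_r_plus :: "('f::field, 'e::field) setting \<Rightarrow> 'f \<Rightarrow> 'f \<Rightarrow> real \<Rightarrow> real \<Rightarrow> ('e ^ 2 ^ 2) set" where
  "torus_r_plus S \<gamma>1 \<gamma>2 y r = torus S \<gamma>1 \<gamma>2 \<inter> Gyr_plus S y r"

definition Gamma_elt :: "('f::field, 'e::field) setting \<Rightarrow> 'f \<Rightarrow> 'f \<Rightarrow> 'f \<Rightarrow> 'f \<Rightarrow> 'e ^ 2 ^ 2" where
  "Gamma_elt S \<gamma>1 \<gamma>2 u v =
     mat2 (emb S u * sqrt_eps S) (emb S v * emb S \<gamma>1 * sqrt_eps S)
          (emb S v * emb S \<gamma>2 * sqrt_eps S) (emb S u * sqrt_eps S)"

definition lie_torus_r :: "('f::field, 'e::field) setting \<Rightarrow> 'f \<Rightarrow> 'f \<Rightarrow> real \<Rightarrow> real \<Rightarrow> ('e ^ 2 ^ 2) set" where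
  "lie_torus_r S \<gamma>1 \<gamma>2 y r = {Gamma_elt S \<gamma>1 \<gamma>2 u v |u v. True} \<inter> lie_yr S y r"

text \<open>\<open>Psi S X\<close> is the formula defining the characters attached to Lie algebra elements, on all matrices.\<close>

definition Psi :: "('f::field, 'e::field) setting \<Rightarrow> 'e ^ 2 ^ 2 \<Rightarrow> 'e ^ 2 ^ 2 \<Rightarrow> complex" where
  "Psi S X g = psiE S (trace (X ** (g - mat 1)))"

definition generic_elt ::
    "('f::field, 'e::field) setting \<Rightarrow> 'f \<Rightarrow> 'f \<Rightarrow> real \<Rightarrow> real \<Rightarrow> 'e ^ 2 ^ 2 \<Rightarrow> bool" where
  "generic_elt S \<gamma>1 \<gamma>2 y r \<Gamma> \<longleftrightarrow>
     \<Gamma> \<in> lie_torus_r S \<gamma>1 \<gamma>2 y (- r) \<and>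
     (\<exists>u v. \<Gamma> = Gamma_elt S \<gamma>1 \<gamma>2 u v \<and> v * \<gamma>1 \<noteq> 0 \<and> real_of_int (nu S (v * \<gamma>1)) = - r - y)"

definition represents ::
    "('f::field, 'e::field) setting \<Rightarrow> 'f \<Rightarrow> 'f \<Rightarrow> real \<Rightarrow> real \<Rightarrow> 'e ^ 2 ^ 2 \<Rightarrow> ('e ^ 2 ^ 2 \<Rightarrow> complex) \<Rightarrow> bool" where
  "represents S \<gamma>1 \<gamma>2 y r \<Gamma> \<phi> \<longleftrightarrow> (\<forall>t\<in>torus_r_plus S \<gamma>1 \<gamma>2 y (r / 2). \<phi> t = Psi S \<Gamma> t)"

definition generic_char ::
    "('f::field, 'e::field) setting \<Rightarrow> 'f \<Rightarrow> 'f \<Rightarrow> real \<Rightarrow> real \<Rightarrow> ('e ^ 2 ^ 2 \<Rightarrow> complex) \<Rightarrow> bool" where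
  "generic_char S \<gamma>1 \<gamma>2 y r \<phi> \<longleftrightarrow>
     (\<forall>t\<in>torus_r_plus S \<gamma>1 \<gamma>2 y r. \<phi> t = 1) \<and> (\<exists>t\<in>torus_r S \<gamma>1 \<gamma>2 y r. \<phi> t \<noteq> 1) \<and>
     (\<exists>\<Gamma>. generic_elt S \<gamma>1 \<gamma>2 y r \<Gamma> \<and> represents S \<gamma>1 \<gamma>2 y r \<Gamma> \<phi>)"


section \<open>Smooth representations\<close>

definition mat_top :: "('f::field, 'e::field) setting \<Rightarrow> ('e ^ 2 ^ 2) topology" where
  "mat_top S = topology (\<lambda>U. \<forall>x\<in>U. \<exists>n. \<forall>y. (\<forall>i j. (y - x) $ i $ j \<in> pE S n) \<longrightarrow> y \<in> U)"

lemma pE_antimono: "m \<le> n \<Longrightarrow> pE S n \<subseteq> pE S m"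
  by (auto simp: pE_def)

lemma openin_mat_top:
  fixes S :: "('f::field, 'e::field) setting"
  shows "openin (mat_top S) U \<longleftrightarrow> (\<forall>x\<in>U. \<exists>n. \<forall>y. (\<forall>i j. (y - x) $ i $ j \<in> pE S n) \<longrightarrow> y \<in> U)"
proof -
  let ?P = "\<lambda>U :: ('e ^ 2 ^ 2) set. \<forall>x\<in>U. \<exists>n. \<forall>y. (\<forall>i j. (y - x) $ i $ j \<in> pE S n) \<longrightarrow> y \<in> U"
  have "?P (A \<inter> B)" if A: "?P A" and B: "?P B" for A B
  proof
    fix x assume x: "x \<in> A \<inter> B"
    from A x obtain m where m: "\<forall>y. (\<forall>i j. (y - x) $ i $ j \<in> pE S m) \<longrightarrow> y \<in> A"
      by blast
    from B x obtain n where n: "\<forall>y. (\<forall>i j. (y - x) $ i $ j \<in> pE S n) \<longrightarrow> y \<in> B"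
      by blast
    have mn: "pE S (max m n) \<subseteq> pE S m" "pE S (max m n) \<subseteq> pE S n"
      by (auto intro!: pE_antimono)
    have "y \<in> A \<inter> B" if "\<forall>i j. (y - x) $ i $ j \<in> pE S (max m n)" for y
      using that m n mn by (meson IntI subsetD)
    then show "\<exists>k. \<forall>y. (\<forall>i j. (y - x) $ i $ j \<in> pE S k) \<longrightarrow> y \<in> A \<inter> B"
      by (intro exI[of _ "max m n"] allI impI)
  qed
  moreover have "?P (\<Union>\<A>)" if "\<forall>A\<in>\<A>. ?P A" for \<A>
  proof
    fix x assume "x \<in> \<Union>\<A>"
    then obtain A where A: "A \<in> \<A>" "x \<in> A" by blast
    with that obtain n where n: "\<forall>y. (\<forall>i j. (y - x) $ i $ j \<in> pE S n) \<longrightarrow> y \<in> A" by meson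
    show "\<exists>n. \<forall>y. (\<forall>i j. (y - x) $ i $ j \<in> pE S n) \<longrightarrow> y \<in> \<Union>\<A>"
      by (rule exI[of _ n]) (use n A in auto)
  qed
  ultimately have "istopology ?P"
    unfolding istopology_def by (intro conjI allI impI) simp_all
  then show ?thesis by (simp only: mat_top_def topology_inverse')
qed

definition mat_subgroup :: "('e::field ^ 2 ^ 2) set \<Rightarrow> bool" where
  "mat_subgroup U \<longleftrightarrow> mat 1 \<in> U \<and> (\<forall>x\<in>U. \<forall>y\<in>U. x ** y \<in> U) \<and> (\<forall>x\<in>U. invertible x \<and> matrix_inv x \<in> U)"

definition smooth_char :: "('f::field, 'e::field) setting \<Rightarrow> ('e ^ 2 ^ 2) set \<Rightarrow> ('e ^ 2 ^ 2 \<Rightarrow> complex) \<Rightarrow> bool" where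
  "smooth_char S H \<xi> \<longleftrightarrow>
     \<xi> (mat 1) = 1 \<and> (\<forall>x\<in>H. \<forall>y\<in>H. \<xi> (x ** y) = \<xi> x * \<xi> y) \<and>
     openin (subtopology (mat_top S) H) {x \<in> H. \<xi> x = 1}"

text \<open>A representation lives on a subspace \<open>rspace\<close> of an ambient complex vector space whose scalar
  multiplication is \<open>rscale\<close>; the values of \<open>ract\<close> matter only on the group in question and on \<open>rspace\<close>.
  So a representation of a group and its restriction to a subgroup are the same record.\<close>

record ('g, 'v) rep =
  rscale :: "complex \<Rightarrow> 'v \<Rightarrow> 'v"
  rspace :: "'v set"
  ract :: "'g \<Rightarrow> 'v \<Rightarrow> 'v"

definition is_rep :: "'g set \<Rightarrow> ('g \<Rightarrow> 'g \<Rightarrow> 'g) \<Rightarrow> 'g \<Rightarrow> ('g, 'v::ab_group_add) rep \<Rightarrow> bool" where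
  "is_rep H mul e R \<longleftrightarrow>
     vector_space (rscale R) \<and> module.subspace (rscale R) (rspace R) \<and>
     (\<forall>h\<in>H. \<forall>v\<in>rspace R. ract R h v \<in> rspace R) \<and>
     (\<forall>h\<in>H. \<forall>v\<in>rspace R. \<forall>w\<in>rspace R. ract R h (v + w) = ract R h v + ract R h w) \<and>
     (\<forall>h\<in>H. \<forall>c. \<forall>v\<in>rspace R. ract R h (rscale R c v) = rscale R c (ract R h v)) \<and>
     (\<forall>v\<in>rspace R. ract R e v = v) \<and>
     (\<forall>g\<in>H. \<forall>h\<in>H. \<forall>v\<in>rspace R. ract R (mul g h) v = ract R g (ract R h v))"

definition smooth_rep ::
    "('f::field, 'e::field) setting \<Rightarrow> ('e ^ 2 ^ 2) set \<Rightarrow> ('e ^ 2 ^ 2, 'v::ab_group_add) rep \<Rightarrow> bool" where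
  "smooth_rep S H R \<longleftrightarrow>
     is_rep H (**) (mat 1) R \<and>
     (\<forall>v\<in>rspace R. openin (subtopology (mat_top S) H) {h \<in> H. ract R h v = v})"

definition irreducible_rep ::
    "('f::field, 'e::field) setting \<Rightarrow> ('e ^ 2 ^ 2) set \<Rightarrow> ('e ^ 2 ^ 2, 'v::ab_group_add) rep \<Rightarrow> bool" where
  "irreducible_rep S H R \<longleftrightarrow>
     smooth_rep S H R \<and> rspace R \<noteq> {0} \<and>
     (\<forall>W. W \<subseteq> rspace R \<and> module.subspace (rscale R) W \<and> (\<forall>h\<in>H. \<forall>v\<in>W. ract R h v \<in> W)
          \<longrightarrow> W = {0} \<or> W = rspace R)"

definition rep_iso :: "'g set \<Rightarrow> ('g, 'v::ab_group_add) rep \<Rightarrow> ('g, 'w::ab_group_add) rep \<Rightarrow> bool" where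
  "rep_iso H A B \<longleftrightarrow>
     (\<exists>T. bij_betw T (rspace A) (rspace B) \<and>
       (\<forall>v\<in>rspace A. \<forall>w\<in>rspace A. T (v + w) = T v + T w) \<and>
       (\<forall>c. \<forall>v\<in>rspace A. T (rscale A c v) = rscale B c (T v)) \<and>
       (\<forall>h\<in>H. \<forall>v\<in>rspace A. T (ract A h v) = ract B h (T v)))"

definition char_rep :: "('g \<Rightarrow> complex) \<Rightarrow> ('g, complex) rep" where
  "char_rep \<xi> = \<lparr>rscale = (*), rspace = UNIV, ract = (\<lambda>g z. \<xi> g * z)\<rparr>"

definition rep_sum ::
    "('g, 'v::ab_group_add) rep \<Rightarrow> ('g, 'w::ab_group_add) rep \<Rightarrow> ('g, 'v \<times> 'w) rep" where
  "rep_sum A B =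
     \<lparr>rscale = (\<lambda>c (v, w). (rscale A c v, rscale B c w)),
      rspace = rspace A \<times> rspace B,
      ract = (\<lambda>g (v, w). (ract A g v, ract B g w))\<rparr>"

definition rep_dsum :: "'i set \<Rightarrow> ('i \<Rightarrow> ('g, 'v::ab_group_add) rep) \<Rightarrow> ('g, 'i \<Rightarrow> 'v) rep" where
  "rep_dsum I R =
     \<lparr>rscale = (\<lambda>c x i. rscale (R i) c (x i)),
      rspace = {x. (\<forall>i\<in>I. x i \<in> rspace (R i)) \<and> (\<forall>i. i \<notin> I \<longrightarrow> x i = 0) \<and> finite {i. x i \<noteq> 0}},
      ract = (\<lambda>g x i. if i \<in> I then ract (R i) g (x i) else 0)\<rparr>"

text \<open>Smooth induction from \<open>H\<close> to \<open>G\<close>; functions on \<open>G\<close> are extended by \<open>0\<close> to all matrices.\<close>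

definition smooth_Ind ::
    "('f::field, 'e::field) setting \<Rightarrow> ('e ^ 2 ^ 2) set \<Rightarrow> ('e ^ 2 ^ 2) set \<Rightarrow>
     ('e ^ 2 ^ 2, 'v::ab_group_add) rep \<Rightarrow> ('e ^ 2 ^ 2, 'e ^ 2 ^ 2 \<Rightarrow> 'v) rep" where
  "smooth_Ind S G H R =
     \<lparr>rscale = (\<lambda>c f x. rscale R c (f x)),
      rspace = {f. (\<forall>x. x \<notin> G \<longrightarrow> f x = 0) \<and> (\<forall>x\<in>G. f x \<in> rspace R) \<and>
                   (\<forall>h\<in>H. \<forall>x\<in>G. f (h ** x) = ract R h (f x)) \<and>
                   (\<exists>U. mat_subgroup U \<and> openin (subtopology (mat_top S) G) U \<and>
                        (\<forall>x\<in>G. \<forall>u\<in>U. f (x ** u) = f x))},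
      ract = (\<lambda>g f x. f (x ** g))\<rparr>"

definition compact_Ind ::
    "('f::field, 'e::field) setting \<Rightarrow> ('e ^ 2 ^ 2) set \<Rightarrow> ('e ^ 2 ^ 2) set \<Rightarrow>
     ('e ^ 2 ^ 2, 'v::ab_group_add) rep \<Rightarrow> ('e ^ 2 ^ 2, 'e ^ 2 ^ 2 \<Rightarrow> 'v) rep" where
  "compact_Ind S G H R =
     (smooth_Ind S G H R)
       \<lparr>rspace := {f \<in> rspace (smooth_Ind S G H R).
                    \<exists>C\<subseteq>G. compactin (mat_top S) C \<and> {x. f x \<noteq> 0} \<subseteq> set_prod H C}\<rparr>"


section \<open>The inducing representation\<close>

definition is_datum ::
    "('f::field, 'e::field) setting \<Rightarrow> 'f \<Rightarrow> 'f \<Rightarrow> real \<Rightarrow> real \<Rightarrow> ('e ^ 2 ^ 2 \<Rightarrow> complex) \<Rightarrow> bool" where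
  "is_datum S \<gamma>1 \<gamma>2 y r \<phi> \<longleftrightarrow>
     torus_point S \<gamma>1 \<gamma>2 y \<and> 0 < r \<and> smooth_char S (torus S \<gamma>1 \<gamma>2) \<phi> \<and> generic_char S \<gamma>1 \<gamma>2 y r \<phi>"

definition inducing_group ::
    "('f::field, 'e::field) setting \<Rightarrow> 'f \<Rightarrow> 'f \<Rightarrow> real \<Rightarrow> real \<Rightarrow> ('e ^ 2 ^ 2) set" where
  "inducing_group S \<gamma>1 \<gamma>2 y r = set_prod (Gyr S y (r / 2)) (torus S \<gamma>1 \<gamma>2)"

definition phi_hat ::
    "('f::field, 'e::field) setting \<Rightarrow> 'f \<Rightarrow> 'f \<Rightarrow> real \<Rightarrow> real \<Rightarrow> ('e ^ 2 ^ 2 \<Rightarrow> complex) \<Rightarrow> 'e ^ 2 ^ 2 \<Rightarrow>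
     'e ^ 2 ^ 2 \<Rightarrow> complex" where
  "phi_hat S \<gamma>1 \<gamma>2 y r \<phi> \<Gamma> x =
     (THE c. \<exists>g\<in>Gyr_plus S y (r / 2). \<exists>t\<in>torus S \<gamma>1 \<gamma>2. x = g ** t \<and> c = Psi S \<Gamma> g * \<phi> t)"

subsection \<open>The symplectic space and the Weil representation\<close>

text \<open>The constants of this subsection depend only on \<open>H = G\<^bsub>y,s\<^esub>\<close>, \<open>N = G\<^bsub>y,s+\<^esub> T\<^sub>s\<close>, the lattice
  \<open>L\<close> of matrices of depth \<open>> s\<close> at \<open>y\<close>, and a character \<open>\<theta>\<close> of \<open>N\<close>. The space \<open>V = H / N\<close> consists of
  cosets, its addition being the product of cosets.\<close>

definition coset_of :: "('e::field ^ 2 ^ 2) set \<Rightarrow> 'e ^ 2 ^ 2 \<Rightarrow> ('e ^ 2 ^ 2) set" where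
  "coset_of N g = set_prod {g} N"

definition quot_space :: "('e::field ^ 2 ^ 2) set \<Rightarrow> ('e ^ 2 ^ 2) set \<Rightarrow> ('e ^ 2 ^ 2) set set" where
  "quot_space H N = coset_of N ` H"

text \<open>The action of \<open>a\<close> (an integer of \<open>F\<close>) on \<open>V\<close>: it sends the class of \<open>1 + X\<close> to that of the
  elements of \<open>H\<close> congruent to \<open>1 + a X\<close> modulo \<open>L\<close>. It only depends on the residue class of \<open>a\<close>.\<close>

definition quot_scale ::
    "('f::field, 'e::field) setting \<Rightarrow> ('e ^ 2 ^ 2) set \<Rightarrow> ('e ^ 2 ^ 2) set \<Rightarrow> ('e ^ 2 ^ 2) set \<Rightarrow> 'f \<Rightarrow>
     ('e ^ 2 ^ 2) set \<Rightarrow> ('e ^ 2 ^ 2) set" where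
  "quot_scale S H N L a C =
     set_prod {h' \<in> H. \<exists>h\<in>C. (h' - mat 1) - mat (emb S a) ** (h - mat 1) \<in> L} N"

definition commutator :: "'e::field ^ 2 ^ 2 \<Rightarrow> 'e ^ 2 ^ 2 \<Rightarrow> 'e ^ 2 ^ 2" where
  "commutator g h = g ** h ** matrix_inv g ** matrix_inv h"

text \<open>The symplectic form with values in the residue field \<open>\<O>\<^sub>F / \<pp>\<^sub>F\<close> (a value is a residue class,
  i.e. a subset of \<open>F\<close>): \<open>\<langle>v, w\<rangle>\<close> is determined by \<open>\<psi>'(b \<langle>v, w\<rangle>) = \<theta> [b v, w]\<close> for all integers \<open>b\<close>.\<close>

definition symp_form ::
    "('f::field, 'e::field) setting \<Rightarrow> ('e ^ 2 ^ 2) set \<Rightarrow> ('e ^ 2 ^ 2) set \<Rightarrow> ('e ^ 2 ^ 2) set \<Rightarrow>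
     ('e ^ 2 ^ 2 \<Rightarrow> complex) \<Rightarrow> ('e ^ 2 ^ 2) set \<Rightarrow> ('e ^ 2 ^ 2) set \<Rightarrow> 'f set" where
  "symp_form S H N L \<theta> C D =
     {a \<in> pF S 0. \<forall>b\<in>pF S 0. \<forall>g\<in>quot_scale S H N L b C. \<forall>h\<in>D. psiF S (b * a) = \<theta> (commutator g h)}"

definition symp_group ::
    "('f::field, 'e::field) setting \<Rightarrow> ('e ^ 2 ^ 2) set \<Rightarrow> ('e ^ 2 ^ 2) set \<Rightarrow> ('e ^ 2 ^ 2) set \<Rightarrow>
     ('e ^ 2 ^ 2 \<Rightarrow> complex) \<Rightarrow> (('e ^ 2 ^ 2) set \<Rightarrow> ('e ^ 2 ^ 2) set) set" where
  "symp_group S H N L \<theta> =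
     {A \<in> extensional (quot_space H N). bij_betw A (quot_space H N) (quot_space H N) \<and>
        (\<forall>C\<in>quot_space H N. \<forall>D\<in>quot_space H N. A (set_prod C D) = set_prod (A C) (A D)) \<and>
        (\<forall>a\<in>pF S 0. \<forall>C\<in>quot_space H N. A (quot_scale S H N L a C) = quot_scale S H N L a (A C)) \<and>
        (\<forall>C\<in>quot_space H N. \<forall>D\<in>quot_space H N.
           symp_form S H N L \<theta> (A C) (A D) = symp_form S H N L \<theta> C D)}"

text \<open>\<open>is_heis_coord \<dots> T c\<close> says that \<open>h \<mapsto> (h N, c h)\<close> is a homomorphism from \<open>H\<close> to the Heisenberg
  group \<open>V \<times> \<complex>\<^sup>*\<close> with product \<open>(v, a) (w, b) = (v + w, a b \<psi>'(\<langle>v, w\<rangle> / 2))\<close>, extending \<open>\<theta>\<close> on the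
  central part \<open>N\<close> and equivariant for \<open>T\<close>, which acts on \<open>H\<close> by conjugation and on the Heisenberg group
  through the symplectic group (a special isomorphism in the sense of Yu). For the tori used here it
  is unique, two choices differing by a \<open>T\<close>-invariant character of \<open>V\<close>.\<close>

definition is_heis_coord ::
    "('f::field, 'e::field) setting \<Rightarrow> ('e ^ 2 ^ 2) set \<Rightarrow> ('e ^ 2 ^ 2) set \<Rightarrow> ('e ^ 2 ^ 2) set \<Rightarrow>
     ('e ^ 2 ^ 2 \<Rightarrow> complex) \<Rightarrow> ('e ^ 2 ^ 2) set \<Rightarrow> ('e ^ 2 ^ 2 \<Rightarrow> complex) \<Rightarrow> bool" where
  "is_heis_coord S H N L \<theta> T c \<longleftrightarrow>
     (\<forall>h\<in>H. c h \<noteq> 0) \<and> (\<forall>n\<in>N. c n = \<theta> n) \<and>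
     (\<forall>g\<in>H. \<forall>h\<in>H. \<forall>a\<in>symp_form S H N L \<theta> (coset_of N g) (coset_of N h).
        c (g ** h) = c g * c h * psiF S (a / 2)) \<and>
     (\<forall>t\<in>T. \<forall>h\<in>H. c (mconj t h) = c h)"

text \<open>A Weil representation of \<open>Sp(V)\<close> on the space \<open>U\<close> of the Heisenberg representation \<open>\<eta>\<close> of \<open>H\<close>.
  As a representation of the Heisenberg group, \<open>\<eta>\<close> sends \<open>(h N, 1)\<close> to \<open>(c h)\<^sup>-\<^sup>1 \<eta> h\<close>, and \<open>\<omega> A\<close>
  must intertwine this with its twist by \<open>A\<close>. This determines \<open>\<omega>\<close> up to a character of \<open>Sp(V) = SL\<^sub>2(q)\<close>,
  hence uniquely unless \<open>q = 3\<close>; in that case the ambiguity is a cubic character, which is trivial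
  on the image of \<open>T\<close>, a group of order dividing \<open>q + 1 = 4\<close>.\<close>

definition is_weil_rep ::
    "('f::field, 'e::field) setting \<Rightarrow> ('e ^ 2 ^ 2) set \<Rightarrow> ('e ^ 2 ^ 2) set \<Rightarrow> ('e ^ 2 ^ 2) set \<Rightarrow>
     ('e ^ 2 ^ 2 \<Rightarrow> complex) \<Rightarrow> ('e ^ 2 ^ 2) set \<Rightarrow> ('e ^ 2 ^ 2, 'v::ab_group_add) rep \<Rightarrow>
     (('e ^ 2 ^ 2) set \<Rightarrow> ('e ^ 2 ^ 2) set, 'v) rep \<Rightarrow> bool" where
  "is_weil_rep S H N L \<theta> T \<eta> \<omega> \<longleftrightarrow>
     rscale \<omega> = rscale \<eta> \<and> rspace \<omega> = rspace \<eta> \<and>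
     is_rep (symp_group S H N L \<theta>) (compose (quot_space H N)) (restrict id (quot_space H N)) \<omega> \<and>
     (\<exists>c. is_heis_coord S H N L \<theta> T c \<and>
       (\<forall>A\<in>symp_group S H N L \<theta>. \<forall>h\<in>H. \<forall>h'\<in>A (coset_of N h). \<forall>v\<in>rspace \<eta>.
          ract \<omega> A (rscale \<eta> (inverse (c h)) (ract \<eta> h v)) =
          rscale \<eta> (inverse (c h')) (ract \<eta> h' (ract \<omega> A v))))"

definition conj_action ::
    "('e::field ^ 2 ^ 2) set \<Rightarrow> ('e ^ 2 ^ 2) set \<Rightarrow> 'e ^ 2 ^ 2 \<Rightarrow> ('e ^ 2 ^ 2) set \<Rightarrow> ('e ^ 2 ^ 2) set" where
  "conj_action H N t = restrict (\<lambda>C. mconj t ` C) (quot_space H N)"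

subsection \<open>The representation attached to a datum\<close>

text \<open>\<open>R\<close> is (a model of) the representation \<open>\<rho>(T, y, r, \<phi>)\<close> of \<open>G\<^bsub>y,s\<^esub> T\<close>. The extended
  character and hence \<open>R\<close> do not depend on the choice of \<open>\<Gamma>\<close>.\<close>

definition is_rho ::
    "('f::field, 'e::field) setting \<Rightarrow> 'f \<Rightarrow> 'f \<Rightarrow> real \<Rightarrow> real \<Rightarrow> ('e ^ 2 ^ 2 \<Rightarrow> complex) \<Rightarrow>
     ('e ^ 2 ^ 2, 'v::ab_group_add) rep \<Rightarrow> bool" where
  "is_rho S \<gamma>1 \<gamma>2 y r \<phi> R \<longleftrightarrow>
     smooth_rep S (inducing_group S \<gamma>1 \<gamma>2 y r) R \<and>
     (\<exists>\<Gamma>. generic_elt S \<gamma>1 \<gamma>2 y r \<Gamma> \<and> represents S \<gamma>1 \<gamma>2 y r \<Gamma> \<phi> \<and>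
       (let T = torus S \<gamma>1 \<gamma>2;
            H = Gyr S y (r / 2);
            N = set_prod (Gyr_plus S y (r / 2)) (torus_r S \<gamma>1 \<gamma>2 y (r / 2));
            L = (\<Union>s\<in>{r / 2<..}. mat_lattice S y s);
            \<theta> = phi_hat S \<gamma>1 \<gamma>2 y r \<phi> \<Gamma>
        in if H = Gyr_plus S y (r / 2)
           then vector_space.dim (rscale R) (rspace R) = 1 \<and>
                (\<forall>x\<in>inducing_group S \<gamma>1 \<gamma>2 y r. \<forall>v\<in>rspace R. ract R x v = rscale R (\<theta> x) v)
           else \<exists>\<eta> \<omega>. rscale \<eta> = rscale R \<and> rspace \<eta> = rspace R \<and> irreducible_rep S H \<eta> \<and>
                  (\<forall>n\<in>N. \<forall>v\<in>rspace \<eta>. ract \<eta> n v = rscale \<eta> (\<theta> n) v) \<and>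
                  is_weil_rep S H N L \<theta> T \<eta> \<omega> \<and>
                  (\<forall>g\<in>H. \<forall>t\<in>T. \<forall>v\<in>rspace R.
                     ract R (g ** t) v = ract \<eta> g (ract \<omega> (conj_action H N t) (rscale R (\<phi> t) v)))))"


section \<open>The representations \<open>\<S>\<^sub>d(X, \<zeta>)\<close> of the maximal compact subgroup\<close>

text \<open>The parameter \<open>d\<close> is a real number, required to be a positive integer in \<open>S_param\<close>; it occurs
  below as \<open>r + 2 t\<close> and the like, where \<open>2 r\<close> is an integer.\<close>

definition Jd :: "('f::field, 'e::field) setting \<Rightarrow> real \<Rightarrow> ('e ^ 2 ^ 2) set" where
  "Jd S d = {g \<in> unitary_group S.
     g $ 1 $ 1 - 1 \<in> pE S \<lceil>d / 2\<rceil> \<and> g $ 1 $ 2 \<in> pE S \<lceil>d / 2\<rceil> \<and>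
     g $ 2 $ 1 \<in> pE S \<lceil>(d + 1) / 2\<rceil> \<and> g $ 2 $ 2 - 1 \<in> pE S \<lceil>d / 2\<rceil>}"

definition TX :: "('f::field, 'e::field) setting \<Rightarrow> 'e ^ 2 ^ 2 \<Rightarrow> ('e ^ 2 ^ 2) set" where
  "TX S X = {k \<in> maxK S. k ** X = X ** k}"

definition S_param ::
    "('f::field, 'e::field) setting \<Rightarrow> real \<Rightarrow> 'e ^ 2 ^ 2 \<Rightarrow> ('e ^ 2 ^ 2 \<Rightarrow> complex) \<Rightarrow> bool" where
  "S_param S d X \<zeta> \<longleftrightarrow>
     d \<in> \<int> \<and> 0 < d \<and>
     (\<exists>z u v. X = mat2 (emb S z * sqrt_eps S) (emb S u * sqrt_eps S)
                       (emb S v * sqrt_eps S) (emb S z * sqrt_eps S) \<and>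
              u \<noteq> 0 \<and> real_of_int (nu S u) = - d \<and>
              (z = 0 \<or> nu S u < nu S z) \<and> (v = 0 \<or> nu S u < nu S v)) \<and>
     smooth_char S (TX S X) \<zeta> \<and> (\<forall>k\<in>TX S X \<inter> Jd S d. \<zeta> k = Psi S X k)"

definition Psi_ext ::
    "('f::field, 'e::field) setting \<Rightarrow> real \<Rightarrow> 'e ^ 2 ^ 2 \<Rightarrow> ('e ^ 2 ^ 2 \<Rightarrow> complex) \<Rightarrow> 'e ^ 2 ^ 2 \<Rightarrow> complex" where
  "Psi_ext S d X \<zeta> x = (THE c. \<exists>t\<in>TX S X. \<exists>j\<in>Jd S d. x = t ** j \<and> c = \<zeta> t * Psi S X j)"

definition S_rep ::
    "('f::field, 'e::field) setting \<Rightarrow> real \<Rightarrow> 'e ^ 2 ^ 2 \<Rightarrow> ('e ^ 2 ^ 2 \<Rightarrow> complex) \<Rightarrow>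
     ('e ^ 2 ^ 2, 'e ^ 2 ^ 2 \<Rightarrow> complex) rep" where
  "S_rep S d X \<zeta> = smooth_Ind S (maxK S) (set_prod (TX S X) (Jd S d)) (char_rep (Psi_ext S d X \<zeta>))"

end

theory Submission
  imports Defs
begin

text \<open>By Mackey theory the restriction to \<open>K\<close> is the sum, over the double cosets \<open>K g J\<close> with
  \<open>J = G\<^bsub>y,s\<^esub> T\<close>, of the representations induced to \<open>K\<close> from the conjugate of \<open>\<rho>\<close> restricted to
  \<open>K \<inter> g J g\<inverse>\<close>. An Iwahori factorization followed by absorption of upper triangular entries into \<open>T\<close>
  shows that the elements \<open>\<alpha>\<^sup>t\<close>, \<open>t \<ge> 0\<close> (and \<open>\<alpha>\<^sup>t w\<close>, \<open>t > 0\<close>, for ramified \<open>T\<close>) represent these cosets.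
  Conjugating a datum by such an element gives a datum of the same kind with another point \<open>y'\<close>, so
  only the trivial coset has to be studied, for all \<open>y'\<close> at once.

  If \<open>y' > 0\<close>, put \<open>d = r + y'\<close>. The space of \<open>\<rho>\<close> contains a vector on which \<open>K \<inter> J \<inter> \<J>\<^sub>d\<close> acts through
  \<open>\<Psi>\<^sub>\<Gamma>\<close>, found by averaging over lower unipotent elements, and \<open>K \<inter> T\<close> acts on all of it by \<open>\<phi>\<close>
  because its elements are scalar modulo \<open>\<pp>\<close>. This vector yields an equivariant map between
  the summand and the irreducible representation \<open>\<S>\<^sub>d(\<Gamma>, \<phi>)\<close>. If \<open>y' = 0\<close>, an element of \<open>K\<close> that intertwines
  \<open>\<Psi>\<^sub>\<Gamma>\<close> on \<open>G\<^bsub>0,s+\<^esub>\<close> commutes with \<open>\<Gamma>\<close> up to depth \<open>-s\<close> and hence lies in \<open>J\<close>, which makes the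
  induced representation irreducible.\<close>

text \<open>Degrees are never compared. An eigenfunction gives an equivariant map by summation over
  cosets; it is injective because its source, an \<open>S_rep\<close>, is irreducible, and
  surjective by a second averaging. The obstacle is the case where \<rho> has dimension q: it is not
  scalar on \<open>H\<close>, only on \<open>Hp\<close>, so a vector with the right behaviour under
  lower unipotent elements of depth exactly s + y has to be produced. The Weil representation stays
  out of sight because torus elements that are scalar up to positive depth at y act trivially on V.
  All intertwining computations rest on one principle: a skew matrix that pairs trivially with a
  filtration group has its entries in the dual lattices, and the integrality of valuations turns
  strict inequalities into half steps. Real-valued depths remove the ceilings, and the point 1/4,
  interior to an alcove, makes the Iwahori subgroup and \<open>Jd S d\<close> members of one
  filtration. Topology is reduced to the congruence groups \<open>Gyr S 0 n\<close>, and integration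
  to finite sums \<open>csum\<close> over cosets.\<close>

locale u11 =
  fixes S :: "('f::field, 'e::field) setting"
  assumes u11: "u11_setting S"
begin

sublocale F: nonarch_local_field "nu S" "unif S"
  using u11 by (simp add: u11_setting_def)

abbreviation "\<nu> \<equiv> nu S"
abbreviation "\<pi> \<equiv> unif S"
abbreviation "\<iota> \<equiv> emb S"
abbreviation "\<sigma> \<equiv> sqrt_eps S"
abbreviation "\<epsilon> \<equiv> eps S"
abbreviation "bar \<equiv> conjE S"

subsection \<open>The valuation of \<open>F\<close>\<close>

lemma nu_one [simp]: "\<nu> 1 = 0"
  using F.val_mult[of 1 1] by simp

lemma nu_mult: "x \<noteq> 0 \<Longrightarrow> y \<noteq> 0 \<Longrightarrow> \<nu> (x * y) = \<nu> x + \<nu> y"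
  by (rule F.val_mult)

lemma nu_minus [simp]: "\<nu> (- x) = \<nu> x"
proof (cases "x = 0")
  case False
  have "\<nu> (- 1) = 0" using F.val_mult[of "-1" "-1"] by simp
  then show ?thesis using F.val_mult[of "-1" x] False by simp
qed simp

lemma nu_inverse: "x \<noteq> 0 \<Longrightarrow> \<nu> (inverse x) = - \<nu> x"
  using F.val_mult[of x "inverse x"] by simp

lemma nu_divide: "x \<noteq> 0 \<Longrightarrow> y \<noteq> 0 \<Longrightarrow> \<nu> (x / y) = \<nu> x - \<nu> y"
  by (simp add: divide_inverse F.val_mult nu_inverse)

lemma nu_power: "x \<noteq> 0 \<Longrightarrow> \<nu> (x ^ n) = int n * \<nu> x"
  by (induction n) (auto simp: F.val_mult algebra_simps)

lemma unif_nonzero [simp]: "\<pi> \<noteq> 0" by (rule F.unif_nonzero)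

lemma nu_powi [simp]: "\<nu> (\<pi> powi n) = n"
  by (cases "n \<ge> 0") (simp_all add: power_int_def nu_power F.val_unif nu_inverse)

lemma nu_add: "x \<noteq> 0 \<Longrightarrow> y \<noteq> 0 \<Longrightarrow> x + y \<noteq> 0 \<Longrightarrow> min (\<nu> x) (\<nu> y) \<le> \<nu> (x + y)"
  by (rule F.val_add)

lemma pF_add: "x \<in> pF S n \<Longrightarrow> y \<in> pF S n \<Longrightarrow> x + y \<in> pF S n"
  using nu_add[of x y] by (fastforce simp: val_ideal_def)

lemma pF_minus: "x \<in> pF S n \<Longrightarrow> - x \<in> pF S n"
  by (auto simp: val_ideal_def)

lemma pF_diff: "x \<in> pF S n \<Longrightarrow> y \<in> pF S n \<Longrightarrow> x - y \<in> pF S n"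
  using pF_add[of x n "- y"] pF_minus by fastforce

lemma pF_mult: "x \<in> pF S m \<Longrightarrow> y \<in> pF S n \<Longrightarrow> x * y \<in> pF S (m + n)"
  unfolding val_ideal_def using F.val_mult[of x y] by fastforce

lemma pF_mono: "x \<in> pF S m \<Longrightarrow> n \<le> m \<Longrightarrow> x \<in> pF S n"
  by (auto simp: val_ideal_def)

lemma zero_pF [simp]: "0 \<in> pF S n" by (simp add: val_ideal_def)

lemma pF_Inter: assumes "\<And>n. x \<in> pF S n" shows "x = 0"
  using assms[of "\<nu> x + 1"] by (auto simp: val_ideal_def)

lemma nu_add_eq: assumes "x \<noteq> 0" "y = 0 \<or> \<nu> x < \<nu> y"
  shows "x + y \<noteq> 0 \<and> \<nu> (x + y) = \<nu> x"
proof (cases "y = 0")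
  case False
  then have lt: "\<nu> x < \<nu> y" using assms by auto
  have ne: "x + y \<noteq> 0"
  proof
    assume "x + y = 0" then have "x = - y" by (simp add: eq_neg_iff_add_eq_0)
    then show False using lt by simp
  qed
  have 1: "\<nu> x \<le> \<nu> (x + y)" using nu_add[OF assms(1) False ne] lt by simp
  have "min (\<nu> (x + y)) (\<nu> y) \<le> \<nu> x"
    using nu_add[of "x + y" "- y"] ne False assms(1) by simp
  then show ?thesis using 1 ne lt by simp
qed (use assms in simp)

text \<open>If 2 had positive valuation, the least positive integer in the maximal ideal would be 2,
  since 1 has valuation 0; this contradicts the assumption on the residual characteristic.\<close>

lemma two_F: "(2::'f) \<noteq> 0 \<and> \<nu> 2 = 0"
proof -
  have "of_nat 2 \<notin> pF S 1"
  proof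
    assume a: "of_nat 2 \<in> pF S 1"
    have "residual_char \<nu> = 2" unfolding residual_char_def
    proof (rule Least_equality)
      show "0 < (2::nat) \<and> of_nat 2 \<in> pF S 1" using a by simp
      fix p :: nat assume p: "0 < p \<and> of_nat p \<in> pF S 1"
      have "p \<noteq> 1" using p by (auto simp: val_ideal_def)
      then show "2 \<le> p" using p by linarith
    qed
    then show False using u11 by (simp add: u11_setting_def)
  qed
  then have ne: "(2::'f) \<noteq> 0" and "\<nu> 2 < 1" by (auto simp: val_ideal_def)
  moreover have "0 \<le> \<nu> 2" using nu_add[of 1 1] ne by simp
  ultimately show ?thesis by simp
qed

lemma two_F_nonzero [simp]: "(2::'f) \<noteq> 0" and nu_two [simp]: "\<nu> 2 = 0"
  using two_F by auto

lemma half_pF: "x \<in> pF S n \<Longrightarrow> x / 2 \<in> pF S n"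
  by (cases "x = 0") (auto simp: val_ideal_def nu_divide)

text \<open>The form of Hensel's lemma behind every later construction of torus elements: units
  close to 1 have square roots equally close to 1.\<close>

lemma sqrt_one_plus:
  assumes c: "c \<in> pF S n" and n: "n \<ge> 1"
  shows "\<exists>m. m - 1 \<in> pF S n \<and> m * m = 1 + c"
proof -
  \<comment> \<open>Newton iteration with the derivative frozen at its value 2 at the starting point
    1. Convergence is only linear, one step of valuation at a time, but the error is easy to
    follow.\<close>
  define X where "X = rec_nat (1::'f) (\<lambda>k x. x - (x * x - 1 - c) / 2)"
  have X0: "X 0 = 1" and XS: "\<And>k. X (Suc k) = X k - (X k * X k - 1 - c) / 2"
    by (simp_all add: X_def)
  have inv: "X k - 1 \<in> pF S n \<and> X k * X k - 1 - c \<in> pF S (n + int k)" for k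
  proof (induction k)
    case 0
    show ?case using c by (simp add: X0 pF_minus)
  next
    case (Suc k)
    define d where "d = X k * X k - 1 - c"
    have d: "d \<in> pF S (n + int k)" and x: "X k - 1 \<in> pF S n" using Suc by (auto simp: d_def)
    have d2: "d / 2 \<in> pF S (n + int k)" by (rule half_pF[OF d])
    have "X (Suc k) - 1 = (X k - 1) - d / 2" by (simp add: XS d_def)
    then have 1: "X (Suc k) - 1 \<in> pF S n"
      using pF_diff[OF x, of "d/2"] pF_mono[OF d2, of n] by (metis of_nat_0_le_iff le_add_same_cancel1)
    have sq: "(X k - h) * (X k - h) - 1 - c = (X k * X k - 1 - c) - X k * (h + h) + h * h" for h
      by (simp add: algebra_simps)
    have "X (Suc k) * X (Suc k) - 1 - c = d - X k * d + (d / 2) * (d / 2)"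
      using sq[of "d / 2"] by (simp add: XS flip: d_def)
    also have "\<dots> = (d / 2) * (d / 2) - (X k - 1) * d" by (simp add: algebra_simps)
    finally have "X (Suc k) * X (Suc k) - 1 - c = (d / 2) * (d / 2) - (X k - 1) * d" .
    moreover have "(d / 2) * (d / 2) \<in> pF S (n + int (Suc k))"
      by (rule pF_mono[OF pF_mult[OF d2 d2]]) (use n in simp)
    moreover have "(X k - 1) * d \<in> pF S (n + int (Suc k))"
      by (rule pF_mono[OF pF_mult[OF x d]]) (use n in simp)
    ultimately show ?case using 1 pF_diff by simp
  qed
  have step: "X (Suc k) - X k \<in> pF S (n + int k)" for k
    using pF_minus[OF half_pF[of "X k * X k - 1 - c"]] inv[of k] by (simp add: XS)
  have mono: "X (k + j) - X k \<in> pF S (n + int k)" for j k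
  proof (induction j)
    case (Suc j)
    have "X (k + Suc j) - X k = (X (Suc (k + j)) - X (k + j)) + (X (k + j) - X k)" by simp
    moreover have "X (Suc (k + j)) - X (k + j) \<in> pF S (n + int k)" by (rule pF_mono[OF step]) simp
    ultimately show ?case using pF_add[OF _ Suc] by metis
  qed simp
  have mono2: "X i - X k \<in> pF S (int k)" if "k \<le> i" for i k
    using pF_mono[OF mono[of k "i - k"], of "int k"] that n by simp
  have "\<exists>L. \<forall>l. \<exists>N. \<forall>i\<ge>N. X i - L \<in> pF S l"
  proof (rule F.complete, rule allI)
    fix l
    show "\<exists>N. \<forall>i\<ge>N. \<forall>j\<ge>N. X i - X j \<in> pF S l"
    proof (intro exI[of _ "nat l"] allI impI)
      fix i j assume "nat l \<le> i" "nat l \<le> j"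
      then have "(X i - X (nat l)) - (X j - X (nat l)) \<in> pF S (int (nat l))"
        by (intro pF_diff mono2)
      then show "X i - X j \<in> pF S l" by (auto intro: pF_mono)
    qed
  qed
  then obtain L where L: "\<And>l. \<exists>N. \<forall>i\<ge>N. X i - L \<in> pF S l" by blast
  have L1: "L - 1 \<in> pF S n"
  proof -
    obtain N where "X N - L \<in> pF S n" using L[of n] by auto
    then have "(X N - 1) - (X N - L) \<in> pF S n" using inv[of N] pF_diff by blast
    then show ?thesis by simp
  qed
  have "L * L - 1 - c \<in> pF S l" for l
  proof -
    obtain N where N: "\<And>i. i \<ge> N \<Longrightarrow> X i - L \<in> pF S (max l 0)" using L[of "max l 0"] by auto
    define i where "i = max N (nat l)"
    have a: "X i - L \<in> pF S (max l 0)" using N i_def by simp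
    have Xi: "X i - 1 \<in> pF S 0" using inv[of i] n by (auto intro: pF_mono)
    have Li: "L - 1 \<in> pF S 0" using L1 n by (auto intro: pF_mono)
    have "(1::'f) \<in> pF S 0" by (simp add: val_ideal_def)
    then have "(X i - 1) + (L - 1) + (1 + 1) \<in> pF S 0" using Xi Li by (intro pF_add)
    then have "X i + L \<in> pF S 0" by simp
    from pF_mult[OF a this] have b: "(X i - L) * (X i + L) \<in> pF S l" by (auto intro: pF_mono)
    have e: "X i * X i - 1 - c \<in> pF S l"
      using inv[of i] n by (elim conjE, elim pF_mono) (auto simp: i_def)
    have "L * L - 1 - c = (X i * X i - 1 - c) - (X i - L) * (X i + L)" by (simp add: algebra_simps)
    then show ?thesis using pF_diff[OF e b] by metis
  qed
  then have "L * L - 1 - c = 0" by (rule pF_Inter)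
  then have "L * L = 1 + c" by (simp add: algebra_simps)
  then show ?thesis using L1 by blast
qed

lemma eps_nonzero [simp]: "\<epsilon> \<noteq> 0" and nu_eps [simp]: "\<nu> \<epsilon> = 0"
  and eps_nonsquare: "x ^ 2 \<noteq> \<epsilon>"
  using u11 by (auto simp: u11_setting_def)

text \<open>If t * t were congruent to \<epsilon>, the quotient of \<epsilon> by t * t would be
  close to 1, hence a square, and \<epsilon> with it. This is what makes E unramified.\<close>

lemma unit_sq_eps: assumes "t \<noteq> 0" "\<nu> t = 0"
  shows "t * t - \<epsilon> \<noteq> 0 \<and> \<nu> (t * t - \<epsilon>) = 0"
proof -
  have ne: "t * t - \<epsilon> \<noteq> 0" using eps_nonsquare[of t] by (simp add: power2_eq_square)
  have "min (\<nu> (t * t)) (\<nu> (- \<epsilon>)) \<le> \<nu> (t * t + - \<epsilon>)"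
    by (rule nu_add) (use assms ne in auto)
  then have ge: "0 \<le> \<nu> (t * t - \<epsilon>)" using assms by (simp add: nu_mult)
  have "\<not> 1 \<le> \<nu> (t * t - \<epsilon>)"
  proof
    assume a: "1 \<le> \<nu> (t * t - \<epsilon>)"
    define c where "c = (\<epsilon> - t * t) / (t * t)"
    have "\<nu> (\<epsilon> - t * t) = \<nu> (t * t - \<epsilon>)" using nu_minus[of "t * t - \<epsilon>"] by simp
    then have "c \<in> pF S 1" using a assms ne by (auto simp: c_def val_ideal_def nu_divide nu_mult)
    then obtain m where "m * m = 1 + c" using sqrt_one_plus by blast
    then have "(t * m) * (t * m) = t * t * (1 + c)" by (simp add: ac_simps)
    also have "\<dots> = t * t + t * t * c" by (simp add: algebra_simps)
    also have "\<dots> = \<epsilon>" using assms(1) by (simp add: c_def)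
    finally have "(t * m) ^ 2 = \<epsilon>" by (simp add: power2_eq_square)
    then show False using eps_nonsquare by blast
  qed
  then show ?thesis using ne ge by simp
qed

text \<open>Meaningless at \<open>(0, 0)\<close>.\<close>

definition vpair :: "'f \<Rightarrow> 'f \<Rightarrow> int" where
  "vpair a b = (if a = 0 then \<nu> b else if b = 0 then \<nu> a else min (\<nu> a) (\<nu> b))"

text \<open>The norm form has no cancellation: for equal valuations the quotient a / b is a unit and
  \<open>unit_sq_eps\<close> applies, otherwise one of the two squares dominates.\<close>

lemma nu_norm_form: assumes "a \<noteq> 0 \<or> b \<noteq> 0"
  shows "a * a - \<epsilon> * (b * b) \<noteq> 0 \<and> \<nu> (a * a - \<epsilon> * (b * b)) = 2 * vpair a b"
proof (cases "a \<noteq> 0 \<and> b \<noteq> 0 \<and> \<nu> a = \<nu> b")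
  case True
  then have t: "a / b \<noteq> 0" "\<nu> (a / b) = 0" by (auto simp: nu_divide)
  have "a * a - \<epsilon> * (b * b) = ((a / b) * (a / b) - \<epsilon>) * (b * b)" using True by (simp add: field_simps)
  then show ?thesis using unit_sq_eps[OF t] True by (simp add: nu_mult vpair_def)
next
  case False
  show ?thesis
  proof (cases "a = 0 \<or> (b \<noteq> 0 \<and> \<nu> b < \<nu> a)")
    case True
    then have b: "b \<noteq> 0" using assms by auto
    have "- \<epsilon> * (b * b) + a * a \<noteq> 0 \<and> \<nu> (- \<epsilon> * (b * b) + a * a) = \<nu> (- \<epsilon> * (b * b))"
      by (rule nu_add_eq, use b in simp, cases "a = 0", use True b in \<open>auto simp: nu_mult\<close>)
    then show ?thesis using b True by (cases "a = 0") (auto simp: nu_mult vpair_def)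
  next
    case nb: False
    then have a: "a \<noteq> 0" by auto
    have "a * a + - \<epsilon> * (b * b) \<noteq> 0 \<and> \<nu> (a * a + - \<epsilon> * (b * b)) = \<nu> (a * a)"
      by (rule nu_add_eq, use a in simp, cases "b = 0", use False nb a in \<open>auto simp: nu_mult\<close>)
    then show ?thesis using a False nb by (cases "b = 0") (auto simp: nu_mult vpair_def)
  qed
qed

subsection \<open>The quadratic extension\<close>

lemma emb_1 [simp]: "\<iota> 1 = 1" and emb_add [simp]: "\<iota> (x + y) = \<iota> x + \<iota> y"
  and emb_mult [simp]: "\<iota> (x * y) = \<iota> x * \<iota> y"
  and sigma_sq: "\<sigma> * \<sigma> = \<iota> \<epsilon>" and E_coord: "\<exists>a b. z = \<iota> a + \<iota> b * \<sigma>"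
  using u11 by (auto simp: u11_setting_def power2_eq_square)

lemma emb_0 [simp]: "\<iota> 0 = 0"
  using emb_add[of 0 0] by (metis add.right_neutral add_cancel_right_right)

lemma emb_minus [simp]: "\<iota> (- x) = - \<iota> x"
  using emb_add[of x "- x"] by (simp del: emb_add add: eq_neg_iff_add_eq_0 add.commute)

lemma emb_diff [simp]: "\<iota> (x - y) = \<iota> x - \<iota> y"
  using emb_add[of x "- y"] by (simp del: emb_add)

lemma emb_eq_0 [simp]: "\<iota> x = 0 \<longleftrightarrow> x = 0"
proof
  assume a: "\<iota> x = 0"
  show "x = 0"
  proof (rule ccontr)
    assume "x \<noteq> 0"
    then have "\<iota> x * \<iota> (inverse x) = 1" by (simp flip: emb_mult)
    then show False using a by simp
  qed
qed simp

lemma emb_eq [simp]: "\<iota> x = \<iota> y \<longleftrightarrow> x = y"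
  using emb_eq_0[of "x - y"] by (simp del: emb_eq_0)

lemma emb_inverse [simp]: "\<iota> (inverse x) = inverse (\<iota> x)"
proof (cases "x = 0")
  case False
  then have "\<iota> x * \<iota> (inverse x) = 1" by (simp flip: emb_mult)
  then show ?thesis by (metis inverse_unique)
qed simp

lemma emb_divide [simp]: "\<iota> (x / y) = \<iota> x / \<iota> y"
  by (simp add: divide_inverse)

lemma emb_2 [simp]: "\<iota> 2 = 2"
  using emb_add[of 1 1] by (simp del: emb_add)

lemma two_E [simp]: "(2::'e) \<noteq> 0"
  using emb_eq_0[of 2] by (simp del: emb_eq_0)

lemma emb_power [simp]: "\<iota> (x ^ n) = \<iota> x ^ n"
  by (induction n) auto

lemma emb_powi [simp]: "\<iota> (x powi n) = \<iota> x powi n"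
  by (simp add: power_int_def)

lemma inv_emb [simp]: "inv \<iota> (\<iota> x) = x"
  by (simp add: inv_f_f inj_def)

lemma sigma_ne_emb: "\<sigma> \<noteq> \<iota> a"
proof
  assume "\<sigma> = \<iota> a"
  then have "\<iota> (a ^ 2) = \<iota> \<epsilon>" using sigma_sq by (simp add: power2_eq_square)
  then show False using eps_nonsquare by (simp del: emb_power)
qed

lemma sigma_nonzero [simp]: "\<sigma> \<noteq> 0" using sigma_ne_emb[of 0] by simp

lemma coord_eq [simp]: "\<iota> a + \<iota> b * \<sigma> = \<iota> c + \<iota> d * \<sigma> \<longleftrightarrow> a = c \<and> b = d"
proof
  assume eq: "\<iota> a + \<iota> b * \<sigma> = \<iota> c + \<iota> d * \<sigma>"
  have "b = d"
  proof (rule ccontr)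
    assume "b \<noteq> d"
    then have "\<sigma> = \<iota> ((a - c) / (d - b))" using eq by (simp add: field_simps)
    then show False using sigma_ne_emb by blast
  qed
  then show "a = c \<and> b = d" using eq by simp
qed simp

lemma bar_coord [simp]: "bar (\<iota> a + \<iota> b * \<sigma>) = \<iota> a - \<iota> b * \<sigma>"
  unfolding conjE_def by (rule the_equality) auto

lemma bar_add [simp]: "bar (x + y) = bar x + bar y"
proof -
  obtain a b c d where x: "x = \<iota> a + \<iota> b * \<sigma>" and y: "y = \<iota> c + \<iota> d * \<sigma>" using E_coord by metis
  have "x + y = \<iota> (a + c) + \<iota> (b + d) * \<sigma>" by (simp add: x y algebra_simps)
  then show ?thesis unfolding x y by (metis bar_coord add_diff_add distrib_right emb_add)
qed

lemma bar_mult [simp]: "bar (x * y) = bar x * bar y"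
proof -
  obtain a b c d where x: "x = \<iota> a + \<iota> b * \<sigma>" and y: "y = \<iota> c + \<iota> d * \<sigma>" using E_coord by metis
  have s: "\<sigma> * (\<sigma> * z) = \<iota> \<epsilon> * z" for z by (simp flip: mult.assoc add: sigma_sq)
  have "x * y = \<iota> (a * c + \<epsilon> * (b * d)) + \<iota> (a * d + b * c) * \<sigma>"
    by (simp add: x y algebra_simps s sigma_sq)
  then have "bar (x * y) = \<iota> (a * c + \<epsilon> * (b * d)) - \<iota> (a * d + b * c) * \<sigma>"
    by (simp only: bar_coord)
  also have "\<dots> = (\<iota> a - \<iota> b * \<sigma>) * (\<iota> c - \<iota> d * \<sigma>)"
    by (simp add: algebra_simps s sigma_sq)
  also have "\<dots> = bar x * bar y" unfolding x y bar_coord ..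
  finally show ?thesis .
qed

lemma bar_bar [simp]: "bar (bar x) = x"
proof -
  obtain a b where x: "x = \<iota> a + \<iota> b * \<sigma>" using E_coord by metis
  have b: "bar x = \<iota> a + \<iota> (- b) * \<sigma>" unfolding x bar_coord by simp
  show ?thesis unfolding b bar_coord by (simp add: x)
qed

lemma bar_emb [simp]: "bar (\<iota> a) = \<iota> a" using bar_coord[of a 0] by simp
lemma bar_sigma [simp]: "bar \<sigma> = - \<sigma>" using bar_coord[of 0 1] by simp
lemma bar_0 [simp]: "bar 0 = 0" using bar_emb[of 0] by (simp del: bar_emb)
lemma bar_1 [simp]: "bar 1 = 1" using bar_emb[of 1] by (simp del: bar_emb)
lemma bar_2 [simp]: "bar 2 = 2" using bar_emb[of 2] by (simp del: bar_emb)
lemma bar_minus [simp]: "bar (- x) = - bar x"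
  using bar_add[of x "- x"] by (simp del: bar_add add: eq_neg_iff_add_eq_0 add.commute)
lemma bar_diff [simp]: "bar (x - y) = bar x - bar y"
  using bar_add[of x "- y"] by (simp del: bar_add)
lemma bar_eq_0 [simp]: "bar x = 0 \<longleftrightarrow> x = 0" by (metis bar_bar bar_0)
lemma bar_inverse [simp]: "bar (inverse x) = inverse (bar x)"
proof (cases "x = 0")
  case False
  then have "bar x * bar (inverse x) = 1" by (simp flip: bar_mult)
  then show ?thesis by (metis inverse_unique)
qed simp
lemma bar_divide [simp]: "bar (x / y) = bar x / bar y" by (simp add: divide_inverse)

definition re :: "'e \<Rightarrow> 'f" where "re x = inv \<iota> ((x + bar x) / 2)"
definition im :: "'e \<Rightarrow> 'f" where "im x = inv \<iota> ((x - bar x) / (2 * \<sigma>))"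

lemma re_coord [simp]: "re (\<iota> a + \<iota> b * \<sigma>) = a" by (simp add: re_def)
lemma im_coord [simp]: "im (\<iota> a + \<iota> b * \<sigma>) = b"
proof -
  have "(\<iota> a + \<iota> b * \<sigma> - bar (\<iota> a + \<iota> b * \<sigma>)) / (2 * \<sigma>) = \<iota> b" by (simp add: field_simps)
  then show ?thesis by (simp add: im_def)
qed

lemma E_eq: "x = \<iota> (re x) + \<iota> (im x) * \<sigma>"
  using E_coord[of x] by auto

lemma E_eqI: "re x = re y \<Longrightarrow> im x = im y \<Longrightarrow> x = y"
  using E_eq[of x] E_eq[of y] by simp

lemma re_emb [simp]: "re (\<iota> a) = a" and im_emb [simp]: "im (\<iota> a) = 0"
  using re_coord[of a 0] im_coord[of a 0] by (simp_all del: re_coord im_coord)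
lemma re_0 [simp]: "re 0 = 0" and im_0 [simp]: "im 0 = 0"
  using re_emb[of 0] im_emb[of 0] by (simp_all del: re_emb im_emb)
lemma re_1 [simp]: "re 1 = 1" and im_1 [simp]: "im 1 = 0"
  using re_emb[of 1] im_emb[of 1] by (simp_all del: re_emb im_emb)
lemma re_sigma [simp]: "re \<sigma> = 0" and im_sigma [simp]: "im \<sigma> = 1"
  using re_coord[of 0 1] im_coord[of 0 1] by (simp_all del: re_coord im_coord)

lemma re_im_add: "re (x + y) = re x + re y \<and> im (x + y) = im x + im y"
proof -
  obtain a b c d where x: "x = \<iota> a + \<iota> b * \<sigma>" and y: "y = \<iota> c + \<iota> d * \<sigma>" using E_coord by metis
  have xy: "x + y = \<iota> (a + c) + \<iota> (b + d) * \<sigma>" by (simp add: x y algebra_simps)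
  show ?thesis unfolding xy re_coord im_coord by (simp add: x y)
qed
lemma re_add [simp]: "re (x + y) = re x + re y" and im_add [simp]: "im (x + y) = im x + im y"
  using re_im_add by auto

lemma re_im_mult: "re (x * y) = re x * re y + \<epsilon> * (im x * im y) \<and> im (x * y) = re x * im y + im x * re y"
proof -
  have s: "\<sigma> * (\<sigma> * z) = \<iota> \<epsilon> * z" for z by (simp flip: mult.assoc add: sigma_sq)
  obtain a b c d where x: "x = \<iota> a + \<iota> b * \<sigma>" and y: "y = \<iota> c + \<iota> d * \<sigma>" using E_coord by metis
  have xy: "x * y = \<iota> (a * c + \<epsilon> * (b * d)) + \<iota> (a * d + b * c) * \<sigma>"
    by (simp add: x y algebra_simps s sigma_sq)
  show ?thesis unfolding xy unfolding x y re_coord im_coord by simp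
qed
lemma re_mult: "re (x * y) = re x * re y + \<epsilon> * (im x * im y)" and im_mult: "im (x * y) = re x * im y + im x * re y"
  using re_im_mult by auto

lemma re_minus [simp]: "re (- x) = - re x" and im_minus [simp]: "im (- x) = - im x"
  using re_add[of x "-x"] im_add[of x "-x"]
  by (simp_all del: re_add im_add add: eq_neg_iff_add_eq_0 add.commute)
lemma re_diff [simp]: "re (x - y) = re x - re y" and im_diff [simp]: "im (x - y) = im x - im y"
  using re_add[of x "-y"] im_add[of x "-y"] by (simp_all del: re_add im_add)
lemma re_im_bar: "re (bar x) = re x \<and> im (bar x) = - im x"
proof -
  obtain a b where x: "x = \<iota> a + \<iota> b * \<sigma>" using E_coord by metis
  have b: "bar x = \<iota> a + \<iota> (- b) * \<sigma>" unfolding x bar_coord by simp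
  show ?thesis unfolding b unfolding x re_coord im_coord by simp
qed
lemma re_bar [simp]: "re (bar x) = re x" and im_bar [simp]: "im (bar x) = - im x"
  using re_im_bar by auto

lemma real_iff: "bar x = x \<longleftrightarrow> im x = 0"
proof -
  have "im x = 0" if "- im x = im x"
  proof -
    have "2 * im x = 0" using that by (metis mult_2 neg_eq_iff_add_eq_0)
    then show ?thesis by simp
  qed
  then show ?thesis by (metis E_eqI im_bar re_bar neg_equal_0_iff_equal)
qed

lemma psiE_re: "psiE S x = psiF S (re x)" by (simp add: psiE_def re_def)

lemma norm_emb: "\<iota> (normE S x) = x * bar x"
proof -
  have "x * bar x = \<iota> (re (x * bar x))"
    by (rule E_eqI) (simp_all add: im_mult re_mult)
  then show ?thesis by (metis inv_emb normE_def)
qed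

lemma norm_re_im: "normE S x = re x * re x - \<epsilon> * (im x * im x)"
proof -
  have "normE S x = re (\<iota> (normE S x))" by simp
  then show ?thesis unfolding norm_emb re_mult by simp
qed

text \<open>The normalized valuation of E, without meaning at 0. By \<open>nu_norm\<close> it is
  half the valuation of the norm, so conditions on elements of E can be tested on their two
  coordinates.\<close>

definition ve :: "'e \<Rightarrow> int" where "ve x = vpair (re x) (im x)"

lemma nonzero_re_im: "x \<noteq> 0 \<longleftrightarrow> re x \<noteq> 0 \<or> im x \<noteq> 0"
  using E_eqI[of x 0] by auto

lemma nu_norm: "x \<noteq> 0 \<Longrightarrow> normE S x \<noteq> 0 \<and> \<nu> (normE S x) = 2 * ve x"
  using nu_norm_form[of "re x" "im x"] by (simp add: norm_re_im ve_def nonzero_re_im)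

lemma norm_mult: "normE S (x * y) = normE S x * normE S y"
proof -
  have "\<iota> (normE S (x * y)) = \<iota> (normE S x * normE S y)" by (simp add: norm_emb)
  then show ?thesis by (simp del: emb_mult)
qed

lemma ve_mult: assumes "x \<noteq> 0" "y \<noteq> 0" shows "ve (x * y) = ve x + ve y"
  using nu_norm[of "x * y"] nu_norm[OF assms(1)] nu_norm[OF assms(2)] assms
  by (simp add: norm_mult nu_mult)

lemma ve_bar [simp]: "ve (bar x) = ve x" by (simp add: ve_def vpair_def)
lemma ve_minus [simp]: "ve (- x) = ve x" by (simp add: ve_def vpair_def)
lemma ve_emb [simp]: "a \<noteq> 0 \<Longrightarrow> ve (\<iota> a) = \<nu> a" by (simp add: ve_def vpair_def)
lemma ve_sigma [simp]: "ve \<sigma> = 0" by (simp add: ve_def vpair_def)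
lemma ve_1 [simp]: "ve 1 = 0" by (simp add: ve_def vpair_def)
lemma ve_2 [simp]: "ve 2 = 0" using ve_emb[of 2] by (simp del: ve_emb)
lemma ve_inverse: "x \<noteq> 0 \<Longrightarrow> ve (inverse x) = - ve x" using ve_mult[of x "inverse x"] by simp
lemma ve_divide: "x \<noteq> 0 \<Longrightarrow> y \<noteq> 0 \<Longrightarrow> ve (x / y) = ve x - ve y"
  by (simp add: divide_inverse ve_mult ve_inverse)

definition geF :: "real \<Rightarrow> 'f \<Rightarrow> bool" where "geF \<rho> a \<longleftrightarrow> a = 0 \<or> \<rho> \<le> real_of_int (\<nu> a)"
definition ge :: "real \<Rightarrow> 'e \<Rightarrow> bool" where "ge \<rho> x \<longleftrightarrow> x = 0 \<or> \<rho> \<le> real_of_int (ve x)"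

lemma geF_iff: "geF \<rho> a \<longleftrightarrow> a \<in> pF S \<lceil>\<rho>\<rceil>"
  by (simp add: geF_def val_ideal_def ceiling_le_iff)

lemma ge_iff: "ge \<rho> x \<longleftrightarrow> geF \<rho> (re x) \<and> geF \<rho> (im x)"
  using nonzero_re_im[of x] by (auto simp: ge_def geF_def ve_def vpair_def)

lemma pE_iff: "x \<in> pE S n \<longleftrightarrow> ge (real_of_int n) x"
  using nu_norm[of x] by (cases "x = 0") (auto simp: pE_def ge_def)

lemma pE_ceiling [simp]: "x \<in> pE S \<lceil>\<rho>\<rceil> \<longleftrightarrow> ge \<rho> x"
  by (simp add: pE_iff ge_def ceiling_le_iff)

lemma geF_add: "geF \<rho> x \<Longrightarrow> geF \<rho> y \<Longrightarrow> geF \<rho> (x + y)" by (simp add: geF_iff pF_add)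
lemma ge_add: "ge \<rho> x \<Longrightarrow> ge \<rho> y \<Longrightarrow> ge \<rho> (x + y)" by (simp add: ge_iff geF_add)
lemma ge_minus_iff [simp]: "ge \<rho> (- x) \<longleftrightarrow> ge \<rho> x" by (simp add: ge_def)
lemma ge_bar_iff [simp]: "ge \<rho> (bar x) \<longleftrightarrow> ge \<rho> x" by (simp add: ge_def)
lemma ge_diff: "ge \<rho> x \<Longrightarrow> ge \<rho> y \<Longrightarrow> ge \<rho> (x - y)" using ge_add[of \<rho> x "- y"] by simp
lemma ge_diff_commute: "ge \<rho> (x - y) \<longleftrightarrow> ge \<rho> (y - x)" using ge_minus_iff[of \<rho> "x - y"] by simp
lemma ge_0 [simp]: "ge \<rho> 0" by (simp add: ge_def)
lemma ge_1 [simp]: "ge \<rho> 1 \<longleftrightarrow> \<rho> \<le> 0" by (simp add: ge_def)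
lemma ge_mono: "ge \<rho> x \<Longrightarrow> \<rho>' \<le> \<rho> \<Longrightarrow> ge \<rho>' x" by (auto simp: ge_def)
lemma ge_mult: "ge \<rho> x \<Longrightarrow> ge \<rho>' y \<Longrightarrow> \<tau> \<le> \<rho> + \<rho>' \<Longrightarrow> ge \<tau> (x * y)"
  by (cases "x = 0 \<or> y = 0") (auto simp: ge_def ve_mult)
lemma ge_emb [simp]: "ge \<rho> (\<iota> a) \<longleftrightarrow> geF \<rho> a" by (cases "a = 0") (auto simp: ge_def geF_def)
lemma ge_sigma_mult [simp]: "ge \<rho> (\<sigma> * x) \<longleftrightarrow> ge \<rho> x" "ge \<rho> (x * \<sigma>) \<longleftrightarrow> ge \<rho> x"
  by (cases "x = 0"; auto simp: ge_def ve_mult)+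

lemma ve_add_eq: assumes "x \<noteq> 0" "y = 0 \<or> ve x < ve y"
  shows "x + y \<noteq> 0 \<and> ve (x + y) = ve x"
proof (cases "y = 0")
  case False
  then have lt: "ve x < ve y" using assms by auto
  have a: "\<not> ge (real_of_int (ve x + 1)) x" using assms(1) by (simp add: ge_def)
  have y: "ge (real_of_int (ve x + 1)) y" using lt by (simp add: ge_def)
  have "\<not> ge (real_of_int (ve x + 1)) (x + y)" using a y ge_diff[of _ "x + y" y] by auto
  moreover have "ge (real_of_int (ve x)) (x + y)"
    by (rule ge_add) (use lt in \<open>auto simp: ge_def\<close>)
  ultimately show ?thesis unfolding ge_def by auto
qed (use assms in simp)

lemma psiF_0 [simp]: "psiF S 0 = 1" and psiF_add: "psiF S (x + y) = psiF S x * psiF S y"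
  and psiF_triv: "x \<in> pF S 1 \<Longrightarrow> psiF S x = 1"
  and psiF_nontriv: "\<exists>x\<in>pF S 0. psiF S x \<noteq> 1"
  using u11 by (auto simp: u11_setting_def)

lemma psiE_0 [simp]: "psiE S 0 = 1" by (simp add: psiE_re)
lemma psiE_add: "psiE S (x + y) = psiE S x * psiE S y" by (simp add: psiE_re psiF_add)
lemma psiE_nonzero [simp]: "psiE S x \<noteq> 0" using psiE_add[of x "- x"] by auto
lemma psiE_triv: assumes "ge \<rho> x" "0 < \<rho>" shows "psiE S x = 1"
proof -
  have "ge 1 x" using assms by (auto simp: ge_def)
  then have "re x \<in> pF S 1" by (simp add: ge_iff geF_iff)
  then show ?thesis by (simp add: psiE_re psiF_triv)
qed
lemma psiE_cong: "ge \<rho> (x - y) \<Longrightarrow> 0 < \<rho> \<Longrightarrow> psiE S x = psiE S y"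
  using psiE_triv[of \<rho> "x - y"] psiE_add[of "x - y" y] by simp

text \<open>The conductor of the additive character, packed into one unit. Every argument that shows
  two characters to be different reduces to hitting this h.\<close>

lemma psi_test_elt: "\<exists>h. h \<noteq> 0 \<and> \<nu> h = 0 \<and> psiF S h \<noteq> 1"
proof -
  obtain h where h: "h \<in> pF S 0" "psiF S h \<noteq> 1" using psiF_nontriv by blast
  then have "h \<noteq> 0" by auto
  moreover have "h \<notin> pF S 1" using h psiF_triv by auto
  ultimately show ?thesis using h by (auto simp: val_ideal_def)
qed

end

subsection \<open>Two by two matrices\<close>

lemma mat2_nth [simp]:
  "mat2 a b c d $ 1 $ 1 = a" "mat2 a b c d $ 1 $ 2 = b"
  "mat2 a b c d $ 2 $ 1 = c" "mat2 a b c d $ 2 $ 2 = d"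
  by (simp_all add: mat2_def)

lemma mat2_eqI:
  assumes "X $ 1 $ 1 = Y $ 1 $ 1" "X $ 1 $ 2 = Y $ 1 $ 2" "X $ 2 $ 1 = Y $ 2 $ 1" "X $ 2 $ 2 = Y $ 2 $ 2"
  shows "X = (Y :: 'a ^ 2 ^ 2)"
  using assms by (simp add: vec_eq_iff forall_2)

lemma mat2_eta: "mat2 (X $ 1 $ 1) (X $ 1 $ 2) (X $ 2 $ 1) (X $ 2 $ 2) = X"
  by (rule mat2_eqI) simp_all

lemma mat2_cases: obtains a b c d where "X = mat2 a b c d"
  using mat2_eta[of X] by metis

lemma mat2_eq_iff [simp]: "mat2 a b c d = mat2 a' b' c' d' \<longleftrightarrow> a = a' \<and> b = b' \<and> c = c' \<and> d = d'"
  by (metis mat2_nth)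

lemma mat2_mult [simp]:
  "mat2 a b c d ** mat2 a' b' c' d' = mat2 (a * a' + b * c') (a * b' + b * d') (c * a' + d * c') (c * b' + d * d')"
  by (rule mat2_eqI) (simp_all add: matrix_matrix_mult_def sum_2)

lemma mat2_one: "mat 1 = mat2 1 0 0 1"
  by (rule mat2_eqI) (simp_all add: mat_def)

lemma mat2_add [simp]: "mat2 a b c d + mat2 a' b' c' d' = mat2 (a + a') (b + b') (c + c') (d + d')"
  by (rule mat2_eqI) simp_all

lemma mat2_diff [simp]: "mat2 a b c d - mat2 a' b' c' d' = mat2 (a - a') (b - b') (c - c') (d - d')"
  by (rule mat2_eqI) simp_all

lemma mat2_trace [simp]: "trace (mat2 a b c d) = a + d"
  by (simp add: trace_def sum_2)

lemma matrix_diff_ldistrib: "A ** (B - C) = A ** B - A ** (C :: 'a::ring_1 ^ 'n ^ 'm)"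
  using matrix_add_ldistrib[of A "B - C" C] by simp

lemma matrix_diff_rdistrib: "(A - B) ** C = A ** C - B ** (C :: 'a::ring_1 ^ 'n ^ 'm)"
  by (simp add: vec_eq_iff matrix_matrix_mult_def left_diff_distrib sum_subtractf)

text \<open>\<open>matrix_inv\<close> is a choice of two-sided inverse; over a field a right inverse
  of a square matrix is already two-sided and unique.\<close>

lemma matrix_inv_eq:
  fixes A B :: "'a::field ^ 'n ^ 'n"
  assumes "A ** B = mat 1" shows "matrix_inv A = B" "invertible A"
proof -
  have BA: "B ** A = mat 1" using assms matrix_left_right_inverse by blast
  then show inv: "invertible A" using assms by (auto simp: invertible_def)
  have "A ** matrix_inv A = mat 1 \<and> matrix_inv A ** A = mat 1"
    unfolding matrix_inv_def by (rule someI_ex) (use assms BA in blast)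
  then show "matrix_inv A = B" by (metis BA matrix_mul_assoc matrix_mul_lid matrix_mul_rid)
qed

section \<open>The unitary group as a group of two by two matrices\<close>

context u11 begin

abbreviation "G \<equiv> unitary_group S"
abbreviation "K \<equiv> maxK S"
abbreviation "L \<equiv> mat_lattice S"

lemma unitary_iff: "mat2 a b c d \<in> G \<longleftrightarrow>
  bar a * c + bar c * a = 0 \<and> bar b * d + bar d * b = 0 \<and> bar a * d + bar c * b = 1"
proof -
  have t: "transpose (\<chi> i j. bar (mat2 a b c d $ i $ j)) = mat2 (bar a) (bar c) (bar b) (bar d)"
    by (rule mat2_eqI) (simp_all add: transpose_def)
  \<comment> \<open>The fourth entry of the defining matrix identity is the conjugate of the
    third.\<close>
  have "bar b * c + bar d * a = 1" if "bar a * d + bar c * b = 1"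
  proof -
    have "bar (bar a * d + bar c * b) = 1" using that by simp
    then show ?thesis by (simp add: algebra_simps)
  qed
  then show ?thesis by (auto simp: unitary_group_def t wmat_def algebra_simps)
qed

lemma unitary_inv: assumes "mat2 a b c d \<in> G"
  shows "matrix_inv (mat2 a b c d) = mat2 (bar d) (bar b) (bar c) (bar a)" "invertible (mat2 a b c d)"
proof -
  have *: "bar a * c + bar c * a = 0" "bar b * d + bar d * b = 0" "bar a * d + bar c * b = 1"
    using assms by (auto simp: unitary_iff)
  have "bar (bar a * d + bar c * b) = 1" using * by simp
  then have "mat2 (bar d) (bar b) (bar c) (bar a) ** mat2 a b c d = mat 1"
    using * by (simp add: mat2_one algebra_simps)
  then have "mat2 a b c d ** mat2 (bar d) (bar b) (bar c) (bar a) = mat 1"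
    using matrix_left_right_inverse by blast
  from matrix_inv_eq[OF this] show "matrix_inv (mat2 a b c d) = mat2 (bar d) (bar b) (bar c) (bar a)"
    "invertible (mat2 a b c d)" by auto
qed

lemma unitary_rows: assumes "mat2 a b c d \<in> G"
  shows "a * bar b + b * bar a = 0" "c * bar d + d * bar c = 0" "a * bar d + b * bar c = 1"
proof -
  note i = unitary_inv[OF assms]
  have "mat2 a b c d ** matrix_inv (mat2 a b c d) = mat 1"
    using i(2) by (metis i(1) matrix_inv_eq(1) invertible_def)
  then show "a * bar b + b * bar a = 0" "c * bar d + d * bar c = 0" "a * bar d + b * bar c = 1"
    unfolding i(1) by (auto simp: mat2_one)
qed

lemma G_one [simp]: "mat 1 \<in> G" by (simp add: mat2_one unitary_iff)

lemma G_inv_right [simp]: "x \<in> G \<Longrightarrow> x ** matrix_inv x = mat 1"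
  by (cases x rule: mat2_cases) (metis unitary_inv(2) invertible_def matrix_inv_eq(1))

lemma G_inv_left [simp]: "x \<in> G \<Longrightarrow> matrix_inv x ** x = mat 1"
  using matrix_left_right_inverse G_inv_right by blast

lemma G_mult [simp]: assumes "x \<in> G" "y \<in> G" shows "x ** y \<in> G"
proof -
  have c: "(\<chi> i j. bar ((x ** y) $ i $ j)) = (\<chi> i j. bar (x $ i $ j)) ** (\<chi> i j. bar (y $ i $ j))"
    by (rule mat2_eqI) (simp_all add: matrix_matrix_mult_def sum_2)
  let ?t = "\<lambda>z. transpose (\<chi> i j. bar (z $ i $ j))"
  have "?t (x ** y) ** wmat ** (x ** y) = ?t y ** (?t x ** wmat ** x) ** y"
    unfolding c by (simp add: matrix_transpose_mul matrix_mul_assoc)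
  then show ?thesis using assms by (simp add: unitary_group_def)
qed

lemma G_inv [simp]: assumes "x \<in> G" shows "matrix_inv x \<in> G"
proof -
  obtain a b c d where x: "x = mat2 a b c d" by (rule mat2_cases)
  have r: "a * bar b + b * bar a = 0" "c * bar d + d * bar c = 0" "a * bar d + b * bar c = 1"
    using assms unitary_rows[of a b c d] by (auto simp: x)
  have "bar a * d + bar b * c = 1" using arg_cong[OF r(3), of bar] by simp
  then show ?thesis using assms r unfolding x
    by (simp add: unitary_inv) (simp add: unitary_iff algebra_simps)
qed

lemma G_invertible [simp]: "x \<in> G \<Longrightarrow> invertible x"
  by (cases x rule: mat2_cases) (metis unitary_inv(2))

lemma G_cancel [simp]: "x \<in> G \<Longrightarrow> x ** (matrix_inv x ** z) = z" "x \<in> G \<Longrightarrow> matrix_inv x ** (x ** z) = z"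
  by (simp_all add: matrix_mul_assoc)

lemma G_inv_inv [simp]: "x \<in> G \<Longrightarrow> matrix_inv (matrix_inv x) = x"
  by (rule matrix_inv_eq) simp

lemma inv_one [simp]: "matrix_inv (mat 1 :: 'e ^ 2 ^ 2) = mat 1"
  by (rule matrix_inv_eq) simp

lemma G_inv_mult [simp]: "x \<in> G \<Longrightarrow> y \<in> G \<Longrightarrow> matrix_inv (x ** y) = matrix_inv y ** matrix_inv x"
  by (rule matrix_inv_eq) (simp flip: matrix_mul_assoc)

lemmas gassoc = matrix_mul_assoc[symmetric]

lemma subgroupI: assumes "H \<subseteq> G" "mat 1 \<in> H" "\<And>x y. x \<in> H \<Longrightarrow> y \<in> H \<Longrightarrow> x ** y \<in> H"
    "\<And>x. x \<in> H \<Longrightarrow> matrix_inv x \<in> H"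
  shows "mat_subgroup H"
  using assms G_invertible by (auto simp: mat_subgroup_def)

lemma subgroup_one: "mat_subgroup H \<Longrightarrow> mat 1 \<in> H"
  and subgroup_mult: "mat_subgroup H \<Longrightarrow> x \<in> H \<Longrightarrow> y \<in> H \<Longrightarrow> x ** y \<in> H"
  and subgroup_inv: "mat_subgroup H \<Longrightarrow> x \<in> H \<Longrightarrow> matrix_inv x \<in> H"
  by (auto simp: mat_subgroup_def)

lemma subgroup_G: "mat_subgroup G" by (rule subgroupI) auto

lemma subgroup_Int: "mat_subgroup A \<Longrightarrow> mat_subgroup B \<Longrightarrow> mat_subgroup (A \<inter> B)"
  by (auto simp: mat_subgroup_def)

subsection \<open>Lattices of matrices and congruence subgroups\<close>

lemma L_iff: "X \<in> L y r \<longleftrightarrow> ge r (X $ 1 $ 1) \<and> ge (r - y) (X $ 1 $ 2) \<and> ge (r + y) (X $ 2 $ 1) \<and> ge r (X $ 2 $ 2)"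
  by (simp add: mat_lattice_def)

lemma L_mat2: "mat2 a b c d \<in> L y r \<longleftrightarrow> ge r a \<and> ge (r - y) b \<and> ge (r + y) c \<and> ge r d"
  by (simp add: L_iff)

lemma L_mono: "X \<in> L y r \<Longrightarrow> r' \<le> r \<Longrightarrow> X \<in> L y r'"
  by (auto simp: L_iff elim: ge_mono)

lemma L_add: "X \<in> L y r \<Longrightarrow> Y \<in> L y r \<Longrightarrow> X + Y \<in> L y r"
  and L_diff: "X \<in> L y r \<Longrightarrow> Y \<in> L y r \<Longrightarrow> X - Y \<in> L y r"
  and L_minus: "X \<in> L y r \<Longrightarrow> - X \<in> L y r"
  by (auto simp: L_iff intro: ge_add ge_diff)

lemma L_diff_commute: "X - Y \<in> L y r \<longleftrightarrow> Y - X \<in> L y r"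
  using L_minus[of "X - Y" y r] L_minus[of "Y - X" y r] by auto

lemma L_zero [simp]: "0 \<in> L y r" by (simp add: L_iff)

lemma L_mult: assumes "X \<in> L y r" "Y \<in> L y s" "\<tau> \<le> r + s" shows "X ** Y \<in> L y \<tau>"
proof -
  obtain a b c d a' b' c' d' where X: "X = mat2 a b c d" and Y: "Y = mat2 a' b' c' d'"
    by (metis mat2_cases)
  show ?thesis using assms unfolding X Y mat2_mult L_mat2
    by (intro conjI ge_add) (auto elim!: ge_mult)
qed

lemma L_one [simp]: "mat 1 \<in> L y 0" by (simp add: mat2_one L_mat2)

lemma Gyr_iff: "g \<in> Gyr S y r \<longleftrightarrow> g \<in> G \<and> g - mat 1 \<in> L y r" by (simp add: Gyr_def)

lemma Gyr_G: "g \<in> Gyr S y r \<Longrightarrow> g \<in> G" by (simp add: Gyr_iff)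

lemma Gyr_0_iff: "g \<in> Gyr S y 0 \<longleftrightarrow> g \<in> G \<and> g \<in> L y 0"
  using L_add[of "g - mat 1" y 0 "mat 1"] L_diff[of g y 0 "mat 1"] by (auto simp: Gyr_iff)

lemma Gyr_antimono: "r' \<le> r \<Longrightarrow> Gyr S y r \<subseteq> Gyr S y r'"
  by (auto simp: Gyr_iff elim: L_mono)

lemma Gyr_L0: "g \<in> Gyr S y r \<Longrightarrow> 0 \<le> r \<Longrightarrow> g \<in> L y 0"
  using Gyr_antimono[of 0 r y] Gyr_0_iff by blast

lemma inv_L0: assumes "g \<in> G" "g \<in> L y 0" shows "matrix_inv g \<in> L y 0"
proof -
  obtain a b c d where g: "g = mat2 a b c d" by (rule mat2_cases)
  show ?thesis using assms unfolding g by (simp add: unitary_inv L_mat2)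
qed

lemma subgroup_Gyr: assumes "0 \<le> r" shows "mat_subgroup (Gyr S y r)"
proof (rule subgroupI)
  show "Gyr S y r \<subseteq> G" by (auto simp: Gyr_iff)
  show "mat 1 \<in> Gyr S y r" by (simp add: Gyr_iff)
next
  fix g h assume g: "g \<in> Gyr S y r" and h: "h \<in> Gyr S y r"
  have "g ** h - mat 1 = g ** (h - mat 1) + (g - mat 1)" by (simp add: matrix_diff_ldistrib)
  moreover have "g ** (h - mat 1) + (g - mat 1) \<in> L y r"
    using L_mult[OF Gyr_L0[OF g assms], of "h - mat 1" r r] g h unfolding Gyr_iff by (intro L_add) auto
  ultimately show "g ** h \<in> Gyr S y r" using g h by (metis Gyr_iff G_mult)
next
  fix g assume g: "g \<in> Gyr S y r"
  then have gG: "g \<in> G" by (simp add: Gyr_iff)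
  have "matrix_inv g - mat 1 = matrix_inv g ** (mat 1 - g)" using gG by (simp add: matrix_diff_ldistrib)
  moreover have "matrix_inv g ** (mat 1 - g) \<in> L y r"
    using L_mult[OF inv_L0[OF gG Gyr_L0[OF g assms]], of "mat 1 - g" r r] g L_diff_commute
    by (auto simp: Gyr_iff)
  ultimately show "matrix_inv g \<in> Gyr S y r" using gG by (simp add: Gyr_iff)
qed

lemma conj_L: assumes "x \<in> Gyr S y 0" "X \<in> L y r" shows "x ** X ** matrix_inv x \<in> L y r"
proof -
  have x: "x \<in> G" "x \<in> L y 0" using assms by (auto simp: Gyr_0_iff)
  show ?thesis by (rule L_mult[OF L_mult[OF x(2) assms(2)] inv_L0[OF x], of r]) auto
qed

lemma Gyr_normal: assumes "x \<in> Gyr S y 0" "g \<in> Gyr S y r" shows "x ** g ** matrix_inv x \<in> Gyr S y r"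
proof -
  have x: "x \<in> G" using assms(1) by (rule Gyr_G)
  have "x ** g ** matrix_inv x - mat 1 = x ** (g - mat 1) ** matrix_inv x"
    using x by (simp add: matrix_diff_ldistrib matrix_diff_rdistrib)
  then show ?thesis using conj_L[OF assms(1)] assms(2) x by (simp add: Gyr_iff)
qed

lemma Gyr_close: assumes "x \<in> Gyr S y 0" "z \<in> G" "z - x \<in> L y r"
  shows "matrix_inv x ** z \<in> Gyr S y r" "z ** matrix_inv x \<in> Gyr S y r"
proof -
  have x: "x \<in> G" "matrix_inv x \<in> L y 0" using assms by (auto simp: Gyr_0_iff inv_L0)
  have "matrix_inv x ** z - mat 1 = matrix_inv x ** (z - x)" "z ** matrix_inv x - mat 1 = (z - x) ** matrix_inv x"
    using x by (simp_all add: matrix_diff_ldistrib matrix_diff_rdistrib)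
  then show "matrix_inv x ** z \<in> Gyr S y r" "z ** matrix_inv x \<in> Gyr S y r"
    using L_mult[OF x(2) assms(3), of r] L_mult[OF assms(3) x(2), of r] x assms(2) by (simp_all add: Gyr_iff)
qed

lemma Gyr_plus_iff: "g \<in> Gyr_plus S y r \<longleftrightarrow> (\<exists>s>r. g \<in> Gyr S y s)"
  by (auto simp: Gyr_plus_def)

lemma Gyr_plus_subset: "Gyr_plus S y r \<subseteq> Gyr S y r"
  using Gyr_antimono[of r] by (auto simp: Gyr_plus_iff) (meson less_imp_le subsetD)

lemma subgroup_Gyr_plus: assumes "0 \<le> r" shows "mat_subgroup (Gyr_plus S y r)"
proof (rule subgroupI)
  show "Gyr_plus S y r \<subseteq> G" using Gyr_G by (auto simp: Gyr_plus_iff)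
  have "mat 1 \<in> Gyr S y (r + 1)" by (simp add: Gyr_iff)
  then show "mat 1 \<in> Gyr_plus S y r" unfolding Gyr_plus_iff by (intro exI[of _ "r+1"]) auto
next
  fix g h assume "g \<in> Gyr_plus S y r" "h \<in> Gyr_plus S y r"
  then obtain s t where s: "s > r" "g \<in> Gyr S y s" and t: "t > r" "h \<in> Gyr S y t" by (auto simp: Gyr_plus_iff)
  then have "g \<in> Gyr S y (min s t)" "h \<in> Gyr S y (min s t)"
    using Gyr_antimono[of "min s t" s y] Gyr_antimono[of "min s t" t y] by auto
  then have "g ** h \<in> Gyr S y (min s t)" using subgroup_mult[OF subgroup_Gyr[of "min s t" y]] s t assms by auto
  then show "g ** h \<in> Gyr_plus S y r" using s t unfolding Gyr_plus_iff by (intro exI[of _ "min s t"]) auto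
next
  fix g assume "g \<in> Gyr_plus S y r"
  then obtain s where s: "s > r" "g \<in> Gyr S y s" by (auto simp: Gyr_plus_iff)
  then show "matrix_inv g \<in> Gyr_plus S y r"
    using subgroup_inv[OF subgroup_Gyr[of s y]] assms by (auto simp: Gyr_plus_iff)
qed

lemma Gyr_plus_normal: assumes "x \<in> Gyr S y 0" "g \<in> Gyr_plus S y r"
  shows "x ** g ** matrix_inv x \<in> Gyr_plus S y r"
  using assms Gyr_normal by (fastforce simp: Gyr_plus_iff)

lemma K_eq: "K = Gyr S 0 0"
  by (auto simp: maxK_def Gyr_0_iff L_iff pE_iff forall_2)

lemma K_iff: "x \<in> K \<longleftrightarrow> x \<in> G \<and> x \<in> L 0 0" by (simp add: K_eq Gyr_0_iff)

lemma subgroup_K: "mat_subgroup K" unfolding K_eq by (rule subgroup_Gyr) simp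

lemma K_subset: "K \<subseteq> G" by (auto simp: K_iff)

lemma Gyr0_subset_K: "0 \<le> r \<Longrightarrow> Gyr S 0 r \<subseteq> K" unfolding K_eq by (rule Gyr_antimono)

subsection \<open>Topology\<close>

text \<open>Multiplication by a fixed matrix loses a bounded amount of depth. This quantitative
  continuity gives the continuity of translations and conjugations wherever it is used.\<close>

lemma near_mult:
  fixes x :: "'e ^ 2 ^ 2"
  obtains m where "m \<ge> 0" "\<And>X r. X \<in> L 0 r \<Longrightarrow> x ** X \<in> L 0 (r - m)" "\<And>X r. X \<in> L 0 r \<Longrightarrow> X ** x \<in> L 0 (r - m)"
proof -
  obtain a b c d where x: "x = mat2 a b c d" by (rule mat2_cases)
  define m where "m = real_of_int (\<bar>ve a\<bar> + \<bar>ve b\<bar> + \<bar>ve c\<bar> + \<bar>ve d\<bar>)"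
  have xm: "x \<in> L 0 (- m)" unfolding x L_mat2 m_def by (auto simp: ge_def)
  have "m \<ge> 0" by (simp add: m_def)
  moreover have "x ** X \<in> L 0 (r - m)" if "X \<in> L 0 r" for X r by (rule L_mult[OF xm that]) simp
  moreover have "X ** x \<in> L 0 (r - m)" if "X \<in> L 0 r" for X r by (rule L_mult[OF that xm]) simp
  ultimately show ?thesis by (rule that)
qed

lemma entries_pE: "(\<forall>i j. X $ i $ j \<in> pE S n) \<longleftrightarrow> X \<in> L 0 (real_of_int n)"
  by (auto simp: L_iff pE_iff forall_2)

text \<open>Replaces the topology by balls around points. A positive radius can always be taken
  because balls shrink as the radius parameter grows.\<close>

lemma openin_sub_iff: "openin (subtopology (mat_top S) H) U \<longleftrightarrow>
    U \<subseteq> H \<and> (\<forall>x\<in>U. \<exists>n>0. \<forall>y\<in>H. y - x \<in> L 0 n \<longrightarrow> y \<in> U)"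
proof
  assume "openin (subtopology (mat_top S) H) U"
  then obtain V where V: "openin (mat_top S) V" "U = V \<inter> H" by (auto simp: openin_subtopology)
  show "U \<subseteq> H \<and> (\<forall>x\<in>U. \<exists>n>0. \<forall>y\<in>H. y - x \<in> L 0 n \<longrightarrow> y \<in> U)"
  proof (intro conjI ballI)
    show "U \<subseteq> H" using V by auto
    fix x assume "x \<in> U"
    then obtain n where n: "\<And>y. y - x \<in> L 0 (real_of_int n) \<Longrightarrow> y \<in> V"
      using V unfolding openin_mat_top entries_pE by blast
    show "\<exists>n>0. \<forall>y\<in>H. y - x \<in> L 0 n \<longrightarrow> y \<in> U"
    proof (intro exI[of _ "max 1 (real_of_int n)"] conjI ballI impI)
      fix y assume y: "y \<in> H" "y - x \<in> L 0 (max 1 (real_of_int n))"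
      then have "y \<in> V" using n L_mono[of "y - x" 0 "max 1 (real_of_int n)" "real_of_int n"] by simp
      then show "y \<in> U" using V y by simp
    qed simp
  qed
next
  assume R: "U \<subseteq> H \<and> (\<forall>x\<in>U. \<exists>n>0. \<forall>y\<in>H. y - x \<in> L 0 n \<longrightarrow> y \<in> U)"
  then obtain n where n: "\<And>x. x \<in> U \<Longrightarrow> n x > 0 \<and> (\<forall>y\<in>H. y - x \<in> L 0 (n x) \<longrightarrow> y \<in> U)" by metis
  define V where "V = {y. \<exists>x\<in>U. y - x \<in> L 0 (n x)}"
  have "openin (mat_top S) V" unfolding openin_mat_top entries_pE
  proof
    fix y assume "y \<in> V"
    then obtain x where x: "x \<in> U" "y - x \<in> L 0 (n x)" by (auto simp: V_def)
    have "z \<in> V" if "z - y \<in> L 0 (real_of_int \<lceil>n x\<rceil>)" for z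
    proof -
      have "z - x = (z - y) + (y - x)" by simp
      then have "z - x \<in> L 0 (n x)" using L_add[OF L_mono[OF that] x(2)] by auto
      then show ?thesis using x by (auto simp: V_def)
    qed
    then show "\<exists>k. \<forall>z. z - y \<in> L 0 (real_of_int k) \<longrightarrow> z \<in> V" by blast
  qed
  moreover have "U = V \<inter> H" using R n by (auto simp: V_def intro!: bexI)
  ultimately show "openin (subtopology (mat_top S) H) U" by (auto simp: openin_subtopology)
qed

lemma open_nbhd: assumes "openin (subtopology (mat_top S) H) U" "mat 1 \<in> U" "H \<subseteq> G"
  shows "\<exists>n>0. H \<inter> Gyr S 0 n \<subseteq> U"
proof -
  obtain n where "n > 0" "\<And>y. y \<in> H \<Longrightarrow> y - mat 1 \<in> L 0 n \<Longrightarrow> y \<in> U"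
    using assms unfolding openin_sub_iff by blast
  then show ?thesis by (intro exI[of _ n]) (auto simp: Gyr_iff)
qed

lemma open_of_nbhd:
  assumes H: "mat_subgroup H" "H \<subseteq> G" and U: "U \<subseteq> H" "\<And>x u. x \<in> U \<Longrightarrow> u \<in> H \<inter> Gyr S 0 n \<Longrightarrow> x ** u \<in> U" and n: "n > 0"
  shows "openin (subtopology (mat_top S) H) U"
  unfolding openin_sub_iff
proof (intro conjI ballI)
  show "U \<subseteq> H" by (rule U)
  fix x assume x: "x \<in> U"
  then have xH: "x \<in> H" "x \<in> G" using U H by auto
  obtain m where m: "m \<ge> 0" "\<And>X r. X \<in> L 0 r \<Longrightarrow> matrix_inv x ** X \<in> L 0 (r - m)"
    using near_mult[of "matrix_inv x"] by metis
  show "\<exists>n>0. \<forall>y\<in>H. y - x \<in> L 0 n \<longrightarrow> y \<in> U"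
  proof (intro exI[of _ "n + m"] conjI ballI impI)
    fix y assume y: "y \<in> H" "y - x \<in> L 0 (n + m)"
    have "matrix_inv x ** y - mat 1 = matrix_inv x ** (y - x)" using xH by (simp add: matrix_diff_ldistrib)
    then have "matrix_inv x ** y \<in> H \<inter> Gyr S 0 n"
      using m(2)[OF y(2)] y xH H subgroup_inv[OF H(1)] subgroup_mult[OF H(1)] by (auto simp: Gyr_iff)
    from U(2)[OF x this] show "y \<in> U" using xH by simp
  qed (use n m in auto)
qed

lemma conj_Gyr: assumes "x \<in> G" "n > 0"
  obtains m where "m > 0" "\<And>u. u \<in> Gyr S 0 m \<Longrightarrow> x ** u ** matrix_inv x \<in> Gyr S 0 n"
proof -
  obtain m where m: "m \<ge> 0" "\<And>X r. X \<in> L 0 r \<Longrightarrow> x ** X \<in> L 0 (r - m)" using near_mult[of x] by metis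
  obtain k where k: "k \<ge> 0" "\<And>X r. X \<in> L 0 r \<Longrightarrow> X ** matrix_inv x \<in> L 0 (r - k)"
    using near_mult[of "matrix_inv x"] by metis
  show ?thesis
  proof (rule that[of "n + m + k"])
    fix u assume u: "u \<in> Gyr S 0 (n + m + k)"
    have "x ** u ** matrix_inv x - mat 1 = x ** (u - mat 1) ** matrix_inv x"
      using assms(1) by (simp add: matrix_diff_ldistrib matrix_diff_rdistrib)
    then show "x ** u ** matrix_inv x \<in> Gyr S 0 n"
      using k(2)[OF m(2), of "u - mat 1" "n + m + k"] u assms(1) by (auto simp: Gyr_iff)
  qed (use m k assms in auto)
qed

text \<open>Smoothness with stabilizers tested on congruence groups; for subgroups of
  \<open>G\<close> it agrees with \<open>smooth_rep\<close> (\<open>smooth_rep_iff\<close>), and it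
  restricts to subgroups without further argument.\<close>

definition srep :: "('e ^ 2 ^ 2) set \<Rightarrow> ('e ^ 2 ^ 2, 'v::ab_group_add) rep \<Rightarrow> bool" where
  "srep H R \<longleftrightarrow> is_rep H (**) (mat 1) R \<and> (\<forall>v\<in>rspace R. \<exists>n>0. \<forall>h\<in>H \<inter> Gyr S 0 n. ract R h v = v)"

lemma smooth_rep_iff: assumes H: "mat_subgroup H" "H \<subseteq> G"
  shows "smooth_rep S H R \<longleftrightarrow> srep H R"
proof -
  have "openin (subtopology (mat_top S) H) {h \<in> H. ract R h v = v} \<longleftrightarrow>
      (\<exists>n>0. \<forall>h\<in>H \<inter> Gyr S 0 n. ract R h v = v)" if rep: "is_rep H (**) (mat 1) R" and v: "v \<in> rspace R" for v
  proof
    assume "openin (subtopology (mat_top S) H) {h \<in> H. ract R h v = v}"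
    from open_nbhd[OF this _ H(2)] show "\<exists>n>0. \<forall>h\<in>H \<inter> Gyr S 0 n. ract R h v = v"
      using rep v subgroup_one[OF H(1)] by (auto simp: is_rep_def)
  next
    assume "\<exists>n>0. \<forall>h\<in>H \<inter> Gyr S 0 n. ract R h v = v"
    then obtain n where n: "n > 0" "\<And>h. h \<in> H \<inter> Gyr S 0 n \<Longrightarrow> ract R h v = v" by blast
    show "openin (subtopology (mat_top S) H) {h \<in> H. ract R h v = v}"
    proof (rule open_of_nbhd[OF H _ _ n(1)])
      fix x u assume x: "x \<in> {h \<in> H. ract R h v = v}" and u: "u \<in> H \<inter> Gyr S 0 n"
      have "ract R (x ** u) v = ract R x (ract R u v)" using rep v x u by (auto simp: is_rep_def)
      then show "x ** u \<in> {h \<in> H. ract R h v = v}" using x u n(2)[OF u] subgroup_mult[OF H(1)] by auto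
    qed auto
  qed
  then show ?thesis by (auto simp: smooth_rep_def srep_def)
qed

subsection \<open>Finiteness of residue rings\<close>

text \<open>Induction on the number of digits: a representative modulo the n-th power of the maximal
  ideal is corrected by \<pi> to the n times a representative of a residue class.\<close>

lemma finite_residues: "\<exists>R. finite R \<and> (\<forall>x\<in>pF S 0. \<exists>r\<in>R. x - r \<in> pF S (int n))"
proof (induction n)
  case 0
  show ?case by (rule exI[of _ "{0}"]) auto
next
  case (Suc n)
  then obtain R where R: "finite R" "\<And>x. x \<in> pF S 0 \<Longrightarrow> \<exists>r\<in>R. x - r \<in> pF S (int n)" by blast
  define Q where "Q = (\<lambda>C. SOME x. x \<in> C) ` ((\<lambda>x. {y. y - x \<in> pF S 1}) ` pF S 0)"
  have Q: "finite Q" unfolding Q_def using F.finite_residue_field by (rule finite_imageI)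
  have Q1: "\<exists>r\<in>Q. x - r \<in> pF S 1" if "x \<in> pF S 0" for x
  proof -
    have "(SOME y. y \<in> {y. y - x \<in> pF S 1}) \<in> {y. y - x \<in> pF S 1}"
      by (rule someI[of _ x]) simp
    then have "x - (SOME y. y \<in> {y. y - x \<in> pF S 1}) \<in> pF S 1"
      using pF_minus[of "(SOME y. y \<in> {y. y - x \<in> pF S 1}) - x" 1] by simp
    then show ?thesis using that unfolding Q_def by blast
  qed
  show ?case
  proof (intro exI[of _ "(\<lambda>(r, q). r + \<pi> powi int n * q) ` (R \<times> Q)"] conjI ballI)
    show "finite ((\<lambda>(r, q). r + \<pi> powi int n * q) ` (R \<times> Q))" using R Q by simp
    fix x assume "x \<in> pF S 0"
    then obtain r where r: "r \<in> R" "x - r \<in> pF S (int n)" using R by blast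
    define z where "z = (x - r) / \<pi> powi int n"
    have z: "z \<in> pF S 0" using r(2) nu_powi[of "int n"]
      by (cases "x = r") (auto simp: z_def val_ideal_def nu_divide simp del: nu_powi)
    then obtain q where q: "q \<in> Q" "z - q \<in> pF S 1" using Q1 by blast
    have "\<pi> powi int n \<noteq> 0" by simp
    then have "x - (r + \<pi> powi int n * q) = \<pi> powi int n * (z - q)"
      unfolding z_def right_diff_distrib by (simp del: power_int_of_nat)
    moreover have "\<pi> powi int n \<in> pF S (int n)" by (simp add: val_ideal_def del: power_int_of_nat)
    ultimately have "x - (r + \<pi> powi int n * q) \<in> pF S (int (Suc n))"
      using pF_mult[OF _ q(2), of "\<pi> powi int n" "int n"] by (simp add: add.commute)
    then show "\<exists>s\<in>(\<lambda>(r, q). r + \<pi> powi int n * q) ` (R \<times> Q). x - s \<in> pF S (int (Suc n))"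
      using r q by force
  qed
qed

lemma finite_residues_E: "\<exists>R. finite R \<and> (\<forall>x. ge 0 x \<longrightarrow> (\<exists>r\<in>R. ge \<rho> (x - r)))"
proof -
  define n where "n = nat \<lceil>\<rho>\<rceil>"
  obtain R where R: "finite R" "\<And>x. x \<in> pF S 0 \<Longrightarrow> \<exists>r\<in>R. x - r \<in> pF S (int n)"
    using finite_residues[of n] by auto
  show ?thesis
  proof (intro exI[of _ "(\<lambda>(a, b). \<iota> a + \<iota> b * \<sigma>) ` (R \<times> R)"] conjI allI impI)
    show "finite ((\<lambda>(a, b). \<iota> a + \<iota> b * \<sigma>) ` (R \<times> R))" using R by simp
    fix x assume "ge 0 x"
    then have "re x \<in> pF S 0" "im x \<in> pF S 0" by (simp_all add: ge_iff geF_iff)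
    then obtain a b where ab: "a \<in> R" "b \<in> R" "re x - a \<in> pF S (int n)" "im x - b \<in> pF S (int n)"
      using R(2)[of "re x"] R(2)[of "im x"] by blast
    have r: "re (\<iota> a + \<iota> b * \<sigma>) = a" "im (\<iota> a + \<iota> b * \<sigma>) = b" by (rule re_coord, rule im_coord)
    have "ge \<rho> (x - (\<iota> a + \<iota> b * \<sigma>))"
      unfolding ge_iff geF_iff re_diff im_diff r
      using pF_mono[OF ab(3), of "\<lceil>\<rho>\<rceil>"] pF_mono[OF ab(4), of "\<lceil>\<rho>\<rceil>"] by (simp add: n_def)
    then show "\<exists>r\<in>(\<lambda>(a, b). \<iota> a + \<iota> b * \<sigma>) ` (R \<times> R). ge \<rho> (x - r)"
      using ab by (intro bexI[of _ "\<iota> a + \<iota> b * \<sigma>"] image_eqI[of _ _ "(a, b)"]) auto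
  qed
qed

lemma finite_residues_L: "\<exists>R. finite R \<and> (\<forall>X\<in>L 0 0. \<exists>Y\<in>R. X - Y \<in> L 0 \<rho>)"
proof -
  obtain R where R: "finite R" "\<And>x. ge 0 x \<Longrightarrow> \<exists>r\<in>R. ge \<rho> (x - r)" using finite_residues_E by blast
  show ?thesis
  proof (intro exI[of _ "(\<lambda>(a, b, c, d). mat2 a b c d) ` (R \<times> R \<times> R \<times> R)"] conjI ballI)
    show "finite ((\<lambda>(a, b, c, d). mat2 a b c d) ` (R \<times> R \<times> R \<times> R))" using R by simp
    fix X :: "'e ^ 2 ^ 2" assume X: "X \<in> L 0 0"
    obtain a b c d where x: "X = mat2 a b c d" by (rule mat2_cases)
    have "ge 0 a" "ge 0 b" "ge 0 c" "ge 0 d" using X by (simp_all add: x L_mat2)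
    then obtain a' b' c' d' where "a' \<in> R" "b' \<in> R" "c' \<in> R" "d' \<in> R"
      "ge \<rho> (a - a')" "ge \<rho> (b - b')" "ge \<rho> (c - c')" "ge \<rho> (d - d')" using R by meson
    then show "\<exists>Y\<in>(\<lambda>(a, b, c, d). mat2 a b c d) ` (R \<times> R \<times> R \<times> R). X - Y \<in> L 0 \<rho>"
      by (intro bexI[of _ "mat2 a' b' c' d'"]) (force simp: x L_mat2)+
  qed
qed

lemma coset_of_eq: "coset_of U x = (\<lambda>u. x ** u) ` U"
  by (auto simp: coset_of_def set_prod_def)

lemma coset_eqI: assumes "mat_subgroup U" "U \<subseteq> G" "x \<in> G" "matrix_inv x ** y \<in> U"
  shows "coset_of U x = coset_of U y"
proof -
  define u where "u = matrix_inv x ** y"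
  have u: "u \<in> U" "u \<in> G" and y: "y = x ** u" using assms by (auto simp: u_def)
  have "x ** v \<in> (\<lambda>v. x ** u ** v) ` U" if "v \<in> U" for v
    using that u assms(1) by (intro image_eqI[of _ _ "matrix_inv u ** v"])
      (auto simp: gassoc intro: subgroup_mult subgroup_inv)
  moreover have "x ** u ** v \<in> (\<lambda>v. x ** v) ` U" if "v \<in> U" for v
    using that u assms(1) by (intro image_eqI[of _ _ "u ** v"]) (auto simp: gassoc intro: subgroup_mult)
  ultimately show ?thesis unfolding coset_of_eq y by blast
qed

text \<open>Compactness of \<open>K\<close> in the form needed for sums: entries modulo a power of
  the maximal ideal take finitely many values, and two elements of \<open>K\<close> with the same
  residues lie in the same coset.\<close>

lemma finite_cosets_K: assumes n: "0 \<le> n" shows "finite ((\<lambda>k. coset_of (Gyr S 0 n) k) ` K)"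
proof -
  obtain R where R: "finite R" "\<And>X. X \<in> L 0 0 \<Longrightarrow> \<exists>Y\<in>R. X - Y \<in> L 0 (n)"
    using finite_residues_L[of "n"] by blast
  \<comment> \<open>The approximating matrix f X need not be unitary. A coset is therefore recovered
    from it by choosing some element of \<open>K\<close> with the same approximation.\<close>
  define f where "f X = (SOME Y. Y \<in> R \<and> X - Y \<in> L 0 (n))" for X
  have f: "f X \<in> R \<and> X - f X \<in> L 0 (n)" if "X \<in> L 0 0" for X
    unfolding f_def by (rule someI_ex) (use R(2)[OF that] in blast)
  define g where "g Y = coset_of (Gyr S 0 n) (SOME k. k \<in> K \<and> f k = Y)" for Y
  have "coset_of (Gyr S 0 n) k = g (f k)" if k: "k \<in> K" for k
  proof -
    define k' where "k' = (SOME k'. k' \<in> K \<and> f k' = f k)"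
    have k': "k' \<in> K \<and> f k' = f k" unfolding k'_def by (rule someI[of _ k]) (use k in simp)
    have "k - f k \<in> L 0 n" "k' - f k \<in> L 0 n" using f[of k] f[of k'] k k' by (auto simp: K_iff)
    then have "(k - f k) - (k' - f k) \<in> L 0 n" by (rule L_diff)
    then have d: "k' - k \<in> L 0 n" using L_diff_commute by auto
    have kG: "k \<in> G" "k' \<in> G" using k k' K_subset by auto
    have "matrix_inv k ** k' \<in> Gyr S 0 n" using Gyr_close(1)[OF _ _ d] k kG K_eq by simp
    then show ?thesis unfolding g_def k'_def[symmetric]
      using coset_eqI[OF subgroup_Gyr[OF n]] Gyr_G kG by blast
  qed
  then have "(\<lambda>k. coset_of (Gyr S 0 n) k) ` K \<subseteq> g ` R" using f by (auto simp: K_iff)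
  then show ?thesis using R(1) finite_subset by blast
qed

subsection \<open>Sums over cosets\<close>

text \<open>A finite substitute for integration over \<open>M\<close>. It is meant for functions
  invariant under \<open>U\<close> on the right, for which the chosen representatives do not
  matter.\<close>

definition csum :: "('e ^ 2 ^ 2) set \<Rightarrow> ('e ^ 2 ^ 2) set \<Rightarrow> ('e ^ 2 ^ 2 \<Rightarrow> 'v::comm_monoid_add) \<Rightarrow> 'v" where
  "csum M U h = (\<Sum>C\<in>coset_of U ` M. h (SOME x. x \<in> C))"

lemma some_coset: assumes "mat_subgroup U"
  shows "\<exists>u\<in>U. (SOME x. x \<in> coset_of U m) = m ** u"
proof -
  have "m ** mat 1 \<in> coset_of U m" unfolding coset_of_eq using subgroup_one[OF assms] by blast
  then have "(SOME x. x \<in> coset_of U m) \<in> coset_of U m" by (rule someI)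
  then show ?thesis unfolding coset_of_eq by auto
qed

text \<open>A coset of \<open>U\<close> in \<open>M\<close> is recovered from the coset of the
  congruence group that contains its representative, and \<open>K\<close> has finitely many of the
  latter.\<close>

lemma finite_cosets:
  assumes "mat_subgroup M" "M \<subseteq> K" "mat_subgroup U" "M \<inter> Gyr S 0 n \<subseteq> U" "n > 0"
  shows "finite (coset_of U ` M)"
proof -
  have "coset_of U m = set_prod (coset_of (Gyr S 0 n) m \<inter> M) U" if m: "m \<in> M" for m
  proof
    have "m ** mat 1 \<in> coset_of (Gyr S 0 n) m" unfolding coset_of_eq
      by (rule imageI, rule subgroup_one, rule subgroup_Gyr) (use assms(5) in simp)
    then have "m \<in> coset_of (Gyr S 0 n) m \<inter> M" using m by simp
    then show "coset_of U m \<subseteq> set_prod (coset_of (Gyr S 0 n) m \<inter> M) U"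
      unfolding coset_of_eq[of U] set_prod_def by blast
    show "set_prod (coset_of (Gyr S 0 n) m \<inter> M) U \<subseteq> coset_of U m"
    proof
      fix z assume "z \<in> set_prod (coset_of (Gyr S 0 n) m \<inter> M) U"
      then obtain g u where g: "g \<in> Gyr S 0 n" "m ** g \<in> M" and u: "u \<in> U" "z = m ** g ** u"
        unfolding coset_of_eq set_prod_def by blast
      have "m \<in> G" using m assms(2) K_subset by auto
      then have "matrix_inv m ** (m ** g) = g" by simp
      then have "g \<in> M" using subgroup_mult[OF assms(1) subgroup_inv[OF assms(1) m] g(2)] by simp
      then have "g \<in> U" using g(1) assms(4) by blast
      then show "z \<in> coset_of U m" unfolding coset_of_eq
        using u subgroup_mult[OF assms(3)] by (auto simp: gassoc)
    qed
  qed
  then have "coset_of U ` M \<subseteq> (\<lambda>C. set_prod (C \<inter> M) U) ` (coset_of (Gyr S 0 n) ` K)"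
    using assms(2) by auto
  moreover have "finite ((\<lambda>C. set_prod (C \<inter> M) U) ` (coset_of (Gyr S 0 n) ` K))"
    by (rule finite_imageI, rule finite_cosets_K) (use assms(5) in simp)
  ultimately show ?thesis by (rule finite_subset)
qed

lemma csum_cong: assumes "mat_subgroup U" "U \<subseteq> M" "mat_subgroup M" "\<And>m. m \<in> M \<Longrightarrow> h m = h' m"
  shows "csum M U h = csum M U h'"
  unfolding csum_def
proof (rule sum.cong[OF refl])
  fix C assume "C \<in> coset_of U ` M"
  then obtain m where m: "m \<in> M" "C = coset_of U m" by blast
  then obtain u where u: "u \<in> U" "(SOME x. x \<in> C) = m ** u" using some_coset[OF assms(1)] by blast
  have "m ** u \<in> M" using m u assms(2) subgroup_mult[OF assms(3)] by blast
  then show "h (SOME x. x \<in> C) = h' (SOME x. x \<in> C)" using u assms(4) by simp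
qed

text \<open>Left translation permutes the cosets, and right invariance makes representatives
  interchangeable: the analogue of the invariance of Haar measure.\<close>

lemma csum_shift:
  assumes M: "mat_subgroup M" "M \<subseteq> G" and U: "mat_subgroup U" "U \<subseteq> M"
    and inv: "\<And>m u. m \<in> M \<Longrightarrow> u \<in> U \<Longrightarrow> h (m ** u) = h m" and m0: "m0 \<in> M"
  shows "csum M U (\<lambda>m. h (m0 ** m)) = csum M U h"
proof -
  have m0': "matrix_inv m0 \<in> M" using subgroup_inv[OF M(1) m0] .
  have G: "m0 \<in> G" using M m0 by auto
  have val: "h (k ** (SOME x. x \<in> coset_of U m)) = h (k ** m)" if "m \<in> M" "k \<in> M" for m k
    using some_coset[OF U(1), of m] inv[of "k ** m"] subgroup_mult[OF M(1) that(2,1)]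
    by (auto simp: matrix_mul_assoc)
  have im: "(\<lambda>x. k ** x) ` coset_of U m = coset_of U (k ** m)" for k m
    by (auto simp: coset_of_eq image_image matrix_mul_assoc)
  show ?thesis unfolding csum_def
  proof (rule sum.reindex_bij_witness[where i = "\<lambda>C. (\<lambda>x. matrix_inv m0 ** x) ` C" and j = "\<lambda>C. (\<lambda>x. m0 ** x) ` C"])
    fix C assume "C \<in> coset_of U ` M"
    then obtain m where m: "m \<in> M" "C = coset_of U m" by blast
    have mm: "m0 ** m \<in> M" "matrix_inv m0 ** m \<in> M" using subgroup_mult[OF M(1)] m m0 m0' by auto
    show "(\<lambda>x. matrix_inv m0 ** x) ` (\<lambda>x. m0 ** x) ` C = C" "(\<lambda>x. m0 ** x) ` (\<lambda>x. matrix_inv m0 ** x) ` C = C"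
      using G by (simp_all add: image_image)
    show "(\<lambda>x. m0 ** x) ` C \<in> coset_of U ` M" "(\<lambda>x. matrix_inv m0 ** x) ` C \<in> coset_of U ` M"
      using mm by (auto simp: m(2) im)
    show "h (SOME x. x \<in> (\<lambda>x. m0 ** x) ` C) = h (m0 ** (SOME x. x \<in> C))"
      using val[OF m(1) m0] val[OF mm(1) subgroup_one[OF M(1)]] by (simp add: m(2) im)
  qed
qed

lemma csum_one:
  assumes M: "mat_subgroup M" "M \<subseteq> G" and U: "mat_subgroup U" "U \<subseteq> M"
    and inv: "\<And>m u. m \<in> M \<Longrightarrow> u \<in> U \<Longrightarrow> h (m ** u) = h m"
    and zero: "\<And>m. m \<in> M \<Longrightarrow> m \<notin> U \<Longrightarrow> h m = 0" and fin: "finite (coset_of U ` M)"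
  shows "csum M U h = h (mat 1)"
proof -
  have "csum M U h = (\<Sum>C\<in>coset_of U ` M. if C = coset_of U (mat 1) then h (mat 1) else 0)"
    unfolding csum_def
  proof (rule sum.cong[OF refl])
    fix C assume "C \<in> coset_of U ` M"
    then obtain m where m: "m \<in> M" "C = coset_of U m" by blast
    then obtain u where u: "u \<in> U" "(SOME x. x \<in> C) = m ** u" using some_coset[OF U(1)] by blast
    show "h (SOME x. x \<in> C) = (if C = coset_of U (mat 1) then h (mat 1) else 0)"
    proof (cases "C = coset_of U (mat 1)")
      case True
      then obtain u where "u \<in> U" "(SOME x. x \<in> C) = mat 1 ** u" using some_coset[OF U(1)] by blast
      then show ?thesis using inv[of "mat 1" u] subgroup_one[OF M(1)] True by simp
    next
      case False
      have "m \<notin> U"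
      proof
        assume "m \<in> U"
        then have "coset_of U (mat 1) = coset_of U m" using coset_eqI[OF U(1), of "mat 1" m] U M by auto
        then show False using False m by simp
      qed
      then show ?thesis using False u inv[OF m(1) u(1)] zero[OF m(1)] by simp
    qed
  qed
  also have "\<dots> = h (mat 1)" using fin subgroup_one[OF M(1)] by (simp add: sum.delta)
  finally show ?thesis .
qed

lemma sum_fun_apply: "(\<Sum>i\<in>I. f i) x = (\<Sum>i\<in>I. f i x)" for f :: "'i \<Rightarrow> 'a \<Rightarrow> 'v::comm_monoid_add"
  by (induction I rule: infinite_finite_induct) auto

lemma csum_apply: "csum M U h x = csum M U (\<lambda>m. h m x)" for h :: "_ \<Rightarrow> 'a \<Rightarrow> 'v::comm_monoid_add"
  by (simp add: csum_def sum_fun_apply)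

lemma fun_vector_space: assumes "vector_space sc"
  shows "vector_space (\<lambda>c f x. sc c (f x))"
proof -
  interpret V: vector_space sc by fact
  show ?thesis by unfold_locales (auto simp: fun_eq_iff V.scale_right_distrib V.scale_left_distrib)
qed

subsection \<open>Induction from open subgroups\<close>

lemma Ind_iff:
  assumes H: "mat_subgroup H" "H \<subseteq> G" and n0: "n0 > 0" "Gyr S 0 n0 \<subseteq> H"
  shows "f \<in> rspace (smooth_Ind S H J R) \<longleftrightarrow> (\<forall>x. x \<notin> H \<longrightarrow> f x = 0) \<and> (\<forall>x\<in>H. f x \<in> rspace R) \<and>
    (\<forall>h\<in>J. \<forall>x\<in>H. f (h ** x) = ract R h (f x)) \<and> (\<exists>n>0. \<forall>x\<in>H. \<forall>u\<in>Gyr S 0 n. f (x ** u) = f x)"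
proof -
  have "(\<exists>U. mat_subgroup U \<and> openin (subtopology (mat_top S) H) U \<and> (\<forall>x\<in>H. \<forall>u\<in>U. f (x ** u) = f x))
     \<longleftrightarrow> (\<exists>n>0. \<forall>x\<in>H. \<forall>u\<in>Gyr S 0 n. f (x ** u) = f x)" (is "?L \<longleftrightarrow> ?R")
  proof
    assume ?L
    then obtain U where U: "mat_subgroup U" "openin (subtopology (mat_top S) H) U"
      "\<And>x u. x \<in> H \<Longrightarrow> u \<in> U \<Longrightarrow> f (x ** u) = f x" by blast
    obtain n where n: "n > 0" "H \<inter> Gyr S 0 n \<subseteq> U"
      using open_nbhd[OF U(2) subgroup_one[OF U(1)] H(2)] by blast
    have "Gyr S 0 (max n n0) \<subseteq> U"
      using n n0 Gyr_antimono[of n "max n n0" 0] Gyr_antimono[of n0 "max n n0" 0] by auto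
    then show ?R using U(3) n by (intro exI[of _ "max n n0"]) auto
  next
    assume ?R
    then obtain n where n: "n > 0" "\<And>x u. x \<in> H \<Longrightarrow> u \<in> Gyr S 0 n \<Longrightarrow> f (x ** u) = f x" by blast
    define m where "m = max n n0"
    have s: "Gyr S 0 m \<subseteq> Gyr S 0 n" "Gyr S 0 m \<subseteq> H"
      using n0 Gyr_antimono[of n m 0] Gyr_antimono[of n0 m 0] by (auto simp: m_def)
    have sg: "mat_subgroup (Gyr S 0 m)" using n by (intro subgroup_Gyr) (simp add: m_def)
    have "openin (subtopology (mat_top S) H) (Gyr S 0 m)"
      by (rule open_of_nbhd[OF H s(2), of m]) (use n subgroup_mult[OF sg] in \<open>auto simp: m_def\<close>)
    then show ?L using sg n s by blast
  qed
  then show ?thesis by (simp add: smooth_Ind_def)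
qed

text \<open>Irreducibility split off from smoothness: the latter passes to subgroups by itself,
  while the former is argued anew for each group.\<close>

definition irr :: "('e ^ 2 ^ 2) set \<Rightarrow> ('e ^ 2 ^ 2, 'v::ab_group_add) rep \<Rightarrow> bool" where
  "irr H R \<longleftrightarrow> rspace R \<noteq> {0} \<and> (\<forall>W. W \<subseteq> rspace R \<and> module.subspace (rscale R) W \<and> (\<forall>h\<in>H. \<forall>v\<in>W. ract R h v \<in> W)
          \<longrightarrow> W = {0} \<or> W = rspace R)"

lemma irreducible_rep_iff: "irreducible_rep S H R \<longleftrightarrow> smooth_rep S H R \<and> irr H R"
  by (auto simp: irreducible_rep_def irr_def)

end

text \<open>The number \<open>n0\<close> witnesses that \<open>J\<close> is open in
  \<open>K\<close>, hence of finite index (\<open>fin_KJ\<close>).\<close>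

locale ind_data = u11 S for S :: "('f::field, 'e::field) setting" +
  fixes J :: "('e ^ 2 ^ 2) set" and R :: "('e ^ 2 ^ 2, 'v::ab_group_add) rep" and n0 :: real
  assumes subgroup_J: "mat_subgroup J" and J_sub: "J \<subseteq> maxK S"
    and n0: "n0 > 0" "Gyr S 0 n0 \<subseteq> J" and srep: "srep J R"
begin

abbreviation "Ind \<equiv> smooth_Ind S K J R"

lemma rep: "is_rep J (**) (mat 1) R" using srep by (simp add: srep_def)

sublocale V: vector_space "rscale R" using rep by (simp add: is_rep_def)

sublocale FV: vector_space "rscale Ind"
  using fun_vector_space[OF V.vector_space_axioms] by (simp add: smooth_Ind_def)

lemma Rsub: "V.subspace (rspace R)" using rep by (simp add: is_rep_def)
lemma ract_in: "h \<in> J \<Longrightarrow> v \<in> rspace R \<Longrightarrow> ract R h v \<in> rspace R"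
  and ract_add: "h \<in> J \<Longrightarrow> v \<in> rspace R \<Longrightarrow> w \<in> rspace R \<Longrightarrow> ract R h (v + w) = ract R h v + ract R h w"
  and ract_scale: "h \<in> J \<Longrightarrow> v \<in> rspace R \<Longrightarrow> ract R h (rscale R c v) = rscale R c (ract R h v)"
  and ract_one: "v \<in> rspace R \<Longrightarrow> ract R (mat 1) v = v"
  and ract_mult: "g \<in> J \<Longrightarrow> h \<in> J \<Longrightarrow> v \<in> rspace R \<Longrightarrow> ract R (g ** h) v = ract R g (ract R h v)"
  using rep by (auto simp: is_rep_def)

lemma ract_zero: "h \<in> J \<Longrightarrow> ract R h 0 = 0"
  using ract_scale[of h 0 0] V.subspace_0[OF Rsub] by simp

lemma ract_sum: assumes "h \<in> J" "\<And>i. i \<in> I \<Longrightarrow> f i \<in> rspace R"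
  shows "ract R h (\<Sum>i\<in>I. f i) = (\<Sum>i\<in>I. ract R h (f i))"
  using assms(2)
proof (induction I rule: infinite_finite_induct)
  case (insert i I)
  then show ?case using ract_add[OF assms(1)] V.subspace_sum[OF Rsub, of I f] by simp
qed (simp_all add: ract_zero assms)

lemma J_G: "J \<subseteq> G" using J_sub K_subset by blast

lemma KE: "x \<in> K \<Longrightarrow> x \<in> G" using K_subset by blast

lemma Ind_rscale: "rscale Ind c f = (\<lambda>x. rscale R c (f x))" and Ind_ract: "ract Ind g f = (\<lambda>x. f (x ** g))"
  by (simp_all add: smooth_Ind_def)

lemma Ind_iff': "f \<in> rspace Ind \<longleftrightarrow> (\<forall>x. x \<notin> K \<longrightarrow> f x = 0) \<and> (\<forall>x\<in>K. f x \<in> rspace R) \<and>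
    (\<forall>h\<in>J. \<forall>x\<in>K. f (h ** x) = ract R h (f x)) \<and> (\<exists>n>0. \<forall>x\<in>K. \<forall>u\<in>Gyr S 0 n. f (x ** u) = f x)"
  by (rule Ind_iff[OF subgroup_K K_subset n0(1)]) (use n0 J_sub in blast)

lemma IndD: assumes "f \<in> rspace Ind"
  shows "\<And>x. x \<notin> K \<Longrightarrow> f x = 0" "\<And>x. x \<in> K \<Longrightarrow> f x \<in> rspace R"
    "\<And>h x. h \<in> J \<Longrightarrow> x \<in> K \<Longrightarrow> f (h ** x) = ract R h (f x)"
    "\<exists>n>0. \<forall>x\<in>K. \<forall>u\<in>Gyr S 0 n. f (x ** u) = f x"
  using assms unfolding Ind_iff' by auto

lemma Ind_val: "f \<in> rspace Ind \<Longrightarrow> f x \<in> rspace R"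
  using IndD(1,2)[of f x] V.subspace_0[OF Rsub] by (cases "x \<in> K") auto

lemma Ind_sub: "FV.subspace (rspace Ind)"
proof (rule FV.subspaceI)
  show "0 \<in> rspace Ind" unfolding Ind_iff'
    using V.subspace_0[OF Rsub] ract_zero by (auto intro!: exI[of _ 1])
next
  fix f g assume f: "f \<in> rspace Ind" and g: "g \<in> rspace Ind"
  obtain n where n: "n > 0" "\<forall>x\<in>K. \<forall>u\<in>Gyr S 0 n. f (x ** u) = f x" using IndD(4)[OF f] by blast
  obtain m where m: "m > 0" "\<forall>x\<in>K. \<forall>u\<in>Gyr S 0 m. g (x ** u) = g x" using IndD(4)[OF g] by blast
  have "\<exists>n>0. \<forall>x\<in>K. \<forall>u\<in>Gyr S 0 n. (f + g) (x ** u) = (f + g) x"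
  proof (intro exI[of _ "max n m"] conjI ballI)
    fix x u assume "x \<in> K" "u \<in> Gyr S 0 (max n m)"
    then have "f (x ** u) = f x" "g (x ** u) = g x"
      using n m Gyr_antimono[of n "max n m" 0] Gyr_antimono[of m "max n m" 0] by auto
    then show "(f + g) (x ** u) = (f + g) x" by simp
  qed (use n in simp)
  then show "f + g \<in> rspace Ind" unfolding Ind_iff'
    using IndD(1-3)[OF f] IndD(1-3)[OF g] V.subspace_add[OF Rsub] ract_add by auto
next
  fix c f assume f: "f \<in> rspace Ind"
  show "rscale Ind c f \<in> rspace Ind" unfolding Ind_iff' Ind_rscale
    using IndD[OF f] V.subspace_scale[OF Rsub] ract_scale by auto
qed

lemma Ind_act: assumes f: "f \<in> rspace Ind" and g: "g \<in> K" shows "ract Ind g f \<in> rspace Ind"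
  unfolding Ind_iff' Ind_ract
proof (intro conjI allI ballI impI)
  fix x assume "x \<notin> K"
  then have "x ** g \<notin> K" using subgroup_mult[OF subgroup_K _ subgroup_inv[OF subgroup_K g], of "x ** g"] KE[OF g]
    by (auto simp: gassoc)
  then show "f (x ** g) = 0" using IndD(1)[OF f] by simp
next
  fix h x assume "h \<in> J" "x \<in> K"
  then show "f (h ** x ** g) = ract R h (f (x ** g))"
    using IndD(3)[OF f, of h "x ** g"] subgroup_mult[OF subgroup_K _ g] by (simp add: gassoc)
next
  fix x assume "x \<in> K" then show "f (x ** g) \<in> rspace R" using Ind_val[OF f] by simp
next
  obtain n where n: "n > 0" "\<And>x u. x\<in>K \<Longrightarrow> u\<in>Gyr S 0 n \<Longrightarrow> f (x ** u) = f x" using IndD(4)[OF f] by blast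
  show "\<exists>n>0. \<forall>x\<in>K. \<forall>u\<in>Gyr S 0 n. f (x ** u ** g) = f (x ** g)"
  proof (intro exI[of _ n] conjI ballI)
    fix x u assume x: "x \<in> K" and u: "u \<in> Gyr S 0 n"
    have u': "matrix_inv g ** u ** g \<in> Gyr S 0 n"
      using Gyr_normal[of "matrix_inv g" 0 u n] subgroup_inv[OF subgroup_K g] u KE[OF g] by (simp add: K_eq)
    have "x ** u ** g = (x ** g) ** (matrix_inv g ** u ** g)" using KE[OF g] by (simp add: gassoc)
    then show "f (x ** u ** g) = f (x ** g)" using n(2)[OF subgroup_mult[OF subgroup_K x g] u'] by simp
  qed (rule n)
qed

lemma Ind_smooth: "smooth_rep S K Ind"
  unfolding smooth_rep_iff[OF subgroup_K K_subset] srep_def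
proof
  show "is_rep K (**) (mat 1) Ind" unfolding is_rep_def
    using FV.vector_space_axioms Ind_sub Ind_act by (auto simp: Ind_ract Ind_rscale gassoc fun_eq_iff)
  show "\<forall>f\<in>rspace Ind. \<exists>n>0. \<forall>h\<in>K \<inter> Gyr S 0 n. ract Ind h f = f"
  proof
    fix f assume f: "f \<in> rspace Ind"
    obtain n where n: "n > 0" "\<And>x u. x\<in>K \<Longrightarrow> u\<in>Gyr S 0 n \<Longrightarrow> f (x ** u) = f x" using IndD(4)[OF f] by blast
    have "ract Ind h f = f" if h: "h \<in> K \<inter> Gyr S 0 n" for h
    proof
      fix x show "ract Ind h f x = f x"
        using n(2)[of x h] h IndD(1)[OF f, of x] IndD(1)[OF Ind_act[OF f, of h], of x]
        by (cases "x \<in> K") (auto simp: Ind_ract)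
    qed
    then show "\<exists>n>0. \<forall>h\<in>K \<inter> Gyr S 0 n. ract Ind h f = f" using n(1) by blast
  qed
qed

text \<open>The canonical copy of \<open>R\<close> in the induced representation: functions
  supported on \<open>J\<close>, determined by their value v at the identity.\<close>

definition ext :: "'v \<Rightarrow> 'e ^ 2 ^ 2 \<Rightarrow> 'v" where
  "ext v x = (if x \<in> J then ract R x v else 0)"

lemma J_left: "h \<in> J \<Longrightarrow> x \<in> G \<Longrightarrow> h ** x \<in> J \<longleftrightarrow> x \<in> J"
  using subgroup_mult[OF subgroup_J] subgroup_inv[OF subgroup_J] J_G by (metis G_cancel(2) subsetD)
lemma J_right: "h \<in> J \<Longrightarrow> x \<in> G \<Longrightarrow> x ** h \<in> J \<longleftrightarrow> x \<in> J"
proof -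
  assume h: "h \<in> J" and x: "x \<in> G"
  have "x = (x ** h) ** matrix_inv h" using h J_G by (auto simp: gassoc)
  then show ?thesis using subgroup_mult[OF subgroup_J _ h, of x]
      subgroup_mult[OF subgroup_J _ subgroup_inv[OF subgroup_J h], of "x ** h"] by auto
qed

lemma ext_in: assumes v: "v \<in> rspace R" shows "ext v \<in> rspace Ind"
  unfolding Ind_iff'
proof (intro conjI allI ballI impI)
  fix x assume "x \<notin> K" then show "ext v x = 0" using J_sub by (auto simp: ext_def)
next
  fix x show "ext v x \<in> rspace R" using V.subspace_0[OF Rsub] ract_in v by (auto simp: ext_def)
next
  fix h x assume h: "h \<in> J" and x: "x \<in> K"
  show "ext v (h ** x) = ract R h (ext v x)"
    using J_left[OF h KE[OF x]] ract_mult[OF h _ v] ract_zero[OF h] by (auto simp: ext_def)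
next
  obtain n where n: "n > 0" "\<And>h. h\<in>J \<inter> Gyr S 0 n \<Longrightarrow> ract R h v = v" using srep v by (auto simp: srep_def)
  show "\<exists>n>0. \<forall>x\<in>K. \<forall>u\<in>Gyr S 0 n. ext v (x ** u) = ext v x"
  proof (intro exI[of _ "max n n0"] conjI ballI)
    fix x u assume x: "x \<in> K" and "u \<in> Gyr S 0 (max n n0)"
    then have u: "u \<in> Gyr S 0 n" "u \<in> J"
      using Gyr_antimono[of n "max n n0" 0] Gyr_antimono[of n0 "max n n0" 0] n0 by auto
    show "ext v (x ** u) = ext v x"
      using J_right[OF u(2) KE[OF x]] ract_mult[OF _ u(2) v, of x] n(2)[of u] u by (auto simp: ext_def)
  qed (use n in simp)
qed

lemma fin_KJ: "finite (coset_of J ` K)"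
  by (rule finite_cosets[OF subgroup_K order_refl subgroup_J _ n0(1)]) (use n0 in auto)

text \<open>Translates of the copy of \<open>R\<close> generate everything. At a point y of
  \<open>K\<close>, left translation of the summation variable by y concentrates the sum on the
  trivial coset, whose contribution is f y.\<close>

lemma Ind_decompose: assumes f: "f \<in> rspace Ind"
  shows "f = csum K J (\<lambda>p. ract Ind p (ext (f (matrix_inv p))))"
proof
  fix y
  define h where "h p = (if y ** p \<in> J then ract R (y ** p) (f (matrix_inv p)) else 0)" for p
  have eq: "csum K J (\<lambda>p. ract Ind p (ext (f (matrix_inv p)))) y = csum K J h"
    unfolding csum_apply Ind_ract ext_def h_def ..
  show "f y = csum K J (\<lambda>p. ract Ind p (ext (f (matrix_inv p)))) y"
  proof (cases "y \<in> K")
    case False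
    have "h p = 0" if "p \<in> K" for p
    proof -
      have "y ** p \<notin> K"
        using False subgroup_mult[OF subgroup_K _ subgroup_inv[OF subgroup_K that], of "y ** p"] KE[OF that]
        by (auto simp: gassoc)
      then show ?thesis using J_sub by (auto simp: h_def)
    qed
    then have "csum K J h = csum K J (\<lambda>_. 0)" by (intro csum_cong[OF subgroup_J J_sub subgroup_K]) simp
    then show ?thesis using eq IndD(1)[OF f False] by (simp add: csum_def)
  next
    case True
    define h' where "h' p = (if p \<in> J then ract R p (f (matrix_inv p ** y)) else 0)" for p
    have y: "y \<in> G" using True KE by simp
    have hh: "h p = h' (y ** p)" if "p \<in> K" for p using KE[OF that] y by (simp add: h_def h'_def gassoc)
    have inv: "h' (m ** u) = h' m" if m: "m \<in> K" and u: "u \<in> J" for m u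
    proof (cases "m \<in> J")
      case mJ: True
      have G: "m \<in> G" "u \<in> G" using m u KE J_G by auto
      have my: "matrix_inv m ** y \<in> K" using subgroup_mult[OF subgroup_K subgroup_inv[OF subgroup_K m] True] .
      have u': "matrix_inv u \<in> J" using subgroup_inv[OF subgroup_J u] .
      have "f (matrix_inv (m ** u) ** y) = ract R (matrix_inv u) (f (matrix_inv m ** y))"
        using IndD(3)[OF f u' my] G by (simp add: gassoc)
      moreover have "ract R (m ** u) (ract R (matrix_inv u) v) = ract R m v" if "v \<in> rspace R" for v
        using ract_mult[of "m ** u" "matrix_inv u" v] mJ u u' that G subgroup_mult[OF subgroup_J mJ u]
        by (simp add: gassoc)
      ultimately show ?thesis using mJ u subgroup_mult[OF subgroup_J mJ u] Ind_val[OF f] by (simp add: h'_def)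
    next
      case False then show ?thesis using J_right[OF u KE[OF m]] by (simp add: h'_def)
    qed
    have "csum K J h = csum K J (\<lambda>p. h' (y ** p))" by (rule csum_cong[OF subgroup_J J_sub subgroup_K]) (rule hh)
    also have "\<dots> = csum K J h'" by (rule csum_shift[OF subgroup_K K_subset subgroup_J J_sub inv True])
    also have "\<dots> = h' (mat 1)"
      by (rule csum_one[OF subgroup_K K_subset subgroup_J J_sub inv _ fin_KJ]) (auto simp: h'_def)
    also have "\<dots> = f y" using subgroup_one[OF subgroup_J] ract_one Ind_val[OF f] by (simp add: h'_def)
    finally show ?thesis using eq by simp
  qed
qed

lemma csum_in: assumes "mat_subgroup M" "mat_subgroup U" "U \<subseteq> M" "FV.subspace W" "\<And>m. m \<in> M \<Longrightarrow> h m \<in> W"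
  shows "csum M U h \<in> W"
  unfolding csum_def
proof (rule FV.subspace_sum[OF assms(4)])
  fix C assume "C \<in> coset_of U ` M"
  then obtain m where m: "m \<in> M" "C = coset_of U m" by blast
  then obtain u where u: "u \<in> U" "(SOME x. x \<in> C) = m ** u" using some_coset[OF assms(2)] by blast
  have "m ** u \<in> M" using m u assms(3) subgroup_mult[OF assms(1)] by blast
  then show "h (SOME x. x \<in> C) \<in> W" using u assms(5) by simp
qed

text \<open>The vectors v with \<open>ext v\<close> in W form a \<open>J\<close>-stable subspace, so
  one nonzero such vector yields all of \<open>R\<close>; \<open>Ind_decompose\<close> then yields
  all of \<open>Ind\<close>.\<close>

lemma full_of_ext:
  assumes W: "W \<subseteq> rspace Ind" "FV.subspace W" "\<And>g f. g \<in> K \<Longrightarrow> f \<in> W \<Longrightarrow> ract Ind g f \<in> W"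
    and irr: "irr J R" and v: "v \<in> rspace R" "v \<noteq> 0" "ext v \<in> W"
  shows "W = rspace Ind"
proof -
  let ?V = "{v \<in> rspace R. ext v \<in> W}"
  have "V.subspace ?V"
  proof (rule V.subspaceI)
    have "ext 0 = 0" using ract_zero by (auto simp: ext_def fun_eq_iff)
    then show "0 \<in> ?V" using V.subspace_0[OF Rsub] FV.subspace_0[OF W(2)] by simp
  next
    fix a b assume a: "a \<in> ?V" and b: "b \<in> ?V"
    have "ext (a + b) = ext a + ext b" using ract_add a b by (auto simp: ext_def fun_eq_iff)
    then show "a + b \<in> ?V" using a b V.subspace_add[OF Rsub] FV.subspace_add[OF W(2)] by simp
  next
    fix c a assume a: "a \<in> ?V"
    have "ext (rscale R c a) = rscale Ind c (ext a)" using ract_scale a by (auto simp: ext_def fun_eq_iff Ind_rscale)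
    then show "rscale R c a \<in> ?V" using a V.subspace_scale[OF Rsub] FV.subspace_scale[OF W(2)] by simp
  qed
  moreover have "ract R h a \<in> ?V" if h: "h \<in> J" and a: "a \<in> ?V" for h a
  proof -
    have hG: "h \<in> G" "h \<in> K" using h J_G J_sub by auto
    have "ext (ract R h a) = ract Ind h (ext a)"
    proof
      fix x
      have "x \<in> J \<longleftrightarrow> x ** h \<in> J"
      proof
        assume "x ** h \<in> J"
        then have "x ** h ** matrix_inv h \<in> J" using subgroup_mult[OF subgroup_J _ subgroup_inv[OF subgroup_J h]] by blast
        then show "x \<in> J" using hG by (simp add: gassoc)
      qed (use h subgroup_mult[OF subgroup_J] in auto)
      then show "ext (ract R h a) x = ract Ind h (ext a) x"
        using ract_mult[OF _ h] a by (simp add: ext_def Ind_ract)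
    qed
    then show ?thesis using a ract_in[OF h] W(3)[OF hG(2)] by simp
  qed
  ultimately have "?V = {0} \<or> ?V = rspace R"
    by (intro irr[unfolded irr_def, THEN conjunct2, rule_format] conjI ballI) (fast | assumption)+
  then have V: "?V = rspace R" using v by auto
  show ?thesis
  proof
    show "rspace Ind \<subseteq> W"
    proof
      fix f assume f: "f \<in> rspace Ind"
      have "ract Ind p (ext (f (matrix_inv p))) \<in> W" if "p \<in> K" for p
        using W(3)[OF that] V Ind_val[OF f] by blast
      then have "csum K J (\<lambda>p. ract Ind p (ext (f (matrix_inv p)))) \<in> W"
        by (rule csum_in[OF subgroup_K subgroup_J J_sub W(2)])
      then show "f \<in> W" using Ind_decompose[OF f] by simp
    qed
  qed (rule W)
qed

text \<open>Averaging a vector against a character of \<open>M\<close> kills its values off \<open>J\<close>, because there the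
  left and right actions of some element of \<open>M\<close> disagree.\<close>

lemma full_of_eigen:
  assumes W: "W \<subseteq> rspace Ind" "FV.subspace W" "\<And>g f. g \<in> K \<Longrightarrow> f \<in> W \<Longrightarrow> ract Ind g f \<in> W"
    and irr: "irr J R" and f: "f \<in> W" "f (mat 1) \<noteq> 0"
    and M: "mat_subgroup M" "M \<subseteq> J" "\<And>m v. m \<in> M \<Longrightarrow> v \<in> rspace R \<Longrightarrow> ract R m v = rscale R (ch m) v"
    and D: "\<And>x. x \<in> K \<Longrightarrow> f x \<noteq> 0 \<Longrightarrow> x \<in> D" "\<And>x m. x \<in> K \<Longrightarrow> m \<in> M \<Longrightarrow> x ** m \<in> D \<Longrightarrow> x \<in> D"
      "\<And>x. x \<in> K \<Longrightarrow> x \<in> D \<Longrightarrow> x \<notin> J \<Longrightarrow> \<exists>m\<in>M. x ** m ** matrix_inv x \<in> M \<and> ch (x ** m ** matrix_inv x) \<noteq> ch m"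
  shows "W = rspace Ind"
proof -
  have fI: "f \<in> rspace Ind" using f W by auto
  have f1: "f (mat 1) \<in> rspace R" using Ind_val[OF fI] .
  have MK: "M \<subseteq> K" "M \<subseteq> G" using M J_sub J_G by auto
  have chi1: "ch (mat 1) = 1"
    using M(3)[OF subgroup_one[OF M(1)] f1] ract_one[OF f1] f(2)
    by (metis V.scale_cancel_right V.scale_one)
  have chim: "ch (a ** b) = ch a * ch b" if "a \<in> M" "b \<in> M" for a b
  proof -
    have "rscale R (ch (a ** b)) (f (mat 1)) = ract R a (ract R b (f (mat 1)))"
      using M(3)[OF subgroup_mult[OF M(1) that] f1] ract_mult[of a b, OF _ _ f1] that M(2) by auto
    also have "\<dots> = rscale R (ch a * ch b) (f (mat 1))"
      using M(3)[OF that(2) f1] M(3)[OF that(1)] V.subspace_scale[OF Rsub f1] by simp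
    finally show ?thesis using f(2) V.scale_cancel_right by metis
  qed
  have chin: "ch a \<noteq> 0" if "a \<in> M" for a
    using chim[OF that subgroup_inv[OF M(1) that]] chi1 MK that by auto
  obtain n where n: "n > 0" "\<And>x u. x\<in>K \<Longrightarrow> u\<in>Gyr S 0 n \<Longrightarrow> f (x ** u) = f x" using IndD(4)[OF fI] by blast
  \<comment> \<open>Both f and the character \<open>ch\<close> are invariant under this group, so
    the average over \<open>M\<close> becomes a finite sum over cosets.\<close>
  define U where "U = M \<inter> Gyr S 0 n"
  have U: "mat_subgroup U" "U \<subseteq> M" using n M(1) unfolding U_def by (auto intro!: subgroup_Int subgroup_Gyr)
  have chiU: "ch u = 1" if "u \<in> U" for u
  proof -
    have "f (mat 1 ** u) = f (mat 1)" using n(2)[OF subgroup_one[OF subgroup_K]] that by (auto simp: U_def)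
    moreover have "u \<in> M" "u \<in> J" using that U(2) M(2) by auto
    then have "f (u ** mat 1) = rscale R (ch u) (f (mat 1))"
      using IndD(3)[OF fI, of u "mat 1"] M(3)[OF _ f1] subgroup_one[OF subgroup_K] by simp
    ultimately have "rscale R (ch u) (f (mat 1)) = rscale R 1 (f (mat 1))" by simp
    then show ?thesis using f(2) V.scale_cancel_right by blast
  qed
  have fin: "finite (coset_of U ` M)"
    by (rule finite_cosets[OF M(1) MK(1) U(1) _ n(1)]) (auto simp: U_def)
  \<comment> \<open>Up to a scalar, the projection of f to the functions on which \<open>M\<close>
    acts by \<open>ch\<close> on the right.\<close>
  define F where "F = csum M U (\<lambda>m. rscale Ind (inverse (ch m)) (ract Ind m f))"
  have FW: "F \<in> W" unfolding F_def
    by (rule csum_in[OF M(1) U W(2)]) (use FV.subspace_scale[OF W(2)] W(3) f(1) MK in blast)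
  then have FI: "F \<in> rspace Ind" using W by auto
  define h where "h x m = rscale R (inverse (ch m)) (f (x ** m))" for x m
  have Fx: "F x = csum M U (h x)" for x
    unfolding F_def csum_apply Ind_rscale Ind_ract h_def ..
  have hinv: "h x (m ** u) = h x m" if "x \<in> K" "m \<in> M" "u \<in> U" for x m u
  proof -
    have "f (x ** m ** u) = f (x ** m)"
      using n(2)[of "x ** m" u] that subgroup_mult[OF subgroup_K] MK by (auto simp: U_def)
    then show ?thesis using chim[of m u] chiU[of u] that U(2) by (auto simp: h_def gassoc)
  qed
  have Fr: "F (x ** m0) = rscale R (ch m0) (F x)" if x: "x \<in> K" and m0: "m0 \<in> M" for x m0
  proof -
    have "F (x ** m0) = csum M U (\<lambda>m. rscale R (ch m0) (h x (m0 ** m)))" unfolding Fx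
      by (rule csum_cong[OF U M(1)]) (use chim[OF m0] chin[OF m0] in \<open>simp add: h_def gassoc\<close>)
    also have "\<dots> = rscale R (ch m0) (csum M U (\<lambda>m. h x (m0 ** m)))" by (simp add: csum_def V.scale_sum_right)
    also have "csum M U (\<lambda>m. h x (m0 ** m)) = F x" unfolding Fx
      by (rule csum_shift[OF M(1) MK(2) U hinv[OF x] m0])
    finally show ?thesis .
  qed
  have F0: "F x = 0" if x: "x \<in> K" "x \<notin> J" for x
  proof (rule ccontr)
    assume nz: "F x \<noteq> 0"
    \<comment> \<open>A nonzero average has a nonzero term, which places x in D. The set D bounds
      the support of f, and only on it is a separating element of \<open>M\<close> provided.\<close>
    have "\<exists>m\<in>M. f (x ** m) \<noteq> 0"
    proof (rule ccontr)
      assume "\<not> ?thesis"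
      then have "csum M U (h x) = csum M U (\<lambda>_. 0)" by (intro csum_cong[OF U M(1)]) (simp add: h_def)
      then show False using nz by (simp add: Fx csum_def)
    qed
    then obtain m where m: "m \<in> M" "f (x ** m) \<noteq> 0" by blast
    have "x ** m \<in> D" using D(1)[OF _ m(2)] subgroup_mult[OF subgroup_K x(1)] m MK by auto
    then have "x \<in> D" using D(2)[OF x(1) m(1)] by simp
    then obtain k where k: "k \<in> M" "x ** k ** matrix_inv x \<in> M" "ch (x ** k ** matrix_inv x) \<noteq> ch k"
      using D(3)[OF x(1)] x(2) by blast
    \<comment> \<open>The element k is moved past x: on the right it acts by \<open>ch k\<close>, on
      the left by \<open>ch\<close> of its conjugate. Since these differ, F x vanishes.\<close>
    have "F (x ** k) = F ((x ** k ** matrix_inv x) ** x)" using KE[OF x(1)] by (simp add: gassoc)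
    also have "\<dots> = rscale R (ch (x ** k ** matrix_inv x)) (F x)"
      using IndD(3)[OF FI, of "x ** k ** matrix_inv x" x] k(2) M(2) x M(3)[OF k(2) Ind_val[OF FI]] by auto
    finally have "rscale R (ch k) (F x) = rscale R (ch (x ** k ** matrix_inv x)) (F x)" using Fr[OF x(1) k(1)] by simp
    then show False using nz k(3) V.scale_cancel_right by metis
  qed
  have Fe: "F = ext (F (mat 1))"
  proof
    fix x
    show "F x = ext (F (mat 1)) x"
    proof (cases "x \<in> J")
      case True
      then show ?thesis using IndD(3)[OF FI True subgroup_one[OF subgroup_K]] by (simp add: ext_def)
    next
      case False
      then show ?thesis using F0[of x] IndD(1)[OF FI, of x] by (cases "x \<in> K") (auto simp: ext_def)
    qed
  qed
  \<comment> \<open>At the identity the left equivariance of f cancels the character, so all terms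
    agree and the sum is a positive integer times a nonzero vector.\<close>
  have "F (mat 1) = csum M U (\<lambda>_. f (mat 1))" unfolding Fx
  proof (rule csum_cong[OF U M(1)])
    fix m assume m: "m \<in> M"
    have "f (m ** mat 1) = rscale R (ch m) (f (mat 1))"
      using IndD(3)[OF fI, of m "mat 1"] M m subgroup_one[OF subgroup_K] f1 by auto
    then show "h (mat 1) m = f (mat 1)" using chin[OF m] by (simp add: h_def)
  qed
  also have "\<dots> = (\<Sum>C\<in>coset_of U ` M. rscale R 1 (f (mat 1)))" by (simp add: csum_def)
  also have "\<dots> = rscale R (of_nat (card (coset_of U ` M))) (f (mat 1))"
    unfolding V.scale_sum_left[symmetric] by simp
  finally have "F (mat 1) \<noteq> 0" using fin f(2) subgroup_one[OF M(1)] by auto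
  then show ?thesis using full_of_ext[OF W irr Ind_val[OF FI]] Fe FW by metis
qed

lemma ext_one: "v \<in> rspace R \<Longrightarrow> ext v (mat 1) = v"
  using subgroup_one[OF subgroup_J] by (simp add: ext_def ract_one)

text \<open>A nonzero invariant subspace contains, after a translation, a function that does not
  vanish at the identity; \<open>full_of_eigen\<close> then applies with D the whole space.\<close>

lemma Ind_irreducible:
  assumes irr: "irr J R"
    and M: "mat_subgroup M" "M \<subseteq> J" "\<And>m v. m \<in> M \<Longrightarrow> v \<in> rspace R \<Longrightarrow> ract R m v = rscale R (ch m) v"
    and D: "\<And>x. x \<in> K \<Longrightarrow> x \<notin> J \<Longrightarrow> \<exists>m\<in>M. x ** m ** matrix_inv x \<in> M \<and> ch (x ** m ** matrix_inv x) \<noteq> ch m"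
  shows "irreducible_rep S K Ind"
  unfolding irreducible_rep_iff
proof
  show "smooth_rep S K Ind" by (rule Ind_smooth)
  show "irr K Ind" unfolding irr_def
  proof (intro conjI allI impI)
    obtain v where v: "v \<in> rspace R" "v \<noteq> 0" using irr V.subspace_0[OF Rsub] unfolding irr_def by blast
    have "ext v \<noteq> 0" using ext_one[OF v(1)] v(2) by (metis zero_fun_apply)
    then show "rspace Ind \<noteq> {0}" using ext_in[OF v(1)] by auto
    fix W assume W: "W \<subseteq> rspace Ind \<and> FV.subspace W \<and> (\<forall>h\<in>K. \<forall>v\<in>W. ract Ind h v \<in> W)"
    show "W = {0} \<or> W = rspace Ind"
    proof (cases "W = {0}")
      case False
      then obtain f where f: "f \<in> W" "f \<noteq> 0" using W FV.subspace_0 by blast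
      then obtain x where x: "f x \<noteq> 0" by (auto simp: fun_eq_iff)
      then have xK: "x \<in> K" using IndD(1)[of f x] f W by blast
      have "ract Ind x f \<in> W" "ract Ind x f (mat 1) \<noteq> 0" using W f xK x by (auto simp: Ind_ract)
      then have "W = rspace Ind"
        using full_of_eigen[of W "ract Ind x f" M ch UNIV] W irr M D by blast
      then show ?thesis ..
    qed simp
  qed
qed

text \<open>Frobenius reciprocity made explicit. The map T attached to f0 is injective because its
  source is irreducible and f0 is nonzero, and its image contains f0, so
  \<open>full_of_eigen\<close> makes it surjective.\<close>

lemma iso_of_eigenvector:
  fixes \<Psi> :: "'e ^ 2 ^ 2 \<Rightarrow> complex"
  assumes B: "ind_data S B (char_rep \<Psi>) n1" "irreducible_rep S K (smooth_Ind S K B (char_rep \<Psi>))"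
    and irr: "irr J R"
    and f0: "f0 \<in> rspace Ind" "\<And>x b. x \<in> K \<Longrightarrow> b \<in> B \<Longrightarrow> f0 (x ** b) = rscale R (\<Psi> b) (f0 x)" "f0 (mat 1) \<noteq> 0"
    and M: "mat_subgroup M" "M \<subseteq> J" "\<And>m v. m \<in> M \<Longrightarrow> v \<in> rspace R \<Longrightarrow> ract R m v = rscale R (ch m) v"
    and D: "\<And>x. x \<in> K \<Longrightarrow> f0 x \<noteq> 0 \<Longrightarrow> x \<in> D" "\<And>x m. x \<in> K \<Longrightarrow> m \<in> M \<Longrightarrow> x ** m \<in> D \<Longrightarrow> x \<in> D"
      "\<And>x. x \<in> K \<Longrightarrow> x \<in> D \<Longrightarrow> x \<notin> J \<Longrightarrow> \<exists>m\<in>M. x ** m ** matrix_inv x \<in> M \<and> ch (x ** m ** matrix_inv x) \<noteq> ch m"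
  shows "rep_iso K (smooth_Ind S K B (char_rep \<Psi>)) Ind"
proof -
  interpret B: ind_data S B "char_rep \<Psi>" n1 by fact
  have bs: "mat_subgroup B" "B \<subseteq> K" "B \<subseteq> G" using B.subgroup_J B.J_sub B.J_G by auto
  have ract: "ract (char_rep \<Psi>) b z = \<Psi> b * z" "rspace (char_rep \<Psi>) = UNIV" "rscale (char_rep \<Psi>) = (*)" for b z
    by (simp_all add: char_rep_def)
  have Psi1: "\<Psi> (mat 1) = 1" using B.ract_one[of 1] by (simp add: ract)
  have Psim: "\<Psi> (a ** b) = \<Psi> a * \<Psi> b" if "a \<in> B" "b \<in> B" for a b
    using B.ract_mult[of a b 1] that by (simp add: ract)
  have Psii: "\<Psi> (matrix_inv b) * \<Psi> b = 1" if "b \<in> B" for b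
    using Psim[OF subgroup_inv[OF bs(1) that] that] bs that Psi1 by auto
  \<comment> \<open>T F is the convolution of F with f0, summed over the cosets of \<open>B\<close>;
    the factor F at the inverse of p cancels the character by which f0 transforms under
    \<open>B\<close>.\<close>
  define h where "h F x p = rscale R (F (matrix_inv p)) (f0 (x ** p))" for F :: "'e ^ 2 ^ 2 \<Rightarrow> complex" and x p
  define T where "T F x = csum K B (h F x)" for F x
  have hinv: "h F x (p ** b) = h F x p" if F: "F \<in> rspace B.Ind" and p: "p \<in> K" and b: "b \<in> B" and x: "x \<in> K" for F x p b
  proof -
    have "F (matrix_inv b ** matrix_inv p) = \<Psi> (matrix_inv b) * F (matrix_inv p)"
      using B.IndD(3)[OF F subgroup_inv[OF bs(1) b] subgroup_inv[OF subgroup_K p]] by (simp add: ract)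
    moreover have "f0 (x ** p ** b) = rscale R (\<Psi> b) (f0 (x ** p))"
      using f0(2)[OF subgroup_mult[OF subgroup_K x p] b] .
    moreover have "\<Psi> (matrix_inv b) * F (matrix_inv p) * \<Psi> b = F (matrix_inv p)"
      using Psii[OF b] by (simp add: mult.assoc mult.left_commute[of _ "F (matrix_inv p)"])
    ultimately show ?thesis using KE[OF p] bs b by (auto simp: h_def gassoc)
  qed
  have h0: "T F x = 0" if "x \<notin> K" for F x
  proof -
    have "h F x p = 0" if p: "p \<in> K" for p
    proof -
      have "x ** p \<notin> K"
        using \<open>x \<notin> K\<close> subgroup_mult[OF subgroup_K _ subgroup_inv[OF subgroup_K p], of "x ** p"] KE[OF p]
        by (auto simp: gassoc)
      then show ?thesis using IndD(1)[OF f0(1)] by (simp add: h_def)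
    qed
    then have "T F x = csum K B (\<lambda>_. 0)" unfolding T_def by (intro csum_cong[OF bs(1,2) subgroup_K])
    then show ?thesis by (simp add: csum_def)
  qed
  have eqv: "T (ract B.Ind k F) = ract Ind k (T F)" if F: "F \<in> rspace B.Ind" and k: "k \<in> K" for F k
  proof
    fix x
    show "T (ract B.Ind k F) x = ract Ind k (T F) x"
    proof (cases "x \<in> K")
      case True
      have xk: "x ** k \<in> K" by (rule subgroup_mult[OF subgroup_K True k])
      have "T (ract B.Ind k F) x = csum K B (\<lambda>p. h F (x ** k) (matrix_inv k ** p))" unfolding T_def
      proof (rule csum_cong[OF bs(1,2) subgroup_K])
        fix p assume "p \<in> K"
        then show "h (ract B.Ind k F) x p = h F (x ** k) (matrix_inv k ** p)"
          using KE[OF k] KE[of p] by (simp add: h_def B.Ind_ract gassoc)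
      qed
      also have "\<dots> = T F (x ** k)" unfolding T_def
        by (rule csum_shift[OF subgroup_K K_subset bs(1,2) hinv[OF F _ _ xk] subgroup_inv[OF subgroup_K k]])
      finally show ?thesis by (simp add: Ind_ract)
    next
      case False
      have "x ** k \<notin> K"
        using False subgroup_mult[OF subgroup_K _ subgroup_inv[OF subgroup_K k], of "x ** k"] KE[OF k]
        by (auto simp: gassoc)
      then show ?thesis using h0 False by (simp add: Ind_ract)
    qed
  qed
  have add: "T (F + F') = T F + T F'" for F F'
    by (rule ext) (simp add: T_def h_def csum_def V.scale_left_distrib sum.distrib)
  have scale: "T (rscale B.Ind c F) = rscale Ind c (T F)" for c F
    by (rule ext) (simp add: T_def h_def csum_def V.scale_sum_right B.Ind_rscale Ind_rscale ract)
  have T_in: "T F \<in> rspace Ind" if F: "F \<in> rspace B.Ind" for F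
    unfolding Ind_iff'
  proof (intro conjI allI ballI impI)
    fix x assume "x \<notin> K" then show "T F x = 0" by (rule h0)
  next
    fix x show "T F x \<in> rspace R" unfolding T_def csum_def h_def
      using V.subspace_scale[OF Rsub Ind_val[OF f0(1)]] by (intro V.subspace_sum[OF Rsub])
  next
    fix j x assume j: "j \<in> J" and x: "x \<in> K"
    have "ract R j (T F x) = csum K B (\<lambda>p. ract R j (h F x p))" unfolding T_def csum_def
      by (rule ract_sum[OF j]) (auto simp: h_def intro!: V.subspace_scale[OF Rsub] Ind_val[OF f0(1)])
    also have "\<dots> = csum K B (h F (j ** x))"
    proof (rule csum_cong[OF bs(1,2) subgroup_K])
      fix p assume "p \<in> K"
      then show "ract R j (h F x p) = h F (j ** x) p"
        using ract_scale[OF j Ind_val[OF f0(1)]] IndD(3)[OF f0(1) j subgroup_mult[OF subgroup_K x], of p]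
        by (simp add: h_def gassoc)
    qed
    finally show "T F (j ** x) = ract R j (T F x)" by (simp add: T_def)
  next
    obtain n where n: "n > 0" "\<And>u. u\<in>K \<inter> Gyr S 0 n \<Longrightarrow> ract B.Ind u F = F"
      using B.Ind_smooth F unfolding smooth_rep_iff[OF subgroup_K K_subset] srep_def by blast
    show "\<exists>n>0. \<forall>x\<in>K. \<forall>u\<in>Gyr S 0 n. T F (x ** u) = T F x"
    proof (intro exI[of _ n] conjI ballI)
      fix x u assume x: "x \<in> K" and u: "u \<in> Gyr S 0 n"
      have uK: "u \<in> K" using u Gyr0_subset_K[of n] n by auto
      show "T F (x ** u) = T F x" using eqv[OF F uK] n(2)[of u] u uK by (simp add: Ind_ract fun_eq_iff)
    qed (rule n)
  qed
  have e1: "B.ext 1 \<in> rspace B.Ind" by (rule B.ext_in) (simp add: ract)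
  \<comment> \<open>The function supported on \<open>B\<close> with value 1 at the identity plays
    the role of a delta function, so T is not zero and f0 lies in its image.\<close>
  have Te1: "T (B.ext 1) = f0"
  proof
    fix x
    show "T (B.ext 1) x = f0 x"
    proof (cases "x \<in> K")
      case True
      have "T (B.ext 1) x = h (B.ext 1) x (mat 1)" unfolding T_def
      proof (rule csum_one[OF subgroup_K K_subset bs(1,2) hinv[OF e1 _ _ True] _ B.fin_KJ])
        fix m assume "m \<in> K" "m \<notin> B"
        then have "matrix_inv m \<notin> B" using subgroup_inv[OF bs(1), of "matrix_inv m"] KE by auto
        then show "h (B.ext 1) x m = 0" by (simp add: h_def B.ext_def)
      qed
      then show ?thesis using subgroup_one[OF bs(1)] by (simp add: h_def B.ext_def ract Psi1)
    qed (simp add: h0 IndD(1)[OF f0(1)])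
  qed
  have Bsub: "B.FV.subspace (rspace B.Ind)" by (rule B.Ind_sub)
  have Tz: "T 0 = 0" using add[of 0 0] by simp
  define N where "N = {F \<in> rspace B.Ind. T F = 0}"
  have "N = {0} \<or> N = rspace B.Ind"
  proof (rule B(2)[unfolded irreducible_rep_iff irr_def, THEN conjunct2, THEN conjunct2, rule_format], intro conjI ballI)
    show "N \<subseteq> rspace B.Ind" by (auto simp: N_def)
    show "B.FV.subspace N" unfolding N_def
      using B.FV.subspace_0[OF Bsub] B.FV.subspace_add[OF Bsub] B.FV.subspace_scale[OF Bsub] Tz
      by (intro B.FV.subspaceI) (auto simp: add scale)
    fix k F assume "k \<in> K" "F \<in> N"
    then show "ract B.Ind k F \<in> N" using eqv[of F k] B.Ind_act[of F k] by (auto simp: N_def Ind_ract fun_eq_iff)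
  qed
  moreover have "B.ext 1 \<notin> N" using Te1 f0(3) by (auto simp: N_def)
  ultimately have N0: "N = {0}" using e1 by blast
  have inj: "inj_on T (rspace B.Ind)"
  proof (rule inj_onI)
    fix F F' assume F: "F \<in> rspace B.Ind" "F' \<in> rspace B.Ind" and eq: "T F = T F'"
    have "T ((F - F') + F') = T (F - F') + T F'" by (rule add)
    then have "T (F - F') = 0" using eq by simp
    then have "F - F' \<in> N" using B.FV.subspace_diff[OF Bsub F] by (simp add: N_def)
    then show "F = F'" using N0 by simp
  qed
  have "T ` rspace B.Ind = rspace Ind"
  proof (rule full_of_eigen[where f = f0 and M = M and ch = ch and D = D, OF _ _ _ irr _ f0(3) M D])
    show "T ` rspace B.Ind \<subseteq> rspace Ind" using T_in by blast
    show "FV.subspace (T ` rspace B.Ind)"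
    proof (rule FV.subspaceI)
      show "0 \<in> T ` rspace B.Ind" using Tz B.FV.subspace_0[OF Bsub] by force
    next
      fix a b assume "a \<in> T ` rspace B.Ind" "b \<in> T ` rspace B.Ind"
      then obtain F F' where F: "F \<in> rspace B.Ind" "F' \<in> rspace B.Ind" "a = T F" "b = T F'" by blast
      then have "a + b = T (F + F')" by (simp add: add)
      then show "a + b \<in> T ` rspace B.Ind" using B.FV.subspace_add[OF Bsub F(1,2)] by blast
    next
      fix c a assume "a \<in> T ` rspace B.Ind"
      then obtain F where F: "F \<in> rspace B.Ind" "a = T F" by blast
      then have "rscale Ind c a = T (rscale B.Ind c F)" by (simp add: scale)
      then show "rscale Ind c a \<in> T ` rspace B.Ind" using B.FV.subspace_scale[OF Bsub F(1)] by blast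
    qed
    fix g f assume g: "g \<in> K" and "f \<in> T ` rspace B.Ind"
    then obtain F where F: "F \<in> rspace B.Ind" "f = T F" by blast
    then have "ract Ind g f = T (ract B.Ind g F)" using eqv[OF F(1) g] by simp
    then show "ract Ind g f \<in> T ` rspace B.Ind" using B.Ind_act[OF F(1) g] by blast
  next
    show "f0 \<in> T ` rspace B.Ind" using e1 Te1 by blast
  qed
  then have "bij_betw T (rspace B.Ind) (rspace Ind)" using inj by (simp add: bij_betw_def)
  then show ?thesis unfolding rep_iso_def using add scale eqv by blast
qed

end

subsection \<open>Isomorphisms of direct sums\<close>

lemma rep_iso_trans: assumes "rep_iso H A B" "rep_iso H B C" shows "rep_iso H A C"
proof -
  obtain T where T: "bij_betw T (rspace A) (rspace B)"
    "\<forall>v\<in>rspace A. \<forall>w\<in>rspace A. T (v + w) = T v + T w"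
    "\<forall>c. \<forall>v\<in>rspace A. T (rscale A c v) = rscale B c (T v)"
    "\<forall>h\<in>H. \<forall>v\<in>rspace A. T (ract A h v) = ract B h (T v)" using assms(1) unfolding rep_iso_def by blast
  obtain U where U: "bij_betw U (rspace B) (rspace C)"
    "\<forall>v\<in>rspace B. \<forall>w\<in>rspace B. U (v + w) = U v + U w"
    "\<forall>c. \<forall>v\<in>rspace B. U (rscale B c v) = rscale C c (U v)"
    "\<forall>h\<in>H. \<forall>v\<in>rspace B. U (ract B h v) = ract C h (U v)" using assms(2) unfolding rep_iso_def by blast
  have "T v \<in> rspace B" if "v \<in> rspace A" for v using T(1) that by (auto simp: bij_betw_def)
  then show ?thesis unfolding rep_iso_def using T U bij_betw_trans[OF T(1) U(1)]
    by (intro exI[of _ "U \<circ> T"]) simp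
qed

lemma rep_iso_sym: assumes "rep_iso H A B" "is_rep H mul e A" shows "rep_iso H B A"
proof -
  obtain T where T: "bij_betw T (rspace A) (rspace B)"
    "\<And>v w. v\<in>rspace A \<Longrightarrow> w\<in>rspace A \<Longrightarrow> T (v + w) = T v + T w"
    "\<And>c v. v\<in>rspace A \<Longrightarrow> T (rscale A c v) = rscale B c (T v)"
    "\<And>h v. h\<in>H \<Longrightarrow> v\<in>rspace A \<Longrightarrow> T (ract A h v) = ract B h (T v)" using assms(1) unfolding rep_iso_def by blast
  interpret V: vector_space "rscale A" using assms(2) by (simp add: is_rep_def)
  have sub: "V.subspace (rspace A)" and act: "\<And>h v. h \<in> H \<Longrightarrow> v \<in> rspace A \<Longrightarrow> ract A h v \<in> rspace A"
    using assms(2) by (auto simp: is_rep_def)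
  define U where "U = inv_into (rspace A) T"
  have UT: "U (T v) = v" if "v \<in> rspace A" for v using T(1) that by (simp add: U_def bij_betw_def)
  have B: "\<exists>v\<in>rspace A. w = T v" if "w \<in> rspace B" for w using T(1) that by (auto simp: bij_betw_def)
  have "bij_betw U (rspace B) (rspace A)" unfolding U_def by (rule bij_betw_inv_into[OF T(1)])
  moreover have "U (v + w) = U v + U w" if "v \<in> rspace B" "w \<in> rspace B" for v w
    using B[OF that(1)] B[OF that(2)] UT T(2) V.subspace_add[OF sub] by metis
  moreover have "U (rscale B c v) = rscale A c (U v)" if "v \<in> rspace B" for c v
    using B[OF that] UT T(3) V.subspace_scale[OF sub] by metis
  moreover have "U (ract B h v) = ract A h (U v)" if "v \<in> rspace B" "h \<in> H" for h v
    using B[OF that(1)] UT T(4)[OF that(2)] act[OF that(2)] by metis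
  ultimately show ?thesis unfolding rep_iso_def by blast
qed

lemma rep_iso_refl: "rep_iso H A A"
  unfolding rep_iso_def by (rule exI[of _ id]) simp

lemma rep_iso_sum: assumes "rep_iso H A A'" "rep_iso H B B'"
  shows "rep_iso H (rep_sum A B) (rep_sum A' B')"
proof -
  obtain T where T: "bij_betw T (rspace A) (rspace A')"
    "\<forall>v\<in>rspace A. \<forall>w\<in>rspace A. T (v + w) = T v + T w"
    "\<forall>c. \<forall>v\<in>rspace A. T (rscale A c v) = rscale A' c (T v)"
    "\<forall>h\<in>H. \<forall>v\<in>rspace A. T (ract A h v) = ract A' h (T v)" using assms(1) unfolding rep_iso_def by blast
  obtain U where U: "bij_betw U (rspace B) (rspace B')"
    "\<forall>v\<in>rspace B. \<forall>w\<in>rspace B. U (v + w) = U v + U w"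
    "\<forall>c. \<forall>v\<in>rspace B. U (rscale B c v) = rscale B' c (U v)"
    "\<forall>h\<in>H. \<forall>v\<in>rspace B. U (ract B h v) = ract B' h (U v)" using assms(2) unfolding rep_iso_def by blast
  have "bij_betw (map_prod T U) (rspace A \<times> rspace B) (rspace A' \<times> rspace B')"
  proof -
    have "map_prod T U ` (rspace A \<times> rspace B) = (T ` rspace A) \<times> (U ` rspace B)"
    proof (intro set_eqI iffI)
      fix p assume "p \<in> (T ` rspace A) \<times> (U ` rspace B)"
      then obtain a b where "a \<in> rspace A" "b \<in> rspace B" "p = map_prod T U (a, b)" by auto
      then show "p \<in> map_prod T U ` (rspace A \<times> rspace B)" by blast
    qed auto
    then show ?thesis using T(1) U(1) by (auto simp: bij_betw_def intro: map_prod_inj_on)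
  qed
  then show ?thesis unfolding rep_iso_def rep_sum_def using T U
    by (intro exI[of _ "map_prod T U"]) auto
qed

text \<open>\<open>rep_dsum\<close> scales also the components outside \<open>I\<close>; they are 0,
  and the condition on \<open>rscale (B i) c 0\<close> keeps them equal to 0.\<close>

lemma rep_iso_dsum:
  assumes iso: "\<And>i. i \<in> I \<Longrightarrow> rep_iso H (A i) (B i)"
    and zero: "\<And>i. i \<in> I \<Longrightarrow> 0 \<in> rspace (A i)" "\<And>i c. rscale (A i) c 0 = 0" "\<And>i c. rscale (B i) c 0 = 0"
  shows "rep_iso H (rep_dsum I A) (rep_dsum I B)"
proof -
  obtain T where T: "\<And>i. i \<in> I \<Longrightarrow> bij_betw (T i) (rspace (A i)) (rspace (B i))"
    "\<And>i v w. i \<in> I \<Longrightarrow> v\<in>rspace (A i) \<Longrightarrow> w\<in>rspace (A i) \<Longrightarrow> T i (v + w) = T i v + T i w"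
    "\<And>i c v. i \<in> I \<Longrightarrow> v\<in>rspace (A i) \<Longrightarrow> T i (rscale (A i) c v) = rscale (B i) c (T i v)"
    "\<And>i h v. i \<in> I \<Longrightarrow> h\<in>H \<Longrightarrow> v\<in>rspace (A i) \<Longrightarrow> T i (ract (A i) h v) = ract (B i) h (T i v)"
  proof -
    have "\<forall>i\<in>I. \<exists>T. bij_betw T (rspace (A i)) (rspace (B i)) \<and>
       (\<forall>v\<in>rspace (A i). \<forall>w\<in>rspace (A i). T (v + w) = T v + T w) \<and>
       (\<forall>c. \<forall>v\<in>rspace (A i). T (rscale (A i) c v) = rscale (B i) c (T v)) \<and>
       (\<forall>h\<in>H. \<forall>v\<in>rspace (A i). T (ract (A i) h v) = ract (B i) h (T v))"
      using iso unfolding rep_iso_def by blast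
    from bchoice[OF this] show thesis by (elim exE, intro that) blast+
  qed
  have T0: "T i 0 = 0" if "i \<in> I" for i using T(2)[OF that zero(1)[OF that] zero(1)[OF that]] by simp
  have Tin: "T i v \<in> rspace (B i)" if "i \<in> I" "v \<in> rspace (A i)" for i v
    using T(1)[OF that(1)] that(2) by (auto simp: bij_betw_def)
  have Tinj: "v = w" if "i \<in> I" "v \<in> rspace (A i)" "w \<in> rspace (A i)" "T i v = T i w" for i v w
    using T(1)[OF that(1)] that by (auto simp: bij_betw_def inj_on_def)
  define P where "P x i = (if i \<in> I then T i (x i) else 0)" for x i
  have "bij_betw P (rspace (rep_dsum I A)) (rspace (rep_dsum I B))"
  proof (rule bij_betwI')
    fix x y assume x: "x \<in> rspace (rep_dsum I A)" and y: "y \<in> rspace (rep_dsum I A)"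
    show "P x = P y \<longleftrightarrow> x = y"
    proof
      assume eq: "P x = P y"
      show "x = y"
      proof
        fix i show "x i = y i"
        proof (cases "i \<in> I")
          case True
          then have "T i (x i) = T i (y i)" using fun_cong[OF eq, of i] by (simp add: P_def)
          then show ?thesis using Tinj[OF True] x y True by (simp add: rep_dsum_def)
        qed (use x y in \<open>simp add: rep_dsum_def\<close>)
      qed
    qed simp
  next
    fix x assume x: "x \<in> rspace (rep_dsum I A)"
    have "{i. P x i \<noteq> 0} \<subseteq> {i. x i \<noteq> 0}" using T0 by (auto simp: P_def)
    then have "finite {i. P x i \<noteq> 0}" by (rule finite_subset) (use x in \<open>simp add: rep_dsum_def\<close>)
    moreover have "\<forall>i\<in>I. P x i \<in> rspace (B i)" using x Tin by (simp add: rep_dsum_def P_def)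
    moreover have "\<forall>i. i \<notin> I \<longrightarrow> P x i = 0" by (simp add: P_def)
    ultimately show "P x \<in> rspace (rep_dsum I B)" by (simp add: rep_dsum_def)
  next
    fix y assume y: "y \<in> rspace (rep_dsum I B)"
    define x where "x i = (if i \<in> I then inv_into (rspace (A i)) (T i) (y i) else 0)" for i
    have yi: "y i \<in> T i ` rspace (A i)" if "i \<in> I" for i
      using y T(1)[OF that] that by (simp add: rep_dsum_def bij_betw_def)
    have xi: "x i \<in> rspace (A i)" "T i (x i) = y i" if "i \<in> I" for i
      using inv_into_into[OF yi[OF that]] f_inv_into_f[OF yi[OF that]] that by (simp_all add: x_def)
    have "{i. x i \<noteq> 0} \<subseteq> {i. y i \<noteq> 0}"
    proof
      fix i assume "i \<in> {i. x i \<noteq> 0}"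
      then have i: "i \<in> I" "x i \<noteq> 0" by (auto simp: x_def split: if_splits)
      then show "i \<in> {i. y i \<noteq> 0}" using xi[OF i(1)] Tinj[OF i(1) _ zero(1)[OF i(1)]] T0[OF i(1)] by auto
    qed
    then have "finite {i. x i \<noteq> 0}" by (rule finite_subset) (use y in \<open>simp add: rep_dsum_def\<close>)
    moreover have "\<forall>i. i \<notin> I \<longrightarrow> x i = 0" by (simp add: x_def)
    ultimately have "x \<in> rspace (rep_dsum I A)" using xi by (simp add: rep_dsum_def)
    moreover have "y = P x" using y xi by (auto simp: P_def fun_eq_iff rep_dsum_def)
    ultimately show "\<exists>x\<in>rspace (rep_dsum I A). y = P x" by blast
  qed
  then show ?thesis unfolding rep_iso_def using T zero(3)
    by (intro exI[of _ P]) (auto simp: rep_dsum_def P_def fun_eq_iff)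
qed

lemma rep_dsum_atLeast:
  fixes A :: "int \<Rightarrow> ('g, 'v::ab_group_add) rep"
  assumes zero: "\<And>i c. rscale (A i) c 0 = 0"
  shows "rep_iso H (rep_dsum {0..} A) (rep_sum (A 0) (rep_dsum {0<..} A))"
proof -
  define P where "P x = (x 0, \<lambda>i. if 0 < i then x i else 0)" for x :: "int \<Rightarrow> 'v"
  define Q where "Q p i = (if i = 0 then fst p else snd p i)" for p :: "'v \<times> (int \<Rightarrow> 'v)" and i
  have "bij_betw P (rspace (rep_dsum {0..} A)) (rspace (rep_sum (A 0) (rep_dsum {0<..} A)))"
  proof (rule bij_betw_byWitness[where f' = Q])
    show "\<forall>x\<in>rspace (rep_dsum {0..} A). Q (P x) = x"
      by (auto simp: P_def Q_def rep_dsum_def fun_eq_iff)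
    show "\<forall>p\<in>rspace (rep_sum (A 0) (rep_dsum {0<..} A)). P (Q p) = p"
      by (auto simp: P_def Q_def rep_dsum_def rep_sum_def fun_eq_iff)
    have "finite {i::int. (if 0 < i then x i else 0) \<noteq> 0}" if "finite {i. x i \<noteq> 0}" for x :: "int \<Rightarrow> 'v"
      by (rule finite_subset[OF _ that]) auto
    then show "P ` rspace (rep_dsum {0..} A) \<subseteq> rspace (rep_sum (A 0) (rep_dsum {0<..} A))"
      by (auto simp: P_def rep_dsum_def rep_sum_def)
    have "finite {i::int. Q (v, x) i \<noteq> 0}" if "finite {i. x i \<noteq> 0}" for v x
      by (rule finite_subset[of _ "insert 0 {i. x i \<noteq> 0}"]) (use that in \<open>auto simp: Q_def\<close>)
    then show "Q ` rspace (rep_sum (A 0) (rep_dsum {0<..} A)) \<subseteq> rspace (rep_dsum {0..} A)"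
      by (auto simp: rep_dsum_def rep_sum_def) (auto simp: Q_def)
  qed
  then show ?thesis unfolding rep_iso_def
    by (intro exI[of _ P]) (auto simp: P_def rep_dsum_def rep_sum_def fun_eq_iff zero)
qed

text \<open>Folds the integers at 0, index -t supplying the second partner of t. The two families of
  double cosets of the ramified case can so be handled as one family over the integers.\<close>

lemma rep_dsum_UNIV:
  fixes A :: "int \<Rightarrow> ('g, 'v::ab_group_add) rep"
  assumes zero: "\<And>i c. rscale (A i) c 0 = 0"
  shows "rep_iso H (rep_dsum UNIV A) (rep_sum (A 0) (rep_dsum {0<..} (\<lambda>t. rep_sum (A t) (A (- t)))))"
proof -
  let ?B = "rep_sum (A 0) (rep_dsum {0<..} (\<lambda>t. rep_sum (A t) (A (- t))))"
  define P where "P x = (x 0, \<lambda>i. if 0 < i then (x i, x (- i)) else 0)" for x :: "int \<Rightarrow> 'v"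
  define Q where "Q p i = (if i = 0 then fst p else if 0 < i then fst (snd p i) else snd (snd p (- i)))"
    for p :: "'v \<times> (int \<Rightarrow> 'v \<times> 'v)" and i
  have "bij_betw P (rspace (rep_dsum UNIV A)) (rspace ?B)"
  proof (rule bij_betw_byWitness[where f' = Q])
    show "\<forall>x\<in>rspace (rep_dsum UNIV A). Q (P x) = x"
      by (auto simp: P_def Q_def rep_dsum_def fun_eq_iff)
    show "\<forall>p\<in>rspace ?B. P (Q p) = p"
      by (auto simp: P_def Q_def rep_dsum_def rep_sum_def fun_eq_iff)
    have "finite {i::int. (if 0 < i then (x i, x (- i)) else 0) \<noteq> 0}" if f: "finite {i. x i \<noteq> 0}" for x :: "int \<Rightarrow> 'v"
    proof (rule finite_subset)
      show "{i::int. (if 0 < i then (x i, x (- i)) else 0) \<noteq> 0} \<subseteq> {i. x i \<noteq> 0} \<union> uminus ` {i. x i \<noteq> 0}"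
        by (force simp: zero_prod_def image_iff split: if_splits)
    qed (use f in simp)
    then show "P ` rspace (rep_dsum UNIV A) \<subseteq> rspace ?B"
      by (auto simp: P_def rep_dsum_def rep_sum_def)
    have "finite {i::int. Q (v, x) i \<noteq> 0}" if f: "finite {i. x i \<noteq> 0}" for v x
    proof (rule finite_subset)
      show "{i. Q (v, x) i \<noteq> 0} \<subseteq> insert 0 ({i. x i \<noteq> 0} \<union> uminus ` {i. x i \<noteq> 0})"
      proof
        fix i assume i: "i \<in> {i. Q (v, x) i \<noteq> 0}"
        consider "i = 0" | "0 < i" | "i < 0" by linarith
        then show "i \<in> insert 0 ({i. x i \<noteq> 0} \<union> uminus ` {i. x i \<noteq> 0})"
        proof cases
          case 2
          then have "x i \<noteq> 0" using i by (auto simp: Q_def)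
          then show ?thesis by simp
        next
          case 3
          then have "x (- i) \<noteq> 0" using i by (auto simp: Q_def)
          then have "- (- i) \<in> uminus ` {i. x i \<noteq> 0}" by blast
          then show ?thesis by simp
        qed simp
      qed
    qed (use f in simp)
    moreover have "Q p i \<in> rspace (A i)" if p: "p \<in> rspace ?B" for p i
    proof -
      have s: "0 < j \<Longrightarrow> fst (snd p j) \<in> rspace (A j) \<and> snd (snd p j) \<in> rspace (A (- j))" for j
        using p by (simp add: rep_dsum_def rep_sum_def mem_Times_iff)
      show ?thesis using s[of i] s[of "- i"] p by (auto simp: Q_def rep_sum_def)
    qed
    ultimately show "Q ` rspace ?B \<subseteq> rspace (rep_dsum UNIV A)"
      unfolding rep_dsum_def by (auto simp: rep_sum_def)
  qed
  then show ?thesis unfolding rep_iso_def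
    by (intro exI[of _ P]) (auto simp: P_def rep_dsum_def rep_sum_def fun_eq_iff zero zero_prod_def)
qed

subsection \<open>Mackey decomposition\<close>

context u11 begin

definition crep :: "'e ^ 2 ^ 2 \<Rightarrow> ('e ^ 2 ^ 2, 'v::ab_group_add) rep \<Rightarrow> ('e ^ 2 ^ 2, 'v) rep" where
  "crep g R = R\<lparr>ract := \<lambda>x. ract R (matrix_inv g ** x ** g)\<rparr>"

lemma crep_simps [simp]: "rscale (crep g R) = rscale R" "rspace (crep g R) = rspace R"
  "ract (crep g R) x = ract R (matrix_inv g ** x ** g)"
  by (simp_all add: crep_def)

lemma open_coset: assumes x: "x \<in> G"
  obtains O' where "openin (mat_top S) O'" "x \<in> O'" "\<And>y. y \<in> O' \<Longrightarrow> y \<in> G \<Longrightarrow> matrix_inv x ** y \<in> K"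
proof -
  obtain m where m: "m \<ge> 0" "\<And>X r. X \<in> L 0 r \<Longrightarrow> matrix_inv x ** X \<in> L 0 (r - m)"
    using near_mult[of "matrix_inv x"] by metis
  define O' where "O' = {y. y - x \<in> L 0 (m + 1)}"
  have "openin (subtopology (mat_top S) UNIV) O'" unfolding openin_sub_iff
  proof (intro conjI ballI)
    fix y assume y: "y \<in> O'"
    show "\<exists>n>0. \<forall>z\<in>UNIV. z - y \<in> L 0 n \<longrightarrow> z \<in> O'"
    proof (intro exI[of _ "m + 1"] conjI ballI impI)
      fix z assume "z - y \<in> L 0 (m + 1)"
      then have "(z - y) + (y - x) \<in> L 0 (m + 1)" using y by (intro L_add) (auto simp: O'_def)
      then show "z \<in> O'" by (simp add: O'_def)
    qed (use m in simp)
  qed simp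
  then have "openin (mat_top S) O'" by simp
  moreover have "x \<in> O'" by (simp add: O'_def)
  moreover have "matrix_inv x ** y \<in> K" if y: "y \<in> O'" "y \<in> G" for y
  proof -
    have e: "matrix_inv x ** y - mat 1 = matrix_inv x ** (y - x)" using x by (simp add: matrix_diff_ldistrib)
    have "matrix_inv x ** (y - x) \<in> L 0 0" using L_mono[OF m(2)[of "y - x" "m + 1"]] y by (simp add: O'_def)
    then show ?thesis unfolding K_eq Gyr_iff e using x y by simp
  qed
  ultimately show ?thesis by (rule that)
qed

lemma topspace_mat_top [simp]: "topspace (mat_top S) = UNIV"
proof -
  have "openin (mat_top S) UNIV" by (simp add: openin_mat_top)
  then show ?thesis using openin_subset by blast
qed

text \<open>The cosets of \<open>K\<close> in \<open>G\<close> are relatively open by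
  \<open>open_coset\<close>, so a compact set meets finitely many. This turns compact support into
  finite support over double cosets.\<close>

lemma compact_coset_cover:
  assumes "compactin (mat_top S) C" "C \<subseteq> G"
  obtains X where "finite X" "X \<subseteq> G" "\<And>c. c \<in> C \<Longrightarrow> \<exists>x\<in>X. matrix_inv x ** c \<in> K"
proof -
  have "\<forall>x\<in>G. \<exists>O'. openin (mat_top S) O' \<and> x \<in> O' \<and> (\<forall>y\<in>O' \<inter> G. matrix_inv x ** y \<in> K)"
    by (meson IntE open_coset)
  from bchoice[OF this] obtain N
    where N: "\<And>x. x \<in> G \<Longrightarrow> openin (mat_top S) (N x) \<and> x \<in> N x \<and> (\<forall>y\<in>N x \<inter> G. matrix_inv x ** y \<in> K)"
    by blast
  have "C \<subseteq> \<Union>(N ` C)" "\<forall>U\<in>N ` C. openin (mat_top S) U" using N assms(2) by auto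
  then obtain F where F: "finite F" "F \<subseteq> N ` C" "C \<subseteq> \<Union>F"
    using assms(1) unfolding compactin_def by meson
  obtain X where X: "X \<subseteq> C" "finite X" "F = N ` X" using finite_subset_image[OF F(1,2)] by blast
  show ?thesis
  proof (rule that[of X])
    fix c assume c: "c \<in> C"
    then obtain x where "x \<in> X" "c \<in> N x" using F(3) X(3) by auto
    then show "\<exists>x\<in>X. matrix_inv x ** c \<in> K" using N[of x] X(1) assms(2) c by blast
  qed (use X assms in auto)
qed

text \<open>A function on \<open>G\<close> is the family of its restrictions to the double cosets;
  the component at i is read along the inverse of g i times \<open>K\<close>. Compact support modulo
  \<open>J\<close> means that finitely many components are nonzero, which is why a direct sum and
  not a product appears.\<close>

lemma mackey:
  fixes R :: "('e ^ 2 ^ 2, 'v::ab_group_add) rep" and g :: "'i \<Rightarrow> 'e ^ 2 ^ 2"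
  assumes J: "mat_subgroup J" "J \<subseteq> G" "n0 > 0" "Gyr S 0 n0 \<subseteq> J" and R: "is_rep J (**) (mat 1) R"
    and g: "\<And>i. i \<in> I \<Longrightarrow> g i \<in> G"
    and ex: "\<And>x. x \<in> G \<Longrightarrow> \<exists>i\<in>I. \<exists>j\<in>J. \<exists>k\<in>K. x = j ** matrix_inv (g i) ** k"
    and uniq: "\<And>i i' j k j' k'. i \<in> I \<Longrightarrow> i' \<in> I \<Longrightarrow> j \<in> J \<Longrightarrow> k \<in> K \<Longrightarrow> j' \<in> J \<Longrightarrow> k' \<in> K \<Longrightarrow>
      j ** matrix_inv (g i) ** k = j' ** matrix_inv (g i') ** k' \<Longrightarrow> i = i'"
  shows "rep_iso K (compact_Ind S G J R) (rep_dsum I (\<lambda>i. smooth_Ind S K (K \<inter> mconj (g i) ` J) (crep (g i) R)))"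
proof -
  interpret V: vector_space "rscale R" using R by (simp add: is_rep_def)
  have Rsub: "V.subspace (rspace R)" and ract_in: "\<And>h v. h \<in> J \<Longrightarrow> v \<in> rspace R \<Longrightarrow> ract R h v \<in> rspace R"
    and ract_scale: "\<And>h v c. h \<in> J \<Longrightarrow> v \<in> rspace R \<Longrightarrow> ract R h (rscale R c v) = rscale R c (ract R h v)"
    and ract_one: "\<And>v. v \<in> rspace R \<Longrightarrow> ract R (mat 1) v = v"
    and ract_mult: "\<And>g h v. g \<in> J \<Longrightarrow> h \<in> J \<Longrightarrow> v \<in> rspace R \<Longrightarrow> ract R (g ** h) v = ract R g (ract R h v)"
    using R by (auto simp: is_rep_def)
  have R0: "0 \<in> rspace R" by (rule V.subspace_0[OF Rsub])
  have ract0: "ract R h 0 = 0" if "h \<in> J" for h using ract_scale[OF that R0, of 0] by simp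
  have JG: "j \<in> G" if "j \<in> J" for j using J that by auto
  have KG: "k \<in> G" if "k \<in> K" for k using K_subset that by auto
  define A where "A i = K \<inter> mconj (g i) ` J" for i
  define B where "B i = smooth_Ind S K (A i) (crep (g i) R)" for i
  have IndG: "f \<in> rspace (smooth_Ind S G J R) \<longleftrightarrow> (\<forall>x. x \<notin> G \<longrightarrow> f x = 0) \<and> (\<forall>x\<in>G. f x \<in> rspace R) \<and>
    (\<forall>h\<in>J. \<forall>x\<in>G. f (h ** x) = ract R h (f x)) \<and> (\<exists>n>0. \<forall>x\<in>G. \<forall>u\<in>Gyr S 0 n. f (x ** u) = f x)" for f
    by (rule Ind_iff[OF subgroup_G order_refl zero_less_one]) (auto intro: Gyr_G)
  have IndK: "f \<in> rspace (B i) \<longleftrightarrow> (\<forall>x. x \<notin> K \<longrightarrow> f x = 0) \<and> (\<forall>x\<in>K. f x \<in> rspace R) \<and>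
    (\<forall>h\<in>A i. \<forall>x\<in>K. f (h ** x) = ract R (matrix_inv (g i) ** h ** g i) (f x)) \<and> (\<exists>n>0. \<forall>x\<in>K. \<forall>u\<in>Gyr S 0 n. f (x ** u) = f x)" for f i
    unfolding B_def
    by (subst Ind_iff[OF subgroup_K K_subset zero_less_one]) (use Gyr0_subset_K[of 1] in simp_all)
  define P where "P = rspace (compact_Ind S G J R)"
  have P: "f \<in> P \<longleftrightarrow> f \<in> rspace (smooth_Ind S G J R) \<and> (\<exists>C\<subseteq>G. compactin (mat_top S) C \<and> {x. f x \<noteq> 0} \<subseteq> set_prod J C)" for f
    by (simp add: P_def compact_Ind_def)
  have cs: "rscale (compact_Ind S G J R) = (\<lambda>c f x. rscale R c (f x))" "ract (compact_Ind S G J R) = (\<lambda>g f x. f (x ** g))"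
    by (simp_all add: compact_Ind_def smooth_Ind_def)
  have Bs: "rscale (B i) = (\<lambda>c f x. rscale R c (f x))" "ract (B i) = (\<lambda>g f x. f (x ** g))" for i
    by (simp_all add: B_def smooth_Ind_def)
  define T where "T f i = (if i \<in> I then (\<lambda>k. if k \<in> K then f (matrix_inv (g i) ** k) else 0) else 0)" for f :: "'e ^ 2 ^ 2 \<Rightarrow> 'v" and i
  have T1: "T f i \<in> rspace (B i)" if f: "f \<in> rspace (smooth_Ind S G J R)" and i: "i \<in> I" for f i
  proof -
    note gi = g[OF i]
    obtain n where n: "n > 0" "\<And>x u. x\<in>G \<Longrightarrow> u\<in>Gyr S 0 n \<Longrightarrow> f (x ** u) = f x" using f unfolding IndG by blast
    have "T f i (h ** x) = ract R (matrix_inv (g i) ** h ** g i) (T f i x)" if h: "h \<in> A i" and x: "x \<in> K" for h x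
    proof -
      obtain j where j: "j \<in> J" "h = g i ** j ** matrix_inv (g i)" "h \<in> K" using h by (auto simp: A_def mconj_def)
      have e: "matrix_inv (g i) ** h ** g i = j" using gi j by (simp add: gassoc)
      have e2: "matrix_inv (g i) ** (h ** x) = j ** (matrix_inv (g i) ** x)" using gi j by (simp add: gassoc)
      show ?thesis unfolding e using f[unfolded IndG] j(1) x gi KG subgroup_mult[OF subgroup_K j(3) x] i
        by (simp add: T_def e2)
    qed
    moreover have "T f i (x ** u) = T f i x" if "x \<in> K" "u \<in> Gyr S 0 n" for x u
    proof -
      have "u \<in> K" using that(2) Gyr0_subset_K[of n] n(1) by auto
      then show ?thesis using n(2)[of "matrix_inv (g i) ** x" u] that gi KG subgroup_mult[OF subgroup_K that(1)] i
        by (simp add: T_def gassoc)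
    qed
    ultimately have "\<forall>h\<in>A i. \<forall>x\<in>K. T f i (h ** x) = ract R (matrix_inv (g i) ** h ** g i) (T f i x)"
      "\<exists>n>0. \<forall>x\<in>K. \<forall>u\<in>Gyr S 0 n. T f i (x ** u) = T f i x" using n(1) by blast+
    moreover have "\<forall>x. x \<notin> K \<longrightarrow> T f i x = 0" using i by (simp add: T_def)
    moreover have "\<forall>x\<in>K. T f i x \<in> rspace R" using f[unfolded IndG] gi KG i by (simp add: T_def)
    ultimately show ?thesis unfolding IndK by blast
  qed
  have Tin: "T f \<in> rspace (rep_dsum I B)" if f: "f \<in> P" for f
  proof -
    obtain C where C: "C \<subseteq> G" "compactin (mat_top S) C" "{x. f x \<noteq> 0} \<subseteq> set_prod J C" using f P by blast
    obtain X where X: "finite X" "X \<subseteq> G" "\<And>c. c \<in> C \<Longrightarrow> \<exists>x\<in>X. matrix_inv x ** c \<in> K"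
      using compact_coset_cover[OF C(2,1)] by blast
    \<comment> \<open>Each x in X lies in exactly one double coset, and every double coset met by
      the support of f contains some x in X. So the image of the finite set X under
      \<open>idx\<close> contains all indices of nonzero components.\<close>
    define idx where "idx x = (SOME i. i \<in> I \<and> (\<exists>j\<in>J. \<exists>k\<in>K. x = j ** matrix_inv (g i) ** k))" for x
    have "{i. T f i \<noteq> 0} \<subseteq> idx ` X"
    proof
      fix i assume "i \<in> {i. T f i \<noteq> 0}"
      then obtain k where i: "i \<in> I" and k: "k \<in> K" "f (matrix_inv (g i) ** k) \<noteq> 0"
        by (auto simp: T_def fun_eq_iff split: if_splits)
      then obtain j c where j: "j \<in> J" "c \<in> C" "matrix_inv (g i) ** k = j ** c"
        using C(3) by (auto simp: set_prod_def)
      obtain x where x: "x \<in> X" "matrix_inv x ** c \<in> K" using X(3)[OF j(2)] by blast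
      define k' where "k' = matrix_inv x ** c"
      have G: "x \<in> G" "c \<in> G" "j \<in> G" "k \<in> G" using x X j C JG k KG by auto
      have "x = c ** matrix_inv k'" using G by (simp add: k'_def gassoc)
      also have "c = matrix_inv j ** matrix_inv (g i) ** k" using j(3) G by (simp add: gassoc)
      finally have xe: "x = matrix_inv j ** matrix_inv (g i) ** (k ** matrix_inv k')" by (simp add: gassoc)
      have kk: "k ** matrix_inv k' \<in> K" "matrix_inv j \<in> J"
        using subgroup_mult[OF subgroup_K k(1) subgroup_inv[OF subgroup_K]] x(2) subgroup_inv[OF J(1) j(1)] by (auto simp: k'_def)
      have "idx x \<in> I \<and> (\<exists>j\<in>J. \<exists>k\<in>K. x = j ** matrix_inv (g (idx x)) ** k)"
        unfolding idx_def by (rule someI[of _ i]) (use i xe kk in blast)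
      then have "idx x = i" using uniq[OF _ i _ _ kk(2,1)] xe by metis
      then show "i \<in> idx ` X" using x by blast
    qed
    then have "finite {i. T f i \<noteq> 0}" using X(1) finite_surj by blast
    then show ?thesis using T1 f P by (auto simp: rep_dsum_def) (simp add: T_def)
  qed
  have Tinj: "f = f'" if f: "f \<in> P" and f': "f' \<in> P" and eq: "T f = T f'" for f f'
  proof
    fix x
    show "f x = f' x"
    proof (cases "x \<in> G")
      case True
      then obtain i j k where i: "i \<in> I" "j \<in> J" "k \<in> K" "x = j ** matrix_inv (g i) ** k" using ex by blast
      have "f (matrix_inv (g i) ** k) = f' (matrix_inv (g i) ** k)"
        using fun_cong[OF fun_cong[OF eq, of i], of k] i by (simp add: T_def)
      then show ?thesis using f f' i g KG unfolding P IndG by (simp add: gassoc)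
    next
      case False then show ?thesis using f f' unfolding P IndG by simp
    qed
  qed
  have Tsurj: "\<exists>f\<in>P. F = T f" if F: "F \<in> rspace (rep_dsum I B)" for F
  proof -
    have FB: "F i \<in> rspace (B i)" if "i \<in> I" for i using F that by (simp add: rep_dsum_def)
    have F0: "F i = 0" if "i \<notin> I" for i using F that by (simp add: rep_dsum_def)
    have fin: "finite {i. F i \<noteq> 0}" using F by (simp add: rep_dsum_def)
    have Fval: "F i k \<in> rspace R" if "i \<in> I" for i k
      using FB[OF that] R0 unfolding IndK by (cases "k \<in> K") auto
    \<comment> \<open>An arbitrary factorization of x. The next claim shows that the value of f does
      not depend on it.\<close>
    define d where "d x = (SOME (i, j, k). i \<in> I \<and> j \<in> J \<and> k \<in> K \<and> x = j ** matrix_inv (g i) ** k)" for x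
    define f where "f x = (if x \<in> G then case d x of (i, j, k) \<Rightarrow> ract R j (F i k) else 0)" for x
    have fx: "f (j ** matrix_inv (g i) ** k) = ract R j (F i k)" if i: "i \<in> I" "j \<in> J" "k \<in> K" for i j k
    proof -
      define x where "x = j ** matrix_inv (g i) ** k"
      have xG: "x \<in> G" using i g JG KG by (simp add: x_def)
      have "case d x of (i, j, k) \<Rightarrow> i \<in> I \<and> j \<in> J \<and> k \<in> K \<and> x = j ** matrix_inv (g i) ** k"
        unfolding d_def by (rule someI[of _ "(i, j, k)"]) (use i in \<open>simp add: x_def\<close>)
      then obtain i' j' k' where d: "d x = (i', j', k')" "i' \<in> I" "j' \<in> J" "k' \<in> K" "x = j' ** matrix_inv (g i') ** k'"
        by (cases "d x") auto
      have ii: "i' = i" using uniq[OF d(2) i(1) d(3,4) i(2,3)] d(5) x_def by simp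
      have G: "g i \<in> G" "j \<in> G" "j' \<in> G" "k \<in> G" "k' \<in> G" using g i d JG KG by auto
      \<comment> \<open>Two factorizations with the same index differ by this element of
        \<open>A i\<close>, under which F i is equivariant.\<close>
      define h where "h = g i ** (matrix_inv j' ** j) ** matrix_inv (g i)"
      have e: "j ** (matrix_inv (g i) ** k) = j' ** (matrix_inv (g i) ** k')" using d(5) ii x_def by (simp add: gassoc)
      have jj: "matrix_inv j' ** j \<in> J" using subgroup_mult[OF J(1) subgroup_inv[OF J(1) d(3)] i(2)] .
      have hk: "h ** k = k'" using G by (simp add: h_def gassoc e)
      have "h = k' ** matrix_inv k" using hk G by (simp add: h_def gassoc flip: hk)
      then have "h \<in> K" using subgroup_mult[OF subgroup_K d(4) subgroup_inv[OF subgroup_K i(3)]] by simp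
      then have hA: "h \<in> A i" using jj by (auto simp: A_def h_def mconj_def)
      have "matrix_inv (g i) ** h ** g i = matrix_inv j' ** j" using G by (simp add: h_def gassoc)
      then have "F i k' = ract R (matrix_inv j' ** j) (F i k)"
        using FB[OF i(1)] hA i(3) hk unfolding IndK by metis
      then have "ract R j' (F i k') = ract R (j' ** (matrix_inv j' ** j)) (F i k)"
        using ract_mult[OF d(3) jj Fval[OF i(1)]] by simp
      then show ?thesis using xG d ii G by (simp add: f_def flip: x_def)
    qed
    have fI: "f \<in> rspace (smooth_Ind S G J R)" unfolding IndG
    proof (intro conjI allI ballI impI)
      fix x assume "x \<notin> G" then show "f x = 0" by (simp add: f_def)
    next
      fix x assume "x \<in> G"
      then obtain i j k where i: "i \<in> I" "j \<in> J" "k \<in> K" "x = j ** matrix_inv (g i) ** k" using ex by blast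
      then show "f x \<in> rspace R" using fx ract_in Fval by simp
    next
      fix h x assume h: "h \<in> J" and "x \<in> G"
      then obtain i j k where i: "i \<in> I" "j \<in> J" "k \<in> K" "x = j ** matrix_inv (g i) ** k" using ex by blast
      have "f (h ** x) = ract R (h ** j) (F i k)"
        using fx[OF i(1) subgroup_mult[OF J(1) h i(2)] i(3)] i(4) by (simp add: gassoc)
      then show "f (h ** x) = ract R h (f x)" using fx[OF i(1-3)] i ract_mult[OF h i(2) Fval[OF i(1)]] by simp
    next
      have "\<forall>i\<in>{i. F i \<noteq> 0}. \<exists>n>0. \<forall>x\<in>K. \<forall>u\<in>Gyr S 0 n. F i (x ** u) = F i x"
        using FB F0 unfolding IndK by blast
      then obtain n where n: "\<And>i. F i \<noteq> 0 \<Longrightarrow> n i > 0 \<and> (\<forall>x\<in>K. \<forall>u\<in>Gyr S 0 (n i). F i (x ** u) = F i x)"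
        using bchoice[of "{i. F i \<noteq> 0}" "\<lambda>i n. n>0 \<and> (\<forall>x\<in>K. \<forall>u\<in>Gyr S 0 n. F i (x ** u) = F i x)"] by blast
      \<comment> \<open>A level common to the finitely many nonzero components. The 1 keeps the
        maximum meaningful when all components vanish.\<close>
      define N where "N = Max (insert 1 (n ` {i. F i \<noteq> 0}))"
      have N: "1 \<le> N" "\<And>i. F i \<noteq> 0 \<Longrightarrow> n i \<le> N" unfolding N_def using fin by (auto intro: Max_ge)
      show "\<exists>n>0. \<forall>x\<in>G. \<forall>u\<in>Gyr S 0 n. f (x ** u) = f x"
      proof (intro exI[of _ N] conjI ballI)
        fix x u assume "x \<in> G" and u: "u \<in> Gyr S 0 N"
        then obtain i j k where i: "i \<in> I" "j \<in> J" "k \<in> K" "x = j ** matrix_inv (g i) ** k" using ex by blast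
        have uK: "u \<in> K" using u Gyr0_subset_K[of N] N by auto
        have "F i (k ** u) = F i k"
          using n[of i] N(2)[of i] u Gyr_antimono[of "n i" N 0] i(3) by (cases "F i = 0") auto
        then have "f (j ** matrix_inv (g i) ** (k ** u)) = f (j ** matrix_inv (g i) ** k)"
          using fx[OF i(1-3)] fx[OF i(1,2) subgroup_mult[OF subgroup_K i(3) uK]] by simp
        then show "f (x ** u) = f x" using i(4) by (simp add: gassoc)
      qed (use N in simp)
    qed
    \<comment> \<open>Inverses of coset representatives of \<open>A i\<close> in \<open>K\<close>,
      transported into the double coset. Since there are finitely many, the support of f is covered
      by \<open>J\<close> times a finite, hence compact, set.\<close>
    define CC where "CC i = (\<lambda>D. matrix_inv (g i) ** matrix_inv (SOME x. x \<in> D)) ` coset_of (A i) ` K" for i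
    define C where "C = \<Union>(CC ` {i. F i \<noteq> 0})"
    have sA: "mat_subgroup (A i)" "A i \<subseteq> K" if i: "i \<in> I" for i
    proof -
      have "mat_subgroup (mconj (g i) ` J)"
      proof (rule subgroupI)
        show "mconj (g i) ` J \<subseteq> G" using g[OF i] JG by (auto simp: mconj_def)
        show "mat 1 \<in> mconj (g i) ` J"
          by (rule image_eqI[OF _ subgroup_one[OF J(1)]]) (use g[OF i] in \<open>simp add: mconj_def\<close>)
        fix x assume "x \<in> mconj (g i) ` J"
        then obtain a where a: "a \<in> J" "x = mconj (g i) a" by blast
        show "matrix_inv x \<in> mconj (g i) ` J"
          by (rule image_eqI[OF _ subgroup_inv[OF J(1) a(1)]]) (use g[OF i] JG[OF a(1)] a in \<open>simp add: mconj_def gassoc\<close>)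
        fix y assume "y \<in> mconj (g i) ` J"
        then obtain b where b: "b \<in> J" "y = mconj (g i) b" by blast
        show "x ** y \<in> mconj (g i) ` J"
          by (rule image_eqI[OF _ subgroup_mult[OF J(1) a(1) b(1)]]) (use g[OF i] a b in \<open>simp add: mconj_def gassoc\<close>)
      qed
      then show "mat_subgroup (A i)" unfolding A_def by (rule subgroup_Int[OF subgroup_K])
    qed (simp add: A_def)
    have finCC: "finite (CC i)" if i: "i \<in> I" for i
    proof -
      obtain m where m: "m > 0" "\<And>u. u \<in> Gyr S 0 m \<Longrightarrow> matrix_inv (g i) ** u ** g i \<in> Gyr S 0 n0"
        using conj_Gyr[of "matrix_inv (g i)" n0] g[OF i] J(3) by auto
      have "K \<inter> Gyr S 0 m \<subseteq> A i"
      proof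
        fix u assume u: "u \<in> K \<inter> Gyr S 0 m"
        then have "u = mconj (g i) (matrix_inv (g i) ** u ** g i)" using g[OF i] by (simp add: mconj_def gassoc)
        then show "u \<in> A i" using m(2)[of u] J(4) u by (auto simp: A_def)
      qed
      then have "finite (coset_of (A i) ` K)"
        by (rule finite_cosets[OF subgroup_K order_refl sA(1)[OF i] _ m(1)])
      then show ?thesis unfolding CC_def by (rule finite_imageI)
    qed
    have CG: "C \<subseteq> G"
    proof
      fix c assume "c \<in> C"
      then obtain i k where i: "F i \<noteq> 0" and k: "k \<in> K" "c = matrix_inv (g i) ** matrix_inv (SOME x. x \<in> coset_of (A i) k)"
        by (auto simp: C_def CC_def)
      have iI: "i \<in> I" using i F0 by blast
      obtain u where "u \<in> A i" "(SOME x. x \<in> coset_of (A i) k) = k ** u" using some_coset[OF sA(1)[OF iI]] by blast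
      then show "c \<in> G" using k g[OF iI] KG sA(2)[OF iI] by auto
    qed
    have "finite C" unfolding C_def using fin finCC F0 by (intro finite_Union) auto
    then have "compactin (mat_top S) C" by (intro finite_imp_compactin) auto
    moreover have "{x. f x \<noteq> 0} \<subseteq> set_prod J C"
    proof
      fix x assume "x \<in> {x. f x \<noteq> 0}"
      then have nz: "f x \<noteq> 0" by simp
      then have "x \<in> G" by (auto simp: f_def split: if_splits)
      then obtain i j k where i: "i \<in> I" "j \<in> J" "k \<in> K" "x = j ** matrix_inv (g i) ** k" using ex by blast
      then have "F i k \<noteq> 0" using fx[OF i(1-3)] nz ract0 by auto
      then have Fi: "F i \<noteq> 0" by auto
      obtain u where u: "u \<in> A i" "(SOME x. x \<in> coset_of (A i) (matrix_inv k)) = matrix_inv k ** u"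
        using some_coset[OF sA(1)[OF i(1)]] by blast
      define c where "c = matrix_inv (g i) ** matrix_inv (matrix_inv k ** u)"
      have "c \<in> CC i" unfolding CC_def c_def u(2)[symmetric] using subgroup_inv[OF subgroup_K i(3)] by blast
      then have cC: "c \<in> C" using Fi by (auto simp: C_def)
      obtain b where b: "b \<in> J" "u = g i ** b ** matrix_inv (g i)" "u \<in> K" using u(1) by (auto simp: A_def mconj_def)
      have G: "g i \<in> G" "j \<in> G" "k \<in> G" "b \<in> G" "u \<in> G" using g i JG KG b by auto
      have "matrix_inv (matrix_inv k ** u) = g i ** matrix_inv b ** matrix_inv (g i) ** k" using G by (simp add: gassoc b(2))
      then have "c = matrix_inv b ** matrix_inv (g i) ** k" using G by (simp add: c_def gassoc)
      then have "x = (j ** b) ** c" using G by (simp add: i(4) gassoc)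
      then show "x \<in> set_prod J C" unfolding set_prod_def using cC subgroup_mult[OF J(1) i(2) b(1)] by blast
    qed
    ultimately have fP: "f \<in> P" using fI CG P by blast
    moreover have "F = T f"
    proof (intro ext)
      fix i k
      show "F i k = T f i k"
      proof (cases "i \<in> I \<and> k \<in> K")
        case True
        then show ?thesis using fx[of i "mat 1" k] subgroup_one[OF J(1)] ract_one[OF Fval] by (simp add: T_def)
      next
        case False
        then show ?thesis using F0 FB[of i] unfolding IndK by (auto simp: T_def)
      qed
    qed
    ultimately show ?thesis by blast
  qed
  have bij: "bij_betw T P (rspace (rep_dsum I B))"
    by (rule bij_betwI') (use Tin Tinj Tsurj in \<open>auto; fail\<close>)+
  have "T (\<lambda>x. f (x ** h)) = (\<lambda>i. if i \<in> I then (\<lambda>x. T f i (x ** h)) else 0)" if h: "h \<in> K" for f h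
  proof (intro ext)
    fix i x
    have "x ** h \<in> K \<longleftrightarrow> x \<in> K"
    proof
      assume "x ** h \<in> K"
      then have "x ** h ** matrix_inv h \<in> K" using subgroup_mult[OF subgroup_K _ subgroup_inv[OF subgroup_K h]] by blast
      then show "x \<in> K" using KG[OF h] by (simp add: gassoc)
    qed (use subgroup_mult[OF subgroup_K _ h] in blast)
    then show "T (\<lambda>x. f (x ** h)) i x = (if i \<in> I then (\<lambda>x. T f i (x ** h)) else 0) x"
      by (simp add: T_def gassoc)
  qed
  then show ?thesis unfolding rep_iso_def P_def[symmetric] A_def[symmetric] B_def[symmetric] cs
    using bij by (intro exI[of _ T]) (auto simp: rep_dsum_def Bs T_def fun_eq_iff)
qed

end

lemma matrix_add_rdistrib2: "(A + B) ** C = A ** C + B ** (C :: 'a::ring_1 ^ 'n ^ 'm)"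
  by (simp add: vec_eq_iff matrix_matrix_mult_def distrib_right sum.distrib)

context u11 begin

subsection \<open>Characters attached to matrices\<close>

lemma L_trace: "X \<in> L y r \<Longrightarrow> ge r (trace X)"
  by (auto simp: trace_def sum_2 L_iff intro: ge_add)

text \<open>Additivity fails only by the trace of X (g - 1) (h - 1), which has depth at least \<rho>
  + a + b and is therefore killed by the additive character.\<close>

lemma Psi_mult:
  assumes "X \<in> L y \<rho>" "g - mat 1 \<in> L y a" "h - mat 1 \<in> L y b" "0 < \<rho> + a + b"
  shows "Psi S X (g ** h) = Psi S X g * Psi S X h"
proof -
  have "g ** h - mat 1 = (g - mat 1) + (h - mat 1) + (g - mat 1) ** (h - mat 1)"
    by (simp add: matrix_diff_ldistrib matrix_diff_rdistrib)
  then have e: "trace (X ** (g ** h - mat 1)) = trace (X ** (g - mat 1)) + trace (X ** (h - mat 1))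
      + trace (X ** ((g - mat 1) ** (h - mat 1)))"
    by (simp only: matrix_add_ldistrib trace_add)
  have "X ** ((g - mat 1) ** (h - mat 1)) \<in> L y (\<rho> + a + b)"
    by (rule L_mult[OF assms(1) L_mult[OF assms(2,3) order_refl]]) simp
  then have "psiE S (trace (X ** ((g - mat 1) ** (h - mat 1)))) = 1"
    using psiE_triv[OF L_trace assms(4)] by blast
  then show ?thesis unfolding Psi_def e by (simp add: psiE_add)
qed

lemma Psi_triv: assumes "X \<in> L y \<rho>" "g - mat 1 \<in> L y a" "0 < \<rho> + a" shows "Psi S X g = 1"
  unfolding Psi_def by (rule psiE_triv[OF L_trace[OF L_mult[OF assms(1,2) order_refl]] assms(3)])

lemma Psi_one [simp]: "Psi S X (mat 1) = 1"
  by (simp add: Psi_def trace_def)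

lemma Psi_conj: assumes "x \<in> G" shows "Psi S X (x ** g ** matrix_inv x) = Psi S (matrix_inv x ** X ** x) g"
proof -
  have e: "x ** g ** matrix_inv x - mat 1 = x ** (g - mat 1) ** matrix_inv x"
    using assms by (simp add: matrix_diff_ldistrib matrix_diff_rdistrib)
  have "trace (X ** (x ** (g - mat 1) ** matrix_inv x)) = trace ((X ** (x ** (g - mat 1))) ** matrix_inv x)"
    by (simp add: gassoc)
  also have "\<dots> = trace (matrix_inv x ** (X ** (x ** (g - mat 1))))" by (rule trace_mul_sym)
  finally show ?thesis unfolding Psi_def e by (simp only: gassoc)
qed

lemma Psi_add: "Psi S (X + Y) g = Psi S X g * Psi S Y g"
  by (simp add: Psi_def matrix_add_rdistrib2 psiE_add trace_add)

lemma Psi_nonzero [simp]: "Psi S X g \<noteq> 0" by (simp add: Psi_def)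

text \<open>Membership in the Lie algebra of \<open>G\<close>.\<close>

definition skew :: "'e ^ 2 ^ 2 \<Rightarrow> bool" where
  "skew X \<longleftrightarrow> X $ 2 $ 2 = - bar (X $ 1 $ 1) \<and> bar (X $ 1 $ 2) = - X $ 1 $ 2 \<and> bar (X $ 2 $ 1) = - X $ 2 $ 1"

lemma skew_conj: assumes "skew X" "x \<in> G" shows "skew (matrix_inv x ** X ** x)"
proof -
  obtain a b c e where x: "x = mat2 a b c e" by (rule mat2_cases)
  obtain p q t u where X: "X = mat2 p q t u" by (rule mat2_cases)
  show ?thesis using assms unfolding x X
    by (simp add: unitary_inv skew_def algebra_simps)
qed

lemma skew_diff: "skew X \<Longrightarrow> skew Y \<Longrightarrow> skew (X - Y)" by (auto simp: skew_def)

lemma imag_eq: "bar y = - y \<longleftrightarrow> re y = 0"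
proof -
  have "bar (y * \<sigma>) = (- bar y) * \<sigma>" by simp
  then have "bar (y * \<sigma>) = y * \<sigma> \<longleftrightarrow> - bar y = y" by (simp only: mult_cancel_right sigma_nonzero) simp
  then have "bar y = - y \<longleftrightarrow> bar (y * \<sigma>) = y * \<sigma>" by (metis minus_minus)
  also have "\<dots> \<longleftrightarrow> im (y * \<sigma>) = 0" by (rule real_iff)
  also have "\<dots> \<longleftrightarrow> re y = 0" by (simp add: im_mult)
  finally show ?thesis .
qed

lemma imag_E: "bar y = - y \<Longrightarrow> y = \<iota> (im y) * \<sigma>"
  using E_eq[of y] by (simp add: imag_eq)

text \<open>The test elements of all duality arguments: two root subgroups and the diagonal, the
  second diagonal entry of \<open>dg\<close> being forced by unitarity. Pairing a skew matrix with
  them reads off its entries one at a time.\<close>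

definition up :: "'f \<Rightarrow> 'e ^ 2 ^ 2" where "up \<beta> = mat2 1 (\<iota> \<beta> * \<sigma>) 0 1"
definition lo :: "'f \<Rightarrow> 'e ^ 2 ^ 2" where "lo \<beta> = mat2 1 0 (\<iota> \<beta> * \<sigma>) 1"
definition dg :: "'e \<Rightarrow> 'e ^ 2 ^ 2" where "dg \<delta> = mat2 (1 + \<delta>) 0 0 (inverse (bar (1 + \<delta>)))"

lemma up_G: "up \<beta> \<in> G" by (simp add: up_def unitary_iff)
lemma lo_G: "lo \<beta> \<in> G" by (simp add: lo_def unitary_iff)

lemma up_L: "up \<beta> - mat 1 \<in> L y r \<longleftrightarrow> geF (r - y) \<beta>"
  by (simp add: up_def mat2_one L_mat2)
lemma lo_L: "lo \<beta> - mat 1 \<in> L y r \<longleftrightarrow> geF (r + y) \<beta>"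
  by (simp add: lo_def mat2_one L_mat2)

lemma one_plus_unit: assumes "ge \<rho> \<delta>" "0 < \<rho>" shows "1 + \<delta> \<noteq> 0" "ve (1 + \<delta>) = 0"
proof -
  have "\<delta> = 0 \<or> ve 1 < ve \<delta>" using assms by (auto simp: ge_def)
  from ve_add_eq[OF _ this] show "1 + \<delta> \<noteq> 0" "ve (1 + \<delta>) = 0" by auto
qed

lemma ge_inverse_one_plus: assumes "ge \<rho> \<delta>" "0 < \<rho>" shows "ge 0 (inverse (1 + \<delta>))" "ge \<rho> (inverse (1 + \<delta>) - 1)"
proof -
  note u = one_plus_unit[OF assms]
  show 0: "ge 0 (inverse (1 + \<delta>))" using u by (simp add: ge_def ve_inverse)
  have "inverse (1 + \<delta>) - 1 = - (\<delta> * inverse (1 + \<delta>))" using u(1) by (simp add: field_simps)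
  then show "ge \<rho> (inverse (1 + \<delta>) - 1)" using ge_mult[OF assms(1) 0, of \<rho>] by simp
qed

lemma dg_G: assumes "ge \<rho> \<delta>" "0 < \<rho>" shows "dg \<delta> \<in> G"
  using one_plus_unit(1)[of \<rho> "bar \<delta>"] assms by (simp add: dg_def unitary_iff)

lemma dg_L: assumes "ge \<rho> \<delta>" "0 < \<rho>" shows "dg \<delta> - mat 1 \<in> L y \<rho>"
  using ge_inverse_one_plus(2)[of \<rho> "bar \<delta>"] assms by (simp add: dg_def mat2_one L_mat2)

lemma Psi_up: "Psi S Y (up \<beta>) = psiE S (Y $ 2 $ 1 * (\<iota> \<beta> * \<sigma>))"
  by (cases Y rule: mat2_cases) (simp add: Psi_def up_def mat2_one)
lemma Psi_lo: "Psi S Y (lo \<beta>) = psiE S (Y $ 1 $ 2 * (\<iota> \<beta> * \<sigma>))"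
  by (cases Y rule: mat2_cases) (simp add: Psi_def lo_def mat2_one)

lemma psiE_imag: assumes "bar y = - y" shows "psiE S (y * (\<iota> \<beta> * \<sigma>)) = psiF S (\<epsilon> * (im y * \<beta>))"
  using assms by (simp add: psiE_re re_mult imag_eq im_mult ac_simps)

text \<open>The second diagonal entry of \<open>dg \<delta>\<close> differs from 1 minus the
  conjugate of \<delta> by a quadratic term. The bound on \<tau> + 2 * \<rho> removes it, and what
  remains is a sum of two conjugates.\<close>

lemma Psi_dg: assumes "skew Y" "ge \<rho> \<delta>" "0 < \<rho>" "ge \<tau> (Y $ 1 $ 1)" "0 < \<tau> + 2 * \<rho>"
  shows "Psi S Y (dg \<delta>) = psiF S (2 * re (Y $ 1 $ 1 * \<delta>))"
proof -
  define y where "y = Y $ 1 $ 1"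
  have u: "1 + bar \<delta> \<noteq> 0" using one_plus_unit(1)[of \<rho> "bar \<delta>"] assms by simp
  have t: "trace (Y ** (dg \<delta> - mat 1)) = y * \<delta> + Y $ 2 $ 2 * (inverse (bar (1 + \<delta>)) - 1)"
    by (cases Y rule: mat2_cases) (simp add: dg_def mat2_one y_def)
  have "trace (Y ** (dg \<delta> - mat 1)) - (y * \<delta> + bar (y * \<delta>)) = - (bar y * bar \<delta>) * (bar \<delta> * inverse (1 + bar \<delta>))"
    unfolding t using assms(1) u by (simp add: skew_def field_simps flip: y_def)
  moreover have "ge (\<tau> + 2 * \<rho>) (- (bar y * bar \<delta>) * (bar \<delta> * inverse (1 + bar \<delta>)))"
    using ge_inverse_one_plus(1)[of \<rho> "bar \<delta>"] assms
    by (intro ge_mult[of "\<tau> + \<rho>" _ \<rho>] ge_mult[of \<rho> _ 0]) (auto simp: y_def intro!: ge_mult[of \<tau> _ \<rho>])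
  ultimately have "psiE S (trace (Y ** (dg \<delta> - mat 1))) = psiE S (y * \<delta> + bar (y * \<delta>))"
    using psiE_cong assms(5) by metis
  then show ?thesis by (simp add: Psi_def psiE_re y_def flip: bar_mult)
qed

text \<open>Otherwise h / (k * y), with h from \<open>psi_test_elt\<close>, would belong to the ball
  and violate the hypothesis. \<open>psi_dual_E\<close> is the same argument over E with the trace
  form.\<close>

lemma psi_dual_F: assumes "k \<noteq> 0" "\<nu> k = 0" "\<And>\<beta>. geF \<rho> \<beta> \<Longrightarrow> psiF S (k * (y * \<beta>)) = 1"
  shows "y = 0 \<or> - \<rho> < real_of_int (\<nu> y)"
proof (rule ccontr)
  assume a: "\<not> ?thesis"
  obtain h where h: "h \<noteq> 0" "\<nu> h = 0" "psiF S h \<noteq> 1" using psi_test_elt by blast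
  have "psiF S (k * (y * (h / (k * y)))) = 1"
    by (rule assms(3)) (use a h assms in \<open>simp add: geF_def nu_divide nu_mult\<close>)
  then show False using a h assms by simp
qed

lemma psi_dual_E: assumes "\<And>\<delta>. ge \<rho> \<delta> \<Longrightarrow> psiF S (2 * re (y * \<delta>)) = 1"
  shows "y = 0 \<or> - \<rho> < real_of_int (ve y)"
proof (rule ccontr)
  assume a: "\<not> ?thesis"
  obtain h where h: "h \<noteq> 0" "\<nu> h = 0" "psiF S h \<noteq> 1" using psi_test_elt by blast
  have "psiF S (2 * re (y * (\<iota> h / (2 * y)))) = 1"
    by (rule assms) (use a h in \<open>simp add: ge_def ve_divide ve_mult\<close>)
  moreover have "y * (\<iota> h / (2 * y)) = \<iota> (h / 2)" using a by simp
  ultimately show False using h by (simp del: emb_divide)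
qed

lemma geF_sqrt: assumes "geF \<rho> c" "0 < \<rho>"
  obtains m where "geF \<rho> (m - 1)" "m * m = 1 + c" "m \<noteq> 0" "geF \<rho> (inverse m - 1)" "geF 0 (inverse m)"
proof -
  have "1 \<le> \<lceil>\<rho>\<rceil>" using assms(2) by simp
  then obtain m where m: "m - 1 \<in> pF S \<lceil>\<rho>\<rceil>" "m * m = 1 + c" using sqrt_one_plus assms(1) geF_iff by blast
  have g: "ge \<rho> (\<iota> (m - 1))" unfolding ge_emb geF_iff by (rule m)
  have "ge 0 (\<iota> (inverse m))" "ge \<rho> (\<iota> (inverse m - 1))" "\<iota> m \<noteq> 0"
    using ge_inverse_one_plus[OF g assms(2)] one_plus_unit[OF g assms(2)] by simp_all
  then show ?thesis using that[of m] m g by (simp only: ge_emb emb_eq_0) blast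
qed

lemma subgroup_set_prod:
  assumes A: "mat_subgroup A" "A \<subseteq> G" and B: "mat_subgroup B" "B \<subseteq> G"
    and n: "\<And>a b. a \<in> A \<Longrightarrow> b \<in> B \<Longrightarrow> a ** b ** matrix_inv a \<in> B"
  shows "mat_subgroup (set_prod A B)" "set_prod A B = set_prod B A"
proof -
  have n': "matrix_inv a ** b ** a \<in> B" if "a \<in> A" "b \<in> B" for a b
    using n[OF subgroup_inv[OF A(1) that(1)] that(2)] A that by auto
  have AG: "a \<in> G" if "a \<in> A" for a using A that by auto
  have BG: "a \<in> G" if "a \<in> B" for a using B that by auto
  show "mat_subgroup (set_prod A B)"
  proof (rule subgroupI)
    show "set_prod A B \<subseteq> G" using AG BG by (auto simp: set_prod_def)
    have "mat 1 ** mat 1 \<in> set_prod A B" unfolding set_prod_def using subgroup_one[OF A(1)] subgroup_one[OF B(1)] by blast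
    then show "mat 1 \<in> set_prod A B" by simp
    fix x assume "x \<in> set_prod A B"
    then obtain a b where x: "a \<in> A" "b \<in> B" "x = a ** b" by (auto simp: set_prod_def)
    have "matrix_inv x = matrix_inv a ** (a ** matrix_inv b ** matrix_inv a)" using x AG BG by (simp add: gassoc)
    then show "matrix_inv x \<in> set_prod A B" unfolding set_prod_def
      using subgroup_inv[OF A(1) x(1)] n[OF x(1) subgroup_inv[OF B(1) x(2)]] by blast
    fix y assume "y \<in> set_prod A B"
    then obtain a' b' where y: "a' \<in> A" "b' \<in> B" "y = a' ** b'" by (auto simp: set_prod_def)
    have "x ** y = (a ** a') ** ((matrix_inv a' ** b ** a') ** b')" using x y AG BG by (simp add: gassoc)
    then show "x ** y \<in> set_prod A B" unfolding set_prod_def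
      using subgroup_mult[OF A(1) x(1) y(1)] subgroup_mult[OF B(1) n'[OF y(1) x(2)] y(2)] by blast
  qed
  show "set_prod A B = set_prod B A"
  proof (intro set_eqI iffI)
    fix x assume "x \<in> set_prod A B"
    then obtain a b where x: "a \<in> A" "b \<in> B" "x = a ** b" by (auto simp: set_prod_def)
    have "x = (a ** b ** matrix_inv a) ** a" using x AG by (simp add: gassoc)
    then show "x \<in> set_prod B A" unfolding set_prod_def using n x by blast
  next
    fix x assume "x \<in> set_prod B A"
    then obtain a b where x: "a \<in> A" "b \<in> B" "x = b ** a" by (auto simp: set_prod_def)
    have "x = a ** (matrix_inv a ** b ** a)" using x AG by (simp add: gassoc)
    then show "x \<in> set_prod A B" unfolding set_prod_def using n' x by blast
  qed
qed

lemma irr_char: "irr H (char_rep f)"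
  unfolding irr_def char_rep_def
proof (simp, intro conjI allI impI)
  have md: "module ((*) :: complex \<Rightarrow> complex \<Rightarrow> complex)" by unfold_locales (auto simp: algebra_simps)
  show "UNIV \<noteq> {0::complex}" by (metis UNIV_I singletonD zero_neq_one)
  fix W assume W: "module.subspace (*) W \<and> (\<forall>h\<in>H. \<forall>v\<in>W. f h * v \<in> W)"
  show "W = {0} \<or> W = UNIV"
  proof (cases "W = {0}")
    case False
    then obtain w where w: "w \<in> W" "w \<noteq> 0" using W module.subspace_0[OF md] by blast
    have "x \<in> W" for x using module.subspace_scale[OF md _ w(1), of "x / w"] W w(2) by simp
    then show ?thesis by auto
  qed simp
qed

text \<open>The point \<open>1/4\<close> serves both parities of \<open>d\<close>.\<close>

lemma Jd_eq: assumes "d \<in> \<int>" shows "Jd S d = Gyr S (1/4) (d/2)"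
proof -
  obtain n where n: "d = real_of_int n" using assms Ints_cases by auto
  have i: "d / 2 \<le> real_of_int k \<longleftrightarrow> d / 2 - 1/4 \<le> real_of_int k"
    "(d + 1) / 2 \<le> real_of_int k \<longleftrightarrow> d / 2 + 1/4 \<le> real_of_int k" for k
  proof -
    have r: "x \<le> y \<longleftrightarrow> real_of_int x \<le> real_of_int y" "x \<le> y \<longleftrightarrow> real_of_int x < real_of_int y + 1" for x y :: int
      by linarith+
    have a: "d / 2 \<le> real_of_int k \<longleftrightarrow> n \<le> 2 * k" unfolding n r(1) by auto
    have b: "d / 2 - 1/4 \<le> real_of_int k \<longleftrightarrow> n \<le> 2 * k"
      using r(1)[of n "2 * k"] r(2)[of n "2 * k"] unfolding n by auto
    have c: "(d + 1) / 2 \<le> real_of_int k \<longleftrightarrow> n + 1 \<le> 2 * k" unfolding n r(1) by auto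
    have e: "d / 2 + 1/4 \<le> real_of_int k \<longleftrightarrow> n + 1 \<le> 2 * k"
      using r(1)[of "n + 1" "2 * k"] r(2)[of "n + 1" "2 * k"] unfolding n by auto
    show "d / 2 \<le> real_of_int k \<longleftrightarrow> d / 2 - 1/4 \<le> real_of_int k" using a b by simp
    show "(d + 1) / 2 \<le> real_of_int k \<longleftrightarrow> d / 2 + 1/4 \<le> real_of_int k" using c e by simp
  qed
  have g: "ge (d / 2) x \<longleftrightarrow> ge (d / 2 - 1/4) x" "ge ((d + 1) / 2) x \<longleftrightarrow> ge (d / 2 + 1/4) x" for x
    unfolding ge_def using i by blast+
  have m: "g - mat 1 \<in> L (1/4) (d/2) \<longleftrightarrow> ge (d/2) (g $ 1 $ 1 - 1) \<and> ge (d/2 - 1/4) (g $ 1 $ 2) \<and>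
      ge (d/2 + 1/4) (g $ 2 $ 1) \<and> ge (d/2) (g $ 2 $ 2 - 1)" for g
    by (cases g rule: mat2_cases) (simp add: mat2_one L_mat2)
  show ?thesis
  proof (rule set_eqI)
    fix x show "x \<in> Jd S d \<longleftrightarrow> x \<in> Gyr S (1/4) (d/2)"
      unfolding Jd_def Gyr_iff m pE_ceiling mem_Collect_eq g(2) g(1)[of "x $ 1 $ 2"] ..
  qed
qed

end

section \<open>Irreducibility of the representations \<open>S_rep S d X \<zeta>\<close>\<close>

locale S_datum = u11 S for S :: "('f::field, 'e::field) setting" +
  fixes d :: real and z0 u0 v0 :: 'f and \<zeta> :: "'e ^ 2 ^ 2 \<Rightarrow> complex" and X
  defines X_def: "X \<equiv> mat2 (emb S z0 * sqrt_eps S) (emb S u0 * sqrt_eps S) (emb S v0 * sqrt_eps S) (emb S z0 * sqrt_eps S)"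
  assumes d: "0 < d" and u0: "u0 \<noteq> 0" "real_of_int (nu S u0) = - d"
    and z0: "z0 = 0 \<or> nu S u0 < nu S z0" and v0: "v0 = 0 \<or> nu S u0 < nu S v0"
    and zeta: "smooth_char S (TX S X) \<zeta>" "\<And>k. k \<in> TX S X \<inter> Jd S d \<Longrightarrow> \<zeta> k = Psi S X k"
begin

lemma d_int: "d \<in> \<int>" using u0(2) by (metis Ints_minus Ints_of_int minus_minus)

lemma d1: "1 \<le> d"
proof -
  have "0 < real_of_int (- \<nu> u0)" using d u0(2) by simp
  then have "1 \<le> - \<nu> u0" unfolding of_int_0_less_iff by simp
  then have "real_of_int 1 \<le> real_of_int (- \<nu> u0)" unfolding of_int_le_iff .
  then show ?thesis using u0(2) by simp
qed

abbreviation "w \<equiv> v0 / u0"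

lemma w: "geF 1 w"
  using v0 u0 by (cases "v0 = 0") (auto simp: geF_def nu_divide)

lemma wE: "ge 1 (\<iota> w)" using w by (simp only: ge_emb)

text \<open>At the point 1/4 the depth of X is 1/4 - d, better than -d, because its only entry of
  valuation -d is the upper right one, which that point weighs by -1/4. The gain of 1/4 is what
  makes \<open>Psi S X\<close> multiplicative on \<open>Jd S d\<close>: 1/4 - d + d/2 + d/2 is
  positive.\<close>

lemma X_L: "X \<in> L (1/4) (1/4 - d)" "X \<in> L 0 (- d)"
proof -
  have "geF (1 - d) z0" "geF (1 - d) v0" "geF (- d) u0"
    using z0 v0 u0(2) by (auto simp: geF_def)
  then have g: "ge (1 - d) (\<iota> z0 * \<sigma>)" "ge (1 - d) (\<iota> v0 * \<sigma>)" "ge (- d) (\<iota> u0 * \<sigma>)" by simp_all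
  show "X \<in> L (1/4) (1/4 - d)" "X \<in> L 0 (- d)"
    unfolding X_def L_mat2
    by (intro conjI; (rule ge_mono[OF g(1)] | rule ge_mono[OF g(2)] | rule ge_mono[OF g(3)]); simp)+
qed

lemma X_skew: "skew X" by (simp add: skew_def X_def)

lemmas Jd' = Jd_eq[OF d_int]

lemma Jd_sub: "mat_subgroup (Jd S d)" unfolding Jd' by (rule subgroup_Gyr) (use d in simp)

text \<open>For integers the bounds -1/4 and 1/4 mean 0 and 1, so depth 0 at the point 1/4 describes
  the Iwahori subgroup.\<close>

lemma Iw_iff: "mat2 a b c e \<in> Gyr S (1/4) 0 \<longleftrightarrow> mat2 a b c e \<in> G \<and> ge 0 a \<and> ge 0 b \<and> ge 1 c \<and> ge 0 e"
proof -
  have "- 1 / 4 \<le> real_of_int k \<longleftrightarrow> 0 \<le> real_of_int k" for k by (cases "k \<ge> 0") linarith+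
  moreover have "1 / 4 \<le> real_of_int k \<longleftrightarrow> 1 \<le> real_of_int k" for k by (cases "k \<ge> 1") linarith+
  ultimately
  show ?thesis unfolding Gyr_0_iff L_mat2 by (simp add: ge_def)
qed

lemma K_Iw: "x \<in> K \<Longrightarrow> ge 1 (x $ 2 $ 1) \<Longrightarrow> x \<in> Gyr S (1/4) 0"
  by (cases x rule: mat2_cases) (simp add: K_iff L_mat2 Iw_iff)

lemma Iw_K: "x \<in> Gyr S (1/4) 0 \<Longrightarrow> x \<in> K"
  by (cases x rule: mat2_cases) (auto simp: K_iff L_mat2 Iw_iff elim: ge_mono)

lemma Jd_Iw: "Jd S d \<subseteq> Gyr S (1/4) 0" unfolding Jd' by (rule Gyr_antimono) (use d in simp)
lemma Jd_K: "Jd S d \<subseteq> K" using Jd_Iw Iw_K by blast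
lemma Jd_G: "Jd S d \<subseteq> G" using Jd_K K_subset by blast

lemma TX_shape: assumes "mat2 a b c e \<in> TX S X" shows "e = a" "c = b * \<iota> w" "mat2 a b c e \<in> K"
proof -
  have eq: "mat2 a b c e ** X = X ** mat2 a b c e" and "mat2 a b c e \<in> K" using assms by (auto simp: TX_def)
  then show "mat2 a b c e \<in> K" by simp
  have e1: "a * (\<iota> z0 * \<sigma>) + b * (\<iota> v0 * \<sigma>) = \<iota> z0 * \<sigma> * a + \<iota> u0 * \<sigma> * c"
    and e2: "a * (\<iota> u0 * \<sigma>) + b * (\<iota> z0 * \<sigma>) = \<iota> z0 * \<sigma> * b + \<iota> u0 * \<sigma> * e"
    using eq by (simp_all add: X_def)
  have "(\<iota> u0 * \<sigma>) * (b * \<iota> w) = (\<iota> u0 * \<sigma>) * c" using e1 u0 by (simp add: algebra_simps)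
  then show "c = b * \<iota> w" using u0 by simp
  have "(\<iota> u0 * \<sigma>) * a = (\<iota> u0 * \<sigma>) * e" using e2 by (simp add: algebra_simps)
  then show "e = a" using u0 by simp
qed

lemma TX_sub: "mat_subgroup (TX S X)"
proof (rule subgroupI)
  show "TX S X \<subseteq> G" using K_subset by (auto simp: TX_def)
  show "mat 1 \<in> TX S X" using subgroup_one[OF subgroup_K] by (simp add: TX_def)
  fix x assume x: "x \<in> TX S X"
  then have xG: "x \<in> G" "x ** X = X ** x" using K_subset by (auto simp: TX_def)
  have "matrix_inv x ** X = matrix_inv x ** (X ** x) ** matrix_inv x" using xG by (simp add: gassoc)
  also have "\<dots> = X ** matrix_inv x" unfolding xG(2)[symmetric] using xG(1) by (simp add: gassoc)
  finally show "matrix_inv x \<in> TX S X" using x subgroup_inv[OF subgroup_K] by (simp add: TX_def)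
  fix y assume "y \<in> TX S X"
  then show "x ** y \<in> TX S X" using x subgroup_mult[OF subgroup_K, of x y]
    by (auto simp: TX_def) (metis matrix_mul_assoc)
qed

lemma TX_K: "TX S X \<subseteq> K" by (auto simp: TX_def)
lemma TX_G: "TX S X \<subseteq> G" using TX_K K_subset by blast

lemma TX_Iw: "TX S X \<subseteq> Gyr S (1/4) 0"
proof
  fix x assume x: "x \<in> TX S X"
  obtain a b c e where m: "x = mat2 a b c e" by (rule mat2_cases)
  note sh = TX_shape[OF x[unfolded m]]
  have "ge 0 b" using sh(3) by (simp add: K_iff L_mat2)
  then have "ge 1 c" unfolding sh(2) by (intro ge_mult[OF _ wE]) auto
  then show "x \<in> Gyr S (1/4) 0" using K_Iw x TX_K by (auto simp: m)
qed

definition B :: "('e ^ 2 ^ 2) set" where "B = set_prod (TX S X) (Jd S d)"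

lemma TX_norm: "t \<in> TX S X \<Longrightarrow> j \<in> Jd S d \<Longrightarrow> t ** j ** matrix_inv t \<in> Jd S d"
  using TX_Iw Gyr_normal unfolding Jd' by blast

lemma Iw_norm: "x \<in> Gyr S (1/4) 0 \<Longrightarrow> j \<in> Jd S d \<Longrightarrow> x ** j ** matrix_inv x \<in> Jd S d"
  using Gyr_normal unfolding Jd' by blast

lemma B_sub: "mat_subgroup B"
  unfolding B_def by (rule subgroup_set_prod(1)[OF TX_sub TX_G Jd_sub Jd_G TX_norm])

lemma B_K: "B \<subseteq> K"
  using subgroup_mult[OF subgroup_K] TX_K Jd_K unfolding B_def set_prod_def by blast

lemma Psi_J: "g \<in> Jd S d \<Longrightarrow> h \<in> Jd S d \<Longrightarrow> Psi S X (g ** h) = Psi S X g * Psi S X h"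
  using Psi_mult[OF X_L(1), of g "d/2" h "d/2"] unfolding Jd' Gyr_iff by simp

lemma zeta_one: "\<zeta> (mat 1) = 1" and zeta_mult: "x \<in> TX S X \<Longrightarrow> y \<in> TX S X \<Longrightarrow> \<zeta> (x ** y) = \<zeta> x * \<zeta> y"
  using zeta(1) by (auto simp: smooth_char_def)

abbreviation "\<Psi> \<equiv> Psi_ext S d X \<zeta>"

text \<open>Two factorizations differ by an element of the intersection of \<open>TX S X\<close> and
  \<open>Jd S d\<close>, where \<zeta> and \<open>Psi S X\<close> agree, so the definite description
  is well defined.\<close>

lemma Psi_ext_eq: assumes t: "t \<in> TX S X" and j: "j \<in> Jd S d" shows "\<Psi> (t ** j) = \<zeta> t * Psi S X j"
  unfolding Psi_ext_def
proof (rule the_equality)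
  show "\<exists>t'\<in>TX S X. \<exists>j'\<in>Jd S d. t ** j = t' ** j' \<and> \<zeta> t * Psi S X j = \<zeta> t' * Psi S X j'" using t j by blast
  fix c assume "\<exists>t'\<in>TX S X. \<exists>j'\<in>Jd S d. t ** j = t' ** j' \<and> c = \<zeta> t' * Psi S X j'"
  then obtain t' j' where t': "t' \<in> TX S X" "j' \<in> Jd S d" "t ** j = t' ** j'" "c = \<zeta> t' * Psi S X j'" by blast
  define k where "k = matrix_inv t' ** t"
  have G: "t \<in> G" "t' \<in> G" "j \<in> G" "j' \<in> G" using t t' j TX_G Jd_G by auto
  have "k ** j = j'" using t'(3) G by (simp add: k_def gassoc)
  then have kj: "k = j' ** matrix_inv j" using G by (simp add: k_def gassoc flip: \<open>k ** j = j'\<close>)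
  have kT: "k \<in> TX S X" unfolding k_def by (rule subgroup_mult[OF TX_sub subgroup_inv[OF TX_sub t'(1)] t])
  have kJ: "k \<in> Jd S d" unfolding kj by (rule subgroup_mult[OF Jd_sub t'(2) subgroup_inv[OF Jd_sub j]])
  have "\<zeta> t = \<zeta> t' * \<zeta> k" using zeta_mult[OF t'(1) kT] G by (simp add: k_def)
  moreover have "Psi S X j' = Psi S X k * Psi S X j" using Psi_J[OF kJ j] \<open>k ** j = j'\<close> by simp
  moreover have "\<zeta> k = Psi S X k" using zeta(2) kT kJ by blast
  ultimately show "c = \<zeta> t * Psi S X j" using t'(4) by simp
qed

lemma Psi_TX_conj: assumes "t \<in> TX S X" shows "Psi S X (matrix_inv t ** j ** t) = Psi S X j"
proof -
  have t: "t \<in> G" "t ** X = X ** t" "matrix_inv t \<in> G" using assms TX_G by (auto simp: TX_def)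
  have "Psi S X (matrix_inv t ** j ** t) = Psi S (t ** X ** matrix_inv t) j"
    using Psi_conj[OF t(3), of X j] t by simp
  also have "t ** X ** matrix_inv t = X" using t by (simp add: gassoc)
  finally show ?thesis .
qed

lemma Psi_ext_mult: assumes "x \<in> B" "y \<in> B" shows "\<Psi> (x ** y) = \<Psi> x * \<Psi> y"
proof -
  obtain t j where x: "t \<in> TX S X" "j \<in> Jd S d" "x = t ** j" using assms(1) by (auto simp: B_def set_prod_def)
  obtain t' j' where y: "t' \<in> TX S X" "j' \<in> Jd S d" "y = t' ** j'" using assms(2) by (auto simp: B_def set_prod_def)
  have G: "t \<in> G" "t' \<in> G" "j \<in> G" "j' \<in> G" using x y TX_G Jd_G by auto
  have jj: "matrix_inv t' ** j ** t' \<in> Jd S d"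
    using TX_norm[OF subgroup_inv[OF TX_sub y(1)] x(2)] G by simp
  have "x ** y = (t ** t') ** ((matrix_inv t' ** j ** t') ** j')" using x y G by (simp add: gassoc)
  then have "\<Psi> (x ** y) = \<zeta> (t ** t') * Psi S X ((matrix_inv t' ** j ** t') ** j')"
    using Psi_ext_eq[OF subgroup_mult[OF TX_sub x(1) y(1)] subgroup_mult[OF Jd_sub jj y(2)]] by simp
  then show ?thesis
    using zeta_mult[OF x(1) y(1)] Psi_J[OF jj y(2)] Psi_TX_conj[OF y(1)] Psi_ext_eq[OF x(1,2)] Psi_ext_eq[OF y(1,2)] x(3) y(3)
    by simp
qed

lemma Psi_ext_J: "j \<in> Jd S d \<Longrightarrow> \<Psi> j = Psi S X j"
  using Psi_ext_eq[OF subgroup_one[OF TX_sub], of j] zeta_one by simp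

lemma J_B: "Jd S d \<subseteq> B"
proof
  fix j assume "j \<in> Jd S d"
  then have "mat 1 ** j \<in> B" unfolding B_def set_prod_def using subgroup_one[OF TX_sub] by blast
  then show "j \<in> B" by simp
qed

lemma Gyr_Jd: "Gyr S 0 (d + 1) \<subseteq> Jd S d"
proof
  fix g assume "g \<in> Gyr S 0 (d + 1)"
  then show "g \<in> Jd S d" unfolding Jd' Gyr_iff L_iff using d by (auto elim: ge_mono)
qed

lemma ind_B: "ind_data S B (char_rep \<Psi>) (d + 1)"
proof unfold_locales
  have md: "vector_space ((*) :: complex \<Rightarrow> complex \<Rightarrow> complex)" by unfold_locales (auto simp: algebra_simps)
  have one: "\<Psi> (mat 1) = 1" using Psi_ext_J[OF subgroup_one[OF Jd_sub]] by simp
  have "module ((*) :: complex \<Rightarrow> complex \<Rightarrow> complex)" by unfold_locales (auto simp: algebra_simps)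
  then have "is_rep B (**) (mat 1) (char_rep \<Psi>)" unfolding is_rep_def char_rep_def
    using md one Psi_ext_mult by (simp add: algebra_simps module.subspace_def)
  moreover have "\<Psi> h = 1" if "h \<in> B \<inter> Gyr S 0 (d + 1)" for h
    using that Psi_ext_J[of h] Gyr_Jd Psi_triv[OF X_L(2), of h "d + 1"] by (auto simp: Gyr_iff)
  then have "\<forall>v. \<exists>n>0. \<forall>h\<in>B \<inter> Gyr S 0 n. \<Psi> h * v = v" using d by (intro allI exI[of _ "d + 1"]) auto
  ultimately show "srep B (char_rep \<Psi>)" unfolding srep_def by (simp add: char_rep_def)
qed (use B_sub B_K Gyr_Jd J_B d in auto)

text \<open>An element of \<open>K\<close> intertwining \<open>\<Psi>\<^sub>X\<close> first lies in the Iwahori subgroup, and then commutes with \<open>X\<close>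
  up to the lattice dual to that of \<open>J\<^sub>d\<close>.\<close>

lemma intertwine_Iw:
  assumes x: "x \<in> K" and int: "\<And>m. m \<in> Jd S d \<Longrightarrow> x ** m ** matrix_inv x \<in> Jd S d \<Longrightarrow> Psi S X (x ** m ** matrix_inv x) = Psi S X m"
  shows "x \<in> Gyr S (1/4) 0"
proof -
  obtain a b c e where m: "x = mat2 a b c e" by (rule mat2_cases)
  have g: "x \<in> G" "ge 0 a" "ge 0 b" "ge 0 c" "ge 0 e" using x by (auto simp: m K_iff L_mat2)
  have "ge 1 c"
  proof (rule ccontr)
    assume "\<not> ge 1 c"
    then have c: "c \<noteq> 0" "ve c = 0" using g(4) by (auto simp: ge_def)
    define N where "N = normE S c"
    have N: "N \<noteq> 0" "\<nu> N = 0" "\<iota> N = c * bar c" using nu_norm[of c] c by (auto simp: N_def norm_emb)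
    obtain h where h: "h \<noteq> 0" "\<nu> h = 0" "psiF S h \<noteq> 1" using psi_test_elt by blast
    \<comment> \<open>If c is a unit, conjugation by x moves the entry n of
      \<open>up \<beta>\<close> to the lower left corner as c n times the conjugate of c, where it
      meets the dominant entry u0 of X. This \<beta> makes the pairing equal to h; all other terms
      of the trace have positive valuation.\<close>
    define \<beta> where "\<beta> = h / (u0 * (\<epsilon> * N))"
    have b: "geF d \<beta>" using h N u0 by (simp add: \<beta>_def geF_def nu_divide nu_mult)
    define n where "n = \<iota> \<beta> * \<sigma>"
    have n: "ge d n" using b by (simp add: n_def)
    have u: "up \<beta> - mat 1 \<in> L 0 d" unfolding up_L using b by simp
    have uG: "up \<beta> \<in> Gyr S 0 d" using u up_G by (simp add: Gyr_iff)
    have sub: "Gyr S 0 d \<subseteq> Jd S d"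
      unfolding Jd' using d1 by (auto simp: Gyr_iff L_iff elim!: ge_mono)
    have xu: "x ** up \<beta> ** matrix_inv x \<in> Gyr S 0 d" using Gyr_normal[of x 0, OF _ uG] x by (simp add: K_eq)
    have P: "Psi S X (x ** up \<beta> ** matrix_inv x) = Psi S X (up \<beta>)"
      by (rule int) (use uG xu sub in auto)
    have e1: "x ** up \<beta> ** matrix_inv x - mat 1 = x ** (up \<beta> - mat 1) ** matrix_inv x"
      using g(1) by (simp add: matrix_diff_ldistrib matrix_diff_rdistrib)
    have tr: "trace (X ** (x ** up \<beta> ** matrix_inv x - mat 1)) =
      \<iota> u0 * \<sigma> * (c * n * bar c) + \<iota> z0 * \<sigma> * (a * n * bar c) + \<iota> z0 * \<sigma> * (c * n * bar a) + \<iota> v0 * \<sigma> * (a * n * bar a)"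
      unfolding e1 unfolding m unitary_inv[OF g(1)[unfolded m]]
      by (simp add: X_def up_def mat2_one n_def algebra_simps)
    have gz: "ge (1 - d) (\<iota> z0 * \<sigma>)" "ge (1 - d) (\<iota> v0 * \<sigma>)" using z0 v0 u0 by (auto simp: geF_def)
    have t: "ge d (p * n * q)" if "ge 0 p" "ge 0 q" for p q
      by (rule ge_mult[OF ge_mult[OF that(1) n, of d] that(2)]) simp_all
    have "ge 1 (trace (X ** (x ** up \<beta> ** matrix_inv x - mat 1)) - \<iota> u0 * \<sigma> * (c * n * bar c))"
    proof -
      have "ge 1 (\<iota> z0 * \<sigma> * (a * n * bar c))" "ge 1 (\<iota> z0 * \<sigma> * (c * n * bar a))" "ge 1 (\<iota> v0 * \<sigma> * (a * n * bar a))"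
        by (rule ge_mult[OF gz(1) t] ge_mult[OF gz(2) t]; use g in simp)+
      then have "ge 1 (\<iota> z0 * \<sigma> * (a * n * bar c) + \<iota> z0 * \<sigma> * (c * n * bar a) + \<iota> v0 * \<sigma> * (a * n * bar a))"
        by (intro ge_add)
      then show ?thesis unfolding tr by (simp add: algebra_simps)
    qed
    then have "Psi S X (x ** up \<beta> ** matrix_inv x) = psiE S (\<iota> u0 * \<sigma> * (c * n * bar c))"
      unfolding Psi_def using psiE_cong by simp
    also have "\<iota> u0 * \<sigma> * (c * n * bar c) = \<iota> (u0 * (\<epsilon> * N) * \<beta>)"
      using N(3) sigma_sq by (simp add: n_def ac_simps)
    also have "u0 * (\<epsilon> * N) * \<beta> = h" using u0 N by (simp add: \<beta>_def)
    finally have "Psi S X (x ** up \<beta> ** matrix_inv x) = psiF S h" by (simp add: psiE_re)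
    \<comment> \<open>Without conjugation the entry of \<open>up \<beta>\<close> meets only v0,
      whose valuation exceeds -d.\<close>
    moreover have "Psi S X (up \<beta>) = 1" unfolding Psi_up
      by (rule psiE_triv[of 1]) (use ge_mult[OF gz(2) n, of 1] in \<open>simp_all add: X_def n_def\<close>)
    ultimately show False using P h by simp
  qed
  then show ?thesis using K_Iw x by (simp add: m)
qed

lemma intertwine_B:
  assumes x: "x \<in> K" and int: "\<And>m. m \<in> Jd S d \<Longrightarrow> x ** m ** matrix_inv x \<in> Jd S d \<Longrightarrow> Psi S X (x ** m ** matrix_inv x) = Psi S X m"
  shows "x \<in> B"
proof -
  have xI: "x \<in> Gyr S (1/4) 0" by (rule intertwine_Iw[OF assms])
  obtain a b c e where m: "x = mat2 a b c e" by (rule mat2_cases)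
  have g: "x \<in> G" "ge 0 a" "ge 0 b" "ge 1 c" "ge 0 e" using xI by (auto simp: m Iw_iff)
  \<comment> \<open>The intertwining condition says exactly that this skew matrix pairs trivially
    with \<open>Jd S d\<close>. Testing it on \<open>up\<close>, \<open>lo\<close> and
    \<open>dg\<close> bounds its entries.\<close>
  define Y where "Y = matrix_inv x ** X ** x - X"
  have Ysk: "skew Y" unfolding Y_def by (rule skew_diff[OF skew_conj[OF X_skew g(1)] X_skew])
  have "matrix_inv x \<in> Gyr S (1/4) 0" by (rule subgroup_inv[OF subgroup_Gyr xI]) simp
  then have "matrix_inv x ** X ** x \<in> L (1/4) (1/4 - d)" using conj_L[of "matrix_inv x" "1/4" X] X_L(1) g(1) by simp
  then have YL: "Y \<in> L (1/4) (1/4 - d)" unfolding Y_def by (rule L_diff[OF _ X_L(1)])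
  have triv: "Psi S Y j = 1" if j: "j \<in> Jd S d" for j
  proof -
    have "Psi S (matrix_inv x ** X ** x) j = Psi S X j"
      using int[OF j Iw_norm[OF xI j]] Psi_conj[OF g(1)] by simp
    moreover have "Psi S (matrix_inv x ** X ** x) j = Psi S Y j * Psi S X j"
      using Psi_add[of Y X j] by (simp add: Y_def)
    ultimately show ?thesis by simp
  qed
  have i21: "bar (Y $ 2 $ 1) = - Y $ 2 $ 1" and i12: "bar (Y $ 1 $ 2) = - Y $ 1 $ 2" using Ysk by (auto simp: skew_def)
  have "im (Y $ 2 $ 1) = 0 \<or> - (d/2 - 1/4) < real_of_int (\<nu> (im (Y $ 2 $ 1)))"
  proof (rule psi_dual_F[of \<epsilon>])
    fix \<beta> assume "geF (d/2 - 1/4) \<beta>"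
    then have "up \<beta> \<in> Jd S d" unfolding Jd' Gyr_iff up_L using up_G by simp
    from triv[OF this] show "psiF S (\<epsilon> * (im (Y $ 2 $ 1) * \<beta>)) = 1" by (simp only: Psi_up psiE_imag[OF i21])
  qed auto
  moreover have "im (Y $ 1 $ 2) = 0 \<or> - (d/2 + 1/4) < real_of_int (\<nu> (im (Y $ 1 $ 2)))"
  proof (rule psi_dual_F[of \<epsilon>])
    fix \<beta> assume "geF (d/2 + 1/4) \<beta>"
    then have "lo \<beta> \<in> Jd S d" unfolding Jd' Gyr_iff lo_L using lo_G by simp
    from triv[OF this] show "psiF S (\<epsilon> * (im (Y $ 1 $ 2) * \<beta>)) = 1" by (simp only: Psi_lo psiE_imag[OF i12])
  qed auto
  moreover have "Y $ 1 $ 1 = 0 \<or> - (d/2) < real_of_int (ve (Y $ 1 $ 1))"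
  proof (rule psi_dual_E)
    fix \<delta> assume de: "ge (d/2) \<delta>"
    have "dg \<delta> \<in> Jd S d" unfolding Jd' Gyr_iff using dg_G[OF de] dg_L[OF de] d by simp
    then show "psiF S (2 * re (Y $ 1 $ 1 * \<delta>)) = 1"
      using triv Psi_dg[OF Ysk de, of "1/4 - d"] YL d by (simp add: L_iff)
  qed
  moreover have "Y $ 2 $ 1 = \<iota> (im (Y $ 2 $ 1)) * \<sigma>" "Y $ 1 $ 2 = \<iota> (im (Y $ 1 $ 2)) * \<sigma>" by (rule imag_E[OF i21] imag_E[OF i12])+
  ultimately have Yb: "Y $ 2 $ 1 = 0 \<or> - (d/2 - 1/4) < real_of_int (ve (Y $ 2 $ 1))"
    "Y $ 1 $ 2 = 0 \<or> - (d/2 + 1/4) < real_of_int (ve (Y $ 1 $ 2))" "Y $ 1 $ 1 = 0 \<or> - (d/2) < real_of_int (ve (Y $ 1 $ 1))"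
    by (metis (no_types) emb_eq_0 mult_eq_0_iff sigma_nonzero ve_emb ve_mult ve_sigma add_0_right)+
  obtain dn where dn: "d = real_of_int dn" using d_int Ints_cases by auto
  \<comment> \<open>Twice a valuation and d are integers, so a strict inequality between them gains
    1, that is 1/2 after halving. \<open>Z2\<close> is the same rounding for the upper right
    entry.\<close>
  have Z: "ge (1/2 - d/2) y" if "y = 0 \<or> - (d/2) < real_of_int (ve y)" for y
  proof (cases "y = 0")
    case False
    then have "real_of_int (- dn) < real_of_int (2 * ve y)" using that dn by simp
    then have "- dn + 1 \<le> 2 * ve y" unfolding of_int_less_iff by simp
    then have "real_of_int (- dn + 1) \<le> real_of_int (2 * ve y)" unfolding of_int_le_iff .
    then show ?thesis using dn by (simp add: ge_def)
  qed simp
  have Z2: "ge (- d/2) y" if "y = 0 \<or> - (d/2 + 1/4) < real_of_int (ve y)" for y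
  proof (cases "y = 0")
    case False
    then have "real_of_int (- dn - 1) < real_of_int (2 * ve y)" using that dn by simp
    then have "- dn \<le> 2 * ve y" unfolding of_int_less_iff by simp
    then have "real_of_int (- dn) \<le> real_of_int (2 * ve y)" unfolding of_int_le_iff .
    then show ?thesis using dn by (simp add: ge_def)
  qed simp
  have Y22: "Y $ 2 $ 2 = - bar (Y $ 1 $ 1)" using Ysk by (simp add: skew_def)
  have "Y \<in> L (1/4) (1/4 - d/2)" unfolding L_iff Y22
    using Z[of "Y $ 1 $ 1"] Z[of "Y $ 2 $ 1"] Z2[of "Y $ 1 $ 2"] Yb by (auto elim: ge_mono)
  then have "x ** Y \<in> L (1/4) (1/4 - d/2)" using L_mult[of x "1/4" 0 Y "1/4 - d/2"] xI by (simp add: Gyr_0_iff)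
  moreover have "x ** Y = X ** x - x ** X" using g(1) by (simp add: Y_def matrix_diff_ldistrib gassoc)
  ultimately have D: "X ** x - x ** X \<in> L (1/4) (1/4 - d/2)" by simp
  \<comment> \<open>The upper two entries of the commutator, in which the terms with z0 cancel.
    Division by u0 gains depth d and shows x to be close to the shape of an element commuting with
    X.\<close>
  have D1: "ge (1/4 - d/2) (\<iota> u0 * \<sigma> * (c - b * \<iota> w))" and D2: "ge (- d/2) (\<iota> u0 * \<sigma> * (e - a))"
    using D u0(1) unfolding m X_def by (simp_all add: L_mat2 algebra_simps)
  have sc: "ge \<rho> (\<iota> u0 * \<sigma> * y) \<longleftrightarrow> ge (\<rho> + d) y" for \<rho> y
    using u0 by (cases "y = 0") (auto simp: ge_def ve_mult)
  have cw: "ge (d/2 + 1/4) (c - b * \<iota> w)" by (rule ge_mono[OF iffD1[OF sc D1]]) simp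
  have ea: "ge (d/2) (e - a)" by (rule ge_mono[OF iffD1[OF sc D2]]) simp
  define n where "n = a * bar a + b * bar b * \<iota> w"
  have un: "bar a * e + bar c * b = 1" and row: "a * bar b + b * bar a = 0" using g(1) unitary_iff unitary_rows m by auto
  have "n - 1 = bar a * (a - e) - b * bar (c - b * \<iota> w)"
    using un by (simp add: n_def algebra_simps)
  moreover have "ge (d/2) (bar a * (a - e))" using ea g by (intro ge_mult[of 0 _ "d/2"]) (auto simp: ge_diff_commute)
  moreover have "ge (d/2) (b * bar (c - b * \<iota> w))" by (rule ge_mult[of 0 _ "d/2+1/4"]) (use cw g in \<open>simp_all del: bar_diff\<close>)
  ultimately have n1: "ge (d/2) (n - 1)" by (simp add: ge_diff)
  have nr: "n = \<iota> (re n)"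
  proof -
    have "bar n = n" by (simp add: n_def ac_simps)
    then have "im n = 0" unfolding real_iff .
    then show ?thesis by (intro E_eqI) simp_all
  qed
  have "ge (d/2) (\<iota> (re n - 1))" using n1 nr by (metis emb_1 emb_diff)
  then have gn: "geF (d/2) (re n - 1)" by (simp only: ge_emb)
  have dp: "0 < d/2" using d by simp
  obtain s where s0: "geF (d/2) (s - 1)" and s: "s * s = 1 + (re n - 1)" "s \<noteq> 0" "geF (d/2) (inverse s - 1)" "geF 0 (inverse s)"
    by (rule geF_sqrt[OF gn dp])
  define \<mu> where "\<mu> = \<iota> (inverse s)"
  have mu: "ge (d/2) (\<mu> - 1)" "ge 0 \<mu>" "bar \<mu> = \<mu>"
    using s(3,4) by (simp_all add: \<mu>_def del: emb_inverse flip: emb_1 emb_diff)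
  have mun: "\<mu> * \<mu> * n = 1"
  proof -
    have "s * s = re n" using s(1) by simp
    then have "n = \<iota> (s * s)" using nr by metis
    moreover have "\<mu> * \<iota> s = 1" using s(2) by (simp add: \<mu>_def)
    then have "(\<mu> * \<iota> s) * (\<mu> * \<iota> s) = 1" by simp
    ultimately show ?thesis by (simp add: ac_simps)
  qed
  \<comment> \<open>The rescaled matrix is unitary and commutes with X: an element of
    \<open>TX S X\<close> that agrees with x to the precision of \<open>Jd S d\<close>.\<close>
  define \<tau> where "\<tau> = mat2 (\<mu> * a) (\<mu> * b) (\<mu> * b * \<iota> w) (\<mu> * a)"
  have tG: "\<tau> \<in> G" unfolding \<tau>_def unitary_iff
  proof (intro conjI)
    show "bar (\<mu> * a) * (\<mu> * b * \<iota> w) + bar (\<mu> * b * \<iota> w) * (\<mu> * a) = 0"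
    proof -
      have "bar (\<mu> * a) * (\<mu> * b * \<iota> w) + bar (\<mu> * b * \<iota> w) * (\<mu> * a) = \<mu> * \<mu> * \<iota> w * (a * bar b + b * bar a)"
        using mu(3) by (simp add: algebra_simps add_divide_distrib)
      then show ?thesis using row by simp
    qed
    show "bar (\<mu> * b) * (\<mu> * a) + bar (\<mu> * a) * (\<mu> * b) = 0"
    proof -
      have "bar (\<mu> * b) * (\<mu> * a) + bar (\<mu> * a) * (\<mu> * b) = \<mu> * \<mu> * (a * bar b + b * bar a)"
        using mu(3) by (simp add: algebra_simps)
      then show ?thesis using row by simp
    qed
    show "bar (\<mu> * a) * (\<mu> * a) + bar (\<mu> * b * \<iota> w) * (\<mu> * b) = 1"
      using mun mu(3) by (simp add: n_def algebra_simps)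
  qed
  note wg = wE
  have tI: "\<tau> \<in> Gyr S (1/4) 0" using tG unfolding \<tau>_def Iw_iff
    using g mu(2) wg by (auto simp del: emb_divide intro!: ge_mult[of 0 _ 0 _ 0] ge_mult[of 0 _ 1 _ 1])
  have tK: "\<tau> \<in> TX S X" using Iw_K[OF tI] u0(1) unfolding TX_def \<tau>_def X_def by (simp add: algebra_simps)
  have "x - \<tau> \<in> L (1/4) (d/2)"
  proof -
    have 1: "ge (d/2) (y - \<mu> * y)" if "ge 0 y" for y
    proof -
      have "y - \<mu> * y = - ((\<mu> - 1) * y)" by (simp add: algebra_simps)
      then show ?thesis using ge_mult[OF mu(1) that, of "d/2"] by simp
    qed
    have 2: "e - \<mu> * a = (e - a) + (a - \<mu> * a)" by simp
    have 3: "c - \<mu> * b * \<iota> w = (c - b * \<iota> w) + (b - \<mu> * b) * \<iota> w"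
      by (simp add: algebra_simps del: emb_divide)
    have "ge (d/2) (e - \<mu> * a)" unfolding 2 by (rule ge_add[OF ea 1[OF g(2)]])
    moreover have "ge (d/2 + 1/4) (c - \<mu> * b * \<iota> w)" unfolding 3
      by (rule ge_add[OF cw ge_mult[OF 1[OF g(3)] wg]]) simp
    ultimately show ?thesis unfolding m \<tau>_def using 1[OF g(2)] ge_mono[OF 1[OF g(3)], of "d/2 - 1/4"] by (simp add: L_mat2)
  qed
  then have "matrix_inv \<tau> ** x \<in> Jd S d" unfolding Jd' by (rule Gyr_close(1)[OF tI g(1)])
  then have "\<tau> ** (matrix_inv \<tau> ** x) \<in> B" unfolding B_def set_prod_def using tK by blast
  then show ?thesis using tG by simp
qed

lemma S_irreducible: "irreducible_rep S K (smooth_Ind S K B (char_rep \<Psi>))"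
proof -
  interpret I: ind_data S B "char_rep \<Psi>" "d + 1" by (rule ind_B)
  show ?thesis
  proof (rule I.Ind_irreducible[OF irr_char Jd_sub J_B])
    show "ract (char_rep \<Psi>) m v = rscale (char_rep \<Psi>) (Psi S X m) v" if "m \<in> Jd S d" for m v
      using Psi_ext_J[OF that] by (simp add: char_rep_def)
    show "\<exists>m\<in>Jd S d. x ** m ** matrix_inv x \<in> Jd S d \<and> Psi S X (x ** m ** matrix_inv x) \<noteq> Psi S X m"
      if "x \<in> K" "x \<notin> B" for x
      using intertwine_B[OF that(1)] that(2) by blast
  qed
qed

lemma S_rep_eq: "S_rep S d X \<zeta> = smooth_Ind S K B (char_rep \<Psi>)"
  by (simp add: S_rep_def B_def)

lemma S_param: "S_param S d X \<zeta>"
  unfolding S_param_def using d d_int u0 z0 v0 zeta by (auto simp: X_def)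

end

subsection \<open>Tori and generic elements\<close>

text \<open>The conditions on the torus are weaker than \<open>torus_point\<close>, so that conjugates of a datum by
  \<open>alpha S t\<close> and by \<open>wmat\<close>, whose points \<open>y\<close> are different, are again instances.\<close>

locale generic_datum = u11 S for S :: "('f::field, 'e::field) setting" +
  fixes \<gamma>1 \<gamma>2 :: 'f and y r :: real and u v :: 'f and \<phi> :: "'e ^ 2 ^ 2 \<Rightarrow> complex"
  assumes gam: "\<gamma>1 \<noteq> 0" "\<gamma>2 \<noteq> 0" "real_of_int (nu S \<gamma>2) - real_of_int (nu S \<gamma>1) = 2 * y"
      "\<gamma>1 * \<gamma>2 = 1 \<or> nu S (\<gamma>1 * \<gamma>2) = 1"
    and r: "0 < r"
    and uv: "u = 0 \<or> - r \<le> real_of_int (nu S u)" "v \<noteq> 0" "real_of_int (nu S (v * \<gamma>1)) = - r - y"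
    and phi: "smooth_char S (torus S \<gamma>1 \<gamma>2) \<phi>"
      "\<And>t. t \<in> torus_r_plus S \<gamma>1 \<gamma>2 y (r / 2) \<Longrightarrow> \<phi> t = Psi S (Gamma_elt S \<gamma>1 \<gamma>2 u v) t"
begin

abbreviation "\<Gamma> \<equiv> Gamma_elt S \<gamma>1 \<gamma>2 u v"
abbreviation "T \<equiv> torus S \<gamma>1 \<gamma>2"
abbreviation "s \<equiv> r / 2"
abbreviation "H \<equiv> Gyr S y s"
abbreviation "Hp \<equiv> Gyr_plus S y s"
abbreviation "J \<equiv> inducing_group S \<gamma>1 \<gamma>2 y r"

lemma T_iff: "t \<in> T \<longleftrightarrow> t \<in> G \<and> (\<exists>a b. t = mat2 a (b * \<iota> \<gamma>1) (b * \<iota> \<gamma>2) a)"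
  by (auto simp: torus_def)

lemma T_G: "T \<subseteq> G" by (auto simp: T_iff)

lemma T_iff2: "mat2 a b c e \<in> T \<longleftrightarrow> mat2 a b c e \<in> G \<and> e = a \<and> c * \<iota> \<gamma>1 = b * \<iota> \<gamma>2"
proof
  assume A: "mat2 a b c e \<in> G \<and> e = a \<and> c * \<iota> \<gamma>1 = b * \<iota> \<gamma>2"
  then have "mat2 a b c e = mat2 a ((b / \<iota> \<gamma>1) * \<iota> \<gamma>1) ((b / \<iota> \<gamma>1) * \<iota> \<gamma>2) a" using gam by (simp add: field_simps)
  then show "mat2 a b c e \<in> T" using A unfolding T_iff by blast
qed (auto simp: T_iff)

lemma T_sub: "mat_subgroup T"
proof (rule subgroupI[OF T_G])
  show "mat 1 \<in> T" using G_one unfolding mat2_one T_iff2 by simp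
  fix x assume x: "x \<in> T"
  obtain a b c e where m: "x = mat2 a b c e" by (rule mat2_cases)
  have x': "x \<in> G" "e = a" "c * \<iota> \<gamma>1 = b * \<iota> \<gamma>2" using x unfolding m T_iff2 by auto
  have bc: "bar c * \<iota> \<gamma>1 = bar b * \<iota> \<gamma>2" using arg_cong[OF x'(3), of bar] by simp
  show "matrix_inv x \<in> T" using x' bc G_inv[OF x'(1)] unfolding m by (simp add: unitary_inv T_iff2)
  fix z assume z: "z \<in> T"
  obtain a' b' c' e' where mz: "z = mat2 a' b' c' e'" by (rule mat2_cases)
  have z': "z \<in> G" "e' = a'" "c' * \<iota> \<gamma>1 = b' * \<iota> \<gamma>2" using z unfolding mz T_iff2 by auto
  have "(c * b') * \<iota> \<gamma>1 = (b * c') * \<iota> \<gamma>1"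
    using x'(3) z'(3) by (metis (no_types, lifting) mult.assoc mult.commute)
  then have cb: "c * b' = b * c'" using gam by simp
  have "(c * a' + a * c') * \<iota> \<gamma>1 = (a * b' + b * a') * \<iota> \<gamma>2"
    using x'(3) z'(3) by (simp add: algebra_simps)
  then show "x ** z \<in> T" using G_mult[OF x'(1) z'(1)] x'(2) z'(2) cb unfolding m mz mat2_mult T_iff2
    by (simp add: algebra_simps)
qed

lemma T_comm: assumes "t \<in> T" shows "t ** \<Gamma> = \<Gamma> ** t"
proof -
  obtain a b c e where m: "t = mat2 a b c e" by (rule mat2_cases)
  have x': "e = a" "c * \<iota> \<gamma>1 = b * \<iota> \<gamma>2" using assms unfolding m T_iff2 by auto
  then show ?thesis unfolding m Gamma_elt_def by (simp add: algebra_simps)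
qed

text \<open>T is anisotropic and fixes the point y. Unitarity says that the norm of a plus \<gamma>1
  * \<gamma>2 times the norm of b is 1. If \<gamma>1 * \<gamma>2 = 1, then a + b and a - b have norm
  1; otherwise the two terms have valuations of different parity and cannot cancel.\<close>

lemma T_L0: "T \<subseteq> Gyr S y 0"
proof
  fix t assume t: "t \<in> T"
  then obtain a b where m: "t = mat2 a (b * \<iota> \<gamma>1) (b * \<iota> \<gamma>2) a" and G: "t \<in> G" unfolding T_iff by blast
  have un: "bar a * (b * \<iota> \<gamma>2) + bar (b * \<iota> \<gamma>2) * a = 0" "bar a * a + bar (b * \<iota> \<gamma>2) * (b * \<iota> \<gamma>1) = 1"
    using G unfolding m unitary_iff by auto
  have "\<iota> \<gamma>2 * (bar a * b + bar b * a) = 0" using un(1) by (simp add: algebra_simps)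
  then have tr: "bar a * b + bar b * a = 0" using gam by simp
  have "\<iota> (normE S a + normE S b * (\<gamma>1 * \<gamma>2)) = 1" using un(2) by (simp add: norm_emb algebra_simps)
  then have "\<iota> (normE S a + normE S b * (\<gamma>1 * \<gamma>2)) = \<iota> 1" by simp
  then have nn: "normE S a + normE S b * (\<gamma>1 * \<gamma>2) = 1" unfolding emb_eq .
  have nm: "\<nu> (\<gamma>1 * \<gamma>2) = \<nu> \<gamma>1 + \<nu> \<gamma>2" using gam nu_mult by simp
  have key: "ge 0 a \<and> ge 0 b \<and> - y \<le> real_of_int (\<nu> \<gamma>1) \<and> y \<le> real_of_int (\<nu> \<gamma>2)"
  proof (cases "\<gamma>1 * \<gamma>2 = 1")
    case True
    have p: "(a + b) * bar (a + b) = 1" "(a - b) * bar (a - b) = 1"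
    proof -
      have "a * bar a + b * bar b = 1" using un(2) True by (simp add: algebra_simps flip: emb_mult)
      moreover have "(a + b) * bar (a + b) = (a * bar a + b * bar b) + (bar a * b + bar b * a)"
        "(a - b) * bar (a - b) = (a * bar a + b * bar b) - (bar a * b + bar b * a)" by (simp_all add: algebra_simps)
      ultimately show "(a + b) * bar (a + b) = 1" "(a - b) * bar (a - b) = 1" using tr by simp_all
    qed
    have one: "ge 0 x" if "x * bar x = 1" for x
    proof -
      have "x \<noteq> 0" using that by auto
      then have "ve x + ve x = ve 1" using ve_mult[of x "bar x"] that by simp
      then show ?thesis by (simp add: ge_def)
    qed
    have two: "ge 0 (inverse 2)" using ve_inverse[of 2] by (simp add: ge_def)
    have "a = ((a + b) + (a - b)) * inverse 2" "b = ((a + b) - (a - b)) * inverse 2" by (simp_all add: field_simps)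
    moreover have "ge 0 (((a + b) + (a - b)) * inverse 2)" "ge 0 (((a + b) - (a - b)) * inverse 2)"
      using ge_mult[OF ge_add[OF one[OF p(1)] one[OF p(2)]] two, of 0] ge_mult[OF ge_diff[OF one[OF p(1)] one[OF p(2)]] two, of 0]
      by simp_all
    moreover have "\<nu> \<gamma>1 + \<nu> \<gamma>2 = 0" using True nm by simp
    then have "real_of_int (\<nu> \<gamma>1) + real_of_int (\<nu> \<gamma>2) = 0" by (metis of_int_0 of_int_add)
    ultimately show ?thesis using gam(3) by (auto simp: ge_def)
  next
    case False
    then have k1: "\<nu> (\<gamma>1 * \<gamma>2) = 1" using gam(4) by simp
    have "ge 0 a \<and> ge 0 b"
    proof (cases "a = 0 \<or> b = 0")
      case True
      have False if "a = 0"
      proof -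
        have "normE S a = 0" using that norm_emb[of a] by simp
        then have e: "normE S b * (\<gamma>1 * \<gamma>2) = 1" using nn by simp
        then have "b \<noteq> 0" using norm_emb[of b] by auto
        then have "2 * ve b + 1 = 0" using nu_mult[of "normE S b" "\<gamma>1 * \<gamma>2"] nu_norm[of b] gam e k1 by simp
        then show False by presburger
      qed
      then have b: "b = 0" "a \<noteq> 0" using True by auto
      then have "normE S b = 0" using norm_emb[of b] by simp
      then have "normE S a = 1" using nn by simp
      then show ?thesis using b nu_norm[of a] by (simp add: ge_def)
    next
      case False
      have na: "normE S a \<noteq> 0" "\<nu> (normE S a) = 2 * ve a" using nu_norm False by auto
      have nb: "normE S b * (\<gamma>1 * \<gamma>2) \<noteq> 0" "\<nu> (normE S b * (\<gamma>1 * \<gamma>2)) = 2 * ve b + 1"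
        using nu_norm[of b] False gam k1 nu_mult[of "normE S b" "\<gamma>1 * \<gamma>2"] by auto
      have "\<nu> (normE S a) \<noteq> \<nu> (normE S b * (\<gamma>1 * \<gamma>2))" unfolding na nb by presburger
      then consider "\<nu> (normE S a) < \<nu> (normE S b * (\<gamma>1 * \<gamma>2))" | "\<nu> (normE S b * (\<gamma>1 * \<gamma>2)) < \<nu> (normE S a)" by linarith
      then show ?thesis
      proof cases
        case 1
        then have "\<nu> (normE S a) = 0" using nu_add_eq[of "normE S a" "normE S b * (\<gamma>1 * \<gamma>2)"] na nb nn by simp
        then show ?thesis using 1 na nb by (auto simp: ge_def)
      next
        case 2
        then have "\<nu> (normE S b * (\<gamma>1 * \<gamma>2)) = 0"
          using nu_add_eq[of "normE S b * (\<gamma>1 * \<gamma>2)" "normE S a"] na nb nn by (simp add: add.commute)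
        then show ?thesis using nb(2) by presburger
      qed
    qed
    moreover have "real_of_int (\<nu> \<gamma>1) + real_of_int (\<nu> \<gamma>2) = 1" using k1 nm by (metis of_int_1 of_int_add)
    ultimately show ?thesis using gam(3) by auto
  qed
  have "ge (- y) (\<iota> \<gamma>1)" "ge y (\<iota> \<gamma>2)" using key by (simp_all add: geF_def)
  then have "t \<in> L y 0" unfolding m L_mat2 using key by (auto intro: ge_mult[of 0 _ "-y"] ge_mult[of 0 _ y])
  then show "t \<in> Gyr S y 0" using G by (simp add: Gyr_0_iff)
qed

lemma Gamma_L: "\<Gamma> \<in> L y (- r)"
proof -
  have v1: "real_of_int (\<nu> v) + real_of_int (\<nu> \<gamma>1) = - r - y" using uv(2,3) gam by (simp add: nu_mult)
  have "geF (- r) u" "geF (- r - y) (v * \<gamma>1)" "geF (- r + y) (v * \<gamma>2)"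
    using uv gam v1 by (auto simp: geF_def nu_mult)
  then have g: "ge (- r) (\<iota> u)" "ge (- r - y) (\<iota> (v * \<gamma>1))" "ge (- r + y) (\<iota> (v * \<gamma>2))" by (simp_all only: ge_emb)
  then show ?thesis unfolding Gamma_elt_def L_mat2 by simp
qed

text \<open>The quadratic error has depth -r + s + s' with s' > s. For two factors of depth exactly
  s it has depth 0 and may survive, which is the origin of the Heisenberg representation.\<close>

lemma Psi_Hp: assumes "g \<in> H" "h \<in> Hp" shows "Psi S \<Gamma> (g ** h) = Psi S \<Gamma> g * Psi S \<Gamma> h"
    "Psi S \<Gamma> (h ** g) = Psi S \<Gamma> h * Psi S \<Gamma> g"
proof -
  obtain s' where "s' > s" "h \<in> Gyr S y s'" using assms(2) by (auto simp: Gyr_plus_iff)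
  then show "Psi S \<Gamma> (g ** h) = Psi S \<Gamma> g * Psi S \<Gamma> h" "Psi S \<Gamma> (h ** g) = Psi S \<Gamma> h * Psi S \<Gamma> g"
    using Psi_mult[OF Gamma_L, of g s h s'] Psi_mult[OF Gamma_L, of h s' g s] assms(1) by (auto simp: Gyr_iff)
qed

lemma s_pos: "0 < s" using r by simp

lemma H_sub: "mat_subgroup H" by (rule subgroup_Gyr) (use r in simp)
lemma Hp_sub: "mat_subgroup Hp" by (rule subgroup_Gyr_plus) (use r in simp)
lemma Hp_H: "Hp \<subseteq> H" by (rule Gyr_plus_subset)
lemma H_G: "H \<subseteq> G" using Gyr_G by blast
lemma Hp_G: "Hp \<subseteq> G" using H_G Hp_H by blast
lemma H_L0: "H \<subseteq> Gyr S y 0" by (rule Gyr_antimono) (use r in simp)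

lemma T_norm_H: "t \<in> T \<Longrightarrow> h \<in> H \<Longrightarrow> t ** h ** matrix_inv t \<in> H"
  using T_L0 Gyr_normal by blast

lemma J_eq: "J = set_prod H T" "J = set_prod T H"
  using subgroup_set_prod(2)[OF T_sub T_G H_sub H_G T_norm_H] by (simp_all add: inducing_group_def)

lemma J_sub: "mat_subgroup J"
  unfolding J_eq(2) by (rule subgroup_set_prod(1)[OF T_sub T_G H_sub H_G T_norm_H])

lemma J_L0: "J \<subseteq> Gyr S y 0"
  using subgroup_mult[OF subgroup_Gyr[of 0 y]] T_L0 H_L0 unfolding J_eq(1) set_prod_def by blast

lemma J_G: "J \<subseteq> G" using J_L0 Gyr_G by blast

lemma H_J: "H \<subseteq> J"
proof
  fix h assume "h \<in> H"
  then have "h ** mat 1 \<in> J" unfolding J_eq(1) set_prod_def using subgroup_one[OF T_sub] by blast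
  then show "h \<in> J" by simp
qed

lemma T_J: "T \<subseteq> J"
proof
  fix h assume "h \<in> T"
  then have "mat 1 ** h \<in> J" unfolding J_eq(1) set_prod_def using subgroup_one[OF H_sub] by blast
  then show "h \<in> J" by simp
qed

lemma Gyr_0_sub: "a + \<bar>b\<bar> \<le> n \<Longrightarrow> Gyr S 0 n \<subseteq> Gyr S b a"
  by (auto simp: Gyr_iff L_iff elim!: ge_mono)

lemma Gyr_J: "Gyr S 0 (s + \<bar>y\<bar>) \<subseteq> J"
  using Gyr_0_sub[of s y] H_J by auto

lemma phi_one: "\<phi> (mat 1) = 1" and phi_mult: "a \<in> T \<Longrightarrow> b \<in> T \<Longrightarrow> \<phi> (a ** b) = \<phi> a * \<phi> b"
  using phi(1) by (auto simp: smooth_char_def)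

lemma unit_diag: assumes "mat2 a b c e \<in> Gyr S z q" "0 < q" shows "a \<noteq> 0" "ve a = 0" "e \<noteq> 0" "ve e = 0"
proof -
  have "ge q (a - 1)" "ge q (e - 1)" using assms(1) by (auto simp: Gyr_iff mat2_one L_mat2)
  then show "a \<noteq> 0" "ve a = 0" "e \<noteq> 0" "ve e = 0"
    using one_plus_unit[of q "a - 1"] one_plus_unit[of q "e - 1"] assms(2) by auto
qed

text \<open>Every small imaginary ratio occurs among the torus elements, since
  \<open>1 - \<epsilon> \<gamma>1 \<gamma>2 \<xi>\<^sup>2\<close> is then a square.\<close>

lemma torus_elt:
  assumes q: "bar q = - q" "q = 0 \<or> \<sigma>' - y - real_of_int (\<nu> \<gamma>1) \<le> real_of_int (ve q)" and sg: "0 < \<sigma>'"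
  obtains \<mu> where "bar \<mu> = \<mu>" "ge (2 * \<sigma>') (\<mu> - 1)" "mat2 \<mu> (\<mu> * q * \<iota> \<gamma>1) (\<mu> * q * \<iota> \<gamma>2) \<mu> \<in> T"
    "mat2 \<mu> (\<mu> * q * \<iota> \<gamma>1) (\<mu> * q * \<iota> \<gamma>2) \<mu> \<in> Gyr S y \<sigma>'"
proof -
  define \<xi> where "\<xi> = im q"
  have qx: "q = \<iota> \<xi> * \<sigma>" unfolding \<xi>_def by (rule imag_E[OF q(1)])
  define c0 where "c0 = - (\<epsilon> * \<xi> * \<xi> * \<gamma>1 * \<gamma>2)"
  have c0: "\<iota> c0 = - (q * q * \<iota> \<gamma>1 * \<iota> \<gamma>2)"
    unfolding c0_def qx by (simp add: ac_simps flip: sigma_sq)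
  have "ge (2 * \<sigma>') (\<iota> c0)" unfolding c0 ge_minus_iff
    using q(2) gam by (cases "q = 0") (auto simp: ge_def ve_mult)
  then have gc: "geF (2 * \<sigma>') c0" by (simp only: ge_emb)
  have sp: "0 < 2 * \<sigma>'" using sg by simp
  obtain k where k0: "geF (2 * \<sigma>') (k - 1)" and k: "k * k = 1 + c0" "k \<noteq> 0" "geF (2 * \<sigma>') (inverse k - 1)" "geF 0 (inverse k)"
    by (rule geF_sqrt[OF gc sp])
  define \<mu> where "\<mu> = \<iota> (inverse k)"
  have mu: "ge (2 * \<sigma>') (\<mu> - 1)" "ge 0 \<mu>" "bar \<mu> = \<mu>"
    using k(3,4) by (simp_all add: \<mu>_def del: emb_inverse flip: emb_1 emb_diff)
  have mm: "\<mu> * \<mu> * (1 - q * q * \<iota> \<gamma>1 * \<iota> \<gamma>2) = 1"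
  proof -
    have "1 - q * q * \<iota> \<gamma>1 * \<iota> \<gamma>2 = \<iota> (k * k)" unfolding k(1) using c0 by simp
    moreover have "\<mu> * \<iota> k = 1" using k(2) by (simp add: \<mu>_def)
    then have "(\<mu> * \<iota> k) * (\<mu> * \<iota> k) = 1" by simp
    ultimately show ?thesis by (simp add: ac_simps)
  qed
  define t where "t = mat2 \<mu> (\<mu> * q * \<iota> \<gamma>1) (\<mu> * q * \<iota> \<gamma>2) \<mu>"
  have tG: "t \<in> G" unfolding t_def unitary_iff using mm mu(3) q(1) by (simp add: algebra_simps)
  have tT: "t \<in> T" using tG unfolding T_iff t_def by blast
  have qg: "ge (\<sigma>' - y) (q * \<iota> \<gamma>1)" "ge (\<sigma>' + y) (q * \<iota> \<gamma>2)"
    using q(2) gam by (cases "q = 0"; auto simp: ge_def ve_mult)+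
  have "t - mat 1 \<in> L y \<sigma>'" unfolding t_def mat2_one mat2_diff L_mat2
    using ge_mult[OF mu(2) qg(1), of "\<sigma>' - y"] ge_mult[OF mu(2) qg(2), of "\<sigma>' + y"] ge_mono[OF mu(1), of \<sigma>'] sg
    by (simp add: mult.assoc)
  then have "t \<in> Gyr S y \<sigma>'" using tG by (simp add: Gyr_iff)
  then show ?thesis using that mu tT by (simp add: t_def)
qed

text \<open>Multiplication by a torus element of ratio q turns the upper right entry into a multiple
  of a q \<gamma>1 + b. The solution q is purely imaginary by unitarity of the first row, as
  \<open>torus_elt\<close> requires.\<close>

lemma lower_triangular_gen:
  assumes h: "mat2 a b c e \<in> G" "a \<noteq> 0" "ve a = 0" "ge (\<sigma>' - y) b" "0 < \<sigma>'"
  obtains t where "t \<in> T" "t \<in> Gyr S y \<sigma>'" "(mat2 a b c e ** t) $ 1 $ 2 = 0"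
proof -
  define q where "q = - (b / (a * \<iota> \<gamma>1))"
  have "b * bar a = - (a * bar b)" using unitary_rows(1)[OF h(1)] by (simp add: eq_neg_iff_add_eq_0 add.commute)
  then have bq: "bar q = - q" using h gam by (simp add: q_def field_simps)
  have gq: "q = 0 \<or> \<sigma>' - y - real_of_int (\<nu> \<gamma>1) \<le> real_of_int (ve q)"
    using h gam by (cases "b = 0") (auto simp: q_def ge_def ve_divide ve_mult)
  obtain \<mu> where mu: "mat2 \<mu> (\<mu> * q * \<iota> \<gamma>1) (\<mu> * q * \<iota> \<gamma>2) \<mu> \<in> T"
    "mat2 \<mu> (\<mu> * q * \<iota> \<gamma>1) (\<mu> * q * \<iota> \<gamma>2) \<mu> \<in> Gyr S y \<sigma>'"
    using torus_elt[OF bq gq h(5)] by blast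
  show ?thesis by (rule that[OF mu]) (use h gam in \<open>simp add: q_def\<close>)
qed

lemma lower_triangular:
  assumes h: "h \<in> H" obtains t where "t \<in> T" "t \<in> H" "(h ** t) $ 1 $ 2 = 0"
proof -
  obtain a b c e where m: "h = mat2 a b c e" by (rule mat2_cases)
  have hG: "mat2 a b c e \<in> G" using h H_G m by auto
  have gb: "ge (s - y) b" using h by (simp add: m Gyr_iff mat2_one L_mat2)
  show ?thesis
    using lower_triangular_gen[OF hG unit_diag(1,2)[OF h[unfolded m] s_pos] gb s_pos] that m by blast
qed

end

section \<open>Lower unipotent groups and orthogonality of characters on the residue field\<close>

lemma (in u11) lo_add: "lo \<beta> ** lo \<beta>' = lo (\<beta> + \<beta>')" by (simp add: lo_def algebra_simps)
lemma (in u11) lo_0 [simp]: "lo 0 = mat 1" by (simp add: lo_def mat2_one)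
lemma (in u11) lo_inv: "matrix_inv (lo \<beta>) = lo (- \<beta>)"
  by (rule matrix_inv_eq) (simp add: lo_add)

definition (in u11) LO :: "real \<Rightarrow> ('e ^ 2 ^ 2) set" where "LO \<rho> = lo ` {\<beta>. geF \<rho> \<beta>}"

context u11 begin

lemma geF_minus [simp]: "geF \<rho> (- x) \<longleftrightarrow> geF \<rho> x" by (simp add: geF_def)
lemma geF_mult: "geF \<rho> x \<Longrightarrow> geF \<rho>' z \<Longrightarrow> \<tau> \<le> \<rho> + \<rho>' \<Longrightarrow> geF \<tau> (x * z)"
  by (cases "x = 0 \<or> z = 0") (auto simp: geF_def nu_mult)
lemma geF_mono: "geF \<rho> x \<Longrightarrow> \<rho>' \<le> \<rho> \<Longrightarrow> geF \<rho>' x" by (auto simp: geF_def)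
lemma geF_0 [simp]: "geF \<rho> 0" by (simp add: geF_def)

lemma LO_sub: "mat_subgroup (LO \<rho>)"
proof (rule subgroupI)
  show "LO \<rho> \<subseteq> G" using lo_G by (auto simp: LO_def)
  show "mat 1 \<in> LO \<rho>" unfolding LO_def using lo_0 geF_0 by (metis image_eqI mem_Collect_eq)
qed (auto simp: LO_def lo_add lo_inv intro!: imageI geF_add)

lemma LO_G: "LO \<rho> \<subseteq> G" using lo_G by (auto simp: LO_def)

lemma LO_K: "0 \<le> \<rho> \<Longrightarrow> LO \<rho> \<subseteq> K"
  using lo_G by (auto simp: LO_def K_eq Gyr_iff lo_L elim: geF_mono)

lemma LO_mono: "\<rho>' \<le> \<rho> \<Longrightarrow> LO \<rho> \<subseteq> LO \<rho>'" by (auto simp: LO_def intro: geF_mono)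

lemma LO_finite: assumes "0 \<le> \<rho>" "0 < \<rho>'" shows "finite (coset_of (LO \<rho>') ` LO \<rho>)"
  by (rule finite_cosets[OF LO_sub LO_K[OF assms(1)] LO_sub _ assms(2)]) (auto simp: LO_def Gyr_iff lo_L)

lemma im_lo [simp]: "im (lo \<beta> $ 2 $ 1) = \<beta>" using im_coord[of 0 \<beta>] by (simp add: lo_def)

text \<open>Translation by \<open>lo (h / k)\<close> multiplies the sum by a number different from
  1. The residue field appears as the quotient of \<open>LO 0\<close> by \<open>LO 1\<close>, so
  that \<open>csum\<close> can serve here too.\<close>

lemma csum_orthogonal:
  assumes k: "k \<noteq> 0" "\<nu> k = 0"
  shows "csum (LO 0) (LO 1) (\<lambda>x. psiF S (k * im (x $ 2 $ 1))) = 0"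
proof -
  let ?f = "\<lambda>x. psiF S (k * im (x $ 2 $ 1))"
  obtain h where h: "h \<noteq> 0" "\<nu> h = 0" "psiF S h \<noteq> 1" using psi_test_elt by blast
  have m0: "lo (h / k) \<in> LO 0" using h k by (auto simp: LO_def geF_def nu_divide)
  have s: "LO 1 \<subseteq> LO 0" by (rule LO_mono) simp
  have "?f (m ** x) = ?f m" if "m \<in> LO 0" "x \<in> LO 1" for m x
  proof -
    obtain a b where ab: "m = lo a" "x = lo b" "geF 1 b" using \<open>m \<in> LO 0\<close> \<open>x \<in> LO 1\<close> by (auto simp: LO_def)
    have "geF 1 (k * b)" by (rule geF_mult[of 0 _ 1]) (use ab k in \<open>auto simp: geF_def\<close>)
    then have "psiF S (k * b) = 1" using psiF_triv by (simp add: geF_iff)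
    then show ?thesis by (simp add: ab lo_add distrib_left psiF_add)
  qed
  then have "csum (LO 0) (LO 1) (\<lambda>x. ?f (lo (h / k) ** x)) = csum (LO 0) (LO 1) ?f"
    by (rule csum_shift[OF LO_sub LO_G LO_sub s _ m0])
  moreover have "csum (LO 0) (LO 1) (\<lambda>x. ?f (lo (h / k) ** x)) = csum (LO 0) (LO 1) (\<lambda>x. psiF S h * ?f x)"
    by (rule csum_cong[OF LO_sub s LO_sub]) (use k in \<open>auto simp: LO_def lo_add distrib_left psiF_add\<close>)
  moreover have "csum (LO 0) (LO 1) (\<lambda>x. psiF S h * ?f x) = psiF S h * csum (LO 0) (LO 1) ?f"
    by (simp add: csum_def sum_distrib_left)
  ultimately have "(psiF S h - 1) * csum (LO 0) (LO 1) ?f = 0" by (simp add: algebra_simps)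
  then show ?thesis using h by simp
qed

end

subsection \<open>Restriction of one Mackey summand\<close>

lemma (in u11) some_coset_in:
  assumes "mat_subgroup U" "U \<subseteq> M" "mat_subgroup M" "C \<in> coset_of U ` M"
  shows "(SOME x. x \<in> C) \<in> M"
proof -
  obtain m where m: "m \<in> M" "C = coset_of U m" using assms(4) by blast
  obtain z where z: "z \<in> U" "(SOME x. x \<in> C) = m ** z" using some_coset[OF assms(1), of m] m(2) by blast
  have "m ** z \<in> M" by (rule subgroup_mult[OF assms(3) m(1)]) (use z assms(2) in blast)
  then show ?thesis using z by simp
qed

text \<open>The only properties of \<open>\<rho>\<close> that enter. Unlike \<open>is_rho\<close> they pass at once to
  conjugates; \<open>R4\<close> says that the Weil representation contributes nothing on torus elements
  that are central modulo \<open>\<pp>\<close>.\<close>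

locale datum_rep = generic_datum S \<gamma>1 \<gamma>2 y r u v \<phi>
  for S :: "('f::field, 'e::field) setting" and \<gamma>1 \<gamma>2 :: 'f and y r :: real and u v :: 'f
    and \<phi> :: "'e ^ 2 ^ 2 \<Rightarrow> complex" +
  fixes R :: "('e ^ 2 ^ 2, 'v::ab_group_add) rep"
  assumes R1: "srep (inducing_group S \<gamma>1 \<gamma>2 y r) R"
    and R2: "\<And>g x. g \<in> Gyr_plus S y (r/2) \<Longrightarrow> x \<in> rspace R \<Longrightarrow> ract R g x = rscale R (Psi S (Gamma_elt S \<gamma>1 \<gamma>2 u v) g) x"
    and R3: "irr (Gyr S y (r/2)) R"
    and R4: "\<And>t x. t \<in> torus S \<gamma>1 \<gamma>2 \<Longrightarrow> t $ 1 $ 2 = 0 \<or> - y < real_of_int (ve (t $ 1 $ 2)) \<Longrightarrow> x \<in> rspace R \<Longrightarrow>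
      ract R t x = rscale R (\<phi> t) x"

section \<open>The summand at a point y > 0\<close>

locale positive_datum_rep = datum_rep S \<gamma>1 \<gamma>2 y r u v \<phi> R
  for S :: "('f::field, 'e::field) setting" and \<gamma>1 \<gamma>2 :: 'f and y r :: real and u v :: 'f
    and \<phi> :: "'e ^ 2 ^ 2 \<Rightarrow> complex" and R :: "('e ^ 2 ^ 2, 'v::ab_group_add) rep" +
  assumes y: "0 < y"
begin

text \<open>Minus the valuation of the upper right entry of \<open>\<Gamma>\<close>, which dominates
  the others when y > 0; hence the depth seen by \<open>K\<close>.\<close>

definition "d = r + y"
definition "A = K \<inter> J"

lemma d_pos: "0 < d" using r y by (simp add: d_def)

lemma Gamma_eq: "\<Gamma> = mat2 (\<iota> u * \<sigma>) (\<iota> (v * \<gamma>1) * \<sigma>) (\<iota> (v * \<gamma>2) * \<sigma>) (\<iota> u * \<sigma>)"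
  by (simp add: Gamma_elt_def)

lemma TX_eq: "TX S \<Gamma> = K \<inter> T"
proof (intro set_eqI iffI)
  fix x assume "x \<in> K \<inter> T" then show "x \<in> TX S \<Gamma>" using T_comm by (simp add: TX_def)
next
  fix x assume x: "x \<in> TX S \<Gamma>"
  obtain a b c e where m: "x = mat2 a b c e" by (rule mat2_cases)
  have eq: "x ** \<Gamma> = \<Gamma> ** x" and xK: "x \<in> K" using x by (auto simp: TX_def)
  have e1: "\<iota> v * \<sigma> * (b * \<iota> \<gamma>2) = \<iota> v * \<sigma> * (c * \<iota> \<gamma>1)" and e2: "\<iota> v * \<iota> \<gamma>1 * \<sigma> * a = \<iota> v * \<iota> \<gamma>1 * \<sigma> * e"
    using eq unfolding m Gamma_elt_def by (simp_all add: algebra_simps)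
  then have "b * \<iota> \<gamma>2 = c * \<iota> \<gamma>1" "a = e" using uv gam by auto
  then show "x \<in> K \<inter> T" using xK K_subset unfolding m by (auto simp: T_iff2)
qed

lemma Jd_bounds: assumes "mat2 a b c e \<in> Jd S d"
  shows "mat2 a b c e \<in> G" "ge (d/2) (a - 1)" "ge (d/2) b" "ge ((d+1)/2) c" "ge (d/2) (e - 1)"
  using assms by (auto simp: Jd_def)

lemma v1: "real_of_int (\<nu> v) + real_of_int (\<nu> \<gamma>1) = - r - y" using uv(2,3) gam by (simp add: nu_mult)

lemma v2: "real_of_int (\<nu> (v * \<gamma>2)) = - r + y" using v1 uv(2) gam by (simp add: nu_mult)

lemma phi_smooth: "smooth_char S (TX S \<Gamma>) \<phi>"
proof -
  have "openin (subtopology (mat_top S) T) {x \<in> T. \<phi> x = 1}" using phi(1) by (simp add: smooth_char_def)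
  then have "openin (subtopology (mat_top S) (K \<inter> T)) {x \<in> K \<inter> T. \<phi> x = 1}"
    unfolding openin_sub_iff by blast
  then show ?thesis using phi_one phi_mult by (simp add: TX_eq smooth_char_def)
qed
text \<open>The torus relation determines the lower left entry as \<gamma>2 / \<gamma>1, of
  valuation 2 y, times the upper right one. So k has depth d/2 > s at y, where
  \<open>\<Gamma>\<close> represents \<phi>.\<close>

lemma phi_agree: assumes k: "k \<in> TX S \<Gamma> \<inter> Jd S d" shows "\<phi> k = Psi S \<Gamma> k"
proof -
  obtain a b c e where m: "k = mat2 a b c e" by (rule mat2_cases)
  have kT: "k \<in> T" using k TX_eq by simp
  have b: "ge (d/2) (a - 1)" "ge (d/2) b" "ge (d/2) (e - 1)" using k Jd_bounds unfolding m by auto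
  have "c * \<iota> \<gamma>1 = b * \<iota> \<gamma>2" using kT unfolding m T_iff2 by simp
  then have "c = b * \<iota> (\<gamma>2 / \<gamma>1)" using gam by (simp add: field_simps)
  moreover have g21: "ge (2 * y) (\<iota> (\<gamma>2 / \<gamma>1))" unfolding ge_emb using gam by (simp add: geF_def nu_divide)
  have "ge (d/2 + 2 * y) (b * \<iota> (\<gamma>2 / \<gamma>1))" by (rule ge_mult[OF b(2) g21]) simp
  ultimately have "ge (d/2 + 2 * y) c" by metis
  then have "k - mat 1 \<in> L y (d/2)" unfolding m mat2_one mat2_diff L_mat2 using b y by (auto elim: ge_mono)
  then have "k \<in> Gyr S y (d/2)" using kT T_G by (auto simp: Gyr_iff)
  moreover have "d/2 > s" using y by (simp add: d_def)
  ultimately have "k \<in> Hp" unfolding Gyr_plus_iff by blast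
  then show ?thesis using phi(2) kT by (simp add: torus_r_plus_def)
qed

sublocale S_datum S d u "v * \<gamma>1" "v * \<gamma>2" \<phi> \<Gamma>
proof -
  show "S_datum S d u (v * \<gamma>1) (v * \<gamma>2) \<phi>"
  proof unfold_locales
    show "0 < d" by (rule d_pos)
    show "v * \<gamma>1 \<noteq> 0" using uv gam by simp
    show "real_of_int (\<nu> (v * \<gamma>1)) = - d" using uv by (simp add: d_def)
    show "u = 0 \<or> \<nu> (v * \<gamma>1) < \<nu> u" using uv y by linarith
    show "v * \<gamma>2 = 0 \<or> \<nu> (v * \<gamma>1) < \<nu> (v * \<gamma>2)" using uv(3) v2 y by linarith
    show "smooth_char S (TX S (mat2 (\<iota> u * \<sigma>) (\<iota> (v * \<gamma>1) * \<sigma>) (\<iota> (v * \<gamma>2) * \<sigma>) (\<iota> u * \<sigma>))) \<phi>"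
      using phi_smooth unfolding Gamma_eq .
    show "\<phi> k = Psi S (mat2 (\<iota> u * \<sigma>) (\<iota> (v * \<gamma>1) * \<sigma>) (\<iota> (v * \<gamma>2) * \<sigma>) (\<iota> u * \<sigma>)) k"
      if "k \<in> TX S (mat2 (\<iota> u * \<sigma>) (\<iota> (v * \<gamma>1) * \<sigma>) (\<iota> (v * \<gamma>2) * \<sigma>) (\<iota> u * \<sigma>)) \<inter> Jd S d" for k
      using phi_agree that unfolding Gamma_eq .
  qed
  show "\<Gamma> \<equiv> mat2 (\<iota> u * \<sigma>) (\<iota> (v * \<gamma>1) * \<sigma>) (\<iota> (v * \<gamma>2) * \<sigma>) (\<iota> u * \<sigma>)"
    by (rule eq_reflection) (rule Gamma_eq)
qed

lemma A_sub: "mat_subgroup A" unfolding A_def by (rule subgroup_Int[OF subgroup_K J_sub])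

lemma A_Iw: "A \<subseteq> Gyr S (1/4) 0"
proof
  fix x assume x: "x \<in> A"
  obtain a b c e where m: "x = mat2 a b c e" by (rule mat2_cases)
  have "ge y c" using x J_L0 by (auto simp: m A_def Gyr_0_iff L_mat2)
  then have "ge 1 c" using y by (auto simp: ge_def)
  then show "x \<in> Gyr S (1/4) 0" using x K_Iw by (auto simp: A_def m)
qed

lemma A_K: "A \<subseteq> K" and A_J: "A \<subseteq> J" by (auto simp: A_def)

sublocale I: ind_data S A R "s + \<bar>y\<bar>"
proof unfold_locales
  have rp: "is_rep J (**) (mat 1) R" "\<forall>v\<in>rspace R. \<exists>n>0. \<forall>h\<in>J \<inter> Gyr S 0 n. ract R h v = v"
    using R1 by (auto simp: srep_def)
  have "is_rep A (**) (mat 1) R" using rp(1) A_J unfolding is_rep_def by blast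
  then show "srep A R" using rp(2) A_J unfolding srep_def by blast
  show "Gyr S 0 (s + \<bar>y\<bar>) \<subseteq> A" using Gyr_J Gyr0_subset_K[of "s + \<bar>y\<bar>"] r by (auto simp: A_def)
qed (use A_sub A_K r in auto)

lemma J_rep: "h \<in> J \<Longrightarrow> x \<in> rspace R \<Longrightarrow> ract R h x \<in> rspace R"
  "g \<in> J \<Longrightarrow> h \<in> J \<Longrightarrow> x \<in> rspace R \<Longrightarrow> ract R (g ** h) x = ract R g (ract R h x)"
  "h \<in> J \<Longrightarrow> x \<in> rspace R \<Longrightarrow> ract R h (rscale R c x) = rscale R c (ract R h x)"
  "h \<in> J \<Longrightarrow> x \<in> rspace R \<Longrightarrow> z \<in> rspace R \<Longrightarrow> ract R h (x + z) = ract R h x + ract R h z"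
  "x \<in> rspace R \<Longrightarrow> ract R (mat 1) x = x"
  using R1 unfolding srep_def is_rep_def by auto

text \<open>Restriction to \<open>K\<close> loses nothing: every h in \<open>H\<close> becomes lower
  triangular, hence an element of \<open>A\<close>, after multiplication by an element of
  \<open>T\<close> of depth s, and the latter acts by a scalar according to
  \<open>R4\<close>.\<close>

lemma A_irr: "irr A R"
  unfolding irr_def
proof (intro conjI allI impI)
  show "rspace R \<noteq> {0}" using R3 by (simp add: irr_def)
  fix W assume W: "W \<subseteq> rspace R \<and> I.V.subspace W \<and> (\<forall>h\<in>A. \<forall>v\<in>W. ract R h v \<in> W)"
  have "ract R h x \<in> W" if h: "h \<in> H" and x: "x \<in> W" for h x
  proof -
    have hG: "h \<in> G" using h H_G by auto
    obtain t where t: "t \<in> T" "t \<in> H" "(h ** t) $ 1 $ 2 = 0" using lower_triangular[OF h] by blast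
    have ht: "h ** t \<in> H" by (rule subgroup_mult[OF H_sub h t(2)])
    have tG: "t \<in> G" using t T_G by auto
    obtain a b c e where m: "h ** t = mat2 a b c e" by (rule mat2_cases)
    have "ge s (a - 1)" "b = 0" "ge (s + y) c" "ge s (e - 1)"
      using ht t(3) unfolding m by (auto simp: Gyr_iff mat2_one L_mat2)
    then have "h ** t - mat 1 \<in> L 0 0" unfolding m mat2_one mat2_diff L_mat2 using r y by (auto elim: ge_mono)
    then have "h ** t \<in> K" unfolding K_eq Gyr_iff using ht H_G by auto
    then have htA: "h ** t \<in> A" using ht H_J by (auto simp: A_def)
    define t' where "t' = matrix_inv t"
    have t': "t' \<in> T" "t' \<in> H" using subgroup_inv[OF T_sub t(1)] subgroup_inv[OF H_sub t(2)] by (auto simp: t'_def)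
    have "ge (s - y) (t' $ 1 $ 2)" using t'(2) by (cases t' rule: mat2_cases) (simp add: Gyr_iff mat2_one L_mat2)
    then have tv: "t' $ 1 $ 2 = 0 \<or> - y < real_of_int (ve (t' $ 1 $ 2))" using r by (auto simp: ge_def)
    have xR: "x \<in> rspace R" using W x by auto
    have "h = (h ** t) ** t'" using tG by (simp add: t'_def gassoc)
    then have "ract R h x = ract R (h ** t) (ract R t' x)"
      using J_rep(2)[of "h ** t" t' x] ht t'(2) H_J xR by auto
    also have "ract R t' x = rscale R (\<phi> t') x" by (rule R4[OF t'(1) tv xR])
    finally show ?thesis using W htA I.V.subspace_scale[of W x] x by simp
  qed
  then show "W = {0} \<or> W = rspace R" using R3 W unfolding irr_def by blast
qed

text \<open>The part of \<open>A\<close> that acts by scalars through \<open>Psi S \<Gamma>\<close>;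
  it carries the averaging in \<open>full_of_eigen\<close>.\<close>

definition "M = K \<inter> Hp"

lemma M_sub: "mat_subgroup M" unfolding M_def by (rule subgroup_Int[OF subgroup_K Hp_sub])
lemma M_A: "M \<subseteq> A" using Hp_H H_J by (auto simp: M_def A_def)

lemma A_norm_M: assumes "a \<in> A" "m \<in> M" shows "a ** m ** matrix_inv a \<in> M"
proof -
  have "a ** m ** matrix_inv a \<in> Hp" using Gyr_plus_normal[of a y m s] assms J_L0 by (auto simp: A_def M_def)
  moreover have "a ** m ** matrix_inv a \<in> K"
    using subgroup_mult[OF subgroup_K subgroup_mult[OF subgroup_K] subgroup_inv[OF subgroup_K]] assms by (auto simp: A_def M_def)
  ultimately show ?thesis by (simp add: M_def)
qed

text \<open>Elements of \<open>M\<close> act by scalars, and scalars commute with the action of a;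
  evaluation at a nonzero vector compares the two characters.\<close>

lemma Psi_A_conj: assumes a: "a \<in> A" and m: "m \<in> M" shows "Psi S \<Gamma> (a ** m ** matrix_inv a) = Psi S \<Gamma> m"
proof -
  obtain x where x: "x \<in> rspace R" "x \<noteq> 0" using R3 I.V.subspace_0[OF I.Rsub] unfolding irr_def by blast
  have aJ: "a \<in> J" "matrix_inv a \<in> J" "a \<in> G" using a A_J subgroup_inv[OF J_sub] J_G by auto
  have mJ: "m \<in> J" "m \<in> Hp" using m M_A A_J by (auto simp: M_def)
  define z where "z = ract R (matrix_inv a) x"
  have z: "z \<in> rspace R" unfolding z_def by (rule J_rep(1)[OF aJ(2) x(1)])
  have az: "ract R a z = x" using J_rep(2)[OF aJ(1,2) x(1)] J_rep(5)[OF x(1)] aJ(3) by (simp add: z_def)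
  have "ract R (a ** m ** matrix_inv a) x = ract R (a ** m) z"
    unfolding z_def by (rule J_rep(2)[OF subgroup_mult[OF J_sub aJ(1) mJ(1)] aJ(2) x(1)])
  also have "\<dots> = rscale R (Psi S \<Gamma> m) x"
    using J_rep(2)[OF aJ(1) mJ(1) z] R2[OF mJ(2) z] J_rep(3)[OF aJ(1) z] az by simp
  finally show ?thesis using R2[of "a ** m ** matrix_inv a" x] A_norm_M[OF a m] x I.V.scale_cancel_right
    by (auto simp: M_def)
qed

text \<open>An element j of \<open>Jd S d\<close> leaves \<open>A\<close> only through its lower
  left entry c. Conjugation by j brings c times the dominant entry of \<open>\<Gamma>\<close> onto
  the diagonal, where a diagonal test element detects it.\<close>

lemma separate:
  assumes j: "j \<in> Jd S d" "j \<notin> A"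
  obtains m where "m \<in> M" "j ** m ** matrix_inv j \<in> M" "Psi S \<Gamma> (j ** m ** matrix_inv j) \<noteq> Psi S \<Gamma> m"
proof -
  obtain a b c e where m: "j = mat2 a b c e" by (rule mat2_cases)
  note jb = Jd_bounds[OF j(1)[unfolded m]]
  have jG: "j \<in> G" "j \<in> K" using jb Jd_K j by (auto simp: m)
  have ds: "d/2 = s + y/2" by (simp add: d_def)
  have nc: "\<not> ge (s + y) c"
  proof
    assume c: "ge (s + y) c"
    have "j - mat 1 \<in> L y s" unfolding m mat2_one mat2_diff L_mat2
      using jb c ds y by (auto elim: ge_mono)
    then have "j \<in> A" using jG H_J by (auto simp: A_def Gyr_iff)
    then show False using j(2) by simp
  qed
  then have c: "c \<noteq> 0" "real_of_int (ve c) < s + y" by (auto simp: ge_def)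
  \<comment> \<open>Minus the valuation of c times the dominant entry of \<open>\<Gamma>\<close>.
    Since c violates the bound s + y, this q exceeds s, so diagonal elements of depth q lie in
    \<open>Hp\<close>.\<close>
  define q where "q = d - real_of_int (ve c)"
  have q: "q > s" using c(2) by (simp add: q_def d_def)
  have unit: "a \<noteq> 0" "ve a = 0" "e \<noteq> 0" "ve e = 0"
    using one_plus_unit[of "d/2" "a - 1"] one_plus_unit[of "d/2" "e - 1"] jb d_pos by auto
  have ge0: "ge 0 a" "ge 0 e" using unit by (auto simp: ge_def)
  define Y where "Y = matrix_inv j ** \<Gamma> ** j - \<Gamma>"
  have Ysk: "skew Y" unfolding Y_def by (rule skew_diff[OF skew_conj[OF X_skew jG(1)] X_skew])
  define x12 where "x12 = \<iota> (v * \<gamma>1) * \<sigma>"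
  define x21 where "x21 = \<iota> (v * \<gamma>2) * \<sigma>"
  define z where "z = \<iota> u * \<sigma>"
  have G: "\<Gamma> = mat2 z x12 x21 z" by (simp add: Gamma_eq x12_def x21_def z_def)
  have x12: "x12 \<noteq> 0" "real_of_int (ve x12) = - d"
    using uv gam ve_emb[of "v * \<gamma>1"] by (simp_all add: x12_def ve_mult d_def del: emb_mult)
  have x21: "ge (- r + y) x21" using v2 by (simp add: x21_def geF_def del: emb_mult)
  have tr: "bar e * a + bar b * c = 1"
    using unitary_iff[of a b c e] jG(1) m by (metis bar_1 bar_add bar_bar bar_mult mult.commute)
  have "Y $ 1 $ 1 = bar e * x12 * c + (bar b * x21 * a + z * (bar e * a + bar b * c - 1))"
    using unitary_inv(1)[OF jG(1)[unfolded m]] by (simp add: Y_def G m algebra_simps)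
  then have Y11: "Y $ 1 $ 1 = bar e * x12 * c + bar b * x21 * a" by (simp add: tr)
  have lead: "bar e * x12 * c \<noteq> 0" "real_of_int (ve (bar e * x12 * c)) = - q"
    using unit c(1) x12 by (simp_all add: ve_mult q_def)
  have "ge (d/2 - r + y) (bar b * x21 * a)"
    by (rule ge_mult[OF ge_mult[OF _ x21, of "d/2"] ge0(1)]) (use jb in auto)
  moreover have "d/2 - r + y > - q" using q y by (simp add: ds)
  ultimately have "bar b * x21 * a = 0 \<or> ve (bar e * x12 * c) < ve (bar b * x21 * a)"
    using lead(2) by (auto simp: ge_def) linarith?
  from ve_add_eq[OF lead(1) this] have Y1: "Y $ 1 $ 1 \<noteq> 0" "real_of_int (ve (Y $ 1 $ 1)) = - q"
    using lead(2) by (simp_all add: Y11)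
  obtain h where h: "h \<noteq> 0" "\<nu> h = 0" "psiF S h \<noteq> 1" using psi_test_elt by blast
  \<comment> \<open>Tuned so that the pairing of Y with \<open>dg \<delta>\<close> is the value of
    the additive character at h.\<close>
  define \<delta> where "\<delta> = \<iota> h / (2 * Y $ 1 $ 1)"
  have dl: "ge q \<delta>" using h Y1 by (simp add: \<delta>_def ge_def ve_divide ve_mult)
  have qp: "0 < q" using q s_pos by simp
  define k where "k = dg \<delta>"
  have kG: "k \<in> G" unfolding k_def by (rule dg_G[OF dl qp])
  have kL: "k - mat 1 \<in> L yy q" for yy unfolding k_def by (rule dg_L[OF dl qp])
  have kHp: "k \<in> Hp" using kG kL[of y] q by (auto simp: Gyr_plus_iff Gyr_iff)
  have k0: "k \<in> Gyr S 0 q" using kG kL by (simp add: Gyr_iff)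
  have kM: "k \<in> M" using kHp k0 Gyr0_subset_K[of q] qp by (auto simp: M_def)
  have jk0: "j ** k ** matrix_inv j \<in> Gyr S 0 q" using Gyr_normal[OF _ k0, of j] jG by (simp add: K_eq)
  have jkK: "j ** k ** matrix_inv j \<in> K" using jk0 Gyr0_subset_K[of q] qp by auto
  have jkG: "j ** k ** matrix_inv j \<in> G" using jG kG by simp
  obtain \<delta>' where kk: "k - mat 1 = mat2 \<delta> 0 0 \<delta>'" "ge q \<delta>'"
    using kL[of 0] by (auto simp: k_def dg_def mat2_one L_mat2)
  have e1: "j ** k ** matrix_inv j - mat 1 = j ** (k - mat 1) ** matrix_inv j"
    using jG by (simp add: matrix_diff_ldistrib matrix_diff_rdistrib)
  have e2: "j ** k ** matrix_inv j - mat 1 = mat2 (a * \<delta> * bar e + b * \<delta>' * bar c) (a * \<delta> * bar b + b * \<delta>' * bar a)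
      (c * \<delta> * bar e + e * \<delta>' * bar c) (c * \<delta> * bar b + e * \<delta>' * bar a)"
    unfolding e1 kk unfolding m unitary_inv[OF jG(1)[unfolded m]] by simp
  have dia: "ge q (a * \<delta> * bar e + b * \<delta>' * bar c)" "ge q (c * \<delta> * bar b + e * \<delta>' * bar a)"
    using jk0 unfolding Gyr_iff e2 L_mat2 by auto
  have ge3: "ge \<tau> (x1 * x2 * x3)" if "ge p1 x1" "ge p2 x2" "ge p3 x3" "\<tau> \<le> p1 + p2 + p3" for \<tau> p1 p2 p3 x1 x2 x3
    by (rule ge_mult[OF ge_mult[OF that(1,2) order_refl] that(3,4)])
  have b0: "ge (d/2) (bar b)" "ge (d/2) b" using jb by simp_all
  have cc: "ge (real_of_int (ve c)) c" "ge (real_of_int (ve c)) (bar c)" by (simp_all add: ge_def)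
  have ae: "ge 0 (bar a)" "ge 0 (bar e)" using ge0 by simp_all
  have r12: "ge (q + d/2) (a * \<delta> * bar b + b * \<delta>' * bar a)"
    by (intro ge_add ge3[OF ge0(1) dl b0(1)] ge3[OF b0(2) kk(2) ae(1)]) simp_all
  have r21: "ge d (c * \<delta> * bar e + e * \<delta>' * bar c)"
    by (intro ge_add ge3[OF cc(1) dl ae(2)] ge3[OF ge0(2) kk(2) cc(2)]) (simp_all add: q_def)
  \<comment> \<open>The conjugate has a lower left entry of valuation at least d = r + y, which
    limits its depth at y to r.\<close>
  define s' where "s' = min q r"
  have s': "s' > s" using q r by (simp add: s'_def)
  have "s' \<le> q" "s' \<le> r" by (simp_all add: s'_def)
  moreover have "d = r + y" by (simp add: d_def)
  ultimately have sb: "s' \<le> q" "s' - y \<le> q + d/2" "s' + y \<le> d" using y d_pos by linarith+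
  have "j ** k ** matrix_inv j - mat 1 \<in> L y s'" unfolding e2 L_mat2
    using ge_mono[OF dia(1) sb(1)] ge_mono[OF dia(2) sb(1)] ge_mono[OF r12 sb(2)] ge_mono[OF r21 sb(3)] by simp
  then have jkM: "j ** k ** matrix_inv j \<in> M" using jkK jkG s' by (auto simp: M_def Gyr_plus_iff Gyr_iff)
  have "Psi S Y k = psiF S (2 * re (Y $ 1 $ 1 * \<delta>))"
    by (rule Psi_dg[OF Ysk dl qp, of "- q", folded k_def]) (use Y1 qp in \<open>auto simp: ge_def\<close>)
  also have "Y $ 1 $ 1 * \<delta> = \<iota> (h / 2)" using Y1(1) by (simp add: \<delta>_def)
  finally have PY: "Psi S Y k = psiF S h" by (simp del: emb_divide)
  have "Psi S \<Gamma> (j ** k ** matrix_inv j) = Psi S Y k * Psi S \<Gamma> k"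
    using Psi_conj[OF jG(1), of \<Gamma> k] Psi_add[of Y \<Gamma> k] by (simp add: Y_def)
  then have "Psi S \<Gamma> (j ** k ** matrix_inv j) \<noteq> Psi S \<Gamma> k" using PY h(3) by simp
  then show ?thesis using that kM jkM by blast
qed

text \<open>The eigenvector is an average over lower unipotent elements; it cannot vanish for all vectors,
  since conjugation by diagonal elements moves the eigencharacter through all its twists.\<close>

lemma lo_eigenvector:
  "\<exists>x0\<in>rspace R. x0 \<noteq> 0 \<and> (\<forall>\<beta>. geF (s + y) \<beta> \<longrightarrow> ract R (lo \<beta>) x0 = rscale R (Psi S \<Gamma> (lo \<beta>)) x0)"
proof -
  obtain x where x: "x \<in> rspace R" "x \<noteq> 0" using R3 I.V.subspace_0[OF I.Rsub] unfolding irr_def by blast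
  have loH: "lo \<beta> \<in> H" if "geF (s + y) \<beta>" for \<beta> using that lo_G by (simp add: Gyr_iff lo_L)
  have loHp: "lo \<beta> \<in> Hp" if "geF q \<beta>" "s + y < q" for \<beta> q
    unfolding Gyr_plus_iff by (rule exI[of _ "q - y"]) (use that lo_G in \<open>simp add: Gyr_iff lo_L\<close>)
  show ?thesis
  proof (cases "s + y \<in> \<int>")
    case False
    \<comment> \<open>Valuations are integers, so here the bound s + y is never attained and all
      these elements lie in \<open>Hp\<close> already; any nonzero vector serves.\<close>
    have "lo \<beta> \<in> Hp" if "geF (s + y) \<beta>" for \<beta>
    proof (cases "\<beta> = 0")
      case True then show ?thesis using subgroup_one[OF Hp_sub] by simp
    next
      case nz: False
      have "real_of_int (\<nu> \<beta>) \<noteq> s + y" using False by (metis Ints_of_int)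
      then show ?thesis using that nz loHp[of "real_of_int (\<nu> \<beta>)" \<beta>] by (auto simp: geF_def)
    qed
    then show ?thesis using R2 x by blast
  next
    case True
    then obtain N where N: "s + y = real_of_int N" using Ints_cases by auto
    have s_int: "s \<in> \<int>"
    proof -
      have "s = d - (s + y)" by (simp add: d_def)
      then show ?thesis using d_int True by (metis Ints_diff)
    qed
    then obtain sn where sn: "s = real_of_int sn" by (rule Ints_cases)
    \<comment> \<open>\<open>?M\<close> consists of the lower unipotent elements of
      \<open>H\<close>; those of \<open>?U\<close> lie in \<open>Hp\<close>, where the action is
      known. The average runs over the finite quotient.\<close>
    let ?M = "LO (s + y)" and ?U = "LO (s + y + 1)"
    have MU: "?U \<subseteq> ?M" by (rule LO_mono) simp
    have finM: "finite (coset_of ?U ` ?M)" by (rule LO_finite) (use r y in auto)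
    have MJ: "?M \<subseteq> J" using loH H_J by (auto simp: LO_def)
    have MH: "?M \<subseteq> H" using loH by (auto simp: LO_def)
    have UHp: "?U \<subseteq> Hp" using loHp[of "s + y + 1"] by (auto simp: LO_def)
    define \<theta> where "\<theta> m = inverse (Psi S \<Gamma> m)" for m
    define h where "h z m = rscale R (\<theta> m) (ract R m z)" for z m
    have h_in: "h z m \<in> rspace R" if "z \<in> rspace R" "m \<in> ?M" for z m
      unfolding h_def using that MJ by (intro I.V.subspace_scale[OF I.Rsub] J_rep(1)) auto
    have h_inv: "h z (m ** w) = h z m" if z: "z \<in> rspace R" and m: "m \<in> ?M" and w: "w \<in> ?U" for z m w
    proof -
      have J: "m \<in> J" "w \<in> J" "m \<in> H" "w \<in> Hp" using m w MJ MH UHp MU by auto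
      have "ract R (m ** w) z = rscale R (Psi S \<Gamma> w) (ract R m z)"
        using J_rep(2)[OF J(1,2) z] R2[OF J(4) z] J_rep(3)[OF J(1) z] by simp
      then show ?thesis using Psi_Hp(1)[OF J(3,4)] by (simp add: h_def \<theta>_def)
    qed
    \<comment> \<open>Up to a scalar, the projection to the wanted eigenspace of
      \<open>?M\<close>.\<close>
    define P where "P z = csum ?M ?U (h z)" for z
    have P_in: "P z \<in> rspace R" if "z \<in> rspace R" for z
    proof -
      have so: "(SOME x. x \<in> C) \<in> ?M" if "C \<in> coset_of ?U ` ?M" for C
        by (rule some_coset_in[OF LO_sub MU LO_sub that])
      show ?thesis unfolding P_def csum_def
        by (rule I.V.subspace_sum[OF I.Rsub], rule h_in[OF that], rule so)
    qed
    have Psi_lo_mult: "Psi S \<Gamma> (m ** m') = Psi S \<Gamma> m * Psi S \<Gamma> m'" if "m \<in> ?M" "m' \<in> ?M" for m m'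
      using that by (auto simp: LO_def lo_add Psi_lo distrib_left distrib_right psiE_add)
    have P_eig: "ract R m0 (P z) = rscale R (Psi S \<Gamma> m0) (P z)" if z: "z \<in> rspace R" and m0: "m0 \<in> ?M" for z m0
    proof -
      have J0: "m0 \<in> J" using m0 MJ by auto
      have so: "(SOME x. x \<in> C) \<in> ?M" if "C \<in> coset_of ?U ` ?M" for C
        by (rule some_coset_in[OF LO_sub MU LO_sub that])
      have "ract R m0 (P z) = csum ?M ?U (\<lambda>m. ract R m0 (h z m))" unfolding P_def csum_def
      proof -
        have "ract R m0 (\<Sum>C\<in>X. h z (SOME x. x \<in> C)) = (\<Sum>C\<in>X. ract R m0 (h z (SOME x. x \<in> C)))"
          if "X \<subseteq> coset_of ?U ` ?M" for X
          using that
        proof (induction X rule: infinite_finite_induct)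
          case (insert C X)
          have "(\<Sum>C\<in>X. h z (SOME x. x \<in> C)) \<in> rspace R"
            by (rule I.V.subspace_sum[OF I.Rsub]) (use insert so h_in[OF z] in blast)
          then show ?case using insert J_rep(4)[OF J0 h_in[OF z so]] by simp
        qed (use J_rep(3)[OF J0 z, of 0] in simp_all)
        then show "ract R m0 (\<Sum>C\<in>coset_of ?U ` ?M. h z (SOME x. x \<in> C)) =
          (\<Sum>C\<in>coset_of ?U ` ?M. ract R m0 (h z (SOME x. x \<in> C)))" by blast
      qed
      also have "\<dots> = csum ?M ?U (\<lambda>m. rscale R (Psi S \<Gamma> m0) (h z (m0 ** m)))"
      proof (rule csum_cong[OF LO_sub MU LO_sub])
        fix m assume m: "m \<in> ?M"
        have mJ: "m \<in> J" using m MJ by auto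
        show "ract R m0 (h z m) = rscale R (Psi S \<Gamma> m0) (h z (m0 ** m))"
          using J_rep(3)[OF J0 J_rep(1)[OF mJ z]] J_rep(2)[OF J0 mJ z] Psi_lo_mult[OF m0 m] by (simp add: h_def \<theta>_def)
      qed
      also have "\<dots> = rscale R (Psi S \<Gamma> m0) (csum ?M ?U (\<lambda>m. h z (m0 ** m)))" by (simp add: csum_def I.V.scale_sum_right)
      also have "csum ?M ?U (\<lambda>m. h z (m0 ** m)) = P z" unfolding P_def
        by (rule csum_shift[OF LO_sub LO_G LO_sub MU h_inv[OF z] m0])
      finally show ?thesis .
    qed
    have "\<exists>z\<in>rspace R. P z \<noteq> 0"
    proof (rule ccontr)
      assume "\<not> ?thesis"
      then have P0: "P z = 0" if "z \<in> rspace R" for z using that by blast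
      \<comment> \<open>Conjugation by the diagonal element with parameter
        \<open>\<pi> powi sn * \<xi>\<close> twists the eigencharacter at \<open>lo \<beta>\<close>
        by \<open>psiF S (k * \<beta> * \<xi>)\<close>. The valuation of k is -(s + y), so k *
        \<beta> is a unit exactly on \<open>?M\<close> outside \<open>?U\<close>.\<close>
      define k where "k = 2 * \<epsilon> * (v * \<gamma>1) * \<pi> powi sn"
      have k: "k \<noteq> 0" "real_of_int (\<nu> k) = - (s + y)"
      proof -
        show "k \<noteq> 0" using uv gam by (simp add: k_def)
        have "\<nu> k = \<nu> (v * \<gamma>1) + sn" using uv gam by (simp add: k_def nu_mult)
        then show "real_of_int (\<nu> k) = - (s + y)" using uv(3) sn by simp
      qed
      have tw: "csum ?M ?U (\<lambda>m. rscale R (psiF S (k * im (m $ 2 $ 1) * \<xi>)) (h x m)) = 0" if xi: "geF 0 \<xi>" for \<xi>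
      proof -
        define \<delta> where "\<delta> = \<pi> powi sn * \<xi>"
        have dF: "geF s \<delta>" unfolding \<delta>_def by (rule geF_mult[OF _ xi, of s]) (use sn in \<open>simp_all add: geF_def\<close>)
        then have dl: "ge s (\<iota> \<delta>)" by simp
        define g where "g = dg (\<iota> \<delta>)"
        have gH: "g \<in> H" using dg_G[OF dl s_pos] dg_L[OF dl s_pos] by (simp add: g_def Gyr_iff)
        have gJ: "g \<in> J" using gH H_J by auto
        have u1: "1 + \<iota> \<delta> \<noteq> 0" by (rule one_plus_unit(1)[OF dl s_pos])
        have gx: "ract R g x \<in> rspace R" by (rule J_rep(1)[OF gJ x(1)])
        have hm: "h (ract R g x) m = ract R g (rscale R (psiF S (k * im (m $ 2 $ 1) * \<xi>)) (h x m))" if m: "m \<in> ?M" for m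
        proof -
          obtain \<beta> where b: "m = lo \<beta>" "geF (s + y) \<beta>" using m by (auto simp: LO_def)
          define \<beta>' where "\<beta>' = \<beta> * (2 * \<delta> + \<delta> * \<delta>)"
          have "geF s (2 * \<delta> + \<delta> * \<delta>)"
            by (intro geF_add geF_mult[of 0 2 s] geF_mult[OF dF dF]) (use dF s_pos in \<open>auto simp: geF_def\<close>)
          from geF_mult[OF b(2) this order_refl] have b': "geF (s + y + s) \<beta>'" by (simp add: \<beta>'_def)
          have lHp: "lo \<beta>' \<in> Hp" by (rule loHp[OF b']) (use s_pos in simp)
          have J3: "lo \<beta> \<in> J" "lo \<beta>' \<in> J" using loH[OF b(2)] lHp Hp_H H_J by auto
          \<comment> \<open>Moving \<open>lo \<beta>\<close> past g multiplies \<beta> by the square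
            of 1 + \<delta>. The extra \<beta>' has depth s more, so \<open>lo \<beta>'\<close> acts
            by a scalar; the square of \<delta> contributes nothing to it.\<close>
          have eq: "lo \<beta> ** g = g ** (lo \<beta> ** lo \<beta>')"
            unfolding lo_add g_def lo_def dg_def \<beta>'_def using u1 by (simp add: field_simps)
          have R': "ract R (lo \<beta>') x = rscale R (Psi S \<Gamma> (lo \<beta>')) x" by (rule R2[OF lHp x(1)])
          have "ract R (lo \<beta>) (ract R g x) = ract R g (ract R (lo \<beta>) (ract R (lo \<beta>') x))"
            using J_rep(2)[OF J3(1) gJ x(1)] J_rep(2)[OF gJ subgroup_mult[OF J_sub J3] x(1)] J_rep(2)[OF J3 x(1)] eq by simp
          also have "\<dots> = ract R g (rscale R (Psi S \<Gamma> (lo \<beta>')) (ract R (lo \<beta>) x))"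
            unfolding R' using J_rep(3)[OF J3(1) x(1)] by simp
          also have "Psi S \<Gamma> (lo \<beta>') = psiF S (k * \<beta> * \<xi>)"
          proof -
            have "psiE S (\<Gamma> $ 1 $ 2 * (\<iota> \<beta>' * \<sigma>)) = psiF S (\<epsilon> * (im (\<Gamma> $ 1 $ 2) * \<beta>'))"
              by (rule psiE_imag) (use X_skew in \<open>simp add: skew_def\<close>)
            also have "im (\<Gamma> $ 1 $ 2) = v * \<gamma>1" using im_coord[of 0 "v * \<gamma>1"] unfolding Gamma_eq by simp
            also have "\<epsilon> * (v * \<gamma>1 * \<beta>') = k * \<beta> * \<xi> + \<epsilon> * (v * \<gamma>1 * (\<beta> * (\<delta> * \<delta>)))"
              by (simp add: \<beta>'_def k_def \<delta>_def algebra_simps)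
            also have "psiF S \<dots> = psiF S (k * \<beta> * \<xi>) * psiF S (\<epsilon> * (v * \<gamma>1 * (\<beta> * (\<delta> * \<delta>))))" by (rule psiF_add)
            also have "psiF S (\<epsilon> * (v * \<gamma>1 * (\<beta> * (\<delta> * \<delta>)))) = 1"
            proof (rule psiF_triv)
              have "geF (- r - y) (v * \<gamma>1)" using uv by (simp add: geF_def)
              from geF_mult[OF this geF_mult[OF b(2) geF_mult[OF dF dF order_refl] order_refl] order_refl]
              have "geF s (v * \<gamma>1 * (\<beta> * (\<delta> * \<delta>)))" by (rule geF_mono) simp
              moreover have "geF 0 \<epsilon>" by (simp add: geF_def)
              ultimately have g: "geF s (\<epsilon> * (v * \<gamma>1 * (\<beta> * (\<delta> * \<delta>))))" using geF_mult[of 0 \<epsilon> s] by simp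
              have "1 \<le> \<lceil>s\<rceil>" using s_pos by simp
              then show "\<epsilon> * (v * \<gamma>1 * (\<beta> * (\<delta> * \<delta>))) \<in> pF S 1" using g pF_mono by (auto simp: geF_iff)
            qed
            finally show ?thesis by (simp add: Psi_lo)
          qed
          finally have "ract R m (ract R g x) = ract R g (rscale R (psiF S (k * \<beta> * \<xi>)) (ract R (lo \<beta>) x))" using b by simp
          moreover have lx: "ract R (lo \<beta>) x \<in> rspace R" by (rule J_rep(1)[OF J3(1) x(1)])
          ultimately show ?thesis
            unfolding h_def b(1) im_lo using J_rep(3)[OF gJ lx] J_rep(3)[OF gJ I.V.subspace_scale[OF I.Rsub lx]]
            by (simp add: mult.commute)
        qed
        define Z where "Z = csum ?M ?U (\<lambda>m. rscale R (psiF S (k * im (m $ 2 $ 1) * \<xi>)) (h x m))"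
        have so: "(SOME x. x \<in> C) \<in> ?M" if "C \<in> coset_of ?U ` ?M" for C
          by (rule some_coset_in[OF LO_sub MU LO_sub that])
        have q_in: "rscale R (psiF S (k * im (m $ 2 $ 1) * \<xi>)) (h x m) \<in> rspace R" if "m \<in> ?M" for m
          by (rule I.V.subspace_scale[OF I.Rsub h_in[OF x(1) that]])
        have Z_in: "Z \<in> rspace R" unfolding Z_def csum_def
          by (rule I.V.subspace_sum[OF I.Rsub]) (use q_in so in blast)
        have "P (ract R g x) = csum ?M ?U (\<lambda>m. ract R g (rscale R (psiF S (k * im (m $ 2 $ 1) * \<xi>)) (h x m)))"
          unfolding P_def by (rule csum_cong[OF LO_sub MU LO_sub hm])
        also have "\<dots> = ract R g Z"
        proof -
          have sm: "ract R g (\<Sum>C\<in>X. f C) = (\<Sum>C\<in>X. ract R g (f C))" if "\<And>C. C \<in> X \<Longrightarrow> f C \<in> rspace R" for X f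
            using that
          proof (induction X rule: infinite_finite_induct)
            case (insert C X)
            have "(\<Sum>C\<in>X. f C) \<in> rspace R" by (rule I.V.subspace_sum[OF I.Rsub]) (use insert in blast)
            then show ?case using insert J_rep(4)[OF gJ] by simp
          qed (use J_rep(3)[OF gJ x(1), of 0] in simp_all)
          show ?thesis unfolding Z_def csum_def by (rule sm[symmetric], rule q_in, rule so)
        qed
        finally have "ract R g Z = 0" using P0[OF gx] by simp
        then have "ract R (matrix_inv g) (ract R g Z) = 0"
          using J_rep(3)[OF subgroup_inv[OF J_sub gJ] x(1), of 0] by simp
        moreover have "ract R (matrix_inv g) (ract R g Z) = Z"
          using J_rep(2)[OF subgroup_inv[OF J_sub gJ] gJ Z_in] J_rep(5)[OF Z_in] gJ J_G by auto
        ultimately show ?thesis by (simp add: Z_def)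
      qed
      \<comment> \<open>Fourier inversion: the sum of all twisted averages vanishes, but
        orthogonality leaves only the trivial coset of \<open>?U\<close>, which contributes x times
        the number of residues.\<close>
      let ?f = "\<lambda>w m :: 'e ^ 2 ^ 2. psiF S (k * im (m $ 2 $ 1) * im (w $ 2 $ 1))"
      have U1: "LO 1 \<subseteq> LO 0" by (rule LO_mono) simp
      have "csum (LO 0) (LO 1) (\<lambda>w. csum ?M ?U (\<lambda>m. rscale R (?f w m) (h x m))) = csum (LO 0) (LO 1) (\<lambda>_. 0)"
        by (rule csum_cong[OF LO_sub U1 LO_sub]) (use tw in \<open>auto simp: LO_def\<close>)
      then have "csum ?M ?U (\<lambda>m. rscale R (csum (LO 0) (LO 1) (\<lambda>w. ?f w m)) (h x m)) = 0"
        unfolding csum_def by (simp add: I.V.scale_sum_left) (subst sum.swap, simp)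
      moreover have "csum ?M ?U (\<lambda>m. rscale R (csum (LO 0) (LO 1) (\<lambda>w. ?f w m)) (h x m)) =
          rscale R (csum (LO 0) (LO 1) (\<lambda>w. ?f w (mat 1))) (h x (mat 1))"
      proof (rule csum_one[OF LO_sub LO_G LO_sub MU _ _ finM])
        fix m w assume m: "m \<in> ?M" and w: "w \<in> ?U"
        obtain a b where ab: "m = lo a" "w = lo b" "geF (s + y + 1) b" using m w by (auto simp: LO_def)
        have "psiF S (k * b * \<xi>) = 1" if "geF 0 \<xi>" for \<xi>
        proof -
          have "geF (- (s + y)) k" using k by (simp add: geF_def)
          from geF_mult[OF geF_mult[OF this ab(3) order_refl] that order_refl] have "geF 1 (k * b * \<xi>)" by simp
          then show ?thesis using psiF_triv by (simp add: geF_iff)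
        qed
        then have "csum (LO 0) (LO 1) (\<lambda>z. ?f z (m ** w)) = csum (LO 0) (LO 1) (\<lambda>z. ?f z m)"
          by (intro csum_cong[OF LO_sub U1 LO_sub]) (auto simp: LO_def ab lo_add distrib_left distrib_right psiF_add)
        then show "rscale R (csum (LO 0) (LO 1) (\<lambda>z. ?f z (m ** w))) (h x (m ** w)) =
          rscale R (csum (LO 0) (LO 1) (\<lambda>z. ?f z m)) (h x m)" using h_inv[OF x(1) m w] by simp
      next
        fix m assume m: "m \<in> ?M" "m \<notin> ?U"
        obtain b where b: "m = lo b" "geF (s + y) b" using m by (auto simp: LO_def)
        have nb: "\<not> geF (s + y + 1) b" using m(2) b by (auto simp: LO_def)
        then have "b \<noteq> 0" "N \<le> \<nu> b" "\<not> N + 1 \<le> \<nu> b" using b(2) unfolding N by (auto simp: geF_def)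
        then have "\<nu> b = N" "b \<noteq> 0" by auto
        moreover have "\<nu> k = - N" using k(2) N by linarith
        ultimately have "k * b \<noteq> 0" "\<nu> (k * b) = 0" using k by (auto simp: nu_mult)
        then have "csum (LO 0) (LO 1) (\<lambda>w. ?f w m) = 0" using csum_orthogonal[of "k * b"] by (simp add: b)
        then show "rscale R (csum (LO 0) (LO 1) (\<lambda>w. ?f w m)) (h x m) = 0" by simp
      qed
      moreover have "h x (mat 1) = x" using J_rep(5)[OF x(1)] by (simp add: h_def \<theta>_def)
      moreover have "csum (LO 0) (LO 1) (\<lambda>w. ?f w (mat 1)) = of_nat (card (coset_of (LO 1) ` LO 0))"
        by (simp add: csum_def mat_def)
      moreover have "card (coset_of (LO 1) ` LO 0) \<noteq> 0"
        using LO_finite[of 0 1] subgroup_one[OF LO_sub] by auto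
      ultimately show False using x(2) by simp
    qed
    then obtain z where z: "z \<in> rspace R" "P z \<noteq> 0" by blast
    show ?thesis
      by (rule bexI[of _ "P z"]) (use z P_eig P_in in \<open>auto simp: LO_def\<close>)
  qed
qed

text \<open>On the intersection of \<open>A\<close> and \<open>Jd S d\<close> only the lower
  unipotent part goes beyond \<open>Hp\<close>: after its removal what remains is upper triangular
  of depth d/2 > s at y.\<close>

lemma eigenvector:
  obtains x0 where "x0 \<in> rspace R" "x0 \<noteq> 0" "\<And>c. c \<in> A \<Longrightarrow> c \<in> Jd S d \<Longrightarrow> ract R c x0 = rscale R (Psi S \<Gamma> c) x0"
proof -
  obtain x0 where x0: "x0 \<in> rspace R" "x0 \<noteq> 0"
    "\<And>\<beta>. geF (s + y) \<beta> \<Longrightarrow> ract R (lo \<beta>) x0 = rscale R (Psi S \<Gamma> (lo \<beta>)) x0" using lo_eigenvector by blast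
  have "ract R k x0 = rscale R (Psi S \<Gamma> k) x0" if k: "k \<in> A" "k \<in> Jd S d" for k
  proof -
    obtain a b c e where m: "k = mat2 a b c e" by (rule mat2_cases)
    note kb = Jd_bounds[OF k(2)[unfolded m]]
    have ds: "d/2 = s + y/2" by (simp add: d_def)
    have kG: "k \<in> G" using kb m by simp
    \<comment> \<open>\<open>Jd S d\<close> alone does not give this bound. In the factorization k =
      g t the upper right entry of t has depth s - y; the torus relation then makes its lower left
      entry of depth s + y.\<close>
    have c: "ge (s + y) c"
    proof -
      obtain g t where gt: "g \<in> H" "t \<in> T" "k = g ** t" using k(1) A_J J_eq(1) by (auto simp: set_prod_def)
      obtain ga gb gc ge' where g: "g = mat2 ga gb gc ge'" by (rule mat2_cases)
      obtain ta tb tc te where t: "t = mat2 ta tb tc te" by (rule mat2_cases)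
      have gi: "matrix_inv g \<in> H" by (rule subgroup_inv[OF H_sub gt(1)])
      have gG: "g \<in> G" using gt(1) H_G by auto
      have tk: "t = matrix_inv g ** k" using gt gG by simp
      have gl: "ge 0 (bar ge')" "ge (s - y) (bar gb)" "ge (s + y) gc" "ge 0 ge'"
        using gi Gyr_L0[OF gi] gt(1) Gyr_L0[OF gt(1)] r unfolding g unitary_inv(1)[OF gG[unfolded g]]
        by (auto simp: Gyr_iff mat2_one L_mat2)
      have ta: "ge 0 ta" using T_L0 gt(2) by (auto simp: t Gyr_0_iff L_mat2)
      have ke: "ge 0 e" using one_plus_unit[of "d/2" "e - 1"] kb d_pos by (simp add: ge_def)
      have "tb = bar ge' * b + bar gb * e" using tk unfolding t g unitary_inv(1)[OF gG[unfolded g]] m by simp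
      moreover have "ge (s - y) (bar ge' * b)" by (rule ge_mult[OF gl(1) kb(3)]) (use y ds in simp)
      moreover have "ge (s - y) (bar gb * e)" by (rule ge_mult[OF gl(2) ke]) simp
      ultimately have tb: "ge (s - y) tb" by (simp add: ge_add)
      have "tc * \<iota> \<gamma>1 = tb * \<iota> \<gamma>2" using gt(2) unfolding t T_iff2 by simp
      then have "tc = tb * \<iota> (\<gamma>2 / \<gamma>1)" using gam by (simp add: field_simps)
      moreover have g21: "ge (2 * y) (\<iota> (\<gamma>2 / \<gamma>1))" unfolding ge_emb using gam by (simp add: geF_def nu_divide)
      have "ge (s + y) (tb * \<iota> (\<gamma>2 / \<gamma>1))" by (rule ge_mult[OF tb g21]) simp
      ultimately have "ge (s + y) tc" by metis
      moreover have "c = gc * ta + ge' * tc" using gt(3) unfolding m g t by simp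
      ultimately show ?thesis using ge_mult[OF gl(3) ta, of "s + y"] ge_mult[OF gl(4), of "s + y" tc "s + y"] by (simp add: ge_add)
    qed
    have ua: "a \<noteq> 0" "ve a = 0" using one_plus_unit[of "d/2" "a - 1"] kb d_pos by auto
    have "bar a * c + bar c * a = 0" using kb(1) by (simp add: unitary_iff)
    then have ac: "bar c * a = - (bar a * c)" by (simp add: eq_neg_iff_add_eq_0 add.commute)
    have "bar (c / a) = - (c / a)" using ua ac by (simp add: field_simps)
    then have ca: "c / a = \<iota> (im (c / a)) * \<sigma>" by (rule imag_E)
    define \<beta> where "\<beta> = im (c / a)"
    have n: "\<iota> \<beta> * \<sigma> = c / a" using ca by (simp add: \<beta>_def)
    have gca: "ge (s + y) (c / a)" using c ua by (cases "c = 0") (auto simp: ge_def ve_divide)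
    then have gb: "geF (s + y) \<beta>" using n by (metis ge_emb ge_sigma_mult(2))
    \<comment> \<open>The lower left entry of k is cleared by its lower unipotent factor
      \<open>lo \<beta>\<close>, which lies in \<open>H\<close>.\<close>
    define k' where "k' = lo (- \<beta>) ** k"
    have kk': "k = lo \<beta> ** k'" by (simp add: k'_def matrix_mul_assoc lo_add)
    have "k' = mat2 a b 0 (e - c / a * b)" unfolding k'_def m lo_def using n ua by simp
    then have "k' - mat 1 = mat2 (a - 1) b 0 ((e - 1) - c / a * b)" by (simp add: mat2_one)
    moreover have "ge (d/2) ((e - 1) - c / a * b)"
      by (rule ge_diff[OF kb(5) ge_mult[OF gca kb(3)]]) (use y r in simp)
    ultimately have k'L: "k' - mat 1 \<in> L y (d/2)" using kb y by (auto simp: L_mat2 elim: ge_mono)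
    have k'G: "k' \<in> G" unfolding k'_def using lo_G kG by simp
    have "s < d/2" using y ds by linarith
    then have k'Hp: "k' \<in> Hp" unfolding Gyr_plus_iff using k'L k'G by (intro exI[of _ "d/2"]) (simp add: Gyr_iff)
    have loH: "lo \<beta> \<in> H" using gb lo_G by (simp add: Gyr_iff lo_L)
    have "ract R k x0 = ract R (lo \<beta>) (ract R k' x0)" unfolding kk'
      using J_rep(2)[of "lo \<beta>" k' x0] loH k'Hp Hp_H H_J x0(1) by blast
    also have "\<dots> = rscale R (Psi S \<Gamma> k') (ract R (lo \<beta>) x0)"
      using R2[OF k'Hp x0(1)] J_rep(3)[of "lo \<beta>" x0] loH H_J x0(1) by auto
    also have "\<dots> = rscale R (Psi S \<Gamma> k) x0" using x0(3)[OF gb] Psi_Hp(1)[OF loH k'Hp] by (simp add: kk' mult.commute)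
    finally show ?thesis .
  qed
  then show ?thesis using that x0(1,2) by blast
qed

text \<open>The eigenfunction f0 lives on the group D = \<open>A\<close> times \<open>Jd S d\<close>
  and sends a j to \<open>Psi S \<Gamma> j\<close> times the image of x0 under a; it is well defined
  because x0 is an eigenvector on the intersection. Since \<open>A\<close> normalizes
  \<open>M\<close> and preserves its character, points of D outside \<open>A\<close> reduce to
  \<open>separate\<close>.\<close>

theorem local_iso:
  "rep_iso K (smooth_Ind S K A R) (S_rep S d \<Gamma> \<phi>)"
proof -
  obtain x0 where x0: "x0 \<in> rspace R" "x0 \<noteq> 0"
    "\<And>c. c \<in> A \<Longrightarrow> c \<in> Jd S d \<Longrightarrow> ract R c x0 = rscale R (Psi S \<Gamma> c) x0" using eigenvector by blast
  have norm: "a ** j ** matrix_inv a \<in> Jd S d" if "a \<in> A" "j \<in> Jd S d" for a j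
    using Iw_norm that A_Iw by blast
  have AG: "A \<subseteq> G" using A_K K_subset by auto
  define D where "D = set_prod A (Jd S d)"
  have D: "mat_subgroup D" unfolding D_def by (rule subgroup_set_prod(1)[OF A_sub AG Jd_sub Jd_G norm])
  have D_K: "D \<subseteq> K" using subgroup_mult[OF subgroup_K] A_K Jd_K unfolding D_def set_prod_def by blast
  have A_D: "A \<subseteq> D"
  proof
    fix a assume "a \<in> A"
    then have "a ** mat 1 \<in> D" unfolding D_def set_prod_def using subgroup_one[OF Jd_sub] by blast
    then show "a \<in> D" by simp
  qed
  have J_D: "Jd S d \<subseteq> D"
  proof
    fix a assume "a \<in> Jd S d"
    then have "mat 1 ** a \<in> D" unfolding D_def set_prod_def using subgroup_one[OF A_sub] by blast
    then show "a \<in> D" by simp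
  qed
  have TX_A: "TX S \<Gamma> \<subseteq> A" using T_J by (auto simp: TX_eq A_def)
  have B_D: "B \<subseteq> D"
  proof
    fix x assume "x \<in> B"
    then obtain t j where "t \<in> TX S \<Gamma>" "j \<in> Jd S d" "x = t ** j" unfolding B_def set_prod_def by blast
    then show "x \<in> D" using subgroup_mult[OF D, of t j] TX_A A_D J_D by blast
  qed
  define f0 where "f0 x = (if x \<in> D then
      (let p = (SOME p. fst p \<in> A \<and> snd p \<in> Jd S d \<and> x = fst p ** snd p) in rscale R (Psi S \<Gamma> (snd p)) (ract R (fst p) x0)) else 0)" for x
  have f0: "f0 (a ** j) = rscale R (Psi S \<Gamma> j) (ract R a x0)" if a: "a \<in> A" and j: "j \<in> Jd S d" for a j
  proof -
    define p where "p = (SOME p. fst p \<in> A \<and> snd p \<in> Jd S d \<and> a ** j = fst p ** snd p)"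
    have p: "fst p \<in> A \<and> snd p \<in> Jd S d \<and> a ** j = fst p ** snd p"
      unfolding p_def by (rule someI[of _ "(a, j)"]) (use a j in simp)
    define a' where "a' = fst p"
    define j' where "j' = snd p"
    have aj: "a' \<in> A" "j' \<in> Jd S d" "a ** j = a' ** j'" using p by (auto simp: a'_def j'_def)
    have G: "a \<in> G" "a' \<in> G" "j \<in> G" "j' \<in> G" using a j aj AG Jd_G by auto
    define k where "k = matrix_inv a' ** a"
    have kA: "k \<in> A" unfolding k_def by (rule subgroup_mult[OF A_sub subgroup_inv[OF A_sub aj(1)] a])
    have kj: "k ** j = j'" using aj(3) G by (simp add: k_def gassoc)
    have "k = j' ** matrix_inv j" using G by (simp add: k_def gassoc flip: kj)
    then have kJ: "k \<in> Jd S d" using subgroup_mult[OF Jd_sub aj(2) subgroup_inv[OF Jd_sub j]] by simp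
    have "a = a' ** k" using G by (simp add: k_def)
    then have "ract R a x0 = ract R a' (rscale R (Psi S \<Gamma> k) x0)"
      using I.ract_mult[OF aj(1) kA x0(1)] x0(3)[OF kA kJ] by simp
    then have "ract R a x0 = rscale R (Psi S \<Gamma> k) (ract R a' x0)" using I.ract_scale[OF aj(1) x0(1)] by simp
    moreover have "Psi S \<Gamma> j' = Psi S \<Gamma> k * Psi S \<Gamma> j" using Psi_J[OF kJ j] kj by simp
    moreover have "a ** j \<in> D" unfolding D_def set_prod_def using a j by blast
    ultimately show ?thesis by (simp add: f0_def Let_def mult.commute flip: p_def a'_def j'_def)
  qed
  have D_cases: thesis if "x \<in> D" "\<And>a j. a \<in> A \<Longrightarrow> j \<in> Jd S d \<Longrightarrow> x = a ** j \<Longrightarrow> thesis" for x thesis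
    using that unfolding D_def set_prod_def by blast
  have f00: "f0 x = 0" if "x \<notin> D" for x using that by (simp add: f0_def)
  have D_left: "h ** x \<in> D \<longleftrightarrow> x \<in> D" if "h \<in> D" "x \<in> K" for h x
  proof
    assume "h ** x \<in> D"
    then have "matrix_inv h ** (h ** x) \<in> D" using subgroup_mult[OF D subgroup_inv[OF D that(1)]] by blast
    then show "x \<in> D" using that D_K K_subset by auto
  qed (use subgroup_mult[OF D that(1)] in blast)
  have D_right: "x ** h \<in> D \<longleftrightarrow> x \<in> D" if "h \<in> D" "x \<in> K" for h x
  proof
    assume "x ** h \<in> D"
    then have "(x ** h) ** matrix_inv h \<in> D" using subgroup_mult[OF D _ subgroup_inv[OF D that(1)]] by blast
    moreover have "h \<in> G" using that D_K K_subset by auto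
    ultimately show "x \<in> D" by (simp add: gassoc)
  qed (use subgroup_mult[OF D _ that(1)] in blast)
  have f0_B: "f0 (x ** b) = rscale R (\<Psi> b) (f0 x)" if x: "x \<in> K" and b: "b \<in> B" for x b
  proof (cases "x \<in> D")
    case True
    then obtain a j where aj: "a \<in> A" "j \<in> Jd S d" "x = a ** j" by (rule D_cases)
    obtain t j' where t: "t \<in> TX S \<Gamma>" "j' \<in> Jd S d" "b = t ** j'" using b by (auto simp: B_def set_prod_def)
    have G: "a \<in> G" "j \<in> G" "t \<in> G" "j' \<in> G" using aj t AG Jd_G TX_G by auto
    have tA: "t \<in> A" using t TX_A by auto
    have jj: "matrix_inv t ** j ** t \<in> Jd S d" using TX_norm[OF subgroup_inv[OF TX_sub t(1)] aj(2)] G by simp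
    have "x ** b = (a ** t) ** ((matrix_inv t ** j ** t) ** j')" using aj t G by (simp add: gassoc)
    then have "f0 (x ** b) = rscale R (Psi S \<Gamma> ((matrix_inv t ** j ** t) ** j')) (ract R (a ** t) x0)"
      using f0[OF subgroup_mult[OF A_sub aj(1) tA] subgroup_mult[OF Jd_sub jj t(2)]] by simp
    also have "Psi S \<Gamma> ((matrix_inv t ** j ** t) ** j') = Psi S \<Gamma> j * Psi S \<Gamma> j'"
      using Psi_J[OF jj t(2)] Psi_TX_conj[OF t(1)] by simp
    also have "ract R (a ** t) x0 = rscale R (\<phi> t) (ract R a x0)"
    proof -
      \<comment> \<open>A torus element of \<open>K\<close> has integral upper right entry, and 0 >
        -y, so \<open>R4\<close> makes it act by \<phi>.\<close>
      have "ge 0 (t $ 1 $ 2)" using t(1) TX_K K_iff by (auto simp: L_iff)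
      then have "t $ 1 $ 2 = 0 \<or> - y < real_of_int (ve (t $ 1 $ 2))" using y by (auto simp: ge_def)
      then have "ract R t x0 = rscale R (\<phi> t) x0" using R4 t(1) TX_eq x0(1) by blast
      then show ?thesis using I.ract_mult[OF aj(1) tA x0(1)] I.ract_scale[OF aj(1) x0(1)] by simp
    qed
    finally show ?thesis using f0[OF aj(1,2)] Psi_ext_eq[OF t(1,2)] aj(3) t(3) by (simp add: ac_simps)
  next
    case False
    then show ?thesis using f00 D_right[of b x] b B_D x by auto
  qed
  have f0_in: "f0 \<in> rspace I.Ind" unfolding I.Ind_iff'
  proof (intro conjI allI ballI impI)
    fix x assume "x \<notin> K" then show "f0 x = 0" using D_K by (intro f00) auto
  next
    fix x show "f0 x \<in> rspace R"
    proof (cases "x \<in> D")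
      case True
      then show ?thesis by (rule D_cases) (simp add: f0 I.V.subspace_scale[OF I.Rsub] I.ract_in x0(1))
    qed (simp add: f00 I.V.subspace_0[OF I.Rsub])
  next
    fix h x assume h: "h \<in> A" and x: "x \<in> K"
    show "f0 (h ** x) = ract R h (f0 x)"
    proof (cases "x \<in> D")
      case True
      then obtain a j where aj: "a \<in> A" "j \<in> Jd S d" "x = a ** j" by (rule D_cases)
      then show ?thesis using f0[OF subgroup_mult[OF A_sub h aj(1)] aj(2)] f0[OF aj(1,2)]
          I.ract_mult[OF h aj(1) x0(1)] I.ract_scale[OF h I.ract_in[OF aj(1) x0(1)]] by (simp add: matrix_mul_assoc)
    next
      case False
      then show ?thesis using D_left[of h x] h A_D x f00 I.ract_zero[OF h] by auto
    qed
  next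
    show "\<exists>n>0. \<forall>x\<in>K. \<forall>w\<in>Gyr S 0 n. f0 (x ** w) = f0 x"
    proof (intro exI[of _ "d + 1"] conjI ballI)
      fix x w assume x: "x \<in> K" and w: "w \<in> Gyr S 0 (d + 1)"
      have wJ: "w \<in> Jd S d" using w Gyr_Jd by blast
      have "\<Psi> w = 1" using Psi_ext_J[OF wJ] Psi_triv[OF X_L(2), of w "d + 1"] w by (auto simp: Gyr_iff)
      then show "f0 (x ** w) = f0 x" using f0_B[OF x, of w] wJ J_B by auto
    qed (use d_pos in simp)
  qed
  have f0_1: "f0 (mat 1) \<noteq> 0"
    using f0[OF subgroup_one[OF A_sub] subgroup_one[OF Jd_sub]] I.ract_one[OF x0(1)] x0(2) by simp
  have "rep_iso K (smooth_Ind S K B (char_rep \<Psi>)) I.Ind"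
  proof (rule I.iso_of_eigenvector[where D = D and ch = "Psi S \<Gamma>", OF ind_B S_irreducible A_irr f0_in f0_B f0_1 M_sub M_A])
    show "ract R m x = rscale R (Psi S \<Gamma> m) x" if "m \<in> M" "x \<in> rspace R" for m x
      using R2 that by (auto simp: M_def)
    show "x \<in> D" if "x \<in> K" "f0 x \<noteq> 0" for x using that f00 by blast
    show "x \<in> D" if "x \<in> K" "m \<in> M" "x ** m \<in> D" for x m using that D_right M_A A_D by blast
    show "\<exists>m\<in>M. x ** m ** matrix_inv x \<in> M \<and> Psi S \<Gamma> (x ** m ** matrix_inv x) \<noteq> Psi S \<Gamma> m"
      if x: "x \<in> K" "x \<in> D" "x \<notin> A" for x
    proof -
      obtain a j where aj: "a \<in> A" "j \<in> Jd S d" "x = a ** j" using x(2) by (rule D_cases)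
      have "j \<notin> A" using x(3) aj subgroup_mult[OF A_sub aj(1)] by auto
      then obtain m where m: "m \<in> M" "j ** m ** matrix_inv j \<in> M" "Psi S \<Gamma> (j ** m ** matrix_inv j) \<noteq> Psi S \<Gamma> m"
        using separate aj(2) by blast
      have "a \<in> G" "j \<in> G" using aj AG Jd_G by auto
      then have e: "x ** m ** matrix_inv x = a ** (j ** m ** matrix_inv j) ** matrix_inv a" by (simp add: aj(3) gassoc)
      show ?thesis unfolding e[symmetric]
        by (rule bexI[OF _ m(1)]) (use e m A_norm_M[OF aj(1) m(2)] Psi_A_conj[OF aj(1) m(2)] in simp)
    qed
  qed
  then have "rep_iso K (S_rep S d \<Gamma> \<phi>) I.Ind" by (simp add: S_rep_eq)
  moreover have "is_rep K (**) (mat 1) (S_rep S d \<Gamma> \<phi>)"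
    using S_irreducible by (simp add: S_rep_eq irreducible_rep_def smooth_rep_def)
  ultimately show ?thesis by (rule rep_iso_sym)
qed

end

subsection \<open>The representation attached to a datum\<close>

context generic_datum begin

text \<open>\<open>is_rho\<close> is built from some generic element, whereas the decomposition is
  stated for any one that represents \<phi>. The difference D of two of them pairs trivially with
  the torus elements in \<open>Hp\<close>; testing on scalars and on \<open>torus_elt\<close> shows
  that D has depth at least -s, hence is trivial on all of \<open>Hp\<close>.\<close>

lemma Psi_unique:
  assumes gd': "generic_datum S \<gamma>1 \<gamma>2 y r u' v' \<phi>" and g: "g \<in> Hp"
  shows "Psi S \<Gamma> g = Psi S (Gamma_elt S \<gamma>1 \<gamma>2 u' v') g"
proof -
  interpret G': generic_datum S \<gamma>1 \<gamma>2 y r u' v' \<phi> by fact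
  define u2 where "u2 = u - u'"
  define v2 where "v2 = v - v'"
  define D where "D = Gamma_elt S \<gamma>1 \<gamma>2 u2 v2"
  have sum: "\<Gamma> = D + G'.\<Gamma>" by (simp add: D_def Gamma_elt_def u2_def v2_def algebra_simps)
  have triv: "Psi S D t = 1" if "t \<in> T" "t \<in> Hp" for t
  proof -
    have "t \<in> torus_r_plus S \<gamma>1 \<gamma>2 y s" using that by (simp add: torus_r_plus_def)
    then have "Psi S \<Gamma> t = Psi S G'.\<Gamma> t" using phi(2) G'.phi(2) by metis
    moreover have "Psi S \<Gamma> t = Psi S D t * Psi S G'.\<Gamma> t" unfolding sum by (rule Psi_add)
    ultimately show ?thesis by simp
  qed
  have "geF (- r) u" "geF (- r) u'" using uv G'.uv by (auto simp: geF_def)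
  then have gu: "geF (- r) u2" unfolding u2_def using geF_add[of "- r" u "- u'"] by simp
  have "geF (- r - y) (v * \<gamma>1)" "geF (- r - y) (v' * \<gamma>1)" using uv G'.uv by (auto simp: geF_def)
  then have gv: "geF (- r - y) (v2 * \<gamma>1)"
    unfolding v2_def using geF_add[of "- r - y" "v * \<gamma>1" "- (v' * \<gamma>1)"] by (simp add: left_diff_distrib)
  have gu': "ge (- r) (\<iota> u2 * \<sigma>)" using gu by simp
  have gv': "ge (- r - y) (\<iota> (v2 * \<gamma>1))" using gv by (simp only: ge_emb)
  have B1: "u2 = 0 \<or> - s' < real_of_int (\<nu> u2)" if s': "s < s'" for s'
  proof (rule psi_dual_F[of "4 * \<epsilon>"])
    have "(2::'f) * 2 \<noteq> 0" by (simp only: mult_eq_0_iff) simp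
    then have four: "(4::'f) \<noteq> 0" "\<nu> 4 = 0" using nu_mult[of 2 2] by simp_all
    then show "4 * \<epsilon> \<noteq> 0" "\<nu> (4 * \<epsilon>) = 0" by (simp_all add: nu_mult)
    fix \<beta> assume b: "geF s' \<beta>"
    define n where "n = \<iota> \<beta> * \<sigma>"
    have n: "ge s' n" "ge s' (- n)" "bar n = - n" using b by (simp_all add: n_def)
    have sp: "0 < s'" using s' s_pos by simp
    have u1: "1 + - n \<noteq> 0" "1 + n \<noteq> 0" using one_plus_unit(1)[OF n(2) sp] one_plus_unit(1)[OF n(1) sp] by auto
    have iv: "ge 0 (inverse (1 + - n))" by (rule ge_inverse_one_plus(1)[OF n(2) sp])
    \<comment> \<open>The Cayley transform of the imaginary n is a scalar of norm one. The trace of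
      D times z - 1 is 4 \<iota> u2 \<sigma> n up to a quadratic error of depth -r + 2 s'.\<close>
    define z where "z = (1 + n) * inverse (1 + - n)"
    have "bar z = inverse z" "z \<noteq> 0" using u1 n(3) by (simp_all add: z_def mult.commute)
    then have "bar z * z = 1" by simp
    then have zG: "mat2 z 0 0 z \<in> G" by (simp add: unitary_iff)
    have zT: "mat2 z 0 0 z \<in> T" using zG by (simp add: T_iff2)
    have z1: "z - 1 = 2 * n * inverse (1 + - n)" using u1 by (simp add: z_def field_simps)
    have "ge s' (z - 1)" unfolding z1
      by (rule ge_mult[OF ge_mult[of 0 2 s' n s'] iv]) (use n in \<open>simp_all add: ge_def\<close>)
    then have "mat2 z 0 0 z \<in> Hp" unfolding Gyr_plus_iff using s' zG
      by (intro exI[of _ s']) (simp add: Gyr_iff mat2_one L_mat2)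
    from triv[OF zT this] have "psiE S (trace (D ** (mat2 z 0 0 z - mat 1))) = 1" by (simp add: Psi_def)
    moreover have "trace (D ** (mat2 z 0 0 z - mat 1)) - 4 * (\<iota> u2 * \<sigma> * n) = 4 * (\<iota> u2 * \<sigma>) * (n * n) * inverse (1 + - n)"
      using u1 z1 by (simp add: D_def Gamma_elt_def mat2_one) (simp add: field_simps)
    moreover have "ge (- r + 2 * s') (4 * (\<iota> u2 * \<sigma>) * (n * n) * inverse (1 + - n))"
    proof -
      have "ge 0 (4::'e)" using ge_mult[of 0 2 0 2 0] by (simp add: ge_def)
      then have a: "ge (- r) (4 * (\<iota> u2 * \<sigma>))" by (rule ge_mult[OF _ gu']) simp
      have b: "ge (2 * s') (n * n)" by (rule ge_mult[OF n(1,1)]) simp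
      show ?thesis by (rule ge_mult[OF ge_mult[OF a b order_refl] iv]) simp
    qed
    ultimately have "psiE S (4 * (\<iota> u2 * \<sigma> * n)) = 1"
      using psiE_cong[of "- r + 2 * s'" "trace (D ** (mat2 z 0 0 z - mat 1))"] s' by simp
    moreover have "4 * (\<iota> u2 * \<sigma> * n) = \<iota> (4 * \<epsilon> * (u2 * \<beta>))"
    proof -
      have "\<iota> 4 = 4" using emb_add[of 2 2] by (simp del: emb_add)
      then show ?thesis by (simp add: n_def ac_simps flip: sigma_sq)
    qed
    ultimately show "psiF S (4 * \<epsilon> * (u2 * \<beta>)) = 1" by (simp add: psiE_re del: emb_mult)
  qed
  have B2: "v2 * (\<gamma>1 * \<gamma>2) = 0 \<or> - (s' - y - real_of_int (\<nu> \<gamma>1)) < real_of_int (\<nu> (v2 * (\<gamma>1 * \<gamma>2)))" if s': "s < s'" for s'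
  proof (rule psi_dual_F[of "2 * \<epsilon>"])
    show "2 * \<epsilon> \<noteq> 0" "\<nu> (2 * \<epsilon>) = 0" by (simp_all add: nu_mult)
    fix \<xi> assume x: "geF (s' - y - real_of_int (\<nu> \<gamma>1)) \<xi>"
    have sp: "0 < s'" using s' s_pos by simp
    define q where "q = \<iota> \<xi> * \<sigma>"
    have q: "bar q = - q" "q = 0 \<or> s' - y - real_of_int (\<nu> \<gamma>1) \<le> real_of_int (ve q)"
      using x by (cases "\<xi> = 0"; auto simp: q_def geF_def ve_mult)+
    obtain \<mu> where mu: "bar \<mu> = \<mu>" "ge (2 * s') (\<mu> - 1)" "mat2 \<mu> (\<mu> * q * \<iota> \<gamma>1) (\<mu> * q * \<iota> \<gamma>2) \<mu> \<in> T"
      "mat2 \<mu> (\<mu> * q * \<iota> \<gamma>1) (\<mu> * q * \<iota> \<gamma>2) \<mu> \<in> Gyr S y s'" by (rule torus_elt[OF q sp])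
    define t where "t = mat2 \<mu> (\<mu> * q * \<iota> \<gamma>1) (\<mu> * q * \<iota> \<gamma>2) \<mu>"
    have "t \<in> Hp" using mu(4) s' by (auto simp: t_def Gyr_plus_iff)
    from triv[OF mu(3)[folded t_def] this] have p1: "psiE S (trace (D ** (t - mat 1))) = 1" by (simp add: Psi_def)
    \<comment> \<open>The pairing with the torus element splits into e0, purely imaginary and so
      invisible to \<psi>, e2 of positive depth, and the term e1, which is linear in \<xi>.\<close>
    define e0 where "e0 = 2 * (\<iota> u2 * \<sigma>) * (\<mu> - 1)"
    define e1 where "e1 = 2 * \<iota> (v2 * (\<gamma>1 * \<gamma>2)) * \<sigma> * q"
    define e2 where "e2 = 2 * \<iota> (v2 * \<gamma>1) * \<sigma> * (q * \<iota> \<gamma>2) * (\<mu> - 1)"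
    have tr: "trace (D ** (t - mat 1)) = e0 + (e1 + e2)"
      by (simp add: t_def D_def Gamma_elt_def mat2_one e0_def e1_def e2_def algebra_simps)
    have "bar e0 = - e0" using mu(1) by (simp add: e0_def)
    then have "re e0 = 0" by (simp add: imag_eq)
    then have p0: "psiE S e0 = 1" by (simp add: psiE_re)
    have q2: "ge (s' + y) (q * \<iota> \<gamma>2)" using q(2) gam by (cases "q = 0") (auto simp: ge_def ve_mult)
    have "ge 0 (2::'e)" by (simp add: ge_def)
    then have "ge (- r - y) (2 * \<iota> (v2 * \<gamma>1))" by (rule ge_mult[OF _ gv']) simp
    then have "ge (- r - y) (2 * \<iota> (v2 * \<gamma>1) * \<sigma>)" by (simp only: ge_sigma_mult)
    from ge_mult[OF ge_mult[OF this q2 order_refl] mu(2) order_refl]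
    have "ge (- r - y + (s' + y) + 2 * s') e2" by (simp add: e2_def)
    then have p2: "psiE S e2 = 1" by (rule psiE_triv) (use s' s_pos in simp)
    have "psiE S e1 = 1" using p1 p0 p2 unfolding tr psiE_add by simp
    moreover have "e1 = \<iota> (2 * \<epsilon> * (v2 * (\<gamma>1 * \<gamma>2) * \<xi>))"
      by (simp add: e1_def q_def ac_simps flip: sigma_sq)
    ultimately show "psiF S (2 * \<epsilon> * (v2 * (\<gamma>1 * \<gamma>2) * \<xi>)) = 1" by (simp add: psiE_re del: emb_mult)
  qed
  have C1: "geF (- s) u2"
  proof (rule ccontr)
    assume "\<not> geF (- s) u2"
    then have "u2 \<noteq> 0" "s < - real_of_int (\<nu> u2)" by (auto simp: geF_def)
    then show False using B1[of "- real_of_int (\<nu> u2)"] by simp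
  qed
  have C2: "geF (- s - y) (v2 * \<gamma>1)" "geF (- s + y) (v2 * \<gamma>2)"
  proof -
    have nv: "v2 \<noteq> 0 \<Longrightarrow> real_of_int (\<nu> (v2 * \<gamma>1)) = real_of_int (\<nu> v2) + real_of_int (\<nu> \<gamma>1)"
      "v2 \<noteq> 0 \<Longrightarrow> real_of_int (\<nu> (v2 * \<gamma>2)) = real_of_int (\<nu> v2) + real_of_int (\<nu> \<gamma>2)"
      "v2 \<noteq> 0 \<Longrightarrow> real_of_int (\<nu> (v2 * (\<gamma>1 * \<gamma>2))) = real_of_int (\<nu> v2) + (real_of_int (\<nu> \<gamma>1) + real_of_int (\<nu> \<gamma>2))"
      using gam by (simp_all add: nu_mult)
    have "- s - y \<le> real_of_int (\<nu> v2) + real_of_int (\<nu> \<gamma>1)" if z: "v2 \<noteq> 0"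
    proof (rule ccontr)
      assume "\<not> ?thesis"
      then have "s < - (real_of_int (\<nu> v2) + real_of_int (\<nu> \<gamma>1) + y)" by simp
      from B2[OF this] show False using z nv(3)[OF z] gam by simp
    qed
    then show "geF (- s - y) (v2 * \<gamma>1)" "geF (- s + y) (v2 * \<gamma>2)" using nv gam(3) by (auto simp: geF_def)
  qed
  have "ge (- s) (\<iota> u2)" "ge (- s - y) (\<iota> (v2 * \<gamma>1))" "ge (- s + y) (\<iota> (v2 * \<gamma>2))" using C1 C2 by (simp_all only: ge_emb)
  then have DL: "D \<in> L y (- s)" by (simp add: D_def Gamma_elt_def L_mat2)
  obtain s' where s': "s' > s" "g \<in> Gyr S y s'" using g by (auto simp: Gyr_plus_iff)
  have "Psi S D g = 1" by (rule Psi_triv[OF DL, of g s']) (use s' in \<open>auto simp: Gyr_iff\<close>)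
  then show ?thesis unfolding sum Psi_add by simp
qed

text \<open>Two factorizations differ by an element of both \<open>Hp\<close> and \<open>T\<close>,
  where \<phi> and \<open>Psi S \<Gamma>\<close> agree because \<open>\<Gamma>\<close> represents
  \<phi>.\<close>

lemma phi_hat_eq: assumes g: "g \<in> Hp" and t: "t \<in> T"
  shows "phi_hat S \<gamma>1 \<gamma>2 y r \<phi> \<Gamma> (g ** t) = Psi S \<Gamma> g * \<phi> t"
  unfolding phi_hat_def
proof (rule the_equality)
  show "\<exists>g'\<in>Hp. \<exists>t'\<in>T. g ** t = g' ** t' \<and> Psi S \<Gamma> g * \<phi> t = Psi S \<Gamma> g' * \<phi> t'" using assms by blast
  fix c assume "\<exists>g'\<in>Hp. \<exists>t'\<in>T. g ** t = g' ** t' \<and> c = Psi S \<Gamma> g' * \<phi> t'"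
  then obtain g' t' where g': "g' \<in> Hp" "t' \<in> T" "g ** t = g' ** t'" "c = Psi S \<Gamma> g' * \<phi> t'" by blast
  define k where "k = matrix_inv g' ** g"
  have G: "g \<in> G" "g' \<in> G" "t \<in> G" "t' \<in> G" using assms g' Hp_G T_G by auto
  have kt: "k ** t = t'" using g'(3) G by (simp add: k_def gassoc)
  have k2: "k = t' ** matrix_inv t" using G by (simp add: k_def gassoc flip: kt)
  have kH: "k \<in> Hp" unfolding k_def by (rule subgroup_mult[OF Hp_sub subgroup_inv[OF Hp_sub g'(1)] g])
  have kT: "k \<in> T" unfolding k2 by (rule subgroup_mult[OF T_sub g'(2) subgroup_inv[OF T_sub t]])
  have "\<phi> k = Psi S \<Gamma> k" using phi(2) kH kT by (simp add: torus_r_plus_def)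
  moreover have "Psi S \<Gamma> g = Psi S \<Gamma> g' * Psi S \<Gamma> k"
    using Psi_Hp(1)[of g' k] g'(1) Hp_H kH G by (auto simp: k_def)
  moreover have "\<phi> t' = \<phi> k * \<phi> t" using phi_mult[OF kT t] kt by simp
  ultimately show "c = Psi S \<Gamma> g * \<phi> t" using g'(4) by simp
qed

abbreviation "Ts \<equiv> torus_r S \<gamma>1 \<gamma>2 y s"
abbreviation "N \<equiv> set_prod Hp Ts"

lemma Ts_sub: "mat_subgroup Ts" unfolding torus_r_def by (rule subgroup_Int[OF T_sub H_sub])
lemma Ts_T: "Ts \<subseteq> T" by (auto simp: torus_r_def)
lemma T_norm_Hp: "t \<in> T \<Longrightarrow> h \<in> Hp \<Longrightarrow> t ** h ** matrix_inv t \<in> Hp"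
  using T_L0 Gyr_plus_normal by blast
lemma N_eq: "N = set_prod Ts Hp"
  using subgroup_set_prod(2)[OF Ts_sub _ Hp_sub Hp_G T_norm_Hp] Ts_T T_G by blast
lemma N_sub: "mat_subgroup N"
  unfolding N_eq using subgroup_set_prod(1)[OF Ts_sub _ Hp_sub Hp_G T_norm_Hp] Ts_T T_G by blast
lemma N_G: "N \<subseteq> G" using subgroup_Gyr Hp_G Ts_T T_G by (force simp: set_prod_def)
lemma Hp_N: "Hp \<subseteq> N"
proof
  fix h assume "h \<in> Hp"
  then have "h ** mat 1 \<in> N" unfolding set_prod_def using subgroup_one[OF Ts_sub] by blast
  then show "h \<in> N" by simp
qed

lemma T_norm_N: assumes t: "t \<in> T" and n: "n \<in> N" shows "mconj t n \<in> N"
proof -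
  obtain h k where hk: "h \<in> Hp" "k \<in> T" "k \<in> H" "n = h ** k" using n by (auto simp: set_prod_def torus_r_def)
  have G: "t \<in> G" "h \<in> G" "k \<in> G" using t hk T_G Hp_G by auto
  have "mconj t n = (t ** h ** matrix_inv t) ** (t ** k ** matrix_inv t)" using G by (simp add: mconj_def hk(4) gassoc)
  moreover have "t ** k ** matrix_inv t \<in> T" using subgroup_mult[OF T_sub subgroup_mult[OF T_sub t hk(2)] subgroup_inv[OF T_sub t]] .
  moreover have "t ** k ** matrix_inv t \<in> H" by (rule T_norm_H[OF t hk(3)])
  moreover have "t ** h ** matrix_inv t \<in> Hp" by (rule T_norm_Hp[OF t hk(1)])
  ultimately show ?thesis unfolding set_prod_def torus_r_def by blast
qed

text \<open>Such a t is a scalar plus an off-diagonal matrix n of depth \<rho> > 0 at y. Only n and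
  h - 1 contribute to the commutator, which therefore has depth \<rho> + s.\<close>

lemma T_deep_commutator:
  assumes t: "t \<in> T" "t $ 1 $ 2 = 0 \<or> - y < real_of_int (ve (t $ 1 $ 2))" and h: "h \<in> H"
  shows "matrix_inv h ** mconj t h \<in> Hp"
proof -
  obtain a b c e where m: "t = mat2 a b c e" by (rule mat2_cases)
  have tT: "mat2 a b c e \<in> T" using t m by simp
  have te: "e = a" "c * \<iota> \<gamma>1 = b * \<iota> \<gamma>2" using tT T_iff2 by auto
  have G: "t \<in> G" "h \<in> G" using t h T_G H_G by auto
  \<comment> \<open>The depth of the off-diagonal part at y; the value 1 for b = 0 is an arbitrary
    positive number.\<close>
  define \<rho> where "\<rho> = (if b = 0 then 1 else real_of_int (ve b) + y)"
  have rp: "0 < \<rho>" using t(2) by (auto simp: \<rho>_def m)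
  have gb: "ge (\<rho> - y) b" by (auto simp: \<rho>_def ge_def)
  have "c = b * \<iota> (\<gamma>2 / \<gamma>1)" using te gam by (simp add: field_simps)
  moreover have g21: "ge (2 * y) (\<iota> (\<gamma>2 / \<gamma>1))" unfolding ge_emb using gam by (simp add: geF_def nu_divide)
  have "ge (\<rho> + y) (b * \<iota> (\<gamma>2 / \<gamma>1))" by (rule ge_mult[OF gb g21]) simp
  ultimately have gc: "ge (\<rho> + y) c" by metis
  define n where "n = mat2 0 b c 0"
  have nL: "n \<in> L y \<rho>" using gb gc by (simp add: n_def L_mat2)
  have hL: "h - mat 1 \<in> L y s" using h by (simp add: Gyr_iff)
  define X where "X = h - mat 1"
  have X: "X \<in> L y s" using hL by (simp add: X_def)
  have hX: "h = mat 1 + X" by (simp add: X_def)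
  have "t ** h - h ** t = n ** X - X ** n"
    unfolding hX by (cases X rule: mat2_cases) (simp add: m te(1) n_def mat2_one algebra_simps)
  moreover have "n ** X - X ** n \<in> L y (\<rho> + s)" by (rule L_diff; rule L_mult[OF nL X] L_mult[OF X nL]) simp_all
  ultimately have c1: "t ** h - h ** t \<in> L y (\<rho> + s)" by simp
  have ti: "matrix_inv t \<in> L y 0" using T_L0 t(1) inv_L0 by (auto simp: Gyr_0_iff)
  have "mconj t h - h = (t ** h - h ** t) ** matrix_inv t" using G by (simp add: mconj_def matrix_diff_rdistrib gassoc)
  then have "mconj t h - h \<in> L y (\<rho> + s)" using L_mult[OF c1 ti, of "\<rho> + s"] by simp
  moreover have "mconj t h \<in> G" using G by (simp add: mconj_def)
  moreover have "h \<in> Gyr S y 0" using h H_L0 by auto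
  ultimately have "matrix_inv h ** mconj t h \<in> Gyr S y (\<rho> + s)" by (intro Gyr_close(1))
  then show ?thesis unfolding Gyr_plus_iff using rp by (intro exI[of _ "\<rho> + s"]) simp
qed

lemma T_deep_action:
  assumes t: "t \<in> T" "t $ 1 $ 2 = 0 \<or> - y < real_of_int (ve (t $ 1 $ 2))"
  shows "conj_action H N t = restrict id (quot_space H N)"
proof -
  have "mconj t ` C = C" if C: "C \<in> quot_space H N" for C
  proof -
    obtain h where h: "h \<in> H" "C = coset_of N h" using C by (auto simp: quot_space_def)
    have G: "t \<in> G" "h \<in> G" using t h T_G H_G by auto
    have ti: "matrix_inv t \<in> T" by (rule subgroup_inv[OF T_sub t(1)])
    have mN: "mconj t ` N = N"
    proof (intro set_eqI iffI)
      fix n assume n: "n \<in> N"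
      have "n = mconj t (mconj (matrix_inv t) n)" using G by (simp add: mconj_def gassoc)
      then show "n \<in> mconj t ` N" using T_norm_N[OF ti n] by blast
    qed (use T_norm_N[OF t(1)] in blast)
    have "mconj t ` C = (\<lambda>x. mconj t h ** x) ` (mconj t ` N)"
      using G by (simp add: h(2) coset_of_eq image_image mconj_def gassoc)
    also have "\<dots> = coset_of N (mconj t h)" by (simp add: mN coset_of_eq)
    also have "\<dots> = coset_of N h"
      by (rule coset_eqI[OF N_sub N_G G(2), symmetric]) (use T_deep_commutator[OF t h(1)] Hp_N in blast)
    finally show ?thesis using h by simp
  qed
  then show ?thesis unfolding conj_action_def by (intro restrict_ext) simp
qed

text \<open>In the Heisenberg case deep torus elements act trivially on V
  (\<open>T_deep_action\<close>), so \<omega> is the identity there: \<rho> restricts to \<eta> on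
  \<open>H\<close> and to \<phi> on these elements. In the other case \<rho> is a line and
  everything is read off \<open>phi_hat\<close>.\<close>

lemma datum_rep_of_rho:
  fixes R :: "('e ^ 2 ^ 2, 'v::ab_group_add) rep"
  assumes rho: "is_rho S \<gamma>1 \<gamma>2 y r \<phi> R"
    and gdI: "\<And>\<Gamma>'. generic_elt S \<gamma>1 \<gamma>2 y r \<Gamma>' \<Longrightarrow> represents S \<gamma>1 \<gamma>2 y r \<Gamma>' \<phi> \<Longrightarrow>
      \<exists>u' v'. \<Gamma>' = Gamma_elt S \<gamma>1 \<gamma>2 u' v' \<and> generic_datum S \<gamma>1 \<gamma>2 y r u' v' \<phi>"
  shows "datum_rep S \<gamma>1 \<gamma>2 y r u v \<phi> R"
proof -
  define cell_lattice where "cell_lattice = (\<Union>s\<in>{r / 2<..}. mat_lattice S y s)"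
  obtain \<Gamma>' where G': "generic_elt S \<gamma>1 \<gamma>2 y r \<Gamma>'" "represents S \<gamma>1 \<gamma>2 y r \<Gamma>' \<phi>"
    and cases: "if H = Hp then vector_space.dim (rscale R) (rspace R) = 1 \<and>
                (\<forall>x\<in>J. \<forall>z\<in>rspace R. ract R x z = rscale R (phi_hat S \<gamma>1 \<gamma>2 y r \<phi> \<Gamma>' x) z)
           else \<exists>\<eta> \<omega>. rscale \<eta> = rscale R \<and> rspace \<eta> = rspace R \<and> irreducible_rep S H \<eta> \<and>
                  (\<forall>n\<in>N. \<forall>z\<in>rspace \<eta>. ract \<eta> n z = rscale \<eta> (phi_hat S \<gamma>1 \<gamma>2 y r \<phi> \<Gamma>' n) z) \<and>
                  is_weil_rep S H N cell_lattice (phi_hat S \<gamma>1 \<gamma>2 y r \<phi> \<Gamma>') T \<eta> \<omega> \<and>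
                  (\<forall>g\<in>H. \<forall>t\<in>T. \<forall>z\<in>rspace R.
                     ract R (g ** t) z = ract \<eta> g (ract \<omega> (conj_action H N t) (rscale R (\<phi> t) z)))"
    and sm: "smooth_rep S J R"
    using rho unfolding is_rho_def Let_def cell_lattice_def by blast
  obtain u' v' where uv': "\<Gamma>' = Gamma_elt S \<gamma>1 \<gamma>2 u' v'" "generic_datum S \<gamma>1 \<gamma>2 y r u' v' \<phi>" using gdI[OF G'] by blast
  interpret G': generic_datum S \<gamma>1 \<gamma>2 y r u' v' \<phi> by (rule uv')
  define \<theta> where "\<theta> = phi_hat S \<gamma>1 \<gamma>2 y r \<phi> \<Gamma>'"
  have theta: "\<theta> (g ** t) = Psi S \<Gamma> g * \<phi> t" if "g \<in> Hp" "t \<in> T" for g t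
    unfolding \<theta>_def uv'(1) using G'.phi_hat_eq[OF that] Psi_unique[OF uv'(2) that(1)] by simp
  have theta_H: "\<theta> g = Psi S \<Gamma> g" if "g \<in> Hp" for g
    using theta[OF that subgroup_one[OF T_sub]] phi_one by simp
  have theta_T: "\<theta> t = \<phi> t" if "t \<in> T" for t
    using theta[OF subgroup_one[OF Hp_sub] that] by simp
  have sr: "srep J R" using sm smooth_rep_iff[OF J_sub J_G] by blast
  then have rp: "is_rep J (**) (mat 1) R" by (simp add: srep_def)
  interpret V: vector_space "rscale R" using rp by (simp add: is_rep_def)
  have Rsub: "V.subspace (rspace R)" using rp by (simp add: is_rep_def)
  have "(\<forall>g\<in>Hp. \<forall>x\<in>rspace R. ract R g x = rscale R (Psi S \<Gamma> g) x) \<and> irr H R \<and>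
    (\<forall>t\<in>T. (t $ 1 $ 2 = 0 \<or> - y < real_of_int (ve (t $ 1 $ 2))) \<longrightarrow> (\<forall>x\<in>rspace R. ract R t x = rscale R (\<phi> t) x))"
  proof (cases "H = Hp")
    case True
    then have dim: "V.dim (rspace R) = 1" and act: "\<And>x z. x \<in> J \<Longrightarrow> z \<in> rspace R \<Longrightarrow> ract R x z = rscale R (\<theta> x) z"
      using cases by (auto simp: \<theta>_def)
    obtain bs where bs: "bs \<subseteq> rspace R" "V.independent bs" "rspace R \<subseteq> V.span bs" "card bs = V.dim (rspace R)"
      using V.basis_exists by blast
    then obtain b where b: "bs = {b}" using dim card_1_singletonE by metis
    have b0: "b \<noteq> 0" using bs(2) b by (metis V.dependent_zero insertI1)
    have gen: "\<exists>c. x = rscale R c b" if "x \<in> rspace R" for x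
      using bs(3) that unfolding b V.span_singleton by blast
    have "irr H R" unfolding irr_def
    proof (intro conjI allI impI)
      show "rspace R \<noteq> {0}" using bs(1) b b0 by auto
      fix W assume W: "W \<subseteq> rspace R \<and> V.subspace W \<and> (\<forall>h\<in>H. \<forall>v\<in>W. ract R h v \<in> W)"
      show "W = {0} \<or> W = rspace R"
      proof (cases "W = {0}")
        case False
        then obtain w where w: "w \<in> W" "w \<noteq> 0" using W V.subspace_0 by blast
        then obtain c where c: "w = rscale R c b" using gen W by blast
        have c0: "c \<noteq> 0" using w(2) c by auto
        have "x \<in> W" if "x \<in> rspace R" for x
        proof -
          obtain a where "x = rscale R a b" using gen[OF \<open>x \<in> rspace R\<close>] by blast
          then have "x = rscale R (a / c) w" using c c0 by simp
          then show ?thesis using V.subspace_scale w(1) W by blast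
        qed
        then show ?thesis using W by blast
      qed simp
    qed
    then show ?thesis using act theta_H theta_T Hp_H H_J T_J by (auto simp: subset_iff)
  next
    case False
    then obtain \<eta> \<omega> where eta: "rscale \<eta> = rscale R" "rspace \<eta> = rspace R" "irreducible_rep S H \<eta>"
      "\<And>n z. n\<in>N \<Longrightarrow> z\<in>rspace \<eta> \<Longrightarrow> ract \<eta> n z = rscale \<eta> (\<theta> n) z"
      "is_weil_rep S H N cell_lattice \<theta> T \<eta> \<omega>"
      "\<And>g t z. g\<in>H \<Longrightarrow> t\<in>T \<Longrightarrow> z\<in>rspace R \<Longrightarrow>
          ract R (g ** t) z = ract \<eta> g (ract \<omega> (conj_action H N t) (rscale R (\<phi> t) z))"
      using cases[unfolded if_not_P[OF False]] unfolding \<theta>_def[symmetric] by blast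
    have om: "ract \<omega> (restrict id (quot_space H N)) z = z" if "z \<in> rspace R" for z
      using eta(5) that eta(2) unfolding is_weil_rep_def is_rep_def by auto
    have one: "(mat 1 :: 'e ^ 2 ^ 2) $ 1 $ 2 = 0" by (simp add: mat_def)
    have eH: "ract R g z = ract \<eta> g z" if g: "g \<in> H" and z: "z \<in> rspace R" for g z
    proof -
      have "ract R (g ** mat 1) z = ract \<eta> g (ract \<omega> (conj_action H N (mat 1)) (rscale R (\<phi> (mat 1)) z))"
        by (rule eta(6)[OF g subgroup_one[OF T_sub] z])
      also have "conj_action H N (mat 1) = restrict id (quot_space H N)"
        by (rule T_deep_action[OF subgroup_one[OF T_sub]]) (use one in simp)
      also have "rscale R (\<phi> (mat 1)) z = z" by (simp add: phi_one)
      finally show ?thesis unfolding om[OF z] by simp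
    qed
    have e1: "ract \<eta> (mat 1) z = z" if "z \<in> rspace R" for z
      using eta(3) that eta(2) unfolding irreducible_rep_def smooth_rep_def is_rep_def by auto
    have "irr H \<eta>" using eta(3) unfolding irreducible_rep_iff by simp
    then have ie: "rspace R \<noteq> {0}" "\<And>W. W \<subseteq> rspace R \<and> V.subspace W \<and> (\<forall>h\<in>H. \<forall>x\<in>W. ract \<eta> h x \<in> W) \<Longrightarrow> W = {0} \<or> W = rspace R"
      unfolding irr_def eta(1,2) by blast+
    have "irr H R" unfolding irr_def
    proof (intro conjI allI impI)
      fix W assume W: "W \<subseteq> rspace R \<and> V.subspace W \<and> (\<forall>h\<in>H. \<forall>x\<in>W. ract R h x \<in> W)"
      have "ract \<eta> h x \<in> W" if "h \<in> H" "x \<in> W" for h x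
      proof -
        have "ract R h x \<in> W" "x \<in> rspace R" using W that by blast+
        then show ?thesis using eH[OF that(1)] by simp
      qed
      then show "W = {0} \<or> W = rspace R" using ie(2) W by blast
    qed (rule ie)
    moreover have "ract R g x = rscale R (Psi S \<Gamma> g) x" if "g \<in> Hp" "x \<in> rspace R" for g x
    proof -
      have "g \<in> H" "g \<in> N" using that(1) Hp_H Hp_N by blast+
      then show ?thesis using eH[of g x] eta(4)[of g x] that theta_H eta(1,2) by simp
    qed
    moreover have "ract R t x = rscale R (\<phi> t) x"
      if t: "t \<in> T" "t $ 1 $ 2 = 0 \<or> - y < real_of_int (ve (t $ 1 $ 2))" and x: "x \<in> rspace R" for t x
    proof -
      have sx: "rscale R (\<phi> t) x \<in> rspace R" by (rule V.subspace_scale[OF Rsub x])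
      show ?thesis using eta(6)[OF subgroup_one[OF H_sub] t(1) x] T_deep_action[OF t] om[OF sx] e1[OF sx] by simp
    qed
    ultimately show ?thesis by blast
  qed
  then show ?thesis using sr by unfold_locales auto
qed

end

lemma (in u11) generic_datum_of_generic_elt:
  assumes tp: "torus_point S \<gamma>1 \<gamma>2 y" and r: "0 < r" and ph: "smooth_char S (torus S \<gamma>1 \<gamma>2) \<phi>"
    and gen: "generic_elt S \<gamma>1 \<gamma>2 y r \<Gamma>" and rp: "represents S \<gamma>1 \<gamma>2 y r \<Gamma> \<phi>"
  shows "\<exists>u v. \<Gamma> = Gamma_elt S \<gamma>1 \<gamma>2 u v \<and> generic_datum S \<gamma>1 \<gamma>2 y r u v \<phi>"
proof -
  obtain u v where uv: "\<Gamma> = Gamma_elt S \<gamma>1 \<gamma>2 u v" "v * \<gamma>1 \<noteq> 0" "real_of_int (\<nu> (v * \<gamma>1)) = - r - y"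
    using gen by (auto simp: generic_elt_def)
  have "\<Gamma> $ 1 $ 1 \<in> pE S \<lceil>- r\<rceil>" using gen by (simp add: generic_elt_def lie_torus_r_def lie_yr_def)
  then have "geF (- r) u" unfolding pE_ceiling by (simp add: uv(1) Gamma_elt_def)
  then have u: "u = 0 \<or> - r \<le> real_of_int (\<nu> u)" by (auto simp: geF_def)
  have np: "\<nu> \<pi> = 1" by (rule F.val_unif)
  have ni: "\<nu> (inverse \<pi>) = - 1" "\<nu> (inverse \<epsilon>) = 0" by (simp_all add: nu_inverse np)
  have ne: "\<nu> (inverse \<epsilon> * \<pi>) = 1" by (simp add: nu_mult ni np)
  have gam: "\<gamma>1 \<noteq> 0 \<and> \<gamma>2 \<noteq> 0 \<and> real_of_int (\<nu> \<gamma>2) - real_of_int (\<nu> \<gamma>1) = 2 * y \<and> (\<gamma>1 * \<gamma>2 = 1 \<or> \<nu> (\<gamma>1 * \<gamma>2) = 1)"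
    using tp unfolding torus_point_def by (elim insertE emptyE) (simp_all add: np ni ne)
  have "generic_datum S \<gamma>1 \<gamma>2 y r u v \<phi>"
    using gam r u uv ph rp by unfold_locales (auto simp: represents_def)
  then show ?thesis using uv(1) by blast
qed

subsection \<open>Conjugation of data\<close>

text \<open>Transport of structure by g. The hypotheses say how conjugation moves the lattices and
  the torus; smoothness needs in addition \<open>conj_Gyr\<close>, since congruence groups at 0 are
  not preserved.\<close>

lemma (in datum_rep) conj_datum_rep:
  assumes g: "g \<in> G" and gL: "\<And>X \<rho>. X \<in> L y \<rho> \<longleftrightarrow> mconj g X \<in> L y' \<rho>"
    and gT: "\<And>a b. mconj g (mat2 a (b * \<iota> \<gamma>1) (b * \<iota> \<gamma>2) a) = mat2 a (b * \<iota> \<gamma>1') (b * \<iota> \<gamma>2') a"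
    and gam': "\<gamma>1' \<noteq> 0" "\<gamma>2' \<noteq> 0" "real_of_int (\<nu> \<gamma>2') - real_of_int (\<nu> \<gamma>1') = 2 * y'"
      "\<gamma>1' * \<gamma>2' = \<gamma>1 * \<gamma>2" "real_of_int (\<nu> (v * \<gamma>1')) = - r - y'"
  shows "datum_rep S \<gamma>1' \<gamma>2' y' r u v (cconj g \<phi>) (crep g R)" "inducing_group S \<gamma>1' \<gamma>2' y' r = mconj g ` J"
    "Gamma_elt S \<gamma>1' \<gamma>2' u v = mconj g \<Gamma>"
proof -
  have mG: "mconj g x \<in> G \<longleftrightarrow> x \<in> G" for x
  proof
    assume "mconj g x \<in> G"
    then have "matrix_inv g ** mconj g x ** g \<in> G" using g by simp
    then show "x \<in> G" using g by (simp add: mconj_def gassoc)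
  qed (use g in \<open>simp add: mconj_def\<close>)
  have surj: "mconj g (matrix_inv g ** x ** g) = x" for x using g by (simp add: mconj_def gassoc)
  have inv: "matrix_inv g ** mconj g x ** g = x" for x using g by (simp add: mconj_def gassoc)
  have imgI: "x \<in> mconj g ` A \<longleftrightarrow> matrix_inv g ** x ** g \<in> A" for x A
    using surj inv by (metis imageE imageI)
  have Gyr': "Gyr S y' \<rho> = mconj g ` Gyr S y \<rho>" for \<rho>
  proof -
    have "x \<in> Gyr S y \<rho> \<longleftrightarrow> mconj g x \<in> Gyr S y' \<rho>" for x
    proof -
      have "mconj g x - mat 1 = mconj g (x - mat 1)"
        using g by (simp add: mconj_def matrix_diff_ldistrib matrix_diff_rdistrib)
      then show ?thesis unfolding Gyr_iff using mG gL by simp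
    qed
    then show ?thesis using surj by (auto simp: image_iff) metis
  qed
  have Gyrp': "Gyr_plus S y' \<rho> = mconj g ` Gyr_plus S y \<rho>" for \<rho>
    unfolding Gyr_plus_def Gyr' by blast
  have T': "torus S \<gamma>1' \<gamma>2' = mconj g ` T"
  proof (intro set_eqI iffI)
    fix x assume x: "x \<in> torus S \<gamma>1' \<gamma>2'"
    then obtain a b where ab: "x = mat2 a (b * \<iota> \<gamma>1') (b * \<iota> \<gamma>2') a" "x \<in> G" by (auto simp: torus_def)
    have "mat2 a (b * \<iota> \<gamma>1) (b * \<iota> \<gamma>2) a \<in> T" unfolding T_iff using ab mG[of "mat2 a (b * \<iota> \<gamma>1) (b * \<iota> \<gamma>2) a"] gT by auto
    then show "x \<in> mconj g ` T" using ab gT by (metis imageI)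
  next
    fix x assume "x \<in> mconj g ` T"
    then obtain z where z: "z \<in> T" "x = mconj g z" by blast
    then obtain a b where ab: "x = mconj g (mat2 a (b * \<iota> \<gamma>1) (b * \<iota> \<gamma>2) a)" "mat2 a (b * \<iota> \<gamma>1) (b * \<iota> \<gamma>2) a \<in> G"
      unfolding T_iff by blast
    have "x \<in> G" unfolding ab(1) mG by (rule ab)
    then show "x \<in> torus S \<gamma>1' \<gamma>2'" unfolding torus_def using ab(1) gT by blast
  qed
  have mm: "mconj g (x ** z) = mconj g x ** mconj g z" for x z using g by (simp add: mconj_def gassoc)
  show J': "inducing_group S \<gamma>1' \<gamma>2' y' r = mconj g ` J"
    unfolding inducing_group_def Gyr' T' set_prod_def by (auto simp: image_iff mm) (metis mm)+
  show Gam': "Gamma_elt S \<gamma>1' \<gamma>2' u v = mconj g \<Gamma>"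
    using gT[of "\<iota> u * \<sigma>" "\<iota> v * \<sigma>"] by (simp add: Gamma_elt_def ac_simps)
  have Psi': "Psi S (mconj g \<Gamma>) x = Psi S \<Gamma> (matrix_inv g ** x ** g)" for x
    using Psi_conj[OF G_inv[OF g], of \<Gamma> x] g by (simp add: mconj_def)
  have TJG: "T \<subseteq> G" "J \<subseteq> G" by (rule T_G, rule J_G)
  note old = gam uv
  interpret C: generic_datum S \<gamma>1' \<gamma>2' y' r u v "cconj g \<phi>"
  proof unfold_locales
    show "\<gamma>1' * \<gamma>2' = 1 \<or> \<nu> (\<gamma>1' * \<gamma>2') = 1" using gam gam'(4) by simp
    show "smooth_char S (torus S \<gamma>1' \<gamma>2') (cconj g \<phi>)" unfolding smooth_char_def
    proof (intro conjI ballI)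
      show "cconj g \<phi> (mat 1) = 1" using g phi_one by (simp add: cconj_def)
      show "cconj g \<phi> (a ** b) = cconj g \<phi> a * cconj g \<phi> b" if "a \<in> torus S \<gamma>1' \<gamma>2'" "b \<in> torus S \<gamma>1' \<gamma>2'" for a b
      proof -
        have "matrix_inv g ** a ** g \<in> T" "matrix_inv g ** b ** g \<in> T" using that unfolding T' imgI by auto
        moreover have "matrix_inv g ** (a ** b) ** g = (matrix_inv g ** a ** g) ** (matrix_inv g ** b ** g)" using g by (simp add: gassoc)
        ultimately show ?thesis using phi_mult by (simp add: cconj_def)
      qed
      have "openin (subtopology (mat_top S) T) {x \<in> T. \<phi> x = 1}" using phi(1) by (simp add: smooth_char_def)
      from open_nbhd[OF this _ T_G] obtain n where n: "n > 0" "T \<inter> Gyr S 0 n \<subseteq> {x \<in> T. \<phi> x = 1}"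
        using subgroup_one[OF T_sub] phi_one by auto
      obtain m where m: "m > 0" "\<And>u. u \<in> Gyr S 0 m \<Longrightarrow> matrix_inv g ** u ** g \<in> Gyr S 0 n"
        using conj_Gyr[OF G_inv[OF g] n(1)] g by auto
      have sub: "mat_subgroup (torus S \<gamma>1' \<gamma>2')"
      proof (rule subgroupI)
        show "torus S \<gamma>1' \<gamma>2' \<subseteq> G" by (auto simp: torus_def)
        show "mat 1 \<in> torus S \<gamma>1' \<gamma>2'" unfolding T' imgI using subgroup_one[OF T_sub] g by simp
        fix x assume x: "x \<in> torus S \<gamma>1' \<gamma>2'"
        then have xT: "matrix_inv g ** x ** g \<in> T" unfolding T' imgI .
        have xG: "x \<in> G" using x by (simp add: torus_def)
        show "matrix_inv x \<in> torus S \<gamma>1' \<gamma>2'" unfolding T' imgI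
          using subgroup_inv[OF T_sub xT] g xG by (simp add: gassoc)
        fix z assume "z \<in> torus S \<gamma>1' \<gamma>2'"
        then have zT: "matrix_inv g ** z ** g \<in> T" unfolding T' imgI .
        show "x ** z \<in> torus S \<gamma>1' \<gamma>2'" unfolding T' imgI
          using subgroup_mult[OF T_sub xT zT] g by (simp add: gassoc)
      qed
      show "openin (subtopology (mat_top S) (torus S \<gamma>1' \<gamma>2')) {x \<in> torus S \<gamma>1' \<gamma>2'. cconj g \<phi> x = 1}"
      proof (rule open_of_nbhd[OF sub _ _ _ m(1)])
        show "torus S \<gamma>1' \<gamma>2' \<subseteq> G" by (auto simp: torus_def)
        fix x w assume x: "x \<in> {x \<in> torus S \<gamma>1' \<gamma>2'. cconj g \<phi> x = 1}" and w: "w \<in> torus S \<gamma>1' \<gamma>2' \<inter> Gyr S 0 m"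
        have xT: "matrix_inv g ** x ** g \<in> T" "\<phi> (matrix_inv g ** x ** g) = 1" using x unfolding T' by (auto simp: imgI cconj_def)
        have wT: "matrix_inv g ** w ** g \<in> T" "matrix_inv g ** w ** g \<in> Gyr S 0 n" using w m(2) unfolding T' by (auto simp: imgI)
        have e: "matrix_inv g ** (x ** w) ** g = (matrix_inv g ** x ** g) ** (matrix_inv g ** w ** g)" using g by (simp add: gassoc)
        have "\<phi> (matrix_inv g ** w ** g) = 1" using wT n(2) by blast
        then have "cconj g \<phi> (x ** w) = 1" unfolding cconj_def e using phi_mult[OF xT(1) wT(1)] xT(2) by simp
        then show "x ** w \<in> {x \<in> torus S \<gamma>1' \<gamma>2'. cconj g \<phi> x = 1}" using x w subgroup_mult[OF sub] by auto
      qed auto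
    qed
    show "cconj g \<phi> t = Psi S (Gamma_elt S \<gamma>1' \<gamma>2' u v) t" if "t \<in> torus_r_plus S \<gamma>1' \<gamma>2' y' (r / 2)" for t
    proof -
      have "matrix_inv g ** t ** g \<in> torus_r_plus S \<gamma>1 \<gamma>2 y (r/2)"
        using that unfolding torus_r_plus_def T' Gyrp' by (auto simp: imgI)
      then show ?thesis unfolding Gam' Psi' cconj_def by (rule phi(2))
    qed
  qed (use gam' r uv in auto)
  have J0: "set_prod (Gyr S y (r/2)) (torus S \<gamma>1 \<gamma>2) \<subseteq> G" using TJG(2) by (simp add: inducing_group_def)
  show "datum_rep S \<gamma>1' \<gamma>2' y' r u v (cconj g \<phi>) (crep g R)"
  proof unfold_locales
    show "srep (inducing_group S \<gamma>1' \<gamma>2' y' r) (crep g R)" unfolding srep_def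
    proof
      have rp: "is_rep (inducing_group S \<gamma>1 \<gamma>2 y r) (**) (mat 1) R" using R1 by (simp add: srep_def)
      have e: "matrix_inv g ** (x ** z) ** g = (matrix_inv g ** x ** g) ** (matrix_inv g ** z ** g)" for x z
        using g by (simp add: gassoc)
      show "is_rep (inducing_group S \<gamma>1' \<gamma>2' y' r) (**) (mat 1) (crep g R)"
        using rp g unfolding is_rep_def J' crep_simps e by (auto simp: imgI[symmetric] inv)
      show "\<forall>x\<in>rspace (crep g R). \<exists>n>0. \<forall>h\<in>inducing_group S \<gamma>1' \<gamma>2' y' r \<inter> Gyr S 0 n. ract (crep g R) h x = x"
      proof
        fix x assume "x \<in> rspace (crep g R)"
        then obtain n where n: "n > 0" "\<And>h. h\<in>inducing_group S \<gamma>1 \<gamma>2 y r \<inter> Gyr S 0 n \<Longrightarrow> ract R h x = x"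
          using R1 by (auto simp: srep_def)
        obtain m where m: "m > 0" "\<And>u. u \<in> Gyr S 0 m \<Longrightarrow> matrix_inv g ** u ** g \<in> Gyr S 0 n"
          using conj_Gyr[OF G_inv[OF g] n(1)] g by auto
        show "\<exists>n>0. \<forall>h\<in>inducing_group S \<gamma>1' \<gamma>2' y' r \<inter> Gyr S 0 n. ract (crep g R) h x = x"
        proof (intro exI[of _ m] conjI ballI)
          fix h assume h: "h \<in> inducing_group S \<gamma>1' \<gamma>2' y' r \<inter> Gyr S 0 m"
          then have "matrix_inv g ** h ** g \<in> inducing_group S \<gamma>1 \<gamma>2 y r" unfolding J' by (auto simp: imgI)
          then show "ract (crep g R) h x = x" using n(2) m(2) h by simp
        qed (rule m)
      qed
    qed
    show "ract (crep g R) h x = rscale (crep g R) (Psi S (Gamma_elt S \<gamma>1' \<gamma>2' u v) h) x"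
      if "h \<in> Gyr_plus S y' (r / 2)" "x \<in> rspace (crep g R)" for h x
      using R2[of "matrix_inv g ** h ** g" x] that unfolding Gyrp' imgI Gam' Psi' by simp
    have ir: "rspace R \<noteq> {0}" "\<And>W. W \<subseteq> rspace R \<and> module.subspace (rscale R) W \<and> (\<forall>h\<in>Gyr S y (r/2). \<forall>x\<in>W. ract R h x \<in> W) \<Longrightarrow> W = {0} \<or> W = rspace R"
      using R3 unfolding irr_def by blast+
    show "irr (Gyr S y' (r / 2)) (crep g R)" unfolding irr_def crep_simps Gyr'
    proof (intro conjI allI impI)
      fix W assume W: "W \<subseteq> rspace R \<and> module.subspace (rscale R) W \<and>
        (\<forall>h\<in>mconj g ` Gyr S y (r/2). \<forall>x\<in>W. ract R (matrix_inv g ** h ** g) x \<in> W)"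
      then have "\<forall>h\<in>Gyr S y (r/2). \<forall>x\<in>W. ract R h x \<in> W" by (auto simp: inv)
      then show "W = {0} \<or> W = rspace R" using ir(2) W by blast
    qed (rule ir)
    show "ract (crep g R) t x = rscale (crep g R) (cconj g \<phi> t) x"
      if t: "t \<in> torus S \<gamma>1' \<gamma>2'" "t $ 1 $ 2 = 0 \<or> - y' < real_of_int (ve (t $ 1 $ 2))" and x: "x \<in> rspace (crep g R)" for t x
    proof -
      obtain a b where ab: "matrix_inv g ** t ** g = mat2 a (b * \<iota> \<gamma>1) (b * \<iota> \<gamma>2) a"
        using t(1) unfolding T' imgI by (auto simp: torus_def)
      have "t = mconj g (mat2 a (b * \<iota> \<gamma>1) (b * \<iota> \<gamma>2) a)" using surj[of t] ab by simp
      then have t12: "t $ 1 $ 2 = b * \<iota> \<gamma>1'" unfolding gT by simp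
      \<comment> \<open>Both sides equal -r minus the valuation of v. Thus the condition on the
        upper right entry in \<open>R4\<close> is invariant under the conjugation.\<close>
      have "real_of_int (\<nu> \<gamma>1') + y' = real_of_int (\<nu> \<gamma>1) + y" using gam' old by (simp add: nu_mult)
      then have "b * \<iota> \<gamma>1 = 0 \<or> - y < real_of_int (ve (b * \<iota> \<gamma>1))"
        using t(2) gam' old unfolding t12 by (cases "b = 0") (auto simp: ve_mult)
      moreover have "matrix_inv g ** t ** g \<in> torus S \<gamma>1 \<gamma>2" using t(1) unfolding T' imgI .
      ultimately show ?thesis using R4[of "matrix_inv g ** t ** g" x] x by (simp add: ab cconj_def)
    qed
  qed
qed

subsection \<open>The summand of the trivial coset at a hyperspecial vertex\<close>

lemma (in datum_rep) irr_J: "irr J R"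
  unfolding irr_def
proof (intro conjI allI impI)
  have ir: "rspace R \<noteq> {0}" "\<And>W. W \<subseteq> rspace R \<and> module.subspace (rscale R) W \<and> (\<forall>h\<in>H. \<forall>x\<in>W. ract R h x \<in> W) \<Longrightarrow> W = {0} \<or> W = rspace R"
    using R3 unfolding irr_def by blast+
  show "rspace R \<noteq> {0}" by (rule ir)
  fix W assume W: "W \<subseteq> rspace R \<and> module.subspace (rscale R) W \<and> (\<forall>h\<in>J. \<forall>v\<in>W. ract R h v \<in> W)"
  then have "\<forall>h\<in>H. \<forall>v\<in>W. ract R h v \<in> W" using H_J by blast
  then show "W = {0} \<or> W = rspace R" using ir(2) W by blast
qed

text \<open>As in \<open>intertwine_B\<close>, the difference Y has depth -s, so x agrees to depth s
  with the matrix of rows (a, b) and (b, a). The eigenvalues a + b and a - b of that matrix have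
  norm 1 up to depth s; correcting each to norm exactly 1 gives an element of \<open>T\<close> close
  to x.\<close>

lemma (in datum_rep) intertwine_hyperspecial:
  assumes y0: "y = 0" "\<gamma>1 = 1" "\<gamma>2 = 1" and x: "x \<in> K"
    and int: "\<And>m. m \<in> Hp \<Longrightarrow> Psi S \<Gamma> (x ** m ** matrix_inv x) = Psi S \<Gamma> m"
  shows "x \<in> J"
proof -
  obtain a b c e where m: "x = mat2 a b c e" by (rule mat2_cases)
  have g: "x \<in> G" "ge 0 a" "ge 0 b" "ge 0 c" "ge 0 e" using x by (auto simp: m K_iff L_mat2)
  have GL: "\<Gamma> \<in> L 0 (- r)" using Gamma_L y0 by simp
  have Gsk: "skew \<Gamma>" by (simp add: skew_def Gamma_elt_def)
  define Y where "Y = matrix_inv x ** \<Gamma> ** x - \<Gamma>"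
  have Ysk: "skew Y" unfolding Y_def by (rule skew_diff[OF skew_conj[OF Gsk g(1)] Gsk])
  have "matrix_inv x ** \<Gamma> ** x \<in> L 0 (- r)"
    using conj_L[of "matrix_inv x" 0 \<Gamma>] GL g(1) subgroup_inv[OF subgroup_K x] by (simp add: K_eq)
  then have YL: "Y \<in> L 0 (- r)" unfolding Y_def by (rule L_diff[OF _ GL])
  have triv: "Psi S Y j = 1" if j: "j \<in> Gyr S 0 s'" "s < s'" for j s'
  proof -
    have "j \<in> Hp" unfolding Gyr_plus_iff y0(1) using that by blast
    then have "Psi S (matrix_inv x ** \<Gamma> ** x) j = Psi S \<Gamma> j" using int Psi_conj[OF g(1)] by simp
    moreover have "Psi S (matrix_inv x ** \<Gamma> ** x) j = Psi S Y j * Psi S \<Gamma> j"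
      using Psi_add[of Y \<Gamma> j] by (simp add: Y_def)
    ultimately show ?thesis by simp
  qed
  have i21: "bar (Y $ 2 $ 1) = - Y $ 2 $ 1" and i12: "bar (Y $ 1 $ 2) = - Y $ 1 $ 2" using Ysk by (auto simp: skew_def)
  have d21: "im (Y $ 2 $ 1) = 0 \<or> - s' < real_of_int (\<nu> (im (Y $ 2 $ 1)))" if s': "s < s'" for s'
  proof (rule psi_dual_F[of \<epsilon>])
    fix \<beta> assume "geF s' \<beta>"
    then have "up \<beta> \<in> Gyr S 0 s'" unfolding Gyr_iff up_L using up_G by simp
    from triv[OF this s'] show "psiF S (\<epsilon> * (im (Y $ 2 $ 1) * \<beta>)) = 1" by (simp only: Psi_up psiE_imag[OF i21])
  qed auto
  have d12: "im (Y $ 1 $ 2) = 0 \<or> - s' < real_of_int (\<nu> (im (Y $ 1 $ 2)))" if s': "s < s'" for s'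
  proof (rule psi_dual_F[of \<epsilon>])
    fix \<beta> assume "geF s' \<beta>"
    then have "lo \<beta> \<in> Gyr S 0 s'" unfolding Gyr_iff lo_L using lo_G by simp
    from triv[OF this s'] show "psiF S (\<epsilon> * (im (Y $ 1 $ 2) * \<beta>)) = 1" by (simp only: Psi_lo psiE_imag[OF i12])
  qed auto
  have d11: "Y $ 1 $ 1 = 0 \<or> - s' < real_of_int (ve (Y $ 1 $ 1))" if s': "s < s'" for s'
  proof (rule psi_dual_E)
    fix \<delta> assume de: "ge s' \<delta>"
    have sp: "0 < s'" using s' s_pos by simp
    have "dg \<delta> \<in> Gyr S 0 s'" unfolding Gyr_iff using dg_G[OF de sp] dg_L[OF de sp] by simp
    from triv[OF this s'] show "psiF S (2 * re (Y $ 1 $ 1 * \<delta>)) = 1"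
      using Psi_dg[OF Ysk de sp, of "- r"] YL s' by (simp add: L_iff)
  qed
  \<comment> \<open>Triviality is known on \<open>Hp\<close> only, that is for all depths s' > s;
    the limit gives a weak inequality with s itself.\<close>
  have c: "- s \<le> k" if "\<And>s'. s < s' \<Longrightarrow> - s' < k" for k :: real
  proof (rule ccontr)
    assume "\<not> - s \<le> k"
    then show False using that[of "- k"] by simp
  qed
  have "geF (- s) (im (Y $ 2 $ 1))" "geF (- s) (im (Y $ 1 $ 2))" "ge (- s) (Y $ 1 $ 1)"
    using c d21 d12 d11 unfolding geF_def ge_def by blast+
  moreover have "Y $ 2 $ 1 = \<iota> (im (Y $ 2 $ 1)) * \<sigma>" "Y $ 1 $ 2 = \<iota> (im (Y $ 1 $ 2)) * \<sigma>" by (rule imag_E[OF i21] imag_E[OF i12])+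
  ultimately have "ge (- s) (Y $ 2 $ 1)" "ge (- s) (Y $ 1 $ 2)" "ge (- s) (Y $ 1 $ 1)" by (metis ge_emb ge_sigma_mult(2))+
  moreover have "Y $ 2 $ 2 = - bar (Y $ 1 $ 1)" using Ysk by (simp add: skew_def)
  ultimately have "Y \<in> L 0 (- s)" by (simp add: L_iff)
  then have "x ** Y \<in> L 0 (- s)" using L_mult[of x 0 0 Y "- s"] x by (simp add: K_iff)
  moreover have "x ** Y = \<Gamma> ** x - x ** \<Gamma>" using g(1) by (simp add: Y_def matrix_diff_ldistrib gassoc)
  ultimately have D: "\<Gamma> ** x - x ** \<Gamma> \<in> L 0 (- s)" by simp
  have D1: "ge (- s) (\<iota> v * \<sigma> * (c - b))" and D2: "ge (- s) (\<iota> v * \<sigma> * (e - a))"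
    using D unfolding m Gamma_elt_def y0 by (simp_all add: L_mat2 algebra_simps)
  have sc: "ge (\<rho> + r) z" if "ge \<rho> (\<iota> v * \<sigma> * z)" for \<rho> z
    using that uv y0 by (cases "z = 0") (auto simp: ge_def ve_mult)
  have cb: "ge s (c - b)" by (rule ge_mono[OF sc[OF D1]]) simp
  have ea: "ge s (e - a)" by (rule ge_mono[OF sc[OF D2]]) simp
  have un: "bar a * c + bar c * a = 0" "bar a * e + bar c * b = 1" using g(1) unitary_iff m by auto
  have n1: "ge s (a * bar a + b * bar b - 1)"
  proof -
    have "a * bar a + b * bar b - 1 = bar a * (a - e) - b * bar (c - b)" using un by (simp add: algebra_simps)
    moreover have "ge s (bar a * (a - e))" using ea g by (intro ge_mult[of 0 _ s]) (auto simp: ge_diff_commute)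
    moreover have "ge s (b * bar (c - b))" by (rule ge_mult[of 0 _ s]) (use cb g in \<open>simp_all del: bar_diff\<close>)
    ultimately show ?thesis by (simp add: ge_diff)
  qed
  have n2: "ge s (bar a * b + bar b * a)"
  proof -
    have "bar a * b + bar b * a = 0 - (bar a * (c - b) + bar (c - b) * a)" using un by (simp add: algebra_simps)
    moreover have "ge s (bar a * (c - b))" using cb g by (intro ge_mult[of 0 _ s]) auto
    moreover have "ge s (bar (c - b) * a)" by (rule ge_mult[of s _ 0]) (use cb g in \<open>simp_all del: bar_diff\<close>)
    ultimately show ?thesis using ge_diff[OF ge_0 ge_add] by metis
  qed
  \<comment> \<open>The norm of p is a real number close to 1; division by its square root makes the
    norm exactly 1.\<close>
  have scale: "\<exists>l. l * bar l = 1 \<and> ge s (l - p)" if p: "ge 0 p" "ge s (p * bar p - 1)" for p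
  proof -
    have "ge s (\<iota> (normE S p - 1))" using p(2) by (simp add: norm_emb)
    then have gn: "geF s (normE S p - 1)" by (simp only: ge_emb)
    obtain k where k0: "geF s (k - 1)" and k: "k * k = 1 + (normE S p - 1)" "k \<noteq> 0" "geF s (inverse k - 1)" "geF 0 (inverse k)"
      by (rule geF_sqrt[OF gn s_pos])
    have kk: "p * bar p = \<iota> k * \<iota> k" using k(1) norm_emb[of p] by (simp flip: emb_mult)
    have "(p * \<iota> (inverse k)) * bar (p * \<iota> (inverse k)) = (p * bar p) * (inverse (\<iota> k) * inverse (\<iota> k))" by (simp add: ac_simps)
    also have "\<dots> = 1" unfolding kk using k(2) by (simp add: field_simps)
    finally have "(p * \<iota> (inverse k)) * bar (p * \<iota> (inverse k)) = 1" .
    moreover have "p * \<iota> (inverse k) - p = p * \<iota> (inverse k - 1)" by (simp add: algebra_simps)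
    moreover have "ge s (\<iota> (inverse k - 1))" using k(3) by (simp only: ge_emb)
    then have "ge s (p * \<iota> (inverse k - 1))" by (rule ge_mult[OF p(1)]) simp
    ultimately show ?thesis by metis
  qed
  have e1: "(a + b) * bar (a + b) - 1 = (a * bar a + b * bar b - 1) + (bar a * b + bar b * a)"
    and e2: "(a - b) * bar (a - b) - 1 = (a * bar a + b * bar b - 1) - (bar a * b + bar b * a)" by (simp_all add: algebra_simps)
  obtain l1 where l1: "l1 * bar l1 = 1" "ge s (l1 - (a + b))"
    using scale[OF ge_add[OF g(2,3)]] ge_add[OF n1 n2] unfolding e1 by blast
  obtain l2 where l2: "l2 * bar l2 = 1" "ge s (l2 - (a - b))"
    using scale[OF ge_diff[OF g(2,3)]] ge_diff[OF n1 n2] unfolding e2 by blast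
  have half: "ge 0 (inverse 2)" using ve_inverse[of 2] by (simp add: ge_def)
  \<comment> \<open>The torus element with eigenvalues l1 and l2, rewritten in the original
    basis.\<close>
  define \<alpha> where "\<alpha> = (l1 + l2) * inverse 2"
  define \<beta> where "\<beta> = (l1 - l2) * inverse 2"
  have "\<alpha> - a = ((l1 - (a + b)) + (l2 - (a - b))) * inverse 2" "\<beta> - b = ((l1 - (a + b)) - (l2 - (a - b))) * inverse 2"
    by (simp_all add: \<alpha>_def \<beta>_def field_simps)
  then have ab: "ge s (\<alpha> - a)" "ge s (\<beta> - b)"
    using ge_mult[OF ge_add[OF l1(2) l2(2)] half, of s] ge_mult[OF ge_diff[OF l1(2) l2(2)] half, of s] by (simp_all only: add_0_right order_refl)
  have l1': "bar l1 = inverse l1" "l1 \<noteq> 0" and l2': "bar l2 = inverse l2" "l2 \<noteq> 0"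
    using l1(1) l2(1) by (auto simp: inverse_unique)
  define t where "t = mat2 \<alpha> \<beta> \<beta> \<alpha>"
  have bars: "bar \<alpha> = (inverse l1 + inverse l2) * inverse 2" "bar \<beta> = (inverse l1 - inverse l2) * inverse 2"
    by (simp_all add: \<alpha>_def \<beta>_def l1'(1) l2'(1))
  have "(2::'e) * 2 \<noteq> 0" by (simp del: mult_2 mult_2_right numeral_times_numeral)
  then have four: "(4::'e) \<noteq> 0" by simp
  then have "(4::'e) * 4 \<noteq> 0" by (simp del: numeral_times_numeral)
  then have four: "(4::'e) \<noteq> 0" "(16::'e) \<noteq> 0" using four by simp_all
  have tG: "t \<in> G" unfolding t_def unitary_iff bars unfolding \<alpha>_def \<beta>_def using l1'(2) l2'(2) four by (simp add: field_simps)
  have tT: "t \<in> T" using tG unfolding t_def T_iff2 by (simp add: y0(2,3))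
  have "x - t \<in> L 0 s"
  proof -
    have "e - \<alpha> = (e - a) + (a - \<alpha>)" "c - \<beta> = (c - b) + (b - \<beta>)" by simp_all
    then have "ge s (e - \<alpha>)" "ge s (c - \<beta>)" using ea cb ab ge_add ge_diff_commute by metis+
    then show ?thesis using ab ge_diff_commute by (simp add: m t_def L_mat2)
  qed
  moreover have "t \<in> Gyr S 0 0" using T_L0 tT y0 by auto
  ultimately have "matrix_inv t ** x \<in> H" using Gyr_close(1)[of t 0 x s] g(1) y0 by simp
  then have "t ** (matrix_inv t ** x) \<in> J" unfolding J_eq(2) set_prod_def using tT by blast
  then show ?thesis using tG by simp
qed

text \<open>At y = 0 the group \<open>Hp\<close> is normal in \<open>K\<close>, so conjugates of
  test elements stay inside it and failure of intertwining always yields a separating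
  element.\<close>

lemma (in datum_rep) hyperspecial_irreducible:
  assumes y0: "y = 0" "\<gamma>1 = 1" "\<gamma>2 = 1"
  shows "irreducible_rep S K (smooth_Ind S K J R)"
proof -
  have JK: "J \<subseteq> K" using J_L0 y0 by (simp add: K_eq)
  interpret I: ind_data S J R "s + \<bar>y\<bar>"
    by unfold_locales (use J_sub JK Gyr_J R1 r in auto)
  show ?thesis
  proof (rule I.Ind_irreducible[OF irr_J Hp_sub _ R2])
    show "Hp \<subseteq> J" using Hp_H H_J by blast
    fix x assume x: "x \<in> K" "x \<notin> J"
    have "x ** m ** matrix_inv x \<in> Hp" if "m \<in> Hp" for m
      using Gyr_plus_normal[of x y m s] x that by (simp add: K_eq y0)
    then show "\<exists>m\<in>Hp. x ** m ** matrix_inv x \<in> Hp \<and> Psi S \<Gamma> (x ** m ** matrix_inv x) \<noteq> Psi S \<Gamma> m"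
      using intertwine_hyperspecial[OF y0 x(1)] x(2) by blast
  qed
qed

subsection \<open>Double cosets\<close>

context u11 begin

definition pw :: "int \<Rightarrow> 'e" where "pw n = \<iota> (\<pi> powi n)"

lemma pw_nonzero [simp]: "pw n \<noteq> 0" by (simp add: pw_def)
lemma ve_pw [simp]: "ve (pw n) = n" using ve_emb[of "\<pi> powi n"] by (simp add: pw_def del: emb_powi)
lemma pw_add: "pw (m + n) = pw m * pw n" by (simp add: pw_def power_int_add)
lemma pw_0 [simp]: "pw 0 = 1" by (simp add: pw_def)
lemma pw_bar [simp]: "bar (pw n) = pw n" using bar_emb[of "\<pi> powi n"] by (simp add: pw_def del: emb_powi bar_emb)
lemma pw_cancel [simp]: "pw n * pw (- n) = 1" "pw (- n) * pw n = 1" by (simp_all flip: pw_add)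
lemma ge_pw: "ge \<rho> (z * pw n) \<longleftrightarrow> ge (\<rho> - real_of_int n) z"
  by (cases "z = 0") (auto simp: ge_def ve_mult)

lemma alpha_eq: "alpha S t = mat2 (pw (- t)) 0 0 (pw t)" by (simp add: alpha_def pw_def)
lemma alpha_G [simp]: "alpha S t \<in> G" by (simp add: alpha_eq unitary_iff)
lemma alpha_inv: "matrix_inv (alpha S t) = mat2 (pw t) 0 0 (pw (- t))"
  using unitary_inv(1)[of "pw (- t)" 0 0 "pw t"] alpha_G[of t] by (simp add: alpha_eq)
lemma w_G [simp]: "wmat \<in> G" by (simp add: wmat_def unitary_iff)
lemma w_inv: "matrix_inv (wmat :: 'e ^ 2 ^ 2) = wmat"
  by (rule matrix_inv_eq) (simp add: wmat_def mat2_one)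
lemma w_K: "wmat \<in> K" by (simp add: K_iff) (simp add: wmat_def L_mat2)
lemma ww [simp]: "wmat ** wmat = (mat 1 :: 'e ^ 2 ^ 2)" by (simp add: wmat_def mat2_one)

lemma mconj_alpha: "mconj (alpha S t) (mat2 a b c e) = mat2 a (b * pw (- 2 * t)) (c * pw (2 * t)) e"
proof -
  have "pw (- 2 * t) = pw (- t) * pw (- t)" "pw (2 * t) = pw t * pw t" by (simp_all flip: pw_add)
  then show ?thesis unfolding mconj_def alpha_inv unfolding alpha_eq by (simp add: ac_simps)
qed

lemma mconj_alphaw: "mconj (alpha S t ** wmat) (mat2 a b c e) = mat2 e (c * pw (- 2 * t)) (b * pw (2 * t)) a"
proof -
  have "mconj (alpha S t ** wmat) X = mconj (alpha S t) (wmat ** X ** wmat)" for X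
    by (simp add: mconj_def w_inv gassoc)
  then show ?thesis by (simp add: wmat_def mconj_alpha)
qed

text \<open>Factorization as \<open>K\<close>, a power of the diagonal element, and the Iwahori
  subgroup; \<open>bruhat\<close> proves it for every element of \<open>G\<close>.\<close>

definition KAI :: "'e ^ 2 ^ 2 \<Rightarrow> bool" where
  "KAI x \<longleftrightarrow> (\<exists>n. \<exists>k\<in>K. \<exists>i\<in>Gyr S (1/4) 0. x = k ** alpha S n ** i)"

lemma KAI_left: assumes "k \<in> K" "x \<in> G" "KAI (k ** x)" shows "KAI x"
proof -
  obtain n k' i where b: "k' \<in> K" "i \<in> Gyr S (1/4) 0" "k ** x = k' ** alpha S n ** i" using assms(3) by (auto simp: KAI_def)
  have "k \<in> G" using assms(1) K_subset by auto
  then have "x = matrix_inv k ** (k ** x)" by simp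
  then have "x = (matrix_inv k ** k') ** alpha S n ** i" using b(3) by (simp add: gassoc)
  then show ?thesis unfolding KAI_def using subgroup_mult[OF subgroup_K subgroup_inv[OF subgroup_K assms(1)] b(1)] b(2) by blast
qed

lemma KAI_right: assumes "i \<in> Gyr S (1/4) 0" "x \<in> G" "KAI (x ** i)" shows "KAI x"
proof -
  obtain n k' i' where b: "k' \<in> K" "i' \<in> Gyr S (1/4) 0" "x ** i = k' ** alpha S n ** i'" using assms(3) by (auto simp: KAI_def)
  have iG: "i \<in> G" by (rule Gyr_G[OF assms(1)])
  have sI: "mat_subgroup (Gyr S (1/4) 0)" by (rule subgroup_Gyr) simp
  have "x = (x ** i) ** matrix_inv i" using iG by (simp add: gassoc)
  then have "x = k' ** alpha S n ** (i' ** matrix_inv i)" using b(3) by (simp add: gassoc)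
  then show ?thesis unfolding KAI_def using subgroup_mult[OF sI b(2) subgroup_inv[OF sI assms(1)]] b(1) by blast
qed

lemma imag_div: assumes "a \<noteq> 0" "bar a * c + bar c * a = 0" shows "bar (c / a) = - (c / a)"
proof -
  have "bar c * a = - (bar a * c)" using assms(2) by (simp add: eq_neg_iff_add_eq_0 add.commute)
  then show ?thesis using assms(1) by (simp add: field_simps)
qed

definition upz :: "'e \<Rightarrow> 'e ^ 2 ^ 2" where "upz z = mat2 1 z 0 1"
definition loz :: "'e \<Rightarrow> 'e ^ 2 ^ 2" where "loz z = mat2 1 0 z 1"

lemma upz_Iw: "bar z = - z \<Longrightarrow> ge 0 z \<Longrightarrow> upz z \<in> Gyr S (1/4) 0"
  by (auto simp: upz_def Gyr_0_iff unitary_iff L_mat2 elim: ge_mono)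
lemma upz_K: "bar z = - z \<Longrightarrow> ge 0 z \<Longrightarrow> upz z \<in> K"
  by (auto simp: upz_def K_iff unitary_iff L_mat2)
lemma loz_K: "bar z = - z \<Longrightarrow> ge 0 z \<Longrightarrow> loz z \<in> K"
  by (auto simp: loz_def K_iff unitary_iff L_mat2)
lemma loz_Iw: "bar z = - z \<Longrightarrow> ge 1 z \<Longrightarrow> loz z \<in> Gyr S (1/4) 0"
  by (auto simp: loz_def Gyr_0_iff unitary_iff L_mat2 elim: ge_mono)

lemma KAI_diag: assumes "mat2 p 0 0 e \<in> G" shows "KAI (mat2 p 0 0 e)"
proof -
  have pe: "bar p * e = 1" using assms by (simp add: unitary_iff)
  then have p: "p \<noteq> 0" by auto
  have e: "e = inverse (bar p)" using pe by (simp add: inverse_unique)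
  define n where "n = - ve p"
  define k where "k = mat2 (p * pw n) 0 0 (e * pw (- n))"
  have "bar (p * pw n) * (e * pw (- n)) = (bar p * e) * (pw n * pw (- n))" by (simp only: bar_mult pw_bar ac_simps)
  then have "bar (p * pw n) * (e * pw (- n)) = 1" by (simp only: pe pw_cancel mult_1)
  then have "k \<in> G" unfolding k_def unitary_iff by (simp del: bar_mult)
  moreover have "k \<in> L 0 0" unfolding k_def L_mat2 using p by (simp add: ge_pw) (simp add: ge_def n_def e ve_inverse)
  ultimately have "k \<in> K" by (simp add: K_iff)
  moreover have "mat2 p 0 0 e = k ** alpha S n ** mat 1" by (simp add: k_def alpha_eq mult.assoc)
  moreover have "mat 1 \<in> Gyr S (1/4) 0" by (rule subgroup_one[OF subgroup_Gyr]) simp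
  ultimately show ?thesis unfolding KAI_def by blast
qed

lemma KAI_upper1: assumes x: "mat2 p b 0 e \<in> G" "b = 0 \<or> ve e \<le> ve b" shows "KAI (mat2 p b 0 e)"
proof -
  have u: "bar b * e + bar e * b = 0" "bar p * e = 1" using x(1) by (simp_all add: unitary_iff)
  have e0: "e \<noteq> 0" using u(2) by auto
  define z where "z = - (b / e)"
  have z: "bar z = - z" using imag_div[OF e0, of b] u(1) by (simp add: z_def add.commute)
  have gz: "ge 0 z" using x(2) e0 by (cases "b = 0") (auto simp: z_def ge_def ve_divide)
  have eq: "upz z ** mat2 p b 0 e = mat2 p 0 0 e" using e0 by (simp add: upz_def z_def)
  have uK: "upz z \<in> K" by (rule upz_K[OF z gz])
  have "upz z ** mat2 p b 0 e \<in> G" using uK K_subset x(1) by auto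
  then have "KAI (upz z ** mat2 p b 0 e)" unfolding eq by (rule KAI_diag)
  then show ?thesis by (rule KAI_left[OF uK x(1)])
qed

text \<open>The entry b is cleared from the left if e divides it and from the right if p does. If b
  divides both properly, p is cleared against b by a lower unipotent Iwahori element, and
  \<open>wmat\<close> makes the result upper triangular again with b on the diagonal.\<close>

lemma KAI_upper: assumes x: "mat2 p b 0 e \<in> G" shows "KAI (mat2 p b 0 e)"
proof -
  have u: "bar b * e + bar e * b = 0" "bar p * e = 1" using x(1) by (simp_all add: unitary_iff)
  have row: "p * bar b + b * bar p = 0" by (rule unitary_rows(1)[OF x])
  have e0: "e \<noteq> 0" "p \<noteq> 0" using u(2) by auto
  have vpe: "ve p + ve e = 0" using ve_mult[of "bar p" e] e0 u(2) by simp
  consider "b = 0 \<or> ve e \<le> ve b" | "b \<noteq> 0" "ve p \<le> ve b" | "b \<noteq> 0" "ve b < ve e" "ve b < ve p" by linarith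
  then show ?thesis
  proof cases
    case 1 then show ?thesis using KAI_upper1 x by blast
  next
    case 2
    define z where "z = - (b / p)"
    have z: "bar z = - z" using imag_div[OF e0(2), of b] row by (simp add: z_def mult.commute add.commute)
    have gz: "ge 0 z" using 2 e0 by (simp add: z_def ge_def ve_divide)
    have eq: "mat2 p b 0 e ** upz z = mat2 p 0 0 e" using e0 by (simp add: upz_def z_def)
    have uI: "upz z \<in> Gyr S (1/4) 0" by (rule upz_Iw[OF z gz])
    have "mat2 p b 0 e ** upz z \<in> G" using Gyr_G[OF uI] x by simp
    then have "KAI (mat2 p b 0 e ** upz z)" unfolding eq by (rule KAI_diag)
    then show ?thesis by (rule KAI_right[OF uI x])
  next
    case 3
    define z where "z = - (p / b)"
    have z: "bar z = - z" using imag_div[OF 3(1), of p] row by (simp add: z_def mult.commute add.commute)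
    have gz: "ge 1 z" using 3 e0 by (simp add: z_def ge_def ve_divide)
    have lI: "loz z \<in> Gyr S (1/4) 0" by (rule loz_Iw[OF z gz])
    have eq: "wmat ** (mat2 p b 0 e ** loz z) = mat2 (e * z) e 0 b" using 3 by (simp add: loz_def z_def wmat_def)
    have xG: "mat2 p b 0 e ** loz z \<in> G" using Gyr_G[OF lI] x by simp
    have "mat2 (e * z) e 0 b \<in> G" unfolding eq[symmetric] using xG by simp
    then have "KAI (wmat ** (mat2 p b 0 e ** loz z))" unfolding eq by (rule KAI_upper1) (use 3 in simp)
    then show ?thesis using KAI_left[OF w_K xG] KAI_right[OF lI x] by blast
  qed
qed

lemma KAI_nonzero: assumes x: "mat2 a b c e \<in> G" "a \<noteq> 0" "c = 0 \<or> ve a \<le> ve c" shows "KAI (mat2 a b c e)"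
proof -
  have u: "bar a * c + bar c * a = 0" using x(1) by (simp add: unitary_iff)
  define z where "z = - (c / a)"
  have z: "bar z = - z" using imag_div[OF x(2) u] by (simp add: z_def)
  have gz: "ge 0 z" using x by (cases "c = 0") (auto simp: z_def ge_def ve_divide)
  have lK: "loz z \<in> K" by (rule loz_K[OF z gz])
  have eq: "loz z ** mat2 a b c e = mat2 a b 0 (z * b + e)" using x(2) by (simp add: loz_def z_def)
  have "loz z ** mat2 a b c e \<in> G" using lK K_subset x(1) by auto
  then have "KAI (loz z ** mat2 a b c e)" unfolding eq by (rule KAI_upper)
  then show ?thesis by (rule KAI_left[OF lK x(1)])
qed

text \<open>Swapping the rows if needed, the first column has its entry of smaller valuation on top,
  and the other entry is cleared by \<open>K\<close>.\<close>

lemma bruhat: assumes x: "x \<in> G" shows "KAI x"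
proof -
  obtain a b c e where m: "x = mat2 a b c e" by (rule mat2_cases)
  show ?thesis
  proof (cases "a \<noteq> 0 \<and> (c = 0 \<or> ve a \<le> ve c)")
    case True then show ?thesis using KAI_nonzero x unfolding m by blast
  next
    case False
    have "c \<noteq> 0" using False x by (auto simp: m unitary_iff)
    moreover have eq: "wmat ** x = mat2 c e a b" by (simp add: m wmat_def)
    moreover have "mat2 c e a b \<in> G" unfolding eq[symmetric] using x by simp
    ultimately have "KAI (wmat ** x)" using KAI_nonzero[of c e a b] False by auto
    then show ?thesis by (rule KAI_left[OF w_K x])
  qed
qed

lemma Iw_unit: assumes "mat2 a b c e \<in> Gyr S (1/4) 0" shows "a \<noteq> 0" "ve a = 0" "e \<noteq> 0" "ve e = 0" "ge 0 b" "ge 1 c"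
proof -
  have g: "mat2 a b c e \<in> G" "ge 0 a" "ge (- 1/4) b" "ge (1/4) c" "ge 0 e" using assms by (simp_all add: Gyr_0_iff L_mat2)
  have b: "ge 0 b"
  proof (cases "b = 0")
    case False
    then have "real_of_int (- 1) < real_of_int (ve b)" using g(3) by (simp add: ge_def)
    then have "0 \<le> ve b" unfolding of_int_less_iff by simp
    then show ?thesis by (simp add: ge_def)
  qed simp
  then show "ge 0 b" .
  show c: "ge 1 c"
  proof (cases "c = 0")
    case False
    then have "real_of_int 0 < real_of_int (ve c)" using g(4) by (simp add: ge_def)
    then have "1 \<le> ve c" unfolding of_int_less_iff by simp
    then show ?thesis by (simp add: ge_def)
  qed simp
  have "bar a * e = 1 + - (bar c * b)" using g(1) by (simp add: unitary_iff eq_diff_eq)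
  moreover have "ge 1 (- (bar c * b))" using ge_mult[of 1 "bar c" 0 b 1] b c by simp
  ultimately have "bar a * e \<noteq> 0" "ve (bar a * e) = 0" using one_plus_unit[of 1 "- (bar c * b)"] by auto
  then show "a \<noteq> 0" "e \<noteq> 0" "ve a = 0" "ve e = 0" using g(2,5) ve_mult[of "bar a" e] by (auto simp: ge_def)
qed

text \<open>These lattices are stable under \<open>K\<close> on the left and \<open>G\<^bsub>y,0\<^esub>\<close> on the right, so they
  tell double cosets apart.\<close>

definition cell_lattice :: "real \<Rightarrow> real \<Rightarrow> ('e ^ 2 ^ 2) set" where
  "cell_lattice y \<rho> = {X. ge \<rho> (X $ 1 $ 1) \<and> ge \<rho> (X $ 2 $ 1) \<and> ge (\<rho> - y) (X $ 1 $ 2) \<and> ge (\<rho> - y) (X $ 2 $ 2)}"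

lemma cell_lattice_mult: assumes "k \<in> K" "X \<in> cell_lattice y \<rho>" "j \<in> Gyr S y 0" shows "k ** X ** j \<in> cell_lattice y \<rho>"
proof -
  obtain a b c e where k: "k = mat2 a b c e" by (rule mat2_cases)
  obtain p q t u where X: "X = mat2 p q t u" by (rule mat2_cases)
  have kb: "ge 0 a" "ge 0 b" "ge 0 c" "ge 0 e" using assms(1) by (simp_all add: k K_iff L_mat2)
  have Xb: "ge \<rho> p" "ge \<rho> t" "ge (\<rho> - y) q" "ge (\<rho> - y) u" using assms(2) by (simp_all add: X cell_lattice_def)
  define Z where "Z = k ** X"
  have Z: "Z \<in> cell_lattice y \<rho>" unfolding Z_def k X cell_lattice_def using kb Xb
    by (auto intro!: ge_add intro: ge_mult[OF kb(1)] ge_mult[OF kb(2)] ge_mult[OF kb(3)] ge_mult[OF kb(4)])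
  obtain p' q' t' u' where Z': "Z = mat2 p' q' t' u'" by (rule mat2_cases)
  have Zb: "ge \<rho> p'" "ge \<rho> t'" "ge (\<rho> - y) q'" "ge (\<rho> - y) u'" using Z by (simp_all add: Z' cell_lattice_def)
  obtain a' b' c' e' where j: "j = mat2 a' b' c' e'" by (rule mat2_cases)
  have jb: "ge 0 a'" "ge (- y) b'" "ge y c'" "ge 0 e'" using assms(3) by (simp_all add: j Gyr_0_iff L_mat2)
  have "Z ** j \<in> cell_lattice y \<rho>" unfolding Z' j cell_lattice_def
    using ge_mult[OF Zb(1) jb(1), of \<rho>] ge_mult[OF Zb(3) jb(3), of \<rho>] ge_mult[OF Zb(1) jb(2), of "\<rho> - y"] ge_mult[OF Zb(3) jb(4), of "\<rho> - y"]
      ge_mult[OF Zb(2) jb(1), of \<rho>] ge_mult[OF Zb(4) jb(3), of \<rho>] ge_mult[OF Zb(2) jb(2), of "\<rho> - y"] ge_mult[OF Zb(4) jb(4), of "\<rho> - y"]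
    by (auto intro!: ge_add)
  then show ?thesis by (simp add: Z_def)
qed

lemma cell_lattice_invariant:
  assumes "k \<in> K" "k' \<in> K" "j \<in> Gyr S y 0" "j' \<in> Gyr S y 0" "h \<in> G" "h' \<in> G"
    and eq: "j ** matrix_inv h ** k = j' ** matrix_inv h' ** k'"
  shows "h \<in> cell_lattice y \<rho> \<longleftrightarrow> h' \<in> cell_lattice y \<rho>"
proof -
  have sJ: "mat_subgroup (Gyr S y 0)" by (rule subgroup_Gyr) simp
  have *: "h' \<in> cell_lattice y \<rho>" if "k \<in> K" "k' \<in> K" "j \<in> Gyr S y 0" "j' \<in> Gyr S y 0" "h \<in> G" "h' \<in> G"
      "j ** matrix_inv h ** k = j' ** matrix_inv h' ** k'" "h \<in> cell_lattice y \<rho>" for k k' j j' h h'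
  proof -
    have G: "k \<in> G" "k' \<in> G" "j \<in> G" "j' \<in> G" using that K_subset Gyr_G by auto
    have "matrix_inv (j ** matrix_inv h ** k) = matrix_inv (j' ** matrix_inv h' ** k')" using that(7) by simp
    then have "matrix_inv k ** (h ** matrix_inv j) = matrix_inv k' ** (h' ** matrix_inv j')" using G that by (simp add: gassoc)
    then have "k' ** (matrix_inv k ** (h ** matrix_inv j)) ** j' = h'" using G by (simp add: gassoc)
    moreover have "(k' ** matrix_inv k) ** h ** (matrix_inv j ** j') \<in> cell_lattice y \<rho>"
      by (rule cell_lattice_mult[OF subgroup_mult[OF subgroup_K that(2) subgroup_inv[OF subgroup_K that(1)]] that(8)
        subgroup_mult[OF sJ subgroup_inv[OF sJ that(3)] that(4)]])
    ultimately show ?thesis by (simp add: gassoc)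
  qed
  show ?thesis using *[OF assms] *[OF assms(2,1,4,3,6,5) eq[symmetric]] by blast
qed

text \<open>The largest admissible \<rho> is an invariant of the double coset. For nonnegative t and
  y it is -t and hence recovers t.\<close>

lemma cell_lattice_alpha: "alpha S t \<in> cell_lattice y \<rho> \<longleftrightarrow> \<rho> \<le> - real_of_int t \<and> \<rho> \<le> real_of_int t + y"
  by (auto simp: alpha_eq cell_lattice_def ge_def)
lemma cell_lattice_alphaw: "alpha S t ** wmat \<in> cell_lattice y \<rho> \<longleftrightarrow> \<rho> \<le> real_of_int t \<and> \<rho> \<le> y - real_of_int t"
  by (auto simp: alpha_eq wmat_def cell_lattice_def ge_def)

end

section \<open>Representatives of the double cosets\<close>

context generic_datum begin

text \<open>For n nonnegative, conjugation by \<open>alpha S n\<close> multiplies the lower left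
  entry by an integral element and fixes the diagonal. An integral lower triangular matrix therefore
  moves to the left into \<open>K\<close>.\<close>

lemma alpha_absorb:
  assumes t: "t \<in> T" and x: "x \<in> G" and xt: "x ** t = mat2 a 0 c e" "ge 0 a" "ge 0 c" "ge 0 e" and n: "0 \<le> n"
  shows "\<exists>k\<in>K. \<exists>t'\<in>T. alpha S n ** x = k ** alpha S n ** t'"
proof -
  have tG: "t \<in> G" using t T_G by auto
  define k where "k = mconj (alpha S n) (x ** t)"
  have "k = mat2 a 0 (c * pw (2 * n)) e" unfolding k_def xt mconj_alpha by simp
  moreover have "ge 0 (c * pw (2 * n))" unfolding ge_pw by (rule ge_mono[OF xt(3)]) (use n in simp)
  ultimately have "k \<in> L 0 0" using xt by (simp add: L_mat2)
  moreover have "k \<in> G" using x tG by (simp add: k_def mconj_def)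
  ultimately have "k \<in> K" by (simp add: K_iff)
  moreover have "alpha S n ** x = k ** alpha S n ** matrix_inv t" using x tG by (simp add: k_def mconj_def gassoc)
  ultimately show ?thesis using subgroup_inv[OF T_sub t] by blast
qed

text \<open>For \<gamma>1 * \<gamma>2 = 1 the torus can clear the upper right entry of any element
  of \<open>G\<close>, not only of elements with unit a and small b as in
  \<open>lower_triangular_gen\<close>.\<close>

lemma split_triangular:
  assumes g: "\<gamma>1 * \<gamma>2 = 1" and x: "x \<in> G"
  obtains t where "t \<in> T" "(x ** t) $ 1 $ 2 = 0"
proof -
  obtain a b c e where m: "x = mat2 a b c e" by (rule mat2_cases)
  have xG: "mat2 a b c e \<in> G" using x m by simp
  note rows = unitary_rows[OF xG]
  define b' where "b' = b / \<iota> \<gamma>1"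
  have bb: "b = b' * \<iota> \<gamma>1" using gam by (simp add: b'_def)
  have "\<iota> \<gamma>1 * (a * bar b' + b' * bar a) = 0" using rows(1) by (simp add: bb algebra_simps)
  then have cross: "a * bar b' + b' * bar a = 0" using gam by simp
  have g': "\<iota> \<gamma>1 * \<iota> \<gamma>2 = 1" using g by (simp flip: emb_mult)
  \<comment> \<open>The row (a, -b') of a torus element annihilates the first row of x. By
    orthogonality of a and b' the norm of a - b' is the sum of their norms, so this factor makes the
    torus element unitary.\<close>
  define l where "l = inverse (a - b')"
  have ne: "a \<noteq> b'"
  proof
    assume ab: "a = b'"
    then have "2 * (a * bar a) = 0" using cross by simp
    then have "a = 0" by simp
    then show False using rows(3) ab bb by simp
  qed
  have "(a - b') * bar (a - b') = a * bar a + b' * bar b' - (a * bar b' + b' * bar a)" by (simp add: algebra_simps)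
  then have nn: "(a - b') * bar (a - b') = a * bar a + b' * bar b'" using cross by simp
  have ll: "l * bar l * (a * bar a + b' * bar b') = 1"
  proof -
    have "l * (a - b') = 1" using ne by (simp add: l_def)
    moreover from this have "bar l * bar (a - b') = 1" by (metis bar_mult bar_1)
    ultimately have "(l * (a - b')) * (bar l * bar (a - b')) = 1" by simp
    then show ?thesis unfolding nn[symmetric] by (simp only: ac_simps)
  qed
  define t where "t = mat2 (l * a) (- (l * b') * \<iota> \<gamma>1) (- (l * b') * \<iota> \<gamma>2) (l * a)"
  have "t \<in> G" unfolding t_def unitary_iff
  proof (intro conjI)
    have c1: "bar (l * a) * (- (l * b')) + bar (- (l * b')) * (l * a) = - (l * bar l) * (a * bar b' + b' * bar a)"
      by (simp add: algebra_simps)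
    have "bar (l * a) * (- (l * b') * \<iota> \<gamma>2) + bar (- (l * b') * \<iota> \<gamma>2) * (l * a) =
      (bar (l * a) * (- (l * b')) + bar (- (l * b')) * (l * a)) * \<iota> \<gamma>2" by (simp add: algebra_simps)
    then show "bar (l * a) * (- (l * b') * \<iota> \<gamma>2) + bar (- (l * b') * \<iota> \<gamma>2) * (l * a) = 0" unfolding c1 cross by simp
    have "bar (- (l * b') * \<iota> \<gamma>1) * (l * a) + bar (l * a) * (- (l * b') * \<iota> \<gamma>1) =
      (bar (l * a) * (- (l * b')) + bar (- (l * b')) * (l * a)) * \<iota> \<gamma>1" by (simp add: algebra_simps)
    then show "bar (- (l * b') * \<iota> \<gamma>1) * (l * a) + bar (l * a) * (- (l * b') * \<iota> \<gamma>1) = 0" unfolding c1 cross by simp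
    have "bar (l * a) * (l * a) + bar (- (l * b') * \<iota> \<gamma>2) * (- (l * b') * \<iota> \<gamma>1) =
      l * bar l * (a * bar a) + l * bar l * (b' * bar b') * (\<iota> \<gamma>1 * \<iota> \<gamma>2)" by (simp add: algebra_simps)
    then show "bar (l * a) * (l * a) + bar (- (l * b') * \<iota> \<gamma>2) * (- (l * b') * \<iota> \<gamma>1) = 1"
      unfolding g' using ll by (simp only: mult_1_right distrib_left)
  qed
  then have "t \<in> T" unfolding T_iff t_def by blast
  moreover have "(x ** t) $ 1 $ 2 = 0" by (simp add: m t_def bb algebra_simps)
  ultimately show ?thesis by (rule that)
qed

text \<open>The Iwahori subgroup is contained in the parahoric subgroup of y, whose elements are
  absorbed by \<open>K\<close> and \<open>T\<close> when the exponent is nonnegative. Negative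
  exponents are first reflected by a torus element.\<close>

lemma cosets_unramified:
  assumes n: "n = 0 \<or> n = 1" and y: "y = real_of_int n" and g: "\<gamma>1 = \<pi> powi (- n)" "\<gamma>2 = \<pi> powi n" and x: "x \<in> G"
  shows "\<exists>t\<ge>0. \<exists>k\<in>K. \<exists>t'\<in>T. x = k ** alpha S t ** t'"
proof -
  have ig: "\<iota> \<gamma>1 = pw (- n)" "\<iota> \<gamma>2 = pw n" using g by (simp_all add: pw_def)
  have gg: "\<gamma>1 * \<gamma>2 = 1" using g by (simp flip: power_int_add)
  have step: "\<exists>k\<in>K. \<exists>t'\<in>T. alpha S t ** z = k ** alpha S t ** t'" if t: "0 \<le> t" and z: "z \<in> Gyr S y 0" for t z
  proof -
    obtain h where h: "h \<in> T" "(z ** h) $ 1 $ 2 = 0" using split_triangular[OF gg Gyr_G[OF z]] by blast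
    have zh: "z ** h \<in> Gyr S y 0" using subgroup_mult[OF subgroup_Gyr z] T_L0 h(1) by auto
    obtain a b c e where m: "z ** h = mat2 a b c e" by (rule mat2_cases)
    have e0: "b = 0" "ge 0 a" "ge y c" "ge 0 e" using zh h(2) by (auto simp: m Gyr_0_iff L_mat2)
    have "ge 0 c" by (rule ge_mono[OF e0(3)]) (use y n in auto)
    with e0 show ?thesis using alpha_absorb[OF h(1) Gyr_G[OF z], of a c e t] m t by simp
  qed
  obtain k m i where b: "k \<in> K" "i \<in> Gyr S (1/4) 0" "x = k ** alpha S m ** i" using bruhat[OF x] by (auto simp: KAI_def)
  have iy: "i \<in> Gyr S y 0"
  proof -
    obtain a b c e where mi: "i = mat2 a b c e" by (rule mat2_cases)
    have iI: "mat2 a b c e \<in> Gyr S (1/4) 0" using b(2) mi by simp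
    show ?thesis using Iw_unit[OF iI] Gyr_G[OF iI] y n unfolding mi by (auto simp: Gyr_0_iff L_mat2 ge_def)
  qed
  show ?thesis
  proof (cases "0 \<le> m")
    case True
    obtain k' t' where k': "k' \<in> K" "t' \<in> T" "alpha S m ** i = k' ** alpha S m ** t'" using step[OF True iy] by blast
    have "x = (k ** k') ** alpha S m ** t'" using b(3) k'(3) by (simp add: gassoc)
    then show ?thesis using subgroup_mult[OF subgroup_K b(1) k'(1)] k'(2) True by blast
  next
    case False
    \<comment> \<open>An antidiagonal element of \<open>T\<close>. It carries
      \<open>alpha S m\<close> to \<open>wmat\<close> times \<open>alpha S m'\<close> with m' = -m -
      n, which is nonnegative since m is negative and n is at most 1.\<close>
    define q where "q = mat2 0 (\<iota> \<gamma>1) (\<iota> \<gamma>2) 0"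
    have qG: "q \<in> G" unfolding q_def ig by (simp add: unitary_iff)
    have "q = mat2 0 (1 * \<iota> \<gamma>1) (1 * \<iota> \<gamma>2) 0" by (simp add: q_def)
    then have qT: "q \<in> T" unfolding T_iff using qG by blast
    define m' where "m' = - m - n"
    have m': "0 \<le> m'" using False n by (auto simp: m'_def)
    have e1: "alpha S m ** q = wmat ** alpha S m'"
    proof -
      have "pw (- m) * pw (- n) = pw m'" "pw m * pw n = pw (- m')" by (simp_all add: m'_def add.commute flip: pw_add)
      then show ?thesis by (simp add: alpha_eq q_def ig wmat_def)
    qed
    have "matrix_inv q \<in> Gyr S y 0" using subgroup_inv[OF T_sub qT] T_L0 by auto
    then have "matrix_inv q ** i \<in> Gyr S y 0" using subgroup_mult[OF subgroup_Gyr _ iy] by simp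
    then obtain k' t' where k': "k' \<in> K" "t' \<in> T" "alpha S m' ** (matrix_inv q ** i) = k' ** alpha S m' ** t'"
      using step[OF m'] by blast
    have "alpha S m ** i = (alpha S m ** q) ** (matrix_inv q ** i)" using qG by (simp add: gassoc)
    also have "\<dots> = wmat ** (k' ** alpha S m' ** t')" unfolding e1 k'(3)[symmetric] by (simp add: gassoc)
    finally have "x = (k ** wmat ** k') ** alpha S m' ** t'" using b(3) by (simp add: gassoc)
    then show ?thesis
      using subgroup_mult[OF subgroup_K subgroup_mult[OF subgroup_K b(1) w_K] k'(1)] k'(2) m' by blast
  qed
qed

end

context datum_rep begin

lemma datum_rep_alpha:
  fixes t :: int
  defines "g \<equiv> alpha S t"
  shows "datum_rep S (\<gamma>1 * \<pi> powi (- 2 * t)) (\<gamma>2 * \<pi> powi (2 * t)) (y + 2 * real_of_int t) r u v (cconj g \<phi>) (crep g R)"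
    "inducing_group S (\<gamma>1 * \<pi> powi (- 2 * t)) (\<gamma>2 * \<pi> powi (2 * t)) (y + 2 * real_of_int t) r = mconj g ` J"
    "Gamma_elt S (\<gamma>1 * \<pi> powi (- 2 * t)) (\<gamma>2 * \<pi> powi (2 * t)) u v = mconj g \<Gamma>"
proof -
  note c = conj_datum_rep[of g "y + 2 * real_of_int t" "\<gamma>1 * \<pi> powi (- 2 * t)" "\<gamma>2 * \<pi> powi (2 * t)"]
  have a1: "g \<in> G" by (simp add: g_def)
  have a2: "X \<in> L y \<rho> \<longleftrightarrow> mconj g X \<in> L (y + 2 * real_of_int t) \<rho>" for X \<rho>
    by (cases X rule: mat2_cases) (simp add: g_def mconj_alpha L_mat2 ge_pw algebra_simps)
  have a3: "mconj g (mat2 a (b * \<iota> \<gamma>1) (b * \<iota> \<gamma>2) a) =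
    mat2 a (b * \<iota> (\<gamma>1 * \<pi> powi (- 2 * t))) (b * \<iota> (\<gamma>2 * \<pi> powi (2 * t))) a" for a b
    unfolding g_def mconj_alpha pw_def by (simp add: mult.assoc)
  have a4: "\<gamma>1 * \<pi> powi (- 2 * t) \<noteq> 0" "\<gamma>2 * \<pi> powi (2 * t) \<noteq> 0" using gam by simp_all
  have nv: "\<nu> (z * \<pi> powi n) = \<nu> z + n" if "z \<noteq> 0" for z n using that by (simp add: nu_mult)
  have a5: "real_of_int (\<nu> (\<gamma>2 * \<pi> powi (2 * t))) - real_of_int (\<nu> (\<gamma>1 * \<pi> powi (- 2 * t))) = 2 * (y + 2 * real_of_int t)"
    unfolding nv[OF gam(1)] nv[OF gam(2)] using gam(3) by simp
  have "\<pi> powi (- 2 * t) * \<pi> powi (2 * t) = 1" by (simp flip: power_int_add)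
  then have a6: "\<gamma>1 * \<pi> powi (- 2 * t) * (\<gamma>2 * \<pi> powi (2 * t)) = \<gamma>1 * \<gamma>2"
    by (metis (no_types, lifting) mult.assoc mult.left_commute mult.right_neutral)
  have "\<nu> (v * (\<gamma>1 * \<pi> powi (- 2 * t))) = \<nu> (v * \<gamma>1) + (- 2 * t)"
    using nv[of "v * \<gamma>1" "- 2 * t"] uv gam by (simp add: mult.assoc)
  then have a7: "real_of_int (\<nu> (v * (\<gamma>1 * \<pi> powi (- 2 * t)))) = - r - (y + 2 * real_of_int t)" using uv(3) by simp
  show "datum_rep S (\<gamma>1 * \<pi> powi (- 2 * t)) (\<gamma>2 * \<pi> powi (2 * t)) (y + 2 * real_of_int t) r u v (cconj g \<phi>) (crep g R)"
    "inducing_group S (\<gamma>1 * \<pi> powi (- 2 * t)) (\<gamma>2 * \<pi> powi (2 * t)) (y + 2 * real_of_int t) r = mconj g ` J"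
    "Gamma_elt S (\<gamma>1 * \<pi> powi (- 2 * t)) (\<gamma>2 * \<pi> powi (2 * t)) u v = mconj g \<Gamma>"
    using c[OF a1 a2 a3 a4 a5 a6 a7] by blast+
qed

lemma datum_rep_alphaw:
  fixes t :: int
  defines "g \<equiv> alpha S t ** wmat"
  shows "datum_rep S (\<gamma>2 * \<pi> powi (- 2 * t)) (\<gamma>1 * \<pi> powi (2 * t)) (2 * real_of_int t - y) r u v (cconj g \<phi>) (crep g R)"
    "inducing_group S (\<gamma>2 * \<pi> powi (- 2 * t)) (\<gamma>1 * \<pi> powi (2 * t)) (2 * real_of_int t - y) r = mconj g ` J"
    "Gamma_elt S (\<gamma>2 * \<pi> powi (- 2 * t)) (\<gamma>1 * \<pi> powi (2 * t)) u v = mconj g \<Gamma>"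
proof -
  note c = conj_datum_rep[of g "2 * real_of_int t - y" "\<gamma>2 * \<pi> powi (- 2 * t)" "\<gamma>1 * \<pi> powi (2 * t)"]
  have a1: "g \<in> G" by (simp add: g_def)
  have a2: "X \<in> L y \<rho> \<longleftrightarrow> mconj g X \<in> L (2 * real_of_int t - y) \<rho>" for X \<rho>
    by (cases X rule: mat2_cases) (auto simp: g_def mconj_alphaw L_mat2 ge_pw algebra_simps)
  have a3: "mconj g (mat2 a (b * \<iota> \<gamma>1) (b * \<iota> \<gamma>2) a) =
    mat2 a (b * \<iota> (\<gamma>2 * \<pi> powi (- 2 * t))) (b * \<iota> (\<gamma>1 * \<pi> powi (2 * t))) a" for a b
    unfolding g_def mconj_alphaw pw_def by (simp add: mult.assoc)
  have a4: "\<gamma>2 * \<pi> powi (- 2 * t) \<noteq> 0" "\<gamma>1 * \<pi> powi (2 * t) \<noteq> 0" using gam by simp_all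
  have nv: "\<nu> (z * \<pi> powi n) = \<nu> z + n" if "z \<noteq> 0" for z n using that by (simp add: nu_mult)
  have a5: "real_of_int (\<nu> (\<gamma>1 * \<pi> powi (2 * t))) - real_of_int (\<nu> (\<gamma>2 * \<pi> powi (- 2 * t))) = 2 * (2 * real_of_int t - y)"
    unfolding nv[OF gam(1)] nv[OF gam(2)] using gam(3) by simp
  have "\<pi> powi (- 2 * t) * \<pi> powi (2 * t) = 1" by (simp flip: power_int_add)
  then have a6: "\<gamma>2 * \<pi> powi (- 2 * t) * (\<gamma>1 * \<pi> powi (2 * t)) = \<gamma>1 * \<gamma>2"
    by (metis (no_types, lifting) mult.assoc mult.commute mult.left_commute mult.right_neutral)
  have "real_of_int (\<nu> (v * \<gamma>2)) = - r + y" using uv gam by (simp add: nu_mult)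
  moreover have "\<nu> (v * (\<gamma>2 * \<pi> powi (- 2 * t))) = \<nu> (v * \<gamma>2) + (- 2 * t)"
    using nv[of "v * \<gamma>2" "- 2 * t"] uv gam by (simp add: mult.assoc)
  ultimately have a7: "real_of_int (\<nu> (v * (\<gamma>2 * \<pi> powi (- 2 * t)))) = - r - (2 * real_of_int t - y)" by simp
  show "datum_rep S (\<gamma>2 * \<pi> powi (- 2 * t)) (\<gamma>1 * \<pi> powi (2 * t)) (2 * real_of_int t - y) r u v (cconj g \<phi>) (crep g R)"
    "inducing_group S (\<gamma>2 * \<pi> powi (- 2 * t)) (\<gamma>1 * \<pi> powi (2 * t)) (2 * real_of_int t - y) r = mconj g ` J"
    "Gamma_elt S (\<gamma>2 * \<pi> powi (- 2 * t)) (\<gamma>1 * \<pi> powi (2 * t)) u v = mconj g \<Gamma>"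
    using c[OF a1 a2 a3 a4 a5 a6 a7] by blast+
qed

end

text \<open>T has no element that reflects the exponent, so negative exponents give a second family.
  They are handled by the first argument applied to the datum conjugated by \<open>wmat\<close>,
  whose point is -1/2.\<close>

lemma (in datum_rep) cosets_ramified:
  assumes y: "y = 1 / 2" and x: "x \<in> G"
  shows "(\<exists>t\<ge>0. \<exists>k\<in>K. \<exists>t'\<in>T. x = k ** alpha S t ** t') \<or> (\<exists>t>0. \<exists>k\<in>K. \<exists>t'\<in>T. x = k ** (alpha S t ** wmat) ** t')"
proof -
  obtain k m i where b: "k \<in> K" "i \<in> Gyr S (1/4) 0" "x = k ** alpha S m ** i" using bruhat[OF x] by (auto simp: KAI_def)
  obtain a c d e where mi: "i = mat2 a c d e" by (rule mat2_cases)
  have iI: "mat2 a c d e \<in> Gyr S (1/4) 0" using b(2) mi by simp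
  note iu = Iw_unit[OF iI]
  have iG: "i \<in> G" by (rule Gyr_G[OF b(2)])
  have iG': "mat2 a c d e \<in> G" using iG mi by simp
  have iK: "ge 0 a" "ge 0 c" "ge 0 d" "ge 0 e" using iu by (auto simp: ge_def)
  show ?thesis
  proof (cases "0 \<le> m")
    case True
    \<comment> \<open>With depth y the bound on c in \<open>lower_triangular_gen\<close> becomes y -
      y = 0, which is just integrality.\<close>
    have yp: "0 < y" "ge (y - y) c" using y iu by simp_all
    obtain h where h: "h \<in> T" "h \<in> Gyr S y y" "(mat2 a c d e ** h) $ 1 $ 2 = 0"
      by (rule lower_triangular_gen[OF iG' iu(1,2) yp(2,1)])
    obtain p q p' q' where hm: "h = mat2 p q p' q'" by (rule mat2_cases)
    have "h - mat 1 \<in> L 0 0" using h(2) y unfolding hm by (auto simp: Gyr_iff mat2_one L_mat2 elim: ge_mono)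
    then have hK: "h \<in> K" using h(2) by (simp add: K_eq Gyr_iff)
    have "i ** h \<in> K" using subgroup_mult[OF subgroup_K _ hK, of i] iG iK by (simp add: mi K_iff L_mat2)
    moreover obtain a' c' d' e' where ih: "i ** h = mat2 a' c' d' e'" by (rule mat2_cases)
    ultimately have "ge 0 a'" "ge 0 d'" "ge 0 e'" "c' = 0" using h(3) by (simp_all add: K_iff L_mat2 flip: mi)
    then obtain k' t' where k': "k' \<in> K" "t' \<in> T" "alpha S m ** i = k' ** alpha S m ** t'"
      using alpha_absorb[OF h(1) iG _ _ _ _ True] ih by blast
    have "x = (k ** k') ** alpha S m ** t'" using b(3) k'(3) by (simp add: gassoc)
    then show ?thesis using subgroup_mult[OF subgroup_K b(1) k'(1)] k'(2) True by blast
  next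
    case False
    \<comment> \<open>With t = 0 this is conjugation by \<open>wmat\<close> alone. At the point -1/2
      the bound needed for d is 1/2 + 1/2 = 1, which is what the Iwahori subgroup provides.\<close>
    interpret W: datum_rep S "\<gamma>2 * \<pi> powi (- 2 * 0)" "\<gamma>1 * \<pi> powi (2 * 0)" "2 * real_of_int 0 - y" r u v
      "cconj (alpha S 0 ** wmat) \<phi>" "crep (alpha S 0 ** wmat) R" by (rule datum_rep_alphaw)
    define z where "z = wmat ** i ** wmat"
    have zm: "z = mat2 e d c a" by (simp add: z_def mi wmat_def)
    have zG: "z \<in> G" using iG by (simp add: z_def)
    have zG': "mat2 e d c a \<in> G" using zG zm by simp
    have d': "ge (1/2 - (2 * real_of_int 0 - y)) d" by (rule ge_mono[OF iu(6)]) (use y in simp)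
    obtain h where h: "h \<in> W.T" "h \<in> Gyr S (2 * real_of_int 0 - y) (1/2)" "(mat2 e d c a ** h) $ 1 $ 2 = 0"
      by (rule W.lower_triangular_gen[OF zG' iu(3,4) d']) simp
    obtain p q p' q' where hm: "h = mat2 p q p' q'" by (rule mat2_cases)
    have "h - mat 1 \<in> L 0 0" using h(2) y unfolding hm by (auto simp: Gyr_iff mat2_one L_mat2 elim: ge_mono)
    then have hK: "h \<in> K" using h(2) by (simp add: K_eq Gyr_iff)
    have "z ** h \<in> K" using subgroup_mult[OF subgroup_K _ hK, of z] zG iK by (simp add: zm K_iff L_mat2)
    moreover obtain a' c' d' e' where ih: "z ** h = mat2 a' c' d' e'" by (rule mat2_cases)
    ultimately have "ge 0 a'" "ge 0 d'" "ge 0 e'" "c' = 0" using h(3) by (simp_all add: K_iff L_mat2 flip: zm)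
    moreover have m0: "0 \<le> - m" using False by simp
    ultimately obtain k' t' where k': "k' \<in> K" "t' \<in> W.T" "alpha S (- m) ** z = k' ** alpha S (- m) ** t'"
      using W.alpha_absorb[OF h(1) zG] ih by blast
    have tw: "wmat ** t' ** wmat \<in> T"
    proof -
      obtain p q p' q' where tm: "t' = mat2 p q p' q'" by (rule mat2_cases)
      have "q' = p \<and> p' * \<iota> \<gamma>2 = q * \<iota> \<gamma>1" using k'(2) unfolding tm W.T_iff2 by simp
      moreover have "wmat ** t' ** wmat \<in> G" using k'(2) W.T_G by auto
      moreover have "wmat ** t' ** wmat = mat2 q' p' q p" by (simp add: tm wmat_def)
      ultimately have "mat2 q' p' q p \<in> T" unfolding T_iff2 by metis
      then show ?thesis by (simp add: tm wmat_def)
    qed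
    have aw: "alpha S m = wmat ** alpha S (- m) ** wmat" by (simp add: alpha_eq wmat_def)
    have iw: "wmat ** i = z ** wmat" by (simp add: z_def gassoc)
    have "alpha S m ** i = wmat ** (alpha S (- m) ** z) ** wmat" by (simp add: aw gassoc iw)
    also have "\<dots> = (wmat ** k') ** (alpha S (- m) ** wmat) ** (wmat ** t' ** wmat)"
    proof -
      have "wmat ** (wmat ** X) = X" for X :: "'e ^ 2 ^ 2" by (simp add: matrix_mul_assoc)
      then show ?thesis unfolding k'(3) by (simp add: gassoc)
    qed
    finally have "x = (k ** (wmat ** k')) ** (alpha S (- m) ** wmat) ** (wmat ** t' ** wmat)" using b(3) by (simp add: gassoc)
    moreover have "k ** (wmat ** k') \<in> K" by (rule subgroup_mult[OF subgroup_K b(1) subgroup_mult[OF subgroup_K w_K k'(1)]])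
    ultimately show ?thesis using tw False by (intro disjI2) (rule exI[of _ "- m"], auto)
  qed
qed

subsection \<open>The decomposition\<close>

context positive_datum_rep begin

lemma summand_facts:
  "rep_iso K (smooth_Ind S K (K \<inter> J) R) (S_rep S (r + y) \<Gamma> \<phi>)"
  "S_param S (r + y) \<Gamma> \<phi>" "irreducible_rep S K (S_rep S (r + y) \<Gamma> \<phi>)"
  "0 \<in> rspace (smooth_Ind S K (K \<inter> J) R)"
  using local_iso S_param S_irreducible[folded S_rep_eq] I.FV.subspace_0[OF I.Ind_sub]
  unfolding A_def d_def by blast+

end

context datum_rep begin

definition summand :: "'e ^ 2 ^ 2 \<Rightarrow> ('e ^ 2 ^ 2, 'e ^ 2 ^ 2 \<Rightarrow> 'v) rep" where
  "summand g = smooth_Ind S K (K \<inter> mconj g ` J) (crep g R)"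

lemma summand_alpha:
  assumes "0 < y + 2 * real_of_int t"
  shows "rep_iso K (summand (alpha S t)) (S_rep S (r + (y + 2 * real_of_int t)) (mconj (alpha S t) \<Gamma>) (cconj (alpha S t) \<phi>))"
    "S_param S (r + (y + 2 * real_of_int t)) (mconj (alpha S t) \<Gamma>) (cconj (alpha S t) \<phi>)"
    "irreducible_rep S K (S_rep S (r + (y + 2 * real_of_int t)) (mconj (alpha S t) \<Gamma>) (cconj (alpha S t) \<phi>))"
    "0 \<in> rspace (summand (alpha S t))"
proof -
  note f = datum_rep_alpha[of t]
  have "positive_datum_rep S (\<gamma>1 * \<pi> powi (- 2 * t)) (\<gamma>2 * \<pi> powi (2 * t)) (y + 2 * real_of_int t) r u v (cconj (alpha S t) \<phi>) (crep (alpha S t) R)"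
    by (rule positive_datum_rep.intro[OF f(1)]) (unfold_locales, rule assms)
  then interpret W: positive_datum_rep S "\<gamma>1 * \<pi> powi (- 2 * t)" "\<gamma>2 * \<pi> powi (2 * t)" "y + 2 * real_of_int t" r u v "cconj (alpha S t) \<phi>" "crep (alpha S t) R" .
  show "rep_iso K (summand (alpha S t)) (S_rep S (r + (y + 2 * real_of_int t)) (mconj (alpha S t) \<Gamma>) (cconj (alpha S t) \<phi>))"
    "S_param S (r + (y + 2 * real_of_int t)) (mconj (alpha S t) \<Gamma>) (cconj (alpha S t) \<phi>)"
    "irreducible_rep S K (S_rep S (r + (y + 2 * real_of_int t)) (mconj (alpha S t) \<Gamma>) (cconj (alpha S t) \<phi>))"
    "0 \<in> rspace (summand (alpha S t))"
    using W.summand_facts unfolding f(2,3) summand_def by blast+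
qed

lemma summand_alphaw:
  assumes "0 < 2 * real_of_int t - y"
  defines "g \<equiv> alpha S t ** wmat"
  shows "rep_iso K (summand g) (S_rep S (r + (2 * real_of_int t - y)) (mconj g \<Gamma>) (cconj g \<phi>))"
    "S_param S (r + (2 * real_of_int t - y)) (mconj g \<Gamma>) (cconj g \<phi>)"
    "irreducible_rep S K (S_rep S (r + (2 * real_of_int t - y)) (mconj g \<Gamma>) (cconj g \<phi>))"
    "0 \<in> rspace (summand g)"
proof -
  note f = datum_rep_alphaw[of t, folded g_def]
  have "positive_datum_rep S (\<gamma>2 * \<pi> powi (- 2 * t)) (\<gamma>1 * \<pi> powi (2 * t)) (2 * real_of_int t - y) r u v (cconj g \<phi>) (crep g R)"
    by (rule positive_datum_rep.intro[OF f(1)]) (unfold_locales, rule assms)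
  then interpret W: positive_datum_rep S "\<gamma>2 * \<pi> powi (- 2 * t)" "\<gamma>1 * \<pi> powi (2 * t)" "2 * real_of_int t - y" r u v "cconj g \<phi>" "crep g R" .
  show "rep_iso K (summand g) (S_rep S (r + (2 * real_of_int t - y)) (mconj g \<Gamma>) (cconj g \<phi>))"
    "S_param S (r + (2 * real_of_int t - y)) (mconj g \<Gamma>) (cconj g \<phi>)"
    "irreducible_rep S K (S_rep S (r + (2 * real_of_int t - y)) (mconj g \<Gamma>) (cconj g \<phi>))"
    "0 \<in> rspace (summand g)"
    using W.summand_facts unfolding f(2,3) summand_def by blast+
qed

lemma alpha_0 [simp]: "alpha S 0 = mat 1"
  by (simp add: alpha_eq mat2_one)

lemma mconj_1 [simp]: "mconj (mat 1) X = (X :: 'e ^ 2 ^ 2)"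
  using matrix_inv_eq[of "mat 1 :: 'e ^ 2 ^ 2" "mat 1"] by (simp add: mconj_def)

lemma cconj_1 [simp]: "cconj (mat 1 :: 'e ^ 2 ^ 2) \<xi> = \<xi>"
  using matrix_inv_eq[of "mat 1 :: 'e ^ 2 ^ 2" "mat 1"] by (simp add: cconj_def)

lemma crep_1 [simp]: "crep (mat 1 :: 'e ^ 2 ^ 2) R = R"
  using matrix_inv_eq[of "mat 1 :: 'e ^ 2 ^ 2" "mat 1"] by (simp add: crep_def)

lemma vector_space_R: "vector_space (rscale R)" and rep_J: "is_rep J (**) (mat 1) R"
  using R1 by (auto simp: srep_def is_rep_def)

lemma rscale_summand: "rscale (summand g) c 0 = 0"
proof -
  interpret vector_space "rscale R" by (rule vector_space_R)
  show ?thesis by (simp add: summand_def smooth_Ind_def fun_eq_iff)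
qed

lemma rscale_S_rep: "rscale (S_rep S d X \<zeta>) c 0 = 0"
  by (simp add: S_rep_def smooth_Ind_def char_rep_def fun_eq_iff)

text \<open>Specializes \<open>mackey\<close> to the cosets at hand: a factorization through
  \<open>T\<close> is enough because \<open>T\<close> lies in \<open>J\<close>, and representatives
  are told apart by the lattices of \<open>cell_lattice_invariant\<close>.\<close>

lemma mackey_alpha:
  fixes g :: "'i \<Rightarrow> 'e ^ 2 ^ 2"
  assumes g: "\<And>i. i \<in> I \<Longrightarrow> g i \<in> G"
    and ex: "\<And>x. x \<in> G \<Longrightarrow> \<exists>i\<in>I. \<exists>k\<in>K. \<exists>t\<in>T. x = k ** g i ** t"
    and uniq: "\<And>i i'. i \<in> I \<Longrightarrow> i' \<in> I \<Longrightarrow> (\<And>\<rho>. g i \<in> cell_lattice y \<rho> \<longleftrightarrow> g i' \<in> cell_lattice y \<rho>) \<Longrightarrow> i = i'"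
  shows "rep_iso K (compact_Ind S G J R) (rep_dsum I (\<lambda>i. summand (g i)))"
  unfolding summand_def
proof (rule mackey[OF J_sub J_G _ Gyr_J rep_J g])
  show "0 < s + \<bar>y\<bar>" using r by simp
next
  fix x assume x: "x \<in> G"
  \<comment> \<open>The factorization is applied to the inverse of x because \<open>mackey\<close>
    has \<open>J\<close> on the left and \<open>K\<close> on the right.\<close>
  obtain i k t where ikt: "i \<in> I" "k \<in> K" "t \<in> T" "matrix_inv x = k ** g i ** t"
    using ex[OF subgroup_inv[OF subgroup_G x]] by blast
  have tG: "t \<in> G" "k \<in> G" using ikt T_G K_subset by auto
  have "(matrix_inv t ** matrix_inv (g i) ** matrix_inv k) ** (k ** g i ** t) = mat 1"
    using tG g[OF ikt(1)] by (simp add: gassoc)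
  then have "(matrix_inv t ** matrix_inv (g i) ** matrix_inv k) ** matrix_inv x = mat 1" by (simp add: ikt(4))
  moreover have "(matrix_inv t ** matrix_inv (g i) ** matrix_inv k) ** matrix_inv x ** x = matrix_inv t ** matrix_inv (g i) ** matrix_inv k"
    using x by (simp add: gassoc)
  ultimately have "x = matrix_inv t ** matrix_inv (g i) ** matrix_inv k" by simp
  moreover have "matrix_inv t \<in> J" using subgroup_inv[OF J_sub] T_J ikt(3) by blast
  moreover have "matrix_inv k \<in> K" by (rule subgroup_inv[OF subgroup_K ikt(2)])
  ultimately show "\<exists>i\<in>I. \<exists>j\<in>J. \<exists>k\<in>K. x = j ** matrix_inv (g i) ** k" using ikt(1) by blast
next
  fix i i' j k j' k'
  assume a: "i \<in> I" "i' \<in> I" "j \<in> J" "k \<in> K" "j' \<in> J" "k' \<in> K"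
    "j ** matrix_inv (g i) ** k = j' ** matrix_inv (g i') ** k'"
  show "i = i'"
    by (rule uniq[OF a(1,2)], rule cell_lattice_invariant[OF a(4,6) _ _ g[OF a(1)] g[OF a(2)] a(7)]) (use a J_L0 in auto)
qed

lemma mackey_unramified:
  assumes n: "n = 0 \<or> n = 1" and y: "y = real_of_int n" and gg: "\<gamma>1 = \<pi> powi (- n)" "\<gamma>2 = \<pi> powi n"
  shows "rep_iso K (compact_Ind S G J R) (rep_dsum {0..} (\<lambda>t. summand (alpha S t)))"
proof (rule mackey_alpha)
  show "\<exists>i\<in>{0..}. \<exists>k\<in>K. \<exists>t\<in>T. x = k ** alpha S i ** t" if "x \<in> G" for x
    using cosets_unramified[OF n y gg that] by auto
  fix i i' :: int
  assume a: "i \<in> {0..}" "i' \<in> {0..}" "\<And>\<rho>. alpha S i \<in> cell_lattice y \<rho> \<longleftrightarrow> alpha S i' \<in> cell_lattice y \<rho>"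
  have "0 \<le> y" using n y by auto
  then show "i = i'" using a(1,2) a(3)[of "- real_of_int i"] a(3)[of "- real_of_int i'"] unfolding cell_lattice_alpha by auto
qed simp

text \<open>One index for both families of ramified representatives, arranged so that
  \<open>rep_dsum_UNIV\<close> pairs the two members belonging to the same t > 0.\<close>

definition refl_alpha :: "int \<Rightarrow> 'e ^ 2 ^ 2" where
  "refl_alpha t = (if 0 \<le> t then alpha S t else alpha S (- t) ** wmat)"

lemma mackey_ramified:
  assumes y: "y = 1 / 2"
  shows "rep_iso K (compact_Ind S G J R) (rep_dsum UNIV (\<lambda>t. summand (refl_alpha t)))"
proof (rule mackey_alpha)
  fix x assume "x \<in> G"
  from cosets_ramified[OF y this] show "\<exists>i\<in>UNIV. \<exists>k\<in>K. \<exists>t\<in>T. x = k ** refl_alpha i ** t"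
  proof
    assume "\<exists>t\<ge>0. \<exists>k\<in>K. \<exists>t'\<in>T. x = k ** alpha S t ** t'"
    then obtain t k t' where t: "0 \<le> t" "k \<in> K" "t' \<in> T" "x = k ** alpha S t ** t'" by blast
    then have "x = k ** refl_alpha t ** t'" by (simp add: refl_alpha_def)
    then show ?thesis using t by blast
  next
    assume "\<exists>t>0. \<exists>k\<in>K. \<exists>t'\<in>T. x = k ** (alpha S t ** wmat) ** t'"
    then obtain t k t' where t: "0 < t" "k \<in> K" "t' \<in> T" "x = k ** (alpha S t ** wmat) ** t'" by blast
    then have "x = k ** refl_alpha (- t) ** t'" by (simp add: refl_alpha_def)
    then show ?thesis using t by blast
  qed
next
  fix i i' :: int
  assume a: "\<And>\<rho>. refl_alpha i \<in> cell_lattice y \<rho> \<longleftrightarrow> refl_alpha i' \<in> cell_lattice y \<rho>"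
  \<comment> \<open>The largest \<rho> for which the representative lies in the lattice, from
    \<open>cell_lattice_alpha\<close> and \<open>cell_lattice_alphaw\<close> at y = 1/2.\<close>
  define m where "m t = (if 0 \<le> t then - real_of_int t else 1 / 2 + real_of_int t)" for t
  have m: "refl_alpha t \<in> cell_lattice y \<rho> \<longleftrightarrow> \<rho> \<le> m t" for t \<rho>
    unfolding refl_alpha_def m_def y by (cases "0 \<le> t") (simp_all only: if_True if_False cell_lattice_alpha cell_lattice_alphaw, auto)
  have "m i = m i'" using a[of "m i"] a[of "m i'"] unfolding m by simp
  then show "i = i'"
  proof (cases "0 \<le> i \<longleftrightarrow> 0 \<le> i'")
    case True
    then show ?thesis using \<open>m i = m i'\<close> by (auto simp: m_def split: if_splits)
  next
    case False
    \<comment> \<open>Between the two families the invariants are integers and proper half-integers,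
      so equality contradicts parity.\<close>
    then have "2 * (i + i') + 1 = 0" using \<open>m i = m i'\<close> by (auto simp: m_def split: if_splits)
    then show ?thesis by presburger
  qed
qed (simp add: refl_alpha_def)

lemma decomposition_hyperspecial:
  assumes y: "y = 0" and gg: "\<gamma>1 = 1" "\<gamma>2 = 1"
  shows "rep_iso K (compact_Ind S G J R) (rep_sum (smooth_Ind S K J R)
      (rep_dsum {0<..} (\<lambda>t. S_rep S (r + 2 * real_of_int t) (mconj (alpha S t) \<Gamma>) (cconj (alpha S t) \<phi>))))"
proof -
  have "summand (alpha S 0) = smooth_Ind S K J R"
  proof -
    have "K \<inter> J = J" using J_L0 y by (auto simp: K_eq)
    then show ?thesis by (simp add: summand_def)
  qed
  moreover have "rep_iso K (compact_Ind S G J R) (rep_dsum {0..} (\<lambda>t. summand (alpha S t)))"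
    by (rule mackey_unramified[of 0]) (use y gg in auto)
  from rep_iso_trans[OF this rep_dsum_atLeast]
  have "rep_iso K (compact_Ind S G J R) (rep_sum (summand (alpha S 0)) (rep_dsum {0<..} (\<lambda>t. summand (alpha S t))))"
    by (simp add: rscale_summand)
  moreover have "rep_iso K (rep_dsum {0<..} (\<lambda>t. summand (alpha S t)))
    (rep_dsum {0<..} (\<lambda>t. S_rep S (r + 2 * real_of_int t) (mconj (alpha S t) \<Gamma>) (cconj (alpha S t) \<phi>)))"
  proof (rule rep_iso_dsum)
    fix t :: int assume "t \<in> {0<..}"
    then have "0 < y + 2 * real_of_int t" using y by simp
    from summand_alpha[OF this] show "rep_iso K (summand (alpha S t)) (S_rep S (r + 2 * real_of_int t) (mconj (alpha S t) \<Gamma>) (cconj (alpha S t) \<phi>))"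
      and "0 \<in> rspace (summand (alpha S t))" using y by simp_all
  qed (rule rscale_summand rscale_S_rep)+
  ultimately show ?thesis using rep_iso_trans[OF _ rep_iso_sum[OF rep_iso_refl]] by simp
qed

lemma decomposition_unramified:
  assumes y: "y = 1" and gg: "\<gamma>1 = inverse \<pi>" "\<gamma>2 = \<pi>"
  shows "rep_iso K (compact_Ind S G J R)
    (rep_dsum {0..} (\<lambda>t. S_rep S (r + 2 * real_of_int t + 1) (mconj (alpha S t) \<Gamma>) (cconj (alpha S t) \<phi>)))"
proof (rule rep_iso_trans[OF mackey_unramified[of 1]])
  show "rep_iso K (rep_dsum {0..} (\<lambda>t. summand (alpha S t)))
    (rep_dsum {0..} (\<lambda>t. S_rep S (r + 2 * real_of_int t + 1) (mconj (alpha S t) \<Gamma>) (cconj (alpha S t) \<phi>)))"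
  proof (rule rep_iso_dsum)
    fix t :: int assume "t \<in> {0..}"
    then have "0 < y + 2 * real_of_int t" using y by simp
    from summand_alpha[OF this] show "rep_iso K (summand (alpha S t)) (S_rep S (r + 2 * real_of_int t + 1) (mconj (alpha S t) \<Gamma>) (cconj (alpha S t) \<phi>))"
      and "0 \<in> rspace (summand (alpha S t))" using y by (simp_all add: ac_simps)
  qed (rule rscale_summand rscale_S_rep)+
qed (use y gg in \<open>simp_all add: power_int_minus\<close>)

lemma decomposition_ramified:
  assumes y: "y = 1 / 2"
  shows "rep_iso K (compact_Ind S G J R) (rep_sum (S_rep S (r + 1 / 2) \<Gamma> \<phi>)
    (rep_dsum {0<..} (\<lambda>t. rep_sum (S_rep S (r + 2 * real_of_int t + 1 / 2) (mconj (alpha S t) \<Gamma>) (cconj (alpha S t) \<phi>))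
      (S_rep S (r + 2 * real_of_int t - 1 / 2) (mconj (alpha S t ** wmat) \<Gamma>) (cconj (alpha S t ** wmat) \<phi>)))))"
proof -
  have "rep_iso K (compact_Ind S G J R) (rep_sum (summand (refl_alpha 0))
      (rep_dsum {0<..} (\<lambda>t. rep_sum (summand (refl_alpha t)) (summand (refl_alpha (- t))))))"
    by (rule rep_iso_trans[OF mackey_ramified[OF y] rep_dsum_UNIV]) (rule rscale_summand)
  moreover have "rep_iso K (summand (refl_alpha 0)) (S_rep S (r + 1 / 2) \<Gamma> \<phi>)"
  proof -
    have p: "0 < y + 2 * real_of_int 0" and e: "r + (y + 2 * real_of_int 0) = r + 1 / 2" using y by simp_all
    show ?thesis using summand_alpha(1)[OF p] unfolding e refl_alpha_def by simp
  qed
  moreover have "rep_iso K (rep_dsum {0<..} (\<lambda>t. rep_sum (summand (refl_alpha t)) (summand (refl_alpha (- t)))))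
    (rep_dsum {0<..} (\<lambda>t. rep_sum (S_rep S (r + 2 * real_of_int t + 1 / 2) (mconj (alpha S t) \<Gamma>) (cconj (alpha S t) \<phi>))
      (S_rep S (r + 2 * real_of_int t - 1 / 2) (mconj (alpha S t ** wmat) \<Gamma>) (cconj (alpha S t ** wmat) \<phi>))))"
  proof (rule rep_iso_dsum)
    fix t :: int assume t: "t \<in> {0<..}"
    have e: "r + (y + 2 * real_of_int t) = r + 2 * real_of_int t + 1 / 2" "r + (2 * real_of_int t - y) = r + 2 * real_of_int t - 1 / 2"
      using y by simp_all
    have p: "0 < y + 2 * real_of_int t" "0 < 2 * real_of_int t - y" using t y by auto
    have g: "refl_alpha t = alpha S t" "refl_alpha (- t) = alpha S t ** wmat" using t by (simp_all add: refl_alpha_def)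
    show "rep_iso K (rep_sum (summand (refl_alpha t)) (summand (refl_alpha (- t))))
      (rep_sum (S_rep S (r + 2 * real_of_int t + 1 / 2) (mconj (alpha S t) \<Gamma>) (cconj (alpha S t) \<phi>))
      (S_rep S (r + 2 * real_of_int t - 1 / 2) (mconj (alpha S t ** wmat) \<Gamma>) (cconj (alpha S t ** wmat) \<phi>)))"
      unfolding g by (rule rep_iso_sum[OF summand_alpha(1)[OF p(1), unfolded e] summand_alphaw(1)[OF p(2), unfolded e]])
    show "0 \<in> rspace (rep_sum (summand (refl_alpha t)) (summand (refl_alpha (- t))))"
      unfolding g using summand_alpha(4)[OF p(1)] summand_alphaw(4)[OF p(2)] by (simp add: rep_sum_def zero_prod_def)
  qed (simp_all add: rep_sum_def zero_prod_def rscale_summand rscale_S_rep)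
  ultimately show ?thesis by (blast intro: rep_iso_trans[OF _ rep_iso_sum])
qed

end

theorem theorem5p18:
  fixes S :: "('f::field, 'e::field) setting"
    and \<gamma>1 \<gamma>2 :: 'f and y r :: real
    and \<phi> :: "'e ^ 2 ^ 2 \<Rightarrow> complex" and \<Gamma> :: "'e ^ 2 ^ 2"
    and \<rho> :: "('e ^ 2 ^ 2, 'v::ab_group_add) rep"
  assumes setting: "u11_setting S"
    and datum: "is_datum S \<gamma>1 \<gamma>2 y r \<phi>"
    and rho: "is_rho S \<gamma>1 \<gamma>2 y r \<phi> \<rho>"
    and generic: "generic_elt S \<gamma>1 \<gamma>2 y r \<Gamma>"
    and represents: "represents S \<gamma>1 \<gamma>2 y r \<Gamma> \<phi>"
  shows
    "let G = unitary_group S; K = maxK S; J = inducing_group S \<gamma>1 \<gamma>2 y r;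
         \<pi> = compact_Ind S G J \<rho>;
         \<pi>0 = smooth_Ind S K J \<rho>;
         X = (\<lambda>t::int. mconj (alpha S t) \<Gamma>);
         \<zeta> = (\<lambda>t::int. cconj (alpha S t) \<phi>);
         Xw = (\<lambda>t::int. mconj (alpha S t ** wmat) \<Gamma>);
         \<zeta>w = (\<lambda>t::int. cconj (alpha S t ** wmat) \<phi>)
     in
     (y = 0 \<longrightarrow>
        rep_iso K \<pi> (rep_sum \<pi>0 (rep_dsum {0<..} (\<lambda>t::int. S_rep S (r + 2 * t) (X t) (\<zeta> t)))) \<and>
        irreducible_rep S K \<pi>0 \<and>
        (\<forall>t\<in>{0::int<..}. S_param S (r + 2 * t) (X t) (\<zeta> t) \<and>
               irreducible_rep S K (S_rep S (r + 2 * t) (X t) (\<zeta> t)))) \<and>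
     (y = 1 \<longrightarrow>
        rep_iso K \<pi> (rep_dsum {0..} (\<lambda>t::int. S_rep S (r + 2 * t + 1) (X t) (\<zeta> t))) \<and>
        (\<forall>t\<in>{0::int..}. S_param S (r + 2 * t + 1) (X t) (\<zeta> t) \<and>
               irreducible_rep S K (S_rep S (r + 2 * t + 1) (X t) (\<zeta> t)))) \<and>
     (y = 1 / 2 \<longrightarrow>
        rep_iso K \<pi>
          (rep_sum (S_rep S (r + 1 / 2) \<Gamma> \<phi>)
            (rep_dsum {0<..} (\<lambda>t::int. rep_sum (S_rep S (r + 2 * t + 1 / 2) (X t) (\<zeta> t))
                                                (S_rep S (r + 2 * t - 1 / 2) (Xw t) (\<zeta>w t))))) \<and>
        S_param S (r + 1 / 2) \<Gamma> \<phi> \<and> irreducible_rep S K (S_rep S (r + 1 / 2) \<Gamma> \<phi>) \<and>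
        (\<forall>t\<in>{0::int<..}. S_param S (r + 2 * t + 1 / 2) (X t) (\<zeta> t) \<and>
               irreducible_rep S K (S_rep S (r + 2 * t + 1 / 2) (X t) (\<zeta> t)) \<and>
               S_param S (r + 2 * t - 1 / 2) (Xw t) (\<zeta>w t) \<and>
               irreducible_rep S K (S_rep S (r + 2 * t - 1 / 2) (Xw t) (\<zeta>w t))))"
proof -
  interpret u11 S by unfold_locales (rule setting)
  have D: "torus_point S \<gamma>1 \<gamma>2 y" "0 < r" "smooth_char S (torus S \<gamma>1 \<gamma>2) \<phi>" using datum by (auto simp: is_datum_def)
  obtain u v where G: "\<Gamma> = Gamma_elt S \<gamma>1 \<gamma>2 u v" and datum': "generic_datum S \<gamma>1 \<gamma>2 y r u v \<phi>"
    using generic_datum_of_generic_elt[OF D generic represents] by blast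
  interpret D: generic_datum S \<gamma>1 \<gamma>2 y r u v \<phi> by (rule datum')
  \<comment> \<open>The given \<open>\<Gamma>\<close> may differ from the generic element used to
    build \<rho>; the passage between them rests on \<open>Psi_unique\<close>.\<close>
  interpret D: datum_rep S \<gamma>1 \<gamma>2 y r u v \<phi> \<rho> by (rule D.datum_rep_of_rho[OF rho generic_datum_of_generic_elt[OF D]])
  have t0: "\<gamma>1 = 1" "\<gamma>2 = 1" if "y = 0" using D(1) that by (auto simp: torus_point_def)
  have t1: "\<gamma>1 = inverse \<pi>" "\<gamma>2 = \<pi>" if "y = 1" using D(1) that by (auto simp: torus_point_def)
  have a: "S_param S d (mconj (alpha S t) \<Gamma>) (cconj (alpha S t) \<phi>) \<and> irreducible_rep S K (S_rep S d (mconj (alpha S t) \<Gamma>) (cconj (alpha S t) \<phi>))"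
    if "d = r + (y + 2 * real_of_int t)" "0 < y + 2 * real_of_int t" for t d
    unfolding G that(1) using D.summand_alpha(2,3)[OF that(2)] by blast
  have w: "S_param S d (mconj (alpha S t ** wmat) \<Gamma>) (cconj (alpha S t ** wmat) \<phi>) \<and>
      irreducible_rep S K (S_rep S d (mconj (alpha S t ** wmat) \<Gamma>) (cconj (alpha S t ** wmat) \<phi>))"
    if "d = r + (2 * real_of_int t - y)" "0 < 2 * real_of_int t - y" for t d
    unfolding G that(1) using D.summand_alphaw(2,3)[OF that(2)] by blast
  have a0: "S_param S (r + 1 / 2) \<Gamma> \<phi> \<and> irreducible_rep S K (S_rep S (r + 1 / 2) \<Gamma> \<phi>)" if "y = 1 / 2"
    using a[of "r + 1 / 2" 0] that by simp
  show ?thesis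
    unfolding Let_def of_int_mult of_int_numeral
  proof (intro conjI impI ballI)
    assume y: "y = 0"
    show "rep_iso K (compact_Ind S G D.J \<rho>) (rep_sum (smooth_Ind S K D.J \<rho>)
        (rep_dsum {0<..} (\<lambda>t. S_rep S (r + 2 * real_of_int t) (mconj (alpha S t) \<Gamma>) (cconj (alpha S t) \<phi>))))"
      unfolding G by (rule D.decomposition_hyperspecial[OF y t0[OF y]])
    show "irreducible_rep S K (smooth_Ind S K D.J \<rho>)" by (rule D.hyperspecial_irreducible[OF y t0[OF y]])
    fix t :: int assume "t \<in> {0<..}"
    then have c: "r + 2 * real_of_int t = r + (y + 2 * real_of_int t)" "0 < y + 2 * real_of_int t" using y by simp_all
    show "S_param S (r + 2 * real_of_int t) (mconj (alpha S t) \<Gamma>) (cconj (alpha S t) \<phi>)"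
      "irreducible_rep S K (S_rep S (r + 2 * real_of_int t) (mconj (alpha S t) \<Gamma>) (cconj (alpha S t) \<phi>))"
      using a[OF c] by blast+
  next
    assume y: "y = 1"
    show "rep_iso K (compact_Ind S G D.J \<rho>)
        (rep_dsum {0..} (\<lambda>t. S_rep S (r + 2 * real_of_int t + 1) (mconj (alpha S t) \<Gamma>) (cconj (alpha S t) \<phi>)))"
      unfolding G by (rule D.decomposition_unramified[OF y t1[OF y]])
    fix t :: int assume "t \<in> {0..}"
    then have c: "r + 2 * real_of_int t + 1 = r + (y + 2 * real_of_int t)" "0 < y + 2 * real_of_int t" using y by simp_all
    show "S_param S (r + 2 * real_of_int t + 1) (mconj (alpha S t) \<Gamma>) (cconj (alpha S t) \<phi>)"
      "irreducible_rep S K (S_rep S (r + 2 * real_of_int t + 1) (mconj (alpha S t) \<Gamma>) (cconj (alpha S t) \<phi>))"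
      using a[OF c] by blast+
  next
    assume y: "y = 1 / 2"
    show "rep_iso K (compact_Ind S G D.J \<rho>) (rep_sum (S_rep S (r + 1 / 2) \<Gamma> \<phi>)
        (rep_dsum {0<..} (\<lambda>t. rep_sum (S_rep S (r + 2 * real_of_int t + 1 / 2) (mconj (alpha S t) \<Gamma>) (cconj (alpha S t) \<phi>))
          (S_rep S (r + 2 * real_of_int t - 1 / 2) (mconj (alpha S t ** wmat) \<Gamma>) (cconj (alpha S t ** wmat) \<phi>)))))"
      unfolding G by (rule D.decomposition_ramified[OF y])
    show "S_param S (r + 1 / 2) \<Gamma> \<phi>" "irreducible_rep S K (S_rep S (r + 1 / 2) \<Gamma> \<phi>)" using a0[OF y] by blast+
    fix t :: int assume "t \<in> {0<..}"
    then have c: "r + 2 * real_of_int t + 1 / 2 = r + (y + 2 * real_of_int t)" "0 < y + 2 * real_of_int t"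
      and c': "r + 2 * real_of_int t - 1 / 2 = r + (2 * real_of_int t - y)" "0 < 2 * real_of_int t - y" using y by auto
    show "S_param S (r + 2 * real_of_int t + 1 / 2) (mconj (alpha S t) \<Gamma>) (cconj (alpha S t) \<phi>)"
      "irreducible_rep S K (S_rep S (r + 2 * real_of_int t + 1 / 2) (mconj (alpha S t) \<Gamma>) (cconj (alpha S t) \<phi>))"
      "S_param S (r + 2 * real_of_int t - 1 / 2) (mconj (alpha S t ** wmat) \<Gamma>) (cconj (alpha S t ** wmat) \<phi>)"
      "irreducible_rep S K (S_rep S (r + 2 * real_of_int t - 1 / 2) (mconj (alpha S t ** wmat) \<Gamma>) (cconj (alpha S t ** wmat) \<phi>))"
      using a[OF c] w[OF c'] by blast+
  qed
qed

end
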